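(* Let $\Gamma$ be a finitely generated group, $M$ a compact manifold, and $\alpha\colon\Gamma\to\mathrm{Diff}^k(M)$ an action on $M$ by $C^k$ diffeomorphisms, $k\ge 2$. If $\Gamma$ has strong property (T) and if $\alpha$ has uniform subexponential growth of derivatives, then $\alpha$ preserves a Riemannian metric on $M$ which is $C^{k-1-\delta}$ for all $\delta>0$.
   Context: Fix a finite symmetric generating set of $\Gamma$ with word-length function $\ell$, and a Riemannian metric on $M$. The action $\alpha$ has uniform subexponential growth of derivatives if for every $\epsilon>0$ there is $C_\epsilon$ such that $\|D\alpha(\gamma)\|:=\sup_{x\in M}\|D_x\alpha(\gamma)\|\le C_\epsilon e^{\epsilon\ell(\gamma)}$ for all $\gamma\in\Gamma$. For a Banach space $X$ let $B(X)$ be the bounded operators on $X$ with the operator norm. For $t>0$, a representation $\pi\colon\Gamma\to B(X)$ has $t$-subexponential norm growth if there is a constant $L$ with $\|\pi(\gamma)\|\le Le^{t\ell(\gamma)}$ for all $\gamma\in\Gamma$. For a finitely supported probability measure $\mu=\sum_\gamma\mu(\gamma)\delta_\gamma$ on $\Gamma$ put $\pi(\mu)=\sum_\gamma\mu(\gamma)\pi(\gamma)$. $\mathcal E_{10}$ denotes the class of Banach spaces introduced by de Laat and de la Salle ("Strong property (T) for higher rank simple Lie groups"). The properties of this class recorded in the paper are: it contains all Hilbert spaces; the complex interpolation of a space in $\mathcal E_{10}$ with any other space is in $\mathcal E_{10}$; it is closed under taking (closed) subspaces. $\Gamma$ has strong property (T) if there exists a sequence of probability measures $\mu_n$ on $\Gamma$,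 with $\mu_n$ supported in the ball $\{\gamma\in\Gamma:\ell(\gamma)\le n\}$, such that for every Banach space $X\in\mathcal E_{10}$ there exists a constant $t>0$ such that for any representation $\pi\colon\Gamma\to B(X)$ with $t$-subexponential norm growth, the operators $\pi(\mu_n)$ converge exponentially quickly to a projection onto the space of invariant vectors; that is, there exist $0<\lambda<1$ (independent of $\pi$), a projection $P\in B(X)$ onto the space of $\Gamma$-invariant vectors, and $n_0\in\mathbb N$ such that $\|\pi(\mu_n)-P\|<\lambda^n$ for all $n\ge n_0$. *)

theory Defs
  imports
    "HOL-Analysis.Analysis"
    "HOL-Probability.Probability_Mass_Function"
    "HOL-Algebra.Generated_Groups"
    "HOL-Library.Function_Algebras"
    "HOL-Library.Infinite_Typeclass"
begin

section \<open>Regularity of functions between Euclidean spaces\<close>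

text \<open>
  \<open>Ck_holder_on n s S f\<close>, for open \<open>S\<close> in a Euclidean space: \<open>f\<close> is of class \<open>C^n\<close> on \<open>S\<close> and its
  derivatives of order \<open>n\<close> are locally \<open>s\<close>-Hoelder (no condition if \<open>s = 0\<close>).
  As the domain is finite-dimensional, continuity (Hoelder continuity) of the \<open>n\<close>-th derivative
  amounts to that of all iterated directional derivatives along fixed vectors.
\<close>

primrec Ck_holder_on ::
  "nat \<Rightarrow> real \<Rightarrow> 'a::euclidean_space set \<Rightarrow> ('a \<Rightarrow> 'b::real_normed_vector) \<Rightarrow> bool" where
  "Ck_holder_on 0 s S f \<longleftrightarrow>
     continuous_on S f \<and>
     (s > 0 \<longrightarrow> (\<forall>x\<in>S. \<exists>e>0. \<exists>C. \<forall>y\<in>S \<inter> ball x e. \<forall>z\<in>S \<inter> ball x e.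
                norm (f y - f z) \<le> C * dist y z powr s))"
| "Ck_holder_on (Suc n) s S f \<longleftrightarrow>
     (\<forall>x\<in>S. f differentiable (at x)) \<and>
     (\<forall>v. Ck_holder_on n s S (\<lambda>x. frechet_derivative f (at x) v))"

abbreviation Ck_on where "Ck_on n S f \<equiv> Ck_holder_on n 0 S f"

text \<open>\<open>C^r\<close> for real \<open>r \<ge> 0\<close>, i.e. \<open>C^{n,s}\<close> with \<open>n\<close> the integer and \<open>s\<close> the fractional part of \<open>r\<close>.\<close>

definition Cr_on :: "real \<Rightarrow> 'a::euclidean_space set \<Rightarrow> ('a \<Rightarrow> 'b::real_normed_vector) \<Rightarrow> bool" where
  "Cr_on r S f \<longleftrightarrow> Ck_holder_on (nat \<lfloor>r\<rfloor>) (frac r) S f"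


section \<open>Smooth manifolds and tangent vectors\<close>

text \<open>
  A chart is a pair of a domain and a coordinate map; the values of the coordinate map outside the
  domain are irrelevant.  The manifold is the whole type \<open>'m\<close>, modelled on the Euclidean space \<open>'e\<close>.
\<close>

type_synonym ('m, 'e) chart = "'m set \<times> ('m \<Rightarrow> 'e)"

definition chart_inv :: "('m, 'e) chart \<Rightarrow> 'e \<Rightarrow> 'm" where
  "chart_inv c = inv_into (fst c) (snd c)"

definition is_chart :: "('m::topological_space, 'e::euclidean_space) chart \<Rightarrow> bool" where
  "is_chart c \<longleftrightarrow> open (fst c) \<and> open (snd c ` fst c) \<and>
     homeomorphism (fst c) (snd c ` fst c) (snd c) (chart_inv c)"

definition smooth_atlas :: "('m::topological_space, 'e::euclidean_space) chart set \<Rightarrow> bool" where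
  "smooth_atlas A \<longleftrightarrow>
     (\<forall>c\<in>A. is_chart c) \<and>
     (\<Union>c\<in>A. fst c) = UNIV \<and>
     (\<forall>c\<in>A. \<forall>c'\<in>A. \<forall>n. Ck_on n (snd c ` (fst c \<inter> fst c')) (snd c' \<circ> chart_inv c))"

definition Ck_map ::
  "('m::topological_space, 'e::euclidean_space) chart set \<Rightarrow> nat \<Rightarrow> ('m \<Rightarrow> 'm) \<Rightarrow> bool" where
  "Ck_map A k f \<longleftrightarrow>
     continuous_on UNIV f \<and>
     (\<forall>c\<in>A. \<forall>c'\<in>A. Ck_on k (snd c ` (fst c \<inter> f -` fst c')) (snd c' \<circ> f \<circ> chart_inv c))"

definition Diff :: "('m::topological_space, 'e::euclidean_space) chart set \<Rightarrow> nat \<Rightarrow> ('m \<Rightarrow> 'm) monoid" where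
  "Diff A k = \<lparr>carrier = {f. bij f \<and> Ck_map A k f \<and> Ck_map A k (inv_into UNIV f)},
               monoid.mult = (\<circ>), one = id\<rparr>"

text \<open>
  A tangent vector at \<open>p\<close> is the family of its coordinate vectors in all charts of the atlas around
  \<open>p\<close>, related by the derivatives of the transition maps; it is extended by \<open>0\<close> to all other charts.
\<close>

type_synonym ('m, 'e) tvec = "('m, 'e) chart \<Rightarrow> 'e"

definition tangent_space ::
  "('m, 'e::euclidean_space) chart set \<Rightarrow> 'm \<Rightarrow> ('m, 'e) tvec set" where
  "tangent_space A p =
     {v. (\<forall>c. \<not> (c \<in> A \<and> p \<in> fst c) \<longrightarrow> v c = 0) \<and>
         (\<forall>c\<in>A. \<forall>c'\<in>A. p \<in> fst c \<longrightarrow> p \<in> fst c' \<longrightarrow>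
            v c' = frechet_derivative (snd c' \<circ> chart_inv c) (at (snd c p)) (v c))}"

text \<open>The tangent vector at \<open>p\<close> whose coordinates in the chart \<open>c\<close> (around \<open>p\<close>) are \<open>u\<close>.\<close>

definition coord_vec ::
  "('m, 'e::euclidean_space) chart set \<Rightarrow> ('m, 'e) chart \<Rightarrow> 'm \<Rightarrow> 'e \<Rightarrow> ('m, 'e) tvec" where
  "coord_vec A c p u =
     (\<lambda>c'. if c' \<in> A \<and> p \<in> fst c'
           then frechet_derivative (snd c' \<circ> chart_inv c) (at (snd c p)) u else 0)"

text \<open>
  The differential of \<open>f\<close> at \<open>p\<close>.  By the chain rule the result does not depend on which chart
  around \<open>p\<close> is used to express the argument.
\<close>

definition differential ::
  "('m, 'e::euclidean_space) chart set \<Rightarrow> ('m \<Rightarrow> 'm) \<Rightarrow> 'm \<Rightarrow> ('m, 'e) tvec \<Rightarrow> ('m, 'e) tvec" where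
  "differential A f p v =
     (let c = (SOME c. c \<in> A \<and> p \<in> fst c)
      in (\<lambda>c'. if c' \<in> A \<and> f p \<in> fst c'
              then frechet_derivative (snd c' \<circ> f \<circ> chart_inv c) (at (snd c p)) (v c) else 0))"


section \<open>Riemannian metrics\<close>

type_synonym ('m, 'e) metric_field = "'m \<Rightarrow> ('m, 'e) tvec \<Rightarrow> ('m, 'e) tvec \<Rightarrow> real"

definition inner_product_field ::
  "('m, 'e::euclidean_space) chart set \<Rightarrow> ('m, 'e) metric_field \<Rightarrow> bool" where
  "inner_product_field A g \<longleftrightarrow>
     (\<forall>p. \<forall>v\<in>tangent_space A p. \<forall>w\<in>tangent_space A p.
        g p v w = g p w v \<and>
        (v \<noteq> 0 \<longrightarrow> g p v v > 0) \<and>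
        (\<forall>r. g p (\<lambda>c. r *\<^sub>R v c) w = r * g p v w) \<and>
        (\<forall>u\<in>tangent_space A p. g p (u + v) w = g p u w + g p v w))"

definition Cr_metric ::
  "('m, 'e::euclidean_space) chart set \<Rightarrow> real \<Rightarrow> ('m, 'e) metric_field \<Rightarrow> bool" where
  "Cr_metric A r g \<longleftrightarrow>
     inner_product_field A g \<and>
     (\<forall>c\<in>A. \<forall>u w. Cr_on r (snd c ` fst c)
        (\<lambda>x. g (chart_inv c x) (coord_vec A c (chart_inv c x) u) (coord_vec A c (chart_inv c x) w)))"

definition smooth_metric ::
  "('m, 'e::euclidean_space) chart set \<Rightarrow> ('m, 'e) metric_field \<Rightarrow> bool" where
  "smooth_metric A g \<longleftrightarrow> (\<forall>n::nat. Cr_metric A (real n) g)"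

definition isometric_map ::
  "('m, 'e::euclidean_space) chart set \<Rightarrow> ('m, 'e) metric_field \<Rightarrow> ('m \<Rightarrow> 'm) \<Rightarrow> bool" where
  "isometric_map A g f \<longleftrightarrow>
     (\<forall>p. \<forall>v\<in>tangent_space A p. \<forall>w\<in>tangent_space A p.
        g (f p) (differential A f p v) (differential A f p w) = g p v w)"

definition deriv_norm ::
  "('m, 'e::euclidean_space) chart set \<Rightarrow> ('m, 'e) metric_field \<Rightarrow> ('m \<Rightarrow> 'm) \<Rightarrow> ereal" where
  "deriv_norm A g f =
     (SUP p. SUP v\<in>{v \<in> tangent_space A p. g p v v \<le> 1}.
        ereal (sqrt (g (f p) (differential A f p v) (differential A f p v))))"


section \<open>Word length and growth of derivatives\<close>

definition symmetric_generating_set :: "('g, 'b) monoid_scheme \<Rightarrow> 'g set \<Rightarrow> bool" where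
  "symmetric_generating_set G S \<longleftrightarrow>
     finite S \<and> S \<subseteq> carrier G \<and> (\<forall>s\<in>S. inv\<^bsub>G\<^esub> s \<in> S) \<and> generate G S = carrier G"

definition word_length :: "('g, 'b) monoid_scheme \<Rightarrow> 'g set \<Rightarrow> 'g \<Rightarrow> nat" where
  "word_length G S x =
     (LEAST n. \<exists>ws. length ws = n \<and> set ws \<subseteq> S \<and> foldr (\<lambda>a b. a \<otimes>\<^bsub>G\<^esub> b) ws \<one>\<^bsub>G\<^esub> = x)"

definition uniform_subexp_growth_of_derivatives ::
  "('g, 'b) monoid_scheme \<Rightarrow> 'g set \<Rightarrow> ('m, 'e::euclidean_space) chart set \<Rightarrow>
   ('m, 'e) metric_field \<Rightarrow> ('g \<Rightarrow> 'm \<Rightarrow> 'm) \<Rightarrow> bool" where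
  "uniform_subexp_growth_of_derivatives G S A g \<alpha> \<longleftrightarrow>
     (\<forall>\<epsilon>>0. \<exists>C::real. \<forall>\<gamma>\<in>carrier G.
        deriv_norm A g (\<alpha> \<gamma>) \<le> ereal (C * exp (\<epsilon> * real (word_length G S \<gamma>))))"


section \<open>Complex Banach spaces\<close>

text \<open>
  To quantify over classes of Banach spaces, a complex normed space is represented by a pair of a
  linear subspace of \<open>'i \<Rightarrow> complex\<close> (with pointwise operations) and a norm on it, unrelated to any
  topology on \<open>'i \<Rightarrow> complex\<close>.  Up to isometry these are all normed spaces of algebraic
  dimension at most that of \<open>'i \<Rightarrow> complex\<close>; for infinite \<open>'i\<close> this includes all separable ones.
  Values of the norm, and of operators, off the subspace are irrelevant.
\<close>

type_synonym 'i cvec = "'i \<Rightarrow> complex"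
type_synonym 'i cspace = "'i cvec set \<times> ('i cvec \<Rightarrow> real)"
type_synonym 'i cop = "'i cvec \<Rightarrow> 'i cvec"

definition cscale :: "complex \<Rightarrow> 'i cvec \<Rightarrow> 'i cvec" where
  "cscale a x = (\<lambda>i. a * x i)"

definition cbanach :: "'i cspace \<Rightarrow> bool" where
  "cbanach X \<longleftrightarrow> (case X of (V, N) \<Rightarrow>
     0 \<in> V \<and> (\<forall>x\<in>V. \<forall>y\<in>V. x + y \<in> V) \<and> (\<forall>a. \<forall>x\<in>V. cscale a x \<in> V) \<and>
     (\<forall>x\<in>V. N x \<ge> 0 \<and> (N x = 0 \<longleftrightarrow> x = 0)) \<and>
     (\<forall>a. \<forall>x\<in>V. N (cscale a x) = cmod a * N x) \<and>
     (\<forall>x\<in>V. \<forall>y\<in>V. N (x + y) \<le> N x + N y) \<and>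
     (\<forall>f::nat \<Rightarrow> 'i cvec. (\<forall>n. f n \<in> V) \<and> (\<forall>e>0. \<exists>n0. \<forall>m\<ge>n0. \<forall>n\<ge>n0. N (f m - f n) < e) \<longrightarrow>
        (\<exists>x\<in>V. (\<lambda>n. N (f n - x)) \<longlonglongrightarrow> 0)))"

definition chilbert :: "'i cspace \<Rightarrow> bool" where
  "chilbert X \<longleftrightarrow> cbanach X \<and> (case X of (V, N) \<Rightarrow>
     \<exists>ip :: 'i cvec \<Rightarrow> 'i cvec \<Rightarrow> complex.
       (\<forall>x\<in>V. \<forall>y\<in>V. ip y x = cnj (ip x y)) \<and>
       (\<forall>x\<in>V. \<forall>y\<in>V. \<forall>z\<in>V. ip (x + y) z = ip x z + ip y z) \<and>
       (\<forall>a. \<forall>x\<in>V. \<forall>y\<in>V. ip (cscale a x) y = a * ip x y) \<and>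
       (\<forall>x\<in>V. ip x x = complex_of_real ((N x)\<^sup>2)))"

definition clinear_between :: "'i cspace \<Rightarrow> 'i cspace \<Rightarrow> 'i cop \<Rightarrow> bool" where
  "clinear_between X Y T \<longleftrightarrow>
     (\<forall>x\<in>fst X. T x \<in> fst Y) \<and>
     (\<forall>x\<in>fst X. \<forall>y\<in>fst X. T (x + y) = T x + T y) \<and>
     (\<forall>a. \<forall>x\<in>fst X. T (cscale a x) = cscale a (T x))"

definition bounded_op :: "'i cspace \<Rightarrow> 'i cop \<Rightarrow> bool" where
  "bounded_op X T \<longleftrightarrow> clinear_between X X T \<and> (\<exists>C. \<forall>x\<in>fst X. snd X (T x) \<le> C * snd X x)"

definition op_norm :: "'i cspace \<Rightarrow> 'i cop \<Rightarrow> real" where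
  "op_norm X T = (SUP x\<in>{x \<in> fst X. snd X x \<le> 1}. snd X (T x))"

definition isometric_embedding :: "'i cspace \<Rightarrow> 'i cspace \<Rightarrow> 'i cop \<Rightarrow> bool" where
  "isometric_embedding Y X T \<longleftrightarrow> clinear_between Y X T \<and> (\<forall>y\<in>fst Y. snd X (T y) = snd Y y)"


section \<open>Complex interpolation\<close>

definition sum_carrier :: "'i cspace \<Rightarrow> 'i cspace \<Rightarrow> 'i cvec set" where
  "sum_carrier X0 X1 = {a + b | a b. a \<in> fst X0 \<and> b \<in> fst X1}"

definition sum_norm :: "'i cspace \<Rightarrow> 'i cspace \<Rightarrow> 'i cvec \<Rightarrow> real" where
  "sum_norm X0 X1 x = Inf {snd X0 a + snd X1 b | a b. a \<in> fst X0 \<and> b \<in> fst X1 \<and> x = a + b}"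

text \<open>
  Two Banach spaces inside a common vector space form a compatible couple (both embed continuously
  in one Hausdorff topological vector space) iff the seminorm of their sum is a norm.
\<close>

definition compatible_couple :: "'i cspace \<Rightarrow> 'i cspace \<Rightarrow> bool" where
  "compatible_couple X0 X1 \<longleftrightarrow> cbanach X0 \<and> cbanach X1 \<and>
     (\<forall>x\<in>sum_carrier X0 X1. sum_norm X0 X1 x = 0 \<longrightarrow> x = 0)"

text \<open>Calderon's function space: \<open>f\<close> is bounded and continuous on the closed strip \<open>0 \<le> Re z \<le> 1\<close>,
  holomorphic inside it (all with values in the sum), and maps the line \<open>Re z = j\<close> continuously
  into \<open>Xj\<close>, vanishing at infinity there.\<close>

definition calderon_space :: "'i cspace \<Rightarrow> 'i cspace \<Rightarrow> (complex \<Rightarrow> 'i cvec) set" where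
  "calderon_space X0 X1 = {f.
     (\<forall>z\<in>{z. 0 \<le> Re z \<and> Re z \<le> 1}. f z \<in> sum_carrier X0 X1) \<and>
     (\<exists>B. \<forall>z\<in>{z. 0 \<le> Re z \<and> Re z \<le> 1}. sum_norm X0 X1 (f z) \<le> B) \<and>
     (\<forall>z\<in>{z. 0 \<le> Re z \<and> Re z \<le> 1}.
        ((\<lambda>w. sum_norm X0 X1 (f w - f z)) \<longlongrightarrow> 0) (at z within {z. 0 \<le> Re z \<and> Re z \<le> 1})) \<and>
     (\<forall>z\<in>{z. 0 < Re z \<and> Re z < 1}. \<exists>d\<in>sum_carrier X0 X1.
        ((\<lambda>h. sum_norm X0 X1 (cscale (1 / h) (f (z + h) - f z) - d)) \<longlongrightarrow> 0) (at 0)) \<and>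
     (\<forall>(j, X)\<in>{(0, X0), (1, X1)}.
        (\<forall>t. f (Complex j t) \<in> fst X) \<and>
        (\<forall>t. ((\<lambda>s. snd X (f (Complex j s) - f (Complex j t))) \<longlongrightarrow> 0) (at t)) \<and>
        ((\<lambda>t. snd X (f (Complex j t))) \<longlongrightarrow> 0) at_infinity)}"

definition calderon_norm :: "'i cspace \<Rightarrow> 'i cspace \<Rightarrow> (complex \<Rightarrow> 'i cvec) \<Rightarrow> real" where
  "calderon_norm X0 X1 f =
     max (SUP t. snd X0 (f (Complex 0 t))) (SUP t. snd X1 (f (Complex 1 t)))"

definition complex_interpolation :: "'i cspace \<Rightarrow> 'i cspace \<Rightarrow> real \<Rightarrow> 'i cspace" where
  "complex_interpolation X0 X1 \<theta> =
     ({f (complex_of_real \<theta>) | f. f \<in> calderon_space X0 X1},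
      \<lambda>x. Inf {calderon_norm X0 X1 f | f. f \<in> calderon_space X0 X1 \<and> f (complex_of_real \<theta>) = x})"

text \<open>
  The class \<open>\<E>\<^sub>1\<^sub>0\<close> of de Laat and de la Salle enters only through these properties, so
  strong property (T) below takes the class as a parameter, and \<open>\<E>\<^sub>1\<^sub>0\<close> (restricted to the
  spaces representable in \<open>'i \<Rightarrow> complex\<close>) is an instance: it contains the Hilbert spaces and
  is stable under closed subspaces and under complex interpolation with an arbitrary
  space.  As a class of Banach spaces is understood up to isometry, a closed subspace of \<open>X\<close> is
  a Banach space that embeds isometrically in \<open>X\<close>.
\<close>

definition E10_properties :: "'i cspace set \<Rightarrow> bool" where
  "E10_properties \<E> \<longleftrightarrow>
     (\<forall>X\<in>\<E>. cbanach X) \<and>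
     (\<forall>X. chilbert X \<longrightarrow> X \<in> \<E>) \<and>
     (\<forall>X Y T. X \<in> \<E> \<and> cbanach Y \<and> isometric_embedding Y X T \<longrightarrow> Y \<in> \<E>) \<and>
     (\<forall>X0 X1 \<theta>. X0 \<in> \<E> \<and> compatible_couple X0 X1 \<and> 0 < \<theta> \<and> \<theta> < 1 \<longrightarrow>
        complex_interpolation X0 X1 \<theta> \<in> \<E>)"


section \<open>Representations and strong property (T)\<close>

definition representation ::
  "('g, 'b) monoid_scheme \<Rightarrow> 'i cspace \<Rightarrow> ('g \<Rightarrow> 'i cop) \<Rightarrow> bool" where
  "representation G X \<pi> \<longleftrightarrow>
     (\<forall>\<gamma>\<in>carrier G. bounded_op X (\<pi> \<gamma>)) \<and>
     (\<forall>x\<in>fst X. \<pi> \<one>\<^bsub>G\<^esub> x = x) \<and>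
     (\<forall>\<gamma>\<in>carrier G. \<forall>\<gamma>'\<in>carrier G. \<forall>x\<in>fst X. \<pi> (\<gamma> \<otimes>\<^bsub>G\<^esub> \<gamma>') x = \<pi> \<gamma> (\<pi> \<gamma>' x))"

definition subexp_norm_growth ::
  "('g, 'b) monoid_scheme \<Rightarrow> 'g set \<Rightarrow> 'i cspace \<Rightarrow> ('g \<Rightarrow> 'i cop) \<Rightarrow> real \<Rightarrow> bool" where
  "subexp_norm_growth G S X \<pi> t \<longleftrightarrow>
     (\<exists>L. \<forall>\<gamma>\<in>carrier G. op_norm X (\<pi> \<gamma>) \<le> L * exp (t * real (word_length G S \<gamma>)))"

definition invariant_vectors ::
  "('g, 'b) monoid_scheme \<Rightarrow> 'i cspace \<Rightarrow> ('g \<Rightarrow> 'i cop) \<Rightarrow> 'i cvec set" where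
  "invariant_vectors G X \<pi> = {x \<in> fst X. \<forall>\<gamma>\<in>carrier G. \<pi> \<gamma> x = x}"

definition projection_onto :: "'i cspace \<Rightarrow> 'i cvec set \<Rightarrow> 'i cop \<Rightarrow> bool" where
  "projection_onto X W P \<longleftrightarrow>
     bounded_op X P \<and> (\<forall>x\<in>fst X. P (P x) = P x) \<and> P ` fst X = W"

text \<open>Only used for finitely supported \<open>\<mu>\<close>.\<close>

definition averaged_op :: "('g \<Rightarrow> 'i cop) \<Rightarrow> 'g pmf \<Rightarrow> 'i cop" where
  "averaged_op \<pi> \<mu> = (\<lambda>x. \<Sum>\<gamma>\<in>set_pmf \<mu>. cscale (complex_of_real (pmf \<mu> \<gamma>)) (\<pi> \<gamma> x))"

definition strong_property_T ::
  "('g, 'b) monoid_scheme \<Rightarrow> 'g set \<Rightarrow> 'i cspace set \<Rightarrow> bool" where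
  "strong_property_T G S \<E> \<longleftrightarrow>
     (\<exists>\<mu> :: nat \<Rightarrow> 'g pmf.
        (\<forall>n. set_pmf (\<mu> n) \<subseteq> {\<gamma> \<in> carrier G. word_length G S \<gamma> \<le> n}) \<and>
        (\<forall>X\<in>\<E>. \<exists>t>0. \<exists>q>0. q < 1 \<and>
           (\<forall>\<pi>. representation G X \<pi> \<and> subexp_norm_growth G S X \<pi> t \<longrightarrow>
              (\<exists>P n0. projection_onto X (invariant_vectors G X \<pi>) P \<and>
                 (\<forall>n\<ge>n0. op_norm X (\<lambda>x. averaged_op \<pi> (\<mu> n) x - P x) < q ^ n)))))"

end

theory Submission
  imports Defs
begin

text \<open>
  Let \<open>g\<^sub>0\<close> be the given metric and average its translates \<open>u \<gamma>\<close> along the measures of strong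
  property (T): \<open>y\<^sub>n = \<Sum>\<gamma>. \<mu>\<^sub>n(\<gamma>) u \<gamma>\<close>.  By subexponential growth of the first derivatives, the
  \<open>L\<^sup>2\<close> form of tensor fields, pulled back to finitely supported functions on the group, grows
  subexponentially under translation; so strong property (T), applied to the Hilbert space
  completion alone, makes both \<open>y\<^sub>n - y\<^sub>n\<^sub>+\<^sub>1\<close> and \<open>\<gamma> y\<^sub>n - y\<^sub>n\<close> decay exponentially in \<open>L\<^sup>2\<close>.
  All derivatives of \<open>u \<gamma>\<close> of order at most \<open>k - 1\<close> also grow subexponentially: on the derivatives
  of top order translation acts, up to lower order terms, through first derivatives only.
  Interpolating between the decay in \<open>L\<^sup>2\<close> and the subexponential growth of order \<open>k - 1\<close> yields
  exponential decay of order \<open>k - 2\<close> together with all Hoelder exponents below 1, hence a limit that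
  is invariant and of the required regularity.  It is positive definite because
  \<open>g\<^sub>0 \<le> C e\<^sup>\<epsilon>\<^sup>n y\<^sub>n\<close> for every \<open>\<epsilon> > 0\<close>, so that \<open>y\<^sub>n\<close> cannot decay exponentially in any direction.
\<close>

section \<open>Hilbert space completion of a degenerate inner product\<close>

text \<open>Strong property (T) is applied to a single vector, the base metric, so the closed span
  of its orbit suffices: a field is encoded by coefficients on the countable group, and translating
  coefficients is pulling back fields. This also fits the Hilbert space into
  \<open>'i \<Rightarrow> complex\<close> for any infinite \<open>'i\<close>. The measures precede
  the choice of the Hilbert space; hence each point may be studied with its own finite cover by
  coordinate cubes, and thus its own \<open>L2\<close> form, while the averages stay the same. In
  the growth of higher derivatives the obstacle is that translation by \<open>x\<close> produces
  lower order terms with constants depending on \<open>x\<close> in an uncontrolled way; cutting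
  words into blocks of one fixed length leaves finitely many of them. The interpolation is
  elementary: a function of bounded slope that is large at a point is large on a small cube, so
  decay in \<open>L2\<close> gives uniform decay; Landau's inequality then gives decay of
  derivatives order by order; powers of the uniform and of the Lipschitz bound combine to the
  Hoelder bound. Order \<open>k - 1\<close> is the last one available because pulling back a metric
  costs one derivative.\<close>

lemma cscale_simps [simp]:
  "cscale 1 x = x" "cscale 0 x = 0" "cscale a 0 = 0"
  by (auto simp: cscale_def fun_eq_iff)

lemma cscale_apply: "cscale a x i = a * x i"
  by (simp add: cscale_def)

lemma cscale_diff_eq: "x - y = x + cscale (-1) y"
  by (auto simp: cscale_def fun_eq_iff)

text \<open>The form may be degenerate, so completing also divides by its null space. The result
  must live in \<open>'i \<Rightarrow> complex\<close>, so a vector is recorded by its products with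
  the \<open>d i\<close>; since the \<open>d i\<close> span \<open>V\<close>, these numbers
  determine it up to the null space.\<close>

locale semi_ip_space =
  fixes V :: "('x \<Rightarrow> complex) set"
    and ip :: "('x \<Rightarrow> complex) \<Rightarrow> ('x \<Rightarrow> complex) \<Rightarrow> complex"
    and d :: "'i \<Rightarrow> 'x \<Rightarrow> complex"
  assumes zero_mem [simp]: "0 \<in> V"
    and add_mem [simp]: "c \<in> V \<Longrightarrow> e \<in> V \<Longrightarrow> c + e \<in> V"
    and scale_mem [simp]: "c \<in> V \<Longrightarrow> cscale k c \<in> V"
    and ip_cnj: "c \<in> V \<Longrightarrow> e \<in> V \<Longrightarrow> ip e c = cnj (ip c e)"
    and ip_add: "c \<in> V \<Longrightarrow> e \<in> V \<Longrightarrow> f \<in> V \<Longrightarrow> ip (c + e) f = ip c f + ip e f"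
    and ip_scale: "c \<in> V \<Longrightarrow> f \<in> V \<Longrightarrow> ip (cscale k c) f = k * ip c f"
    and ip_nonneg: "c \<in> V \<Longrightarrow> 0 \<le> Re (ip c c)"
    and d_mem [simp]: "d i \<in> V"
    and span: "c \<in> V \<Longrightarrow> \<exists>F k. finite F \<and> c = (\<Sum>i\<in>F. cscale (k i) (d i))"
begin

lemma diff_mem [simp]: "c \<in> V \<Longrightarrow> e \<in> V \<Longrightarrow> c - e \<in> V"
  by (simp add: cscale_diff_eq)

lemma sum_mem: "(\<And>i. i \<in> F \<Longrightarrow> f i \<in> V) \<Longrightarrow> (\<Sum>i\<in>F. f i) \<in> V"
  by (induction F rule: infinite_finite_induct) auto

lemma ip_diff: "c \<in> V \<Longrightarrow> e \<in> V \<Longrightarrow> f \<in> V \<Longrightarrow> ip (c - e) f = ip c f - ip e f"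
  by (simp add: cscale_diff_eq ip_add ip_scale)

lemma ip_add_right: "c \<in> V \<Longrightarrow> e \<in> V \<Longrightarrow> f \<in> V \<Longrightarrow> ip f (c + e) = ip f c + ip f e"
  by (metis add_mem complex_cnj_add ip_add ip_cnj)

lemma ip_scale_right: "c \<in> V \<Longrightarrow> f \<in> V \<Longrightarrow> ip f (cscale k c) = cnj k * ip f c"
  by (metis complex_cnj_mult ip_cnj ip_scale scale_mem)

lemma ip_zero_right: "f \<in> V \<Longrightarrow> ip f 0 = 0"
  using ip_scale_right[of 0 f 0] by simp

lemma ip_diff_right: "c \<in> V \<Longrightarrow> e \<in> V \<Longrightarrow> f \<in> V \<Longrightarrow> ip f (c - e) = ip f c - ip f e"
  by (simp add: cscale_diff_eq ip_add_right ip_scale_right)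

lemma ip_self: "c \<in> V \<Longrightarrow> ip c c = complex_of_real (Re (ip c c))"
  using ip_cnj[of c c] by (simp add: complex_eq_iff)

section \<open>Seminorm and Cauchy-Schwarz inequality\<close>

definition nrm :: "('x \<Rightarrow> complex) \<Rightarrow> real" where
  "nrm c = sqrt (Re (ip c c))"

lemma nrm_nonneg [simp]: "c \<in> V \<Longrightarrow> 0 \<le> nrm c"
  by (simp add: nrm_def ip_nonneg)

lemma nrm_sq: "c \<in> V \<Longrightarrow> (nrm c)\<^sup>2 = Re (ip c c)"
  by (simp add: nrm_def ip_nonneg)

lemma nrm_sq_add:
  assumes "c \<in> V" "e \<in> V"
  shows "(nrm (c + e))\<^sup>2 = (nrm c)\<^sup>2 + 2 * Re (ip c e) + (nrm e)\<^sup>2"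
  using assms ip_cnj[of c e] by (simp add: nrm_sq ip_add ip_add_right)

lemma nrm_scale: "c \<in> V \<Longrightarrow> nrm (cscale k c) = cmod k * nrm c"
proof -
  assume c: "c \<in> V"
  have "ip (cscale k c) (cscale k c) = (k * cnj k) * complex_of_real (Re (ip c c))"
    using c ip_self[OF c] by (simp add: ip_scale ip_scale_right mult.assoc)
  also have "\<dots> = complex_of_real ((cmod k)\<^sup>2 * Re (ip c c))"
    by (simp only: complex_norm_square[symmetric] of_real_mult)
  finally show ?thesis
    by (simp add: nrm_def real_sqrt_mult)
qed

lemma cauchy_schwarz:
  assumes c: "c \<in> V" and e: "e \<in> V"
  shows "cmod (ip c e) \<le> nrm c * nrm e"
proof -
  define z where "z = ip c e"
  \<comment> \<open>The squared seminorm of \<open>c - t z e\<close> is nonnegative for every real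
    \<open>t\<close>.\<close>
  have key: "0 \<le> (nrm c)\<^sup>2 - 2 * t * (cmod z)\<^sup>2 + t\<^sup>2 * (cmod z)\<^sup>2 * (nrm e)\<^sup>2" for t :: real
  proof -
    let ?s = "- (complex_of_real t * z)"
    have "ip c (cscale ?s e) = - complex_of_real t * (cnj z * z)"
      using c e by (simp add: ip_scale_right z_def mult_ac)
    also have "cnj z * z = complex_of_real ((cmod z)\<^sup>2)"
      by (simp only: complex_norm_square mult.commute)
    finally have "Re (ip c (cscale ?s e)) = - t * (cmod z)\<^sup>2"
      by (metis Re_complex_of_real of_real_minus of_real_mult)
    then have "(nrm (c + cscale ?s e))\<^sup>2 = (nrm c)\<^sup>2 - 2 * t * (cmod z)\<^sup>2 + (cmod ?s * nrm e)\<^sup>2"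
      using c e by (simp add: nrm_sq_add nrm_scale)
    also have "(cmod ?s * nrm e)\<^sup>2 = t\<^sup>2 * (cmod z)\<^sup>2 * (nrm e)\<^sup>2"
      by (simp add: norm_mult power_mult_distrib)
    finally show ?thesis
      by (metis zero_le_power2)
  qed
  show ?thesis
  proof (cases "nrm e = 0")
    case True
    have "z = 0"
    proof (rule ccontr)
      assume "z \<noteq> 0"
      then have "(cmod z)\<^sup>2 > 0" by simp
      \<comment> \<open>This \<open>t\<close> makes the right-hand side of \<open>key\<close> equal
        to -1.\<close>
      with key[of "((nrm c)\<^sup>2 + 1) / (2 * (cmod z)\<^sup>2)"] True show False
        by (simp add: field_simps)
    qed
    then show ?thesis using True by (simp add: z_def)
  next
    case False
    then have pos: "(nrm e)\<^sup>2 > 0" by simp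
    have "0 \<le> (nrm c)\<^sup>2 - (cmod z)\<^sup>2 / (nrm e)\<^sup>2"
    proof -
      have "(1 / E)\<^sup>2 * Z * E = Z / E" if "E > 0" for E Z :: real
        using that by (simp add: power2_eq_square)
      from this[OF pos, of "(cmod z)\<^sup>2"] key[of "1 / (nrm e)\<^sup>2"] show ?thesis by simp
    qed
    then have "(cmod z)\<^sup>2 \<le> (nrm c * nrm e)\<^sup>2"
      using pos by (simp add: field_simps power_mult_distrib)
    then show ?thesis
      unfolding z_def by (rule power2_le_imp_le) (use c e in simp)
  qed
qed

lemma nrm_triangle:
  assumes "c \<in> V" "e \<in> V" shows "nrm (c + e) \<le> nrm c + nrm e"
proof (rule power2_le_imp_le)
  have "Re (ip c e) \<le> nrm c * nrm e"
    using cauchy_schwarz[OF assms] complex_Re_le_cmod order_trans by blast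
  then show "(nrm (c + e))\<^sup>2 \<le> (nrm c + nrm e)\<^sup>2"
    using assms by (simp add: nrm_sq_add power2_sum)
qed (use assms in simp)

lemma nrm_minus: "c \<in> V \<Longrightarrow> e \<in> V \<Longrightarrow> nrm (c - e) = nrm (e - c)"
proof -
  assume "c \<in> V" "e \<in> V"
  moreover have "c - e = cscale (-1) (e - c)" by (auto simp: cscale_def fun_eq_iff)
  ultimately show ?thesis by (simp add: nrm_scale)
qed

lemma nrm_zero [simp]: "nrm 0 = 0"
  using nrm_scale[OF zero_mem, of 0] by simp

lemma nrm_reverse_triangle:
  assumes "c \<in> V" "e \<in> V" shows "\<bar>nrm c - nrm e\<bar> \<le> nrm (c - e)"
  using nrm_triangle[of "c - e" e] nrm_triangle[of "e - c" c] nrm_minus[of c e] assms by simp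

section \<open>Cauchy sequences of \<open>V\<close> and their coordinate limits\<close>

definition qcauchy :: "(nat \<Rightarrow> 'x \<Rightarrow> complex) \<Rightarrow> bool" where
  "qcauchy u \<longleftrightarrow> (\<forall>n. u n \<in> V) \<and> (\<forall>e>0. \<exists>N. \<forall>m\<ge>N. \<forall>n\<ge>N. nrm (u m - u n) < e)"

text \<open>The completion consists of the families of limits \<open>lim\<^sub>n ip (u n) (d i)\<close> of Cauchy sequences.\<close>

definition rep :: "(nat \<Rightarrow> 'x \<Rightarrow> complex) \<Rightarrow> ('i \<Rightarrow> complex) \<Rightarrow> bool" where
  "rep u a \<longleftrightarrow> qcauchy u \<and> (\<forall>i. (\<lambda>n. ip (u n) (d i)) \<longlonglongrightarrow> a i)"

lemma qcauchyD: "qcauchy u \<Longrightarrow> u n \<in> V" by (simp add: qcauchy_def)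

lemma rep_mem: "rep u a \<Longrightarrow> u n \<in> V" by (simp add: rep_def qcauchy_def)

lemma qcauchy_const: "c \<in> V \<Longrightarrow> qcauchy (\<lambda>_. c)" by (simp add: qcauchy_def)

lemma qcauchy_add:
  assumes "qcauchy u" "qcauchy v" shows "qcauchy (\<lambda>n. u n + v n)"
  unfolding qcauchy_def
proof (intro conjI allI impI)
  show "u n + v n \<in> V" for n using assms by (simp add: qcauchy_def)
  fix e :: real assume "e > 0"
  then obtain N1 N2 where N: "\<And>m n. m \<ge> N1 \<Longrightarrow> n \<ge> N1 \<Longrightarrow> nrm (u m - u n) < e/2"
     "\<And>m n. m \<ge> N2 \<Longrightarrow> n \<ge> N2 \<Longrightarrow> nrm (v m - v n) < e/2"
    using assms unfolding qcauchy_def by (meson half_gt_zero)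
  have "nrm (u m + v m - (u n + v n)) < e" if "m \<ge> max N1 N2" "n \<ge> max N1 N2" for m n
  proof -
    have "nrm (u m + v m - (u n + v n)) = nrm ((u m - u n) + (v m - v n))"
      by (simp add: algebra_simps)
    also have "\<dots> \<le> nrm (u m - u n) + nrm (v m - v n)"
      using assms by (intro nrm_triangle) (auto simp: qcauchy_def)
    finally show ?thesis using N(1)[of m n] N(2)[of m n] that by simp
  qed
  then show "\<exists>N. \<forall>m\<ge>N. \<forall>n\<ge>N. nrm (u m + v m - (u n + v n)) < e" by blast
qed

lemma qcauchy_lipschitz:
  assumes u: "qcauchy u" and T: "\<And>c. c \<in> V \<Longrightarrow> T c \<in> V"
    and lip: "\<And>c e. c \<in> V \<Longrightarrow> e \<in> V \<Longrightarrow> nrm (T c - T e) \<le> M * nrm (c - e)"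
  shows "qcauchy (\<lambda>n. T (u n))"
  unfolding qcauchy_def
proof (intro conjI allI impI)
  show "T (u n) \<in> V" for n using u T by (simp add: qcauchy_def)
  fix e :: real assume "e > 0"
  then have "e / (\<bar>M\<bar> + 1) > 0" by simp
  then obtain N where N: "\<And>m n. m \<ge> N \<Longrightarrow> n \<ge> N \<Longrightarrow> nrm (u m - u n) < e / (\<bar>M\<bar> + 1)"
    using u unfolding qcauchy_def by blast
  have "nrm (T (u m) - T (u n)) < e" if "m \<ge> N" "n \<ge> N" for m n
  proof -
    have mem: "u m \<in> V" "u n \<in> V" using u by (auto simp: qcauchy_def)
    have "nrm (T (u m) - T (u n)) \<le> M * nrm (u m - u n)" using lip mem by blast
    also have "\<dots> \<le> (\<bar>M\<bar> + 1) * nrm (u m - u n)" using mem by (intro mult_right_mono) auto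
    also have "\<dots> < (\<bar>M\<bar> + 1) * (e / (\<bar>M\<bar> + 1))"
      using N[OF that] by (intro mult_strict_left_mono) auto
    finally show ?thesis by simp
  qed
  then show "\<exists>N. \<forall>m\<ge>N. \<forall>n\<ge>N. nrm (T (u m) - T (u n)) < e" by blast
qed

lemma qcauchy_scale:
  assumes "qcauchy u" shows "qcauchy (\<lambda>n. cscale k (u n))"
proof (rule qcauchy_lipschitz[OF assms])
  show "nrm (cscale k c - cscale k e) \<le> cmod k * nrm (c - e)" if "c \<in> V" "e \<in> V" for c e
  proof -
    have "cscale k c - cscale k e = cscale k (c - e)" by (auto simp: cscale_def fun_eq_iff algebra_simps)
    then show ?thesis using that by (simp add: nrm_scale)
  qed
qed simp

lemma qcauchy_bounded:
  assumes "qcauchy u" shows "\<exists>B>0. \<forall>n. nrm (u n) \<le> B"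
proof -
  obtain N where N: "\<And>m n. m \<ge> N \<Longrightarrow> n \<ge> N \<Longrightarrow> nrm (u m - u n) < 1"
    using assms unfolding qcauchy_def by (meson zero_less_one)
  define B where "B = nrm (u N) + 1 + (\<Sum>n<N. nrm (u n))"
  have mem: "u n \<in> V" for n using assms by (simp add: qcauchy_def)
  have "nrm (u n) \<le> B" for n
  proof (cases "n < N")
    case True
    then have "nrm (u n) \<le> (\<Sum>n<N. nrm (u n))" using mem by (intro member_le_sum) auto
    then show ?thesis using mem[of N] by (simp add: B_def add_increasing)
  next
    case False
    then have "nrm (u n) \<le> nrm (u N) + 1"
      using N[of n N] nrm_reverse_triangle[OF mem mem, of n N] by simp
    then show ?thesis using mem by (simp add: B_def sum_nonneg add_increasing2)
  qed
  moreover have "B > 0" using mem unfolding B_def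
    by (simp add: add_pos_nonneg add_nonneg_pos sum_nonneg)
  ultimately show ?thesis by blast
qed

lemma ip_converges:
  assumes u: "qcauchy u" and v: "qcauchy v" shows "convergent (\<lambda>n. ip (u n) (v n))"
proof (rule Cauchy_convergent, rule metric_CauchyI)
  fix e :: real assume e: "e > 0"
  obtain B1 B2 where B: "B1 > 0" "\<And>n. nrm (u n) \<le> B1" "B2 > 0" "\<And>n. nrm (v n) \<le> B2"
    using qcauchy_bounded u v by metis
  have mem: "u n \<in> V" "v n \<in> V" for n using u v by (auto simp: qcauchy_def)
  obtain N1 where N1: "\<And>m n. m \<ge> N1 \<Longrightarrow> n \<ge> N1 \<Longrightarrow> nrm (u m - u n) < e / (2 * B2)"
    using u e B unfolding qcauchy_def by (metis divide_pos_pos mult_pos_pos zero_less_numeral)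
  obtain N2 where N2: "\<And>m n. m \<ge> N2 \<Longrightarrow> n \<ge> N2 \<Longrightarrow> nrm (v m - v n) < e / (2 * B1)"
    using v e B unfolding qcauchy_def by (metis divide_pos_pos mult_pos_pos zero_less_numeral)
  have "dist (ip (u m) (v m)) (ip (u n) (v n)) < e" if "m \<ge> max N1 N2" "n \<ge> max N1 N2" for m n
  proof -
    have "ip (u m) (v m) - ip (u n) (v n) = ip (u m - u n) (v m) + ip (u n) (v m - v n)"
      using mem by (simp add: ip_diff ip_diff_right)
    then have "dist (ip (u m) (v m)) (ip (u n) (v n))
        \<le> cmod (ip (u m - u n) (v m)) + cmod (ip (u n) (v m - v n))"
      by (simp add: dist_norm norm_triangle_ineq)
    also have "\<dots> \<le> nrm (u m - u n) * nrm (v m) + nrm (u n) * nrm (v m - v n)"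
      using mem by (intro add_mono cauchy_schwarz) auto
    also have "\<dots> \<le> nrm (u m - u n) * B2 + B1 * nrm (v m - v n)"
      using B mem by (intro add_mono mult_mono) auto
    also have "\<dots> < e / (2 * B2) * B2 + B1 * (e / (2 * B1))"
      using N1[of m n] N2[of m n] that B
      by (intro add_strict_mono mult_strict_right_mono mult_strict_left_mono) auto
    also have "\<dots> = e" using B by simp
    finally show ?thesis .
  qed
  then show "\<exists>M. \<forall>m\<ge>M. \<forall>n\<ge>M. dist (ip (u m) (v m)) (ip (u n) (v n)) < e" by blast
qed

lemma rep_of_qcauchy:
  assumes "qcauchy u" shows "rep u (\<lambda>i. lim (\<lambda>n. ip (u n) (d i)))"
  using ip_converges[OF assms qcauchy_const[OF d_mem]] assms
  by (simp add: rep_def convergent_LIMSEQ_iff)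

lemma rep_unique: "rep u a \<Longrightarrow> rep u b \<Longrightarrow> a = b"
  unfolding rep_def using LIMSEQ_unique by blast

lemma rep_add: "rep u a \<Longrightarrow> rep v b \<Longrightarrow> rep (\<lambda>n. u n + v n) (a + b)"
  unfolding rep_def using qcauchy_add[of u v]
  by (auto simp: ip_add qcauchyD intro!: tendsto_add)

lemma rep_scale: "rep u a \<Longrightarrow> rep (\<lambda>n. cscale k (u n)) (cscale k a)"
  unfolding rep_def using qcauchy_scale[of u]
  by (auto simp: ip_scale qcauchyD cscale_apply intro!: tendsto_mult)

lemma rep_diff: "rep u a \<Longrightarrow> rep v b \<Longrightarrow> rep (\<lambda>n. u n - v n) (a - b)"
  unfolding cscale_diff_eq by (intro rep_add rep_scale)

lemma rep_zero: "rep (\<lambda>_. 0) 0"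
  using ip_scale[OF zero_mem, of _ 0] by (auto simp: rep_def qcauchy_const)

text \<open>A weakly null Cauchy sequence is null in norm: the squared norm of \<open>u n\<close> is
  its product with \<open>u n - u N\<close>, small by the Cauchy property, plus its product with the
  fixed vector \<open>u N\<close>, a combination of the \<open>d i\<close>. This is why distinct
  classes have distinct coordinates.\<close>

lemma rep_0_nrm:
  assumes "rep u 0" shows "(\<lambda>n. nrm (u n)) \<longlonglongrightarrow> 0"
proof -
  have u: "qcauchy u" and mem: "u n \<in> V" for n using assms by (auto simp: rep_def qcauchy_def)
  have lim: "(\<lambda>n. ip (u n) c) \<longlonglongrightarrow> 0" if c: "c \<in> V" for c
  proof -
    obtain F k where F: "finite F" "c = (\<Sum>i\<in>F. cscale (k i) (d i))" using span[OF c] by blast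
    have eq: "ip (u n) (\<Sum>i\<in>F. cscale (k i) (d i)) = (\<Sum>i\<in>F. cnj (k i) * ip (u n) (d i))" for n
      using F(1)
    proof (induction F rule: finite_induct)
      case empty
      show ?case by (simp only: sum.empty ip_zero_right[OF mem])
    next
      case (insert x F)
      then show ?case by (simp add: ip_add_right sum_mem mem ip_scale_right del: plus_fun_apply)
    qed
    have "(\<lambda>n. \<Sum>i\<in>F. cnj (k i) * ip (u n) (d i)) \<longlonglongrightarrow> (\<Sum>i\<in>F. cnj (k i) * 0)"
      using assms by (intro tendsto_sum tendsto_mult) (auto simp: rep_def)
    then show ?thesis by (simp add: F(2) eq)
  qed
  obtain B where B: "B > 0" "\<And>n. nrm (u n) \<le> B" using qcauchy_bounded[OF u] by blast
  have "(\<lambda>n. (nrm (u n))\<^sup>2) \<longlonglongrightarrow> 0"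
  proof (rule LIMSEQ_I)
    fix e :: real assume e: "e > 0"
    then obtain N where N: "\<And>m n. m \<ge> N \<Longrightarrow> n \<ge> N \<Longrightarrow> nrm (u m - u n) < e / (2 * B)"
      using u B unfolding qcauchy_def by (metis divide_pos_pos mult_pos_pos zero_less_numeral)
    obtain N' where N': "\<And>n. n \<ge> N' \<Longrightarrow> cmod (ip (u n) (u N)) < e / 2"
      using LIMSEQ_D[OF lim[OF mem[of N]], of "e/2"] e by auto
    have "norm ((nrm (u n))\<^sup>2 - 0) < e" if "n \<ge> max N N'" for n
    proof -
      have "(nrm (u n))\<^sup>2 = Re (ip (u n) (u n - u N)) + Re (ip (u n) (u N))"
        using mem by (simp add: nrm_sq ip_diff_right)
      also have "\<dots> \<le> nrm (u n) * nrm (u n - u N) + cmod (ip (u n) (u N))"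
        using cauchy_schwarz[of "u n" "u n - u N"] mem
        by (intro add_mono complex_Re_le_cmod) (auto intro: order_trans[OF complex_Re_le_cmod])
      also have "\<dots> \<le> B * nrm (u n - u N) + cmod (ip (u n) (u N))"
        using B mem by (intro add_mono mult_right_mono) auto
      also have "\<dots> < B * (e / (2 * B)) + e / 2"
        using N[of n N] N'[of n] that B by (intro add_strict_mono mult_strict_left_mono) auto
      also have "\<dots> = e" using B by simp
      finally show ?thesis by simp
    qed
    then show "\<exists>no. \<forall>n\<ge>no. norm ((nrm (u n))\<^sup>2 - 0) < e" by blast
  qed
  then have "(\<lambda>n. sqrt ((nrm (u n))\<^sup>2)) \<longlonglongrightarrow> sqrt 0" by (rule tendsto_real_sqrt)
  then show ?thesis using mem by simp
qed

section \<open>The completion as a space of coordinate families\<close>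

definition carrierH :: "('i \<Rightarrow> complex) set" where "carrierH = {a. \<exists>u. rep u a}"

definition crep :: "('i \<Rightarrow> complex) \<Rightarrow> nat \<Rightarrow> 'x \<Rightarrow> complex" where
  "crep a = (SOME u. rep u a)"

definition ipH :: "('i \<Rightarrow> complex) \<Rightarrow> ('i \<Rightarrow> complex) \<Rightarrow> complex" where
  "ipH a b = lim (\<lambda>n. ip (crep a n) (crep b n))"

definition normH :: "('i \<Rightarrow> complex) \<Rightarrow> real" where
  "normH a = sqrt (Re (ipH a a))"

lemma crep: "a \<in> carrierH \<Longrightarrow> rep (crep a) a"
  unfolding carrierH_def crep_def using someI_ex[of "\<lambda>u. rep u a"] by blast

lemma repH: "rep u a \<Longrightarrow> a \<in> carrierH" by (auto simp: carrierH_def)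

text \<open>Two sequences with the same coordinates differ by a null sequence
  (\<open>rep_0_nrm\<close>), so the choice made by \<open>crep\<close> drops out. Algebraic laws
  then pass to the limit along whichever sequences are convenient.\<close>

lemma ipH_lim:
  assumes u: "rep u a" and v: "rep v b" shows "(\<lambda>n. ip (u n) (v n)) \<longlonglongrightarrow> ipH a b"
proof -
  let ?u = "crep a" and ?v = "crep b"
  have u': "rep ?u a" and v': "rep ?v b" using crep repH u v by blast+
  note mem = rep_mem[OF u] rep_mem[OF v] rep_mem[OF u'] rep_mem[OF v']
  have z: "(\<lambda>n. nrm (u n - ?u n)) \<longlonglongrightarrow> 0" "(\<lambda>n. nrm (v n - ?v n)) \<longlonglongrightarrow> 0"
    using rep_0_nrm rep_diff[OF u u'] rep_diff[OF v v'] by auto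
  obtain B1 B2 where B: "\<And>n. nrm (?u n) \<le> B1" "\<And>n. nrm (v n) \<le> B2"
    using qcauchy_bounded u' v unfolding rep_def by metis
  have l: "(\<lambda>n. ip (?u n) (?v n)) \<longlonglongrightarrow> ipH a b"
    using ip_converges[of ?u ?v] u' v' by (simp add: ipH_def rep_def convergent_LIMSEQ_iff)
  have "(\<lambda>n. ip (u n) (v n) - ip (?u n) (?v n)) \<longlonglongrightarrow> 0"
  proof (rule tendsto_norm_zero_cancel, rule tendsto_sandwich[of "\<lambda>_. 0"])
    show "\<forall>\<^sub>F n in sequentially. norm (ip (u n) (v n) - ip (?u n) (?v n))
        \<le> nrm (u n - ?u n) * B2 + B1 * nrm (v n - ?v n)"
    proof (intro always_eventually allI)
      fix n
      have "ip (u n) (v n) - ip (?u n) (?v n) = ip (u n - ?u n) (v n) + ip (?u n) (v n - ?v n)"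
        using mem by (simp add: ip_diff ip_diff_right)
      then have "norm (ip (u n) (v n) - ip (?u n) (?v n))
        \<le> cmod (ip (u n - ?u n) (v n)) + cmod (ip (?u n) (v n - ?v n))"
        by (simp add: norm_triangle_ineq)
      also have "\<dots> \<le> nrm (u n - ?u n) * nrm (v n) + nrm (?u n) * nrm (v n - ?v n)"
        using mem by (intro add_mono cauchy_schwarz) auto
      also have "\<dots> \<le> nrm (u n - ?u n) * B2 + B1 * nrm (v n - ?v n)"
        using B mem by (intro add_mono mult_left_mono mult_right_mono) auto
      finally show "norm (ip (u n) (v n) - ip (?u n) (?v n))
        \<le> nrm (u n - ?u n) * B2 + B1 * nrm (v n - ?v n)" .
    qed
    show "(\<lambda>n. nrm (u n - ?u n) * B2 + B1 * nrm (v n - ?v n)) \<longlonglongrightarrow> 0"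
      using tendsto_add[OF tendsto_mult_left_zero[OF z(1)] tendsto_mult_right_zero[OF z(2)]] by simp
  qed auto
  from tendsto_add[OF this l] show ?thesis by simp
qed

lemma normH_lim:
  assumes "rep u a" shows "(\<lambda>n. nrm (u n)) \<longlonglongrightarrow> normH a"
  unfolding nrm_def normH_def by (intro tendsto_intros ipH_lim assms)

lemma carrierH_closed [simp]:
  "0 \<in> carrierH" "a \<in> carrierH \<Longrightarrow> b \<in> carrierH \<Longrightarrow> a + b \<in> carrierH"
  "a \<in> carrierH \<Longrightarrow> cscale k a \<in> carrierH"
  "a \<in> carrierH \<Longrightarrow> b \<in> carrierH \<Longrightarrow> a - b \<in> carrierH"
  using crep repH rep_zero rep_add rep_scale rep_diff by meson+

lemma ipH_cnj:
  assumes "a \<in> carrierH" "b \<in> carrierH" shows "ipH b a = cnj (ipH a b)"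
proof -
  have a: "rep (crep a) a" and b: "rep (crep b) b" using crep assms by auto
  have "(\<lambda>n. ip (crep b n) (crep a n)) = (\<lambda>n. cnj (ip (crep a n) (crep b n)))"
    using ip_cnj rep_mem[OF a] rep_mem[OF b] by blast
  then have "(\<lambda>n. ip (crep b n) (crep a n)) \<longlonglongrightarrow> cnj (ipH a b)"
    using tendsto_cnj[OF ipH_lim[OF a b]] by simp
  then show ?thesis using ipH_lim[OF b a] LIMSEQ_unique by blast
qed

lemma ipH_add:
  assumes "a \<in> carrierH" "b \<in> carrierH" "c \<in> carrierH" shows "ipH (a + b) c = ipH a c + ipH b c"
proof -
  have a: "rep (crep a) a" and b: "rep (crep b) b" and c: "rep (crep c) c" using crep assms by auto
  have "(\<lambda>n. ip (crep a n + crep b n) (crep c n)) \<longlonglongrightarrow> ipH a c + ipH b c"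
    using tendsto_add[OF ipH_lim[OF a c] ipH_lim[OF b c]]
    by (simp add: ip_add rep_mem[OF a] rep_mem[OF b] rep_mem[OF c])
  then show ?thesis using ipH_lim[OF rep_add[OF a b] c] LIMSEQ_unique by blast
qed

lemma ipH_scale:
  assumes "a \<in> carrierH" "c \<in> carrierH" shows "ipH (cscale k a) c = k * ipH a c"
proof -
  have a: "rep (crep a) a" and c: "rep (crep c) c" using crep assms by auto
  have "(\<lambda>n. ip (cscale k (crep a n)) (crep c n)) \<longlonglongrightarrow> k * ipH a c"
    using tendsto_mult_left[OF ipH_lim[OF a c], of k]
    by (simp add: ip_scale rep_mem[OF a] rep_mem[OF c])
  then show ?thesis using ipH_lim[OF rep_scale[OF a] c] LIMSEQ_unique by blast
qed

lemma normH_nonneg [simp]: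
  assumes "a \<in> carrierH" shows "0 \<le> normH a"
  using normH_lim[OF crep[OF assms]] rep_mem[OF crep[OF assms]]
  by (intro LIMSEQ_le_const) auto

lemma ipH_self:
  assumes "a \<in> carrierH" shows "ipH a a = complex_of_real ((normH a)\<^sup>2)"
proof -
  have "Re (ipH a a) \<ge> 0" using normH_nonneg[OF assms] by (simp add: normH_def)
  moreover have "Im (ipH a a) = 0" using ipH_cnj[OF assms assms] by (simp add: complex_eq_iff)
  ultimately show ?thesis by (simp add: normH_def complex_eq_iff)
qed

text \<open>By Cauchy-Schwarz the coordinate \<open>a i\<close> is at most \<open>normH a\<close>
  times the seminorm of \<open>d i\<close>, so norm zero forces every coordinate to vanish.\<close>

lemma normH_eq_0:
  assumes "a \<in> carrierH" shows "normH a = 0 \<longleftrightarrow> a = 0"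
proof
  assume z: "normH a = 0"
  let ?u = "crep a"
  have u: "rep ?u a" using crep assms by auto
  have l: "(\<lambda>n. nrm (?u n) * nrm (d i)) \<longlonglongrightarrow> 0" for i
    using normH_lim[OF u] z by (simp add: tendsto_mult_left_zero)
  have "(\<lambda>n. ip (?u n) (d i)) \<longlonglongrightarrow> 0" for i
    by (rule Lim_null_comparison[OF _ l])
      (auto intro!: always_eventually cauchy_schwarz rep_mem[OF u])
  then have "a i = 0" for i using u LIMSEQ_unique unfolding rep_def by blast
  then show "a = 0" by (simp add: fun_eq_iff)
next
  assume "a = 0"
  then show "normH a = 0" using normH_lim[OF rep_zero] by (simp add: LIMSEQ_const_iff)
qed

lemma normH_scale:
  assumes "a \<in> carrierH" shows "normH (cscale k a) = cmod k * normH a"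
proof -
  have a: "rep (crep a) a" using crep assms by auto
  have "(\<lambda>n. nrm (cscale k (crep a n))) \<longlonglongrightarrow> cmod k * normH a"
    using tendsto_mult_left[OF normH_lim[OF a], of "cmod k"] by (simp add: nrm_scale rep_mem[OF a])
  then show ?thesis using normH_lim[OF rep_scale[OF a]] LIMSEQ_unique by blast
qed

lemma normH_triangle:
  assumes "a \<in> carrierH" "b \<in> carrierH" shows "normH (a + b) \<le> normH a + normH b"
proof -
  have a: "rep (crep a) a" and b: "rep (crep b) b" using crep assms by auto
  show ?thesis
    using normH_lim[OF rep_add[OF a b]] tendsto_add[OF normH_lim[OF a] normH_lim[OF b]]
    by (rule LIMSEQ_le) (use nrm_triangle rep_mem[OF a] rep_mem[OF b] in blast)
qed

section \<open>Dense embedding and completeness\<close>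

definition emb :: "('x \<Rightarrow> complex) \<Rightarrow> 'i \<Rightarrow> complex" where "emb c = (\<lambda>i. ip c (d i))"

lemma rep_emb: "c \<in> V \<Longrightarrow> rep (\<lambda>_. c) (emb c)" by (simp add: rep_def qcauchy_const emb_def)

lemma emb_mem [simp]: "c \<in> V \<Longrightarrow> emb c \<in> carrierH" using rep_emb repH by blast

lemma normH_emb: "c \<in> V \<Longrightarrow> normH (emb c) = nrm c"
  using normH_lim[OF rep_emb] LIMSEQ_const_iff by metis

lemma emb_diff: "c \<in> V \<Longrightarrow> e \<in> V \<Longrightarrow> emb (c - e) = emb c - emb e"
  by (auto simp: emb_def ip_diff)

lemma emb_add: "c \<in> V \<Longrightarrow> e \<in> V \<Longrightarrow> emb (c + e) = emb c + emb e"
  by (auto simp: emb_def ip_add)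

lemma emb_scale: "c \<in> V \<Longrightarrow> emb (cscale k c) = cscale k (emb c)"
  by (auto simp: emb_def ip_scale cscale_apply)

lemma emb_sum:
  "(\<And>j. j \<in> F \<Longrightarrow> f j \<in> V) \<Longrightarrow> emb (\<Sum>j\<in>F. f j) = (\<Sum>j\<in>F. emb (f j))"
proof (induction F rule: infinite_finite_induct)
  case (insert x F)
  then show ?case by (simp add: emb_add sum_mem del: plus_fun_apply)
qed (use emb_scale[OF zero_mem, of 0] in simp_all)

lemma emb_dense:
  assumes "rep u a" shows "(\<lambda>n. normH (a - emb (u n))) \<longlonglongrightarrow> 0"
proof (rule LIMSEQ_I)
  fix e :: real assume e: "e > 0"
  then obtain N where N: "\<And>m n. m \<ge> N \<Longrightarrow> n \<ge> N \<Longrightarrow> nrm (u m - u n) < e / 2"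
    using assms unfolding rep_def qcauchy_def by (meson half_gt_zero)
  have "norm (normH (a - emb (u n)) - 0) < e" if "n \<ge> N" for n
  proof -
    have r: "rep (\<lambda>m. u m - u n) (a - emb (u n))"
      using rep_diff[OF assms rep_emb] rep_mem[OF assms] by blast
    have "normH (a - emb (u n)) \<le> e / 2"
      by (rule LIMSEQ_le_const2[OF normH_lim[OF r]]) (use N that in \<open>meson less_imp_le\<close>)
    then show ?thesis using e normH_nonneg[OF repH[OF r]] by simp
  qed
  then show "\<exists>no. \<forall>n\<ge>no. norm (normH (a - emb (u n)) - 0) < e" by blast
qed

text \<open>Approximate \<open>f n\<close> by the image of some \<open>c n\<close> in
  \<open>V\<close> to within \<open>1 / (n + 1)\<close>. The \<open>c n\<close> form a Cauchy
  sequence, and its class is the limit.\<close>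

lemma complete:
  assumes f: "\<And>n::nat. f n \<in> carrierH"
    and cau: "\<And>e. e > 0 \<Longrightarrow> \<exists>n0. \<forall>m\<ge>n0. \<forall>n\<ge>n0. normH (f m - f n) < e"
  shows "\<exists>x\<in>carrierH. (\<lambda>n. normH (f n - x)) \<longlonglongrightarrow> 0"
proof -
  have "\<exists>c\<in>V. normH (f n - emb c) < inverse (real (Suc n))" for n
  proof -
    have r: "rep (crep (f n)) (f n)" using crep f by blast
    have "inverse (real (Suc n)) > 0" by simp
    from LIMSEQ_D[OF emb_dense[OF r] this] obtain N where
      "\<forall>m\<ge>N. norm (normH (f n - emb (crep (f n) m)) - 0) < inverse (real (Suc n))" by blast
    then show ?thesis using rep_mem[OF r] by (intro bexI[of _ "crep (f n) N"]) auto
  qed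
  then obtain c where c: "\<And>n. c n \<in> V" "\<And>n. normH (f n - emb (c n)) < inverse (real (Suc n))"
    by metis
  have inv0: "(\<lambda>n. inverse (real (Suc n))) \<longlonglongrightarrow> 0" by (rule LIMSEQ_inverse_real_of_nat)
  have tri: "normH (x - z) \<le> normH (x - y) + normH (y - z)"
    if "x \<in> carrierH" "y \<in> carrierH" "z \<in> carrierH" for x y z
    using normH_triangle[of "x - y" "y - z"] that by simp
  have sym: "normH (x - y) = normH (y - x)" if "x \<in> carrierH" "y \<in> carrierH" for x y
  proof -
    have "x - y = cscale (-1) (y - x)" by (auto simp: cscale_def fun_eq_iff)
    then show ?thesis using that normH_scale[of "y - x" "-1"] by simp
  qed
  have q: "qcauchy c"
    unfolding qcauchy_def
  proof (intro conjI allI impI c)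
    fix e :: real assume e: "e > 0"
    then obtain N1 where N1: "\<And>m n. m \<ge> N1 \<Longrightarrow> n \<ge> N1 \<Longrightarrow> normH (f m - f n) < e / 3"
      using cau[of "e/3"] by auto
    obtain N2 where N2: "\<And>n. n \<ge> N2 \<Longrightarrow> inverse (real (Suc n)) < e / 3"
      using LIMSEQ_D[OF inv0, of "e/3"] e by auto
    have "nrm (c m - c n) < e" if "m \<ge> max N1 N2" "n \<ge> max N1 N2" for m n
    proof -
      have "nrm (c m - c n) = normH (emb (c m) - emb (c n))"
        using c by (simp add: normH_emb emb_diff[symmetric])
      also have "\<dots> \<le> normH (emb (c m) - f m) + (normH (f m - f n) + normH (f n - emb (c n)))"
        using tri[of "emb (c m)" "f m" "emb (c n)"] tri[of "f m" "f n" "emb (c n)"] c f by simp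
      also have "\<dots> < e / 3 + (e / 3 + e / 3)"
      proof (intro add_strict_mono)
        show "normH (emb (c m) - f m) < e/3"
          using sym[OF emb_mem[OF c(1)] f, of m m] less_trans[OF c(2) N2, of m] that by simp
        show "normH (f n - emb (c n)) < e/3" using less_trans[OF c(2) N2, of n] that by simp
      qed (use N1 that in simp)
      finally show ?thesis by simp
    qed
    then show "\<exists>N. \<forall>m\<ge>N. \<forall>n\<ge>N. nrm (c m - c n) < e" by blast
  qed
  obtain x where x: "rep c x" using rep_of_qcauchy[OF q] by blast
  have "(\<lambda>n. normH (f n - x)) \<longlonglongrightarrow> 0"
  proof (rule tendsto_sandwich[of "\<lambda>_. 0" _ _ "\<lambda>n. inverse (real (Suc n)) + normH (x - emb (c n))"])
    show "\<forall>\<^sub>F n in sequentially. 0 \<le> normH (f n - x)" using f repH[OF x] by simp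
    show "\<forall>\<^sub>F n in sequentially. normH (f n - x) \<le> inverse (real (Suc n)) + normH (x - emb (c n))"
    proof (intro always_eventually allI)
      fix n
      have "normH (f n - x) \<le> normH (f n - emb (c n)) + normH (emb (c n) - x)"
        using tri f c repH[OF x] by simp
      then show "normH (f n - x) \<le> inverse (real (Suc n)) + normH (x - emb (c n))"
        using c(2)[of n] sym[of "emb (c n)" x] c(1) repH[OF x] by simp
    qed
    show "(\<lambda>n. inverse (real (Suc n)) + normH (x - emb (c n))) \<longlonglongrightarrow> 0"
      using tendsto_add[OF inv0 emb_dense[OF x]] by simp
  qed simp
  then show ?thesis using repH[OF x] by blast
qed

lemma chilbert_completion: "chilbert (carrierH, normH)"
proof -
  have "cbanach (carrierH, normH)"
    unfolding cbanach_def prod.case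
    using normH_eq_0 normH_scale normH_triangle complete by auto
  then show ?thesis
    unfolding chilbert_def prod.case
    using ipH_cnj ipH_add ipH_scale ipH_self by blast
qed

section \<open>Continuous extension of bounded operators\<close>

definition ext :: "(('x \<Rightarrow> complex) \<Rightarrow> ('x \<Rightarrow> complex)) \<Rightarrow> ('i \<Rightarrow> complex) \<Rightarrow> 'i \<Rightarrow> complex" where
  "ext T a = (\<lambda>i. lim (\<lambda>n. ip (T (crep a n)) (d i)))"

definition bop :: "(('x \<Rightarrow> complex) \<Rightarrow> ('x \<Rightarrow> complex)) \<Rightarrow> real \<Rightarrow> bool" where
  "bop T M \<longleftrightarrow> (\<forall>c\<in>V. T c \<in> V \<and> nrm (T c) \<le> M * nrm c) \<and>
     (\<forall>c\<in>V. \<forall>e\<in>V. T (c + e) = T c + T e) \<and> (\<forall>k. \<forall>c\<in>V. T (cscale k c) = cscale k (T c))"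

lemma bop_diff: "bop T M \<Longrightarrow> c \<in> V \<Longrightarrow> e \<in> V \<Longrightarrow> T (c - e) = T c - T e"
  by (simp add: bop_def cscale_diff_eq)

text \<open>A Lipschitz map sends equivalent Cauchy sequences to equivalent ones, so
  \<open>ext T\<close> can be computed along any representing sequence. Linearity, composition and
  identity of extensions then follow from a suitable choice of sequence and
  \<open>rep_unique\<close>.\<close>

lemma bop_lim:
  assumes T: "bop T M" and u: "rep u a" shows "rep (\<lambda>n. T (u n)) (ext T a)"
proof -
  have q: "qcauchy (\<lambda>n. T (u n))" if u: "rep u a" for u
  proof (rule qcauchy_lipschitz[where T = T and M = M])
    show "nrm (T c - T e) \<le> M * nrm (c - e)" if "c \<in> V" "e \<in> V" for c e
      unfolding bop_diff[OF T that, symmetric] using T diff_mem[OF that] by (simp add: bop_def)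
  qed (use u T in \<open>simp_all add: rep_def bop_def\<close>)
  have u': "rep (crep a) a" using crep repH u by blast
  have r': "rep (\<lambda>n. T (crep a n)) (ext T a)" unfolding ext_def by (rule rep_of_qcauchy[OF q[OF u']])
  obtain b where b: "rep (\<lambda>n. T (u n)) b" using rep_of_qcauchy[OF q[OF u]] by blast
  have mem: "u n \<in> V" "crep a n \<in> V" for n using rep_mem u u' by auto
  have z: "(\<lambda>n. nrm (u n - crep a n)) \<longlonglongrightarrow> 0" using rep_0_nrm[OF rep_diff[OF u u', simplified]] .
  have "(\<lambda>n. nrm (T (u n) - T (crep a n))) \<longlonglongrightarrow> 0"
  proof (rule tendsto_sandwich[of "\<lambda>_. 0"])
    show "(\<lambda>n. M * nrm (u n - crep a n)) \<longlonglongrightarrow> 0" using tendsto_mult_right_zero[OF z] .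
    show "\<forall>\<^sub>F n in sequentially. nrm (T (u n) - T (crep a n)) \<le> M * nrm (u n - crep a n)"
      unfolding bop_diff[OF T mem, symmetric] using T diff_mem[OF mem] by (simp add: bop_def)
    show "\<forall>\<^sub>F n in sequentially. 0 \<le> nrm (T (u n) - T (crep a n))"
      using T mem by (simp add: bop_def)
  qed simp
  moreover have rd: "rep (\<lambda>n. T (u n) - T (crep a n)) (b - ext T a)" using rep_diff[OF b r'] .
  ultimately have "normH (b - ext T a) = 0" using normH_lim LIMSEQ_unique by blast
  then have "b = ext T a" using normH_eq_0[OF repH[OF rd]] by simp
  then show ?thesis using b by simp
qed

lemma ext_mem: "bop T M \<Longrightarrow> a \<in> carrierH \<Longrightarrow> ext T a \<in> carrierH"
  using bop_lim crep repH by meson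

lemma ext_norm:
  assumes T: "bop T M" and a: "a \<in> carrierH" shows "normH (ext T a) \<le> M * normH a"
proof (rule LIMSEQ_le[OF normH_lim[OF bop_lim[OF T crep[OF a]]] tendsto_mult_left[OF normH_lim[OF crep[OF a]]]])
  show "\<exists>N. \<forall>n\<ge>N. nrm (T (crep a n)) \<le> M * nrm (crep a n)"
    using T rep_mem[OF crep[OF a]] by (auto simp: bop_def)
qed

lemma ext_add:
  assumes T: "bop T M" and a: "a \<in> carrierH" "b \<in> carrierH"
  shows "ext T (a + b) = ext T a + ext T b"
proof -
  note r = crep[OF a(1)] crep[OF a(2)]
  have "rep (\<lambda>n. T (crep a n + crep b n)) (ext T (a + b))" by (intro bop_lim[OF T] rep_add r)
  moreover have "(\<lambda>n. T (crep a n + crep b n)) = (\<lambda>n. T (crep a n) + T (crep b n))"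
    using T rep_mem[OF r(1)] rep_mem[OF r(2)] by (simp add: bop_def)
  ultimately show ?thesis
    using rep_unique[OF _ rep_add[OF bop_lim[OF T r(1)] bop_lim[OF T r(2)]]] by simp
qed

lemma ext_scale:
  assumes T: "bop T M" and a: "a \<in> carrierH"
  shows "ext T (cscale k a) = cscale k (ext T a)"
proof -
  note r = crep[OF a(1)]
  have "rep (\<lambda>n. T (cscale k (crep a n))) (ext T (cscale k a))" by (intro bop_lim[OF T] rep_scale r)
  moreover have "(\<lambda>n. T (cscale k (crep a n))) = (\<lambda>n. cscale k (T (crep a n)))"
    using T rep_mem[OF r(1)] by (simp add: bop_def)
  ultimately show ?thesis
    using rep_unique[OF _ rep_scale[OF bop_lim[OF T r(1)]]] by simp
qed

lemma ext_comp:
  assumes T: "bop T M" "bop T' M'" and T'': "bop T'' M''"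
    and eq: "\<And>c. c \<in> V \<Longrightarrow> T'' c = T (T' c)" and a: "a \<in> carrierH"
  shows "ext T'' a = ext T (ext T' a)"
proof -
  note r = crep[OF a(1)]
  have "rep (\<lambda>n. T (T' (crep a n))) (ext T (ext T' a))" by (intro bop_lim[OF T(1)] bop_lim[OF T(2)] r)
  moreover have "(\<lambda>n. T (T' (crep a n))) = (\<lambda>n. T'' (crep a n))"
    using eq rep_mem[OF r(1)] by simp
  ultimately show ?thesis
    using rep_unique[OF bop_lim[OF T'' r]] by simp
qed

lemma ext_id:
  assumes "\<And>c. c \<in> V \<Longrightarrow> T c = c" and a: "a \<in> carrierH" shows "ext T a = a"
proof -
  have T: "bop T 1"
    unfolding bop_def
  proof (intro conjI ballI allI)
    fix c e k assume c: "c \<in> V" and e: "e \<in> V"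
    show "T (c + e) = T c + T e"
      unfolding assms(1)[OF c] assms(1)[OF e] by (rule assms(1)[OF add_mem[OF c e]])
  next
    fix c k assume c: "c \<in> V"
    show "T c \<in> V" "nrm (T c) \<le> 1 * nrm c" "T (cscale k c) = cscale k (T c)"
      unfolding assms(1)[OF c] assms(1)[OF scale_mem[OF c]] using c by simp_all
  qed
  have "rep (\<lambda>n. T (crep a n)) (ext T a)" by (intro bop_lim[OF T] crep a)
  then have "rep (\<lambda>n. crep a n) (ext T a)" unfolding assms(1)[OF rep_mem[OF crep[OF a]]] .
  then show ?thesis by (rule rep_unique) (rule crep[OF a])
qed

lemma ext_emb:
  assumes T: "bop T M" and c: "c \<in> V" shows "ext T (emb c) = emb (T c)"
  by (rule rep_unique[OF bop_lim[OF T rep_emb[OF c]] rep_emb]) (use T c in \<open>simp add: bop_def\<close>)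

lemma bounded_op_ext:
  assumes T: "bop T M" shows "bounded_op (carrierH, normH) (ext T)"
  unfolding bounded_op_def clinear_between_def
  using ext_mem[OF T] ext_add[OF T] ext_scale[OF T] ext_norm[OF T]
  by (auto intro!: exI[of _ M])

lemma op_norm_ext_le:
  assumes T: "bop T M" and M: "M \<ge> 0" shows "op_norm (carrierH, normH) (ext T) \<le> M"
  unfolding op_norm_def
proof (rule cSUP_least)
  have "normH 0 = 0" using normH_eq_0 by simp
  then show "{x \<in> fst (carrierH, normH). snd (carrierH, normH) x \<le> 1} \<noteq> {}"
    using carrierH_closed(1) by (auto intro!: exI[of _ 0])
  fix x assume "x \<in> {x \<in> fst (carrierH, normH). snd (carrierH, normH) x \<le> 1}"
  then have "x \<in> carrierH" "normH x \<le> 1" by auto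
  then show "snd (carrierH, normH) (ext T x) \<le> M"
    using ext_norm[OF T, of x] M mult_left_mono[of "normH x" 1 M] by simp
qed

end

text \<open>\<open>op_norm\<close> is a supremum of reals, so it bounds anything only once the set
  is known to be bounded above, which \<open>bounded_op\<close> provides. The rest is homogeneity,
  with vectors of norm zero treated apart.\<close>

lemma op_norm_bound:
  assumes X: "cbanach X" and T: "bounded_op X T" and x: "x \<in> fst X"
  shows "snd X (T x) \<le> op_norm X T * snd X x"
proof -
  obtain V N where XV: "X = (V, N)" by force
  have lin: "T (cscale a x) = cscale a (T x)" "T x \<in> V" if "x \<in> V" for a x
    using T that unfolding XV bounded_op_def clinear_between_def fst_conv by blast+
  have X': "\<forall>x\<in>V. N x \<ge> 0 \<and> (N x = 0 \<longleftrightarrow> x = 0)" "\<forall>a. \<forall>x\<in>V. N (cscale a x) = cmod a * N x"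
    "\<forall>a. \<forall>x\<in>V. cscale a x \<in> V"
    using X unfolding XV cbanach_def prod.case by - (elim conjE, assumption)+
  have ban: "N (cscale a x) = cmod a * N x" "N x \<ge> 0" "N x = 0 \<longleftrightarrow> x = 0" "cscale a x \<in> V"
    if "x \<in> V" for a x
    using X' that by auto
  obtain C where C: "\<And>x. x \<in> V \<Longrightarrow> N (T x) \<le> C * N x"
    using T unfolding XV bounded_op_def fst_conv snd_conv by blast
  have bdd: "bdd_above ((\<lambda>x. N (T x)) ` {x \<in> V. N x \<le> 1})"
  proof (rule bdd_aboveI2)
    fix x assume "x \<in> {x \<in> V. N x \<le> 1}"
    then have "N (T x) \<le> C * N x" "N x \<le> 1" "N x \<ge> 0" using C ban by auto
    moreover have "C * N x \<le> \<bar>C\<bar> * 1" using calculation by (intro mult_mono) auto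
    ultimately show "N (T x) \<le> \<bar>C\<bar>" by linarith
  qed
  show ?thesis
  proof (cases "N x = 0")
    case True
    then have "x = 0" using ban x XV by simp
    then have "T x = 0" using lin(1)[of x 0] x XV by simp
    then have "T x = x" using \<open>x = 0\<close> by simp
    then have "N (T x) = 0" using True by simp
    then show ?thesis using True by (simp add: XV)
  next
    case False
    let ?a = "complex_of_real (1 / N x)"
    have xV: "x \<in> V" using x XV by simp
    have pos: "N x > 0" using False ban(2)[OF xV] by linarith
    have "N (cscale ?a x) = 1" using pos ban(1)[OF xV, of ?a] by (simp add: norm_divide)
    then have "N (T (cscale ?a x)) \<le> op_norm X T"
      unfolding op_norm_def XV using bdd ban(4)[OF xV, of ?a] by (auto intro!: cSUP_upper)
    then have "N (T x) / N x \<le> op_norm X T"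
      using lin(1)[OF xV, of ?a] ban(1)[OF lin(2)[OF xV], of ?a] pos by (simp add: norm_divide)
    then show ?thesis using pos by (simp add: XV field_simps)
  qed
qed

section \<open>Word length\<close>

locale wgroup = group G for G :: "('g, 'b) monoid_scheme" (structure) +
  fixes S :: "'g set"
  assumes sg: "symmetric_generating_set G S"
begin

abbreviation len :: "'g \<Rightarrow> nat" where "len \<equiv> word_length G S"

abbreviation word :: "'g list \<Rightarrow> 'g" where "word ws \<equiv> foldr (\<lambda>a b. a \<otimes> b) ws \<one>"

lemma S_carrier: "S \<subseteq> carrier G" and S_finite: "finite S"
  and S_inv: "s \<in> S \<Longrightarrow> inv s \<in> S" and S_gen: "generate G S = carrier G"
  using sg by (auto simp: symmetric_generating_set_def)

lemma word_closed: "set ws \<subseteq> S \<Longrightarrow> word ws \<in> carrier G"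
  using S_carrier by (induction ws) auto

lemma word_append: "set ws \<subseteq> S \<Longrightarrow> set vs \<subseteq> S \<Longrightarrow> word (ws @ vs) = word ws \<otimes> word vs"
proof (induction ws)
  case (Cons a ws)
  then show ?case using S_carrier word_closed[of ws] word_closed[of vs] by (auto simp: m_assoc)
qed (use word_closed in auto)

lemma word_inv: "set ws \<subseteq> S \<Longrightarrow> word (map (m_inv G) (rev ws)) = inv (word ws)"
proof (induction ws)
  case (Cons a ws)
  have a: "a \<in> S" "a \<in> carrier G" using Cons.prems S_carrier by auto
  have "word (map (m_inv G) (rev (a # ws))) = word (map (m_inv G) (rev ws) @ [inv a])" by simp
  also have "\<dots> = word (map (m_inv G) (rev ws)) \<otimes> word [inv a]"
    using Cons.prems S_inv by (intro word_append) auto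
  also have "\<dots> = inv (word (a # ws))"
    using Cons a word_closed[of ws] by (simp add: inv_mult_group)
  finally show ?case .
qed simp

lemma word_exists:
  assumes "x \<in> carrier G" shows "\<exists>ws. set ws \<subseteq> S \<and> word ws = x"
proof -
  have "x \<in> generate G S" using assms S_gen by simp
  then show ?thesis
  proof (induction rule: generate.induct)
    case one
    show ?case by (intro exI[of _ "[]"]) simp
  next
    case (incl h)
    then show ?case using S_carrier by (intro exI[of _ "[h]"]) auto
  next
    case (inv h)
    then show ?case using S_inv S_carrier by (intro exI[of _ "[inv h]"]) auto
  next
    case (eng h1 h2)
    then obtain w1 w2 where "set w1 \<subseteq> S" "word w1 = h1" "set w2 \<subseteq> S" "word w2 = h2" by blast
    then show ?case using word_append by (intro exI[of _ "w1 @ w2"]) auto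
  qed
qed

lemma len_word:
  assumes "x \<in> carrier G" shows "\<exists>ws. length ws = len x \<and> set ws \<subseteq> S \<and> word ws = x"
proof -
  obtain ws where "set ws \<subseteq> S" "word ws = x" using word_exists assms by blast
  then have "\<exists>n ws. length ws = n \<and> set ws \<subseteq> S \<and> word ws = x" by blast
  from LeastI_ex[OF this] show ?thesis unfolding word_length_def .
qed

lemma len_le: "set ws \<subseteq> S \<Longrightarrow> len (word ws) \<le> length ws"
  unfolding word_length_def by (rule Least_le) blast

lemma len_mult:
  assumes "x \<in> carrier G" "y \<in> carrier G" shows "len (x \<otimes> y) \<le> len x + len y"
proof -
  obtain w1 w2 where "length w1 = len x" "set w1 \<subseteq> S" "word w1 = x"
     "length w2 = len y" "set w2 \<subseteq> S" "word w2 = y" using len_word assms by metis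
  then show ?thesis using len_le[of "w1 @ w2"] word_append[of w1 w2] by (simp del: foldr_append)
qed

lemma len_inv_le:
  assumes "x \<in> carrier G" shows "len (inv x) \<le> len x"
proof -
  obtain w where w: "length w = len x" "set w \<subseteq> S" "word w = x" using len_word assms by metis
  have "set (map (m_inv G) (rev w)) \<subseteq> S" using w S_inv by auto
  from len_le[OF this] word_inv[OF w(2)] w show ?thesis by simp
qed

lemma len_inv: "x \<in> carrier G \<Longrightarrow> len (inv x) = len x"
  using len_inv_le[of x] len_inv_le[of "inv x"] by simp

lemma len_0: "x \<in> carrier G \<Longrightarrow> len x = 0 \<Longrightarrow> x = \<one>"
  using len_word[of x] by auto

text \<open>A shortest word is cut after its first \<open>m\<close> letters.\<close>

lemma len_split:
  assumes "x \<in> carrier G" "len x \<le> m + n"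
  shows "\<exists>y\<in>carrier G. \<exists>z\<in>carrier G. x = y \<otimes> z \<and> len y \<le> m \<and> len z \<le> n"
proof -
  obtain w where w: "length w = len x" "set w \<subseteq> S" "word w = x" using len_word assms by metis
  have s: "set (take m w) \<subseteq> S" "set (drop m w) \<subseteq> S"
    using w set_take_subset[of m w] set_drop_subset[of m w] by auto
  show ?thesis
  proof (rule bexI[of _ "word (take m w)"], rule bexI[of _ "word (drop m w)"], intro conjI)
    show "x = word (take m w) \<otimes> word (drop m w)"
      using word_append[OF s] unfolding append_take_drop_id w(3) .
    have "length (take m w) \<le> m" "length (drop m w) \<le> n" using w(1) assms(2) by auto
    then show "len (word (take m w)) \<le> m" "len (word (drop m w)) \<le> n"
      using le_trans[OF len_le[OF s(1)]] le_trans[OF len_le[OF s(2)]] by blast+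
  qed (rule word_closed[OF s(1)] word_closed[OF s(2)])+
qed

lemma carrier_countable: "countable (carrier G)"
proof -
  have "carrier G \<subseteq> word ` lists S"
  proof
    fix x assume "x \<in> carrier G"
    then obtain ws where "set ws \<subseteq> S" "word ws = x" using word_exists by blast
    then show "x \<in> word ` lists S" by (intro image_eqI[of _ _ ws]) auto
  qed
  moreover have "countable (lists S)" using S_finite by (intro countable_lists countable_finite)
  ultimately show ?thesis by (meson countable_image countable_subset)
qed

lemma ball_finite: "finite {x \<in> carrier G. len x \<le> n}"
proof (rule finite_subset)
  show "{x \<in> carrier G. len x \<le> n} \<subseteq> word ` {ws. set ws \<subseteq> S \<and> length ws \<le> n}"
  proof
    fix x assume x: "x \<in> {x \<in> carrier G. len x \<le> n}"
    then obtain w where "length w = len x" "set w \<subseteq> S" "word w = x" using len_word by blast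
    then show "x \<in> word ` {ws. set ws \<subseteq> S \<and> length ws \<le> n}" using x by auto
  qed
  show "finite (word ` {ws. set ws \<subseteq> S \<and> length ws \<le> n})"
    using S_finite finite_lists_length_le by blast
qed

text \<open>A cocycle-type bound whose leading constant is subexponential propagates: cut a word into
  blocks so long that the constant is absorbed by the exponential of the block length.\<close>

lemma subexp_blocks:
  fixes bnd bndQ :: "'g \<Rightarrow> real \<Rightarrow> bool"
  assumes mono: "\<And>x b b'. bnd x b \<Longrightarrow> b \<le> b' \<Longrightarrow> bnd x b'"
    and base: "\<exists>b. bnd \<one> b"
    and Q: "\<And>e. e > 0 \<Longrightarrow> \<exists>C. \<forall>x\<in>carrier G. bndQ x (C * exp (e * real (len x)))"
    and step: "\<And>e. e > 0 \<Longrightarrow> \<exists>C. \<forall>x\<in>carrier G. \<exists>R. \<forall>y\<in>carrier G. \<forall>b b'.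
       b \<ge> 0 \<longrightarrow> b' \<ge> 0 \<longrightarrow> bnd y b \<longrightarrow> bndQ y b' \<longrightarrow> bnd (x \<otimes> y) (C * exp (e * real (len x)) * b + R * b')"
    and monoQ: "\<And>x b b'. bndQ x b \<Longrightarrow> b \<le> b' \<Longrightarrow> bndQ x b'"
    and e: "e > 0"
  shows "\<exists>C. \<forall>x\<in>carrier G. bnd x (C * exp (e * real (len x)))"
proof -
  \<comment> \<open>The bound proved for words of at most \<open>r\<close> blocks is the cube of
    \<open>E ^ r\<close>, with \<open>E = exp (h * m)\<close>; in terms of length this is an
    exponential of rate \<open>3 * h\<close>, which stays below \<open>e\<close>.\<close>
  define h where "h = e / 4"
  have h: "h > 0" using e by (simp add: h_def)
  obtain C1 where C1: "\<And>x. x \<in> carrier G \<Longrightarrow> \<exists>R. \<forall>y\<in>carrier G. \<forall>b b'. b \<ge> 0 \<longrightarrow> b' \<ge> 0 \<longrightarrow>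
      bnd y b \<longrightarrow> bndQ y b' \<longrightarrow> bnd (x \<otimes> y) (C1 * exp (h * real (len x)) * b + R * b')"
    using step[OF h] by blast
  obtain R where R: "\<And>x y b b'. x \<in> carrier G \<Longrightarrow> y \<in> carrier G \<Longrightarrow> b \<ge> 0 \<Longrightarrow> b' \<ge> 0 \<Longrightarrow>
      bnd y b \<Longrightarrow> bndQ y b' \<Longrightarrow> bnd (x \<otimes> y) (C1 * exp (h * real (len x)) * b + R x * b')"
    using C1 by metis
  obtain CQ where CQ: "\<And>x. x \<in> carrier G \<Longrightarrow> bndQ x (CQ * exp (h * real (len x)))"
    using Q[OF h] by blast
  obtain b0 where b0: "bnd \<one> b0" using base by blast
  \<comment> \<open>Blocks so long that \<open>E\<close> is at least
    \<open>\<bar>C1\<bar> + 2\<close>: one factor \<open>E\<close> absorbs the constant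
    \<open>C1\<close>, and the excess 2 leaves room for the lower order term.\<close>
  define m where "m = Suc (nat \<lceil>(\<bar>C1\<bar> + 2) / h\<rceil>)"
  have mh: "real m * h \<ge> \<bar>C1\<bar> + 2"
  proof -
    have "real m \<ge> (\<bar>C1\<bar> + 2) / h" unfolding m_def by linarith
    then show ?thesis using h by (simp add: field_simps)
  qed
  define E where "E = exp (h * real m)"
  have E: "E \<ge> \<bar>C1\<bar> + 2" "E \<ge> 1"
    using exp_ge_add_one_self[of "h * real m"] mh unfolding E_def
    by (simp_all only: mult.commute[of h])
  \<comment> \<open>The constants \<open>R x\<close> are arbitrary, but only those of the finitely
    many blocks of length at most \<open>m\<close> occur.\<close>
  define Rm where "Rm = (\<Sum>x\<in>{x \<in> carrier G. len x \<le> m}. \<bar>R x\<bar>)"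
  have Rm: "\<bar>R x\<bar> \<le> Rm" if "x \<in> carrier G" "len x \<le> m" for x
    unfolding Rm_def using that ball_finite by (intro member_le_sum) auto
  define D where "D = \<bar>b0\<bar> + Rm * \<bar>CQ\<bar> + 1"
  have Rm0: "Rm \<ge> 0" by (simp add: Rm_def sum_nonneg)
  have D: "D \<ge> \<bar>b0\<bar>" "D \<ge> Rm * \<bar>CQ\<bar>" "D > 0"
    using mult_nonneg_nonneg[OF Rm0, of "\<bar>CQ\<bar>"] unfolding D_def by linarith+
  have main: "bnd x (D * (E ^ r) ^ 3)" if "x \<in> carrier G" "len x \<le> r * m" for r x
    using that
  proof (induction r arbitrary: x)
    case 0
    then have "x = \<one>" using len_0 by simp
    then show ?case using b0 D mono[of x b0] by simp
  next
    case (Suc r)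
    then obtain y z where yz: "y \<in> carrier G" "z \<in> carrier G" "x = y \<otimes> z" "len y \<le> m" "len z \<le> r * m"
      using len_split[of x m "r * m"] by auto
    have bz: "bnd z (D * (E ^ r) ^ 3)" using Suc.IH yz by blast
    have "CQ * exp (h * real (len z)) \<le> \<bar>CQ\<bar> * E ^ r"
    proof -
      have "exp (h * real (len z)) \<le> exp (real r * (h * real m))"
      proof -
        have "real (len z) \<le> real r * real m" using yz(5) by (metis of_nat_le_iff of_nat_mult)
        then have "h * real (len z) \<le> h * (real r * real m)" using h by (intro mult_left_mono) auto
        then show ?thesis by (simp add: mult.left_commute)
      qed
      also have "\<dots> = E ^ r" by (simp add: E_def exp_of_nat_mult)
      finally show ?thesis by (intro mult_mono) auto
    qed
    then have bQ: "bndQ z (\<bar>CQ\<bar> * E ^ r)" using CQ[OF yz(2)] monoQ by blast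
    have Er: "E ^ r \<ge> 1" using E by simp
    have b: "bnd x (C1 * exp (h * real (len y)) * (D * (E ^ r) ^ 3) + R y * (\<bar>CQ\<bar> * E ^ r))"
      unfolding yz(3) using Er D E by (intro R yz bz bQ) auto
    have "C1 * exp (h * real (len y)) \<le> (E - 2) * E"
    proof -
      have "exp (h * real (len y)) \<le> E" using yz(4) h by (simp add: E_def)
      then show ?thesis using E by (intro mult_mono) auto
    qed
    then have "C1 * exp (h * real (len y)) * (D * (E ^ r) ^ 3) \<le> (E - 2) * E * (D * (E ^ r) ^ 3)"
      using D Er by (intro mult_right_mono) auto
    moreover have "R y * (\<bar>CQ\<bar> * E ^ r) \<le> D * (E ^ r) ^ 3"
    proof -
      have "R y * (\<bar>CQ\<bar> * E ^ r) \<le> (Rm * \<bar>CQ\<bar>) * E ^ r"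
      proof -
        have "R y * (\<bar>CQ\<bar> * E ^ r) \<le> Rm * (\<bar>CQ\<bar> * E ^ r)"
          using Rm[OF yz(1,4)] Er by (intro mult_right_mono) auto
        then show ?thesis by (simp only: mult.assoc)
      qed
      also have "\<dots> \<le> D * (E ^ r) ^ 3"
        using D Er Rm0 self_le_power[of "E ^ r" 3] by (intro mult_mono) auto
      finally show ?thesis .
    qed
    moreover have "(E - 2) * E * (D * (E ^ r) ^ 3) + D * (E ^ r) ^ 3 \<le> D * (E ^ Suc r) ^ 3"
    proof -
      have "(E - 2) * E + 1 \<le> E ^ 3"
      proof -
        have "1 * (E * E) \<le> E * (E * E)" using E by (intro mult_right_mono) auto
        moreover have "1 \<le> 2 * E" using E by simp
        moreover have "(E - 2) * E = E * E - 2 * E" "E ^ 3 = E * (E * E)"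
          by (simp_all add: power3_eq_cube left_diff_distrib)
        ultimately show ?thesis by linarith
      qed
      then have "((E - 2) * E + 1) * (D * (E ^ r) ^ 3) \<le> E ^ 3 * (D * (E ^ r) ^ 3)"
        using D Er by (intro mult_right_mono) auto
      moreover have "E ^ 3 * (D * (E ^ r) ^ 3) = D * (E ^ Suc r) ^ 3"
        by (simp add: power_mult_distrib)
      moreover have "((E - 2) * E + 1) * Y = (E - 2) * E * Y + Y" for Y
        by (simp add: distrib_right)
      ultimately show ?thesis by (simp only:)
    qed
    ultimately have "C1 * exp (h * real (len y)) * (D * (E ^ r) ^ 3) + R y * (\<bar>CQ\<bar> * E ^ r)
        \<le> D * (E ^ Suc r) ^ 3" by linarith
    then show ?case by (rule mono[OF b])
  qed
  have "bnd x (D * E ^ 3 * exp (e * real (len x)))" if x: "x \<in> carrier G" for x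
  proof -
    \<comment> \<open>One block more than the quotient, so that the remainder fits as well; its cost
      is the factor \<open>E ^ 3\<close> in the final constant.\<close>
    define r where "r = len x div m + 1"
    have m0: "m > 0" by (simp add: m_def)
    have lx: "len x \<le> r * m"
    proof -
      have "len x = len x div m * m + len x mod m" by simp
      moreover have "len x mod m < m" using m0 by simp
      moreover have "r * m = len x div m * m + m" by (simp add: r_def)
      ultimately show ?thesis by linarith
    qed
    have "E ^ r = E * exp (h * real m * real (len x div m))"
      by (simp add: r_def E_def exp_of_nat_mult[symmetric] mult.commute)
    also have "\<dots> \<le> E * exp (h * real (len x))"
    proof -
      have "real m * real (len x div m) \<le> real (len x)"
        by (metis of_nat_le_iff of_nat_mult times_div_less_eq_dividend)
      then show ?thesis using h E by (simp add: mult.assoc)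
    qed
    finally have "(E ^ r) ^ 3 \<le> (E * exp (h * real (len x))) ^ 3"
      using E by (intro power_mono) auto
    also have "\<dots> = E ^ 3 * exp (3 * (h * real (len x)))"
      by (simp add: power_mult_distrib exp_of_nat_mult[symmetric])
    also have "\<dots> \<le> E ^ 3 * exp (e * real (len x))"
      using E e by (intro mult_left_mono) (auto simp: h_def)
    finally have "D * (E ^ r) ^ 3 \<le> D * E ^ 3 * exp (e * real (len x))"
      using D by (simp add: mult.assoc)
    then show ?thesis using main[OF x lx] mono by blast
  qed
  then show ?thesis by blast
qed

end

section \<open>Averages in forms of subexponential growth\<close>

lemma cbanachD:
  assumes "cbanach (V, N)"
  shows "0 \<in> V" "x \<in> V \<Longrightarrow> y \<in> V \<Longrightarrow> x + y \<in> V" "x \<in> V \<Longrightarrow> cscale a x \<in> V"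
    "x \<in> V \<Longrightarrow> N x \<ge> 0" "x \<in> V \<Longrightarrow> N (cscale a x) = cmod a * N x"
    "x \<in> V \<Longrightarrow> y \<in> V \<Longrightarrow> N (x + y) \<le> N x + N y"
proof -
  have h: "0 \<in> V" "\<forall>x\<in>V. \<forall>y\<in>V. x + y \<in> V" "\<forall>a. \<forall>x\<in>V. cscale a x \<in> V"
    "\<forall>x\<in>V. N x \<ge> 0 \<and> (N x = 0 \<longleftrightarrow> x = 0)" "\<forall>a. \<forall>x\<in>V. N (cscale a x) = cmod a * N x"
    "\<forall>x\<in>V. \<forall>y\<in>V. N (x + y) \<le> N x + N y"
    using assms unfolding cbanach_def prod.case by - (elim conjE, assumption)+
  show "0 \<in> V" by (rule h(1))
  show "x \<in> V \<Longrightarrow> y \<in> V \<Longrightarrow> x + y \<in> V" using h(2) by simp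
  show "x \<in> V \<Longrightarrow> cscale a x \<in> V" using h(3) by simp
  show "x \<in> V \<Longrightarrow> N x \<ge> 0" using h(4) by simp
  show "x \<in> V \<Longrightarrow> N (cscale a x) = cmod a * N x" using h(5) by simp
  show "x \<in> V \<Longrightarrow> y \<in> V \<Longrightarrow> N (x + y) \<le> N x + N y" using h(6) by simp
qed

lemma bounded_opI:
  assumes "\<And>x. x \<in> V \<Longrightarrow> T x \<in> V" "\<And>x y. x \<in> V \<Longrightarrow> y \<in> V \<Longrightarrow> T (x + y) = T x + T y"
    "\<And>a x. x \<in> V \<Longrightarrow> T (cscale a x) = cscale a (T x)" "\<And>x. x \<in> V \<Longrightarrow> N (T x) \<le> C * N x"
  shows "bounded_op (V, N) T"
  using assms by (auto simp: bounded_op_def clinear_between_def intro!: exI[of _ C])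

lemma bounded_opD:
  assumes "bounded_op (V, N) T"
  shows "x \<in> V \<Longrightarrow> T x \<in> V" "x \<in> V \<Longrightarrow> y \<in> V \<Longrightarrow> T (x + y) = T x + T y"
    "x \<in> V \<Longrightarrow> T (cscale a x) = cscale a (T x)" "\<exists>C. \<forall>x\<in>V. N (T x) \<le> C * N x"
  using assms by (auto simp: bounded_op_def clinear_between_def)

lemma cscale_add: "cscale a (x + y) = cscale a x + cscale a y"
  by (auto simp: cscale_def fun_eq_iff algebra_simps)

lemma cscale_cscale: "cscale a (cscale b x) = cscale (a * b) x"
  by (auto simp: cscale_def fun_eq_iff algebra_simps)

lemma bounded_op_add:
  assumes X: "cbanach (V, N)" and T: "bounded_op (V, N) T" and U: "bounded_op (V, N) U"
  shows "bounded_op (V, N) (\<lambda>x. T x + U x)"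
proof -
  obtain C D where CD: "\<And>x. x \<in> V \<Longrightarrow> N (T x) \<le> C * N x" "\<And>x. x \<in> V \<Longrightarrow> N (U x) \<le> D * N x"
    using bounded_opD(4)[OF T] bounded_opD(4)[OF U] by blast
  show ?thesis
  proof (rule bounded_opI[where C = "C + D"])
    fix x assume x: "x \<in> V"
    then show "T x + U x \<in> V" using bounded_opD(1) T U cbanachD(2)[OF X] by blast
    have "N (T x + U x) \<le> N (T x) + N (U x)"
      using bounded_opD(1)[OF T x] bounded_opD(1)[OF U x] by (rule cbanachD(6)[OF X])
    then show "N (T x + U x) \<le> (C + D) * N x" using CD[OF x] by (simp add: distrib_right)
    show "T (cscale a x) + U (cscale a x) = cscale a (T x + U x)" for a
      by (simp only: bounded_opD(3)[OF T x] bounded_opD(3)[OF U x] cscale_add)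
  next
    fix x y assume x: "x \<in> V" "y \<in> V"
    show "T (x + y) + U (x + y) = T x + U x + (T y + U y)"
      by (simp only: bounded_opD(2)[OF T x] bounded_opD(2)[OF U x] add_ac)
  qed
qed

lemma bounded_op_cscale:
  assumes X: "cbanach (V, N)" and T: "bounded_op (V, N) T"
  shows "bounded_op (V, N) (\<lambda>x. cscale k (T x))"
proof -
  obtain C where C: "\<And>x. x \<in> V \<Longrightarrow> N (T x) \<le> C * N x" using bounded_opD(4)[OF T] by blast
  show ?thesis
  proof (rule bounded_opI[where C = "cmod k * C"])
    fix x assume x: "x \<in> V"
    note Tx = bounded_opD(1)[OF T x]
    show "cscale k (T x) \<in> V" by (rule cbanachD(3)[OF X Tx])
    show "N (cscale k (T x)) \<le> cmod k * C * N x"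
      unfolding cbanachD(5)[OF X Tx] mult.assoc by (rule mult_left_mono[OF C[OF x]]) simp
    show "cscale k (T (cscale a x)) = cscale a (cscale k (T x))" for a
      by (simp only: bounded_opD(3)[OF T x] cscale_cscale mult.commute)
  next
    fix x y assume x: "x \<in> V" "y \<in> V"
    show "cscale k (T (x + y)) = cscale k (T x) + cscale k (T y)"
      by (simp only: bounded_opD(2)[OF T x] cscale_add)
  qed
qed

lemma bounded_op_diff:
  assumes "cbanach (V, N)" "bounded_op (V, N) T" "bounded_op (V, N) U"
  shows "bounded_op (V, N) (\<lambda>x. T x - U x)"
  using bounded_op_add[OF assms(1,2) bounded_op_cscale[OF assms(1,3), of "-1"]]
  by (simp only: cscale_diff_eq)

lemma bounded_op_sum:
  assumes X: "cbanach (V, N)" and T: "\<And>j. j \<in> F \<Longrightarrow> bounded_op (V, N) (T j)"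
  shows "bounded_op (V, N) (\<lambda>x. \<Sum>j\<in>F. T j x)"
  using T
proof (induction F rule: infinite_finite_induct)
  case (insert j F)
  have "bounded_op (V, N) (\<lambda>x. T j x + (\<Sum>j\<in>F. T j x))"
    using insert by (intro bounded_op_add[OF X]) auto
  then show ?case by (simp only: sum.insert[OF insert.hyps(1,2)])
next
  case empty
  have "N 0 = 0" using cbanachD(5)[OF X cbanachD(1)[OF X], of 0] by simp
  then have "bounded_op (V, N) (\<lambda>x. 0)"
    using cbanachD(1)[OF X] by (intro bounded_opI[where C = 0]) simp_all
  then show ?case by (simp only: sum.empty)
next
  case (infinite A)
  have "N 0 = 0" using cbanachD(5)[OF X cbanachD(1)[OF X], of 0] by simp
  then have "bounded_op (V, N) (\<lambda>x. 0)"
    using cbanachD(1)[OF X] by (intro bounded_opI[where C = 0]) simp_all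
  then show ?case by (simp only: sum.infinite[OF infinite.hyps])
qed

text \<open>Strong property (T) with its measures exposed: they come before the quantifier over the
  spaces, so one sequence \<open>\<mu>\<close> serves every Hilbert space built below.\<close>

definition averaging_sequence ::
  "('g, 'b) monoid_scheme \<Rightarrow> 'g set \<Rightarrow> 'i cspace set \<Rightarrow> (nat \<Rightarrow> 'g pmf) \<Rightarrow> bool" where
  "averaging_sequence G S \<E> \<mu> \<longleftrightarrow>
     (\<forall>n. set_pmf (\<mu> n) \<subseteq> {\<gamma> \<in> carrier G. word_length G S \<gamma> \<le> n}) \<and>
     (\<forall>X\<in>\<E>. \<exists>t>0. \<exists>q>0. q < 1 \<and>
        (\<forall>\<pi>. representation G X \<pi> \<and> subexp_norm_growth G S X \<pi> t \<longrightarrow>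
           (\<exists>P n0. projection_onto X (invariant_vectors G X \<pi>) P \<and>
              (\<forall>n\<ge>n0. op_norm X (\<lambda>x. averaged_op \<pi> (\<mu> n) x - P x) < q ^ n))))"

lemma strong_property_T_iff: "strong_property_T G S \<E> \<longleftrightarrow> (\<exists>\<mu>. averaging_sequence G S \<E> \<mu>)"
  unfolding strong_property_T_def averaging_sequence_def ..

section \<open>Finitely supported functions on the group\<close>

definition fsupp :: "'g set \<Rightarrow> ('g \<Rightarrow> 'a::zero) \<Rightarrow> bool" where
  "fsupp A c \<longleftrightarrow> finite {x. c x \<noteq> 0} \<and> {x. c x \<noteq> 0} \<subseteq> A"

definition delta :: "'g \<Rightarrow> 'g \<Rightarrow> 'a::zero_neq_one" where
  "delta a = (\<lambda>x. if x = a then 1 else 0)"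

text \<open>The left regular action; the value 0 off the carrier, where group operations are
  meaningless, keeps supports inside the group.\<close>

definition translate :: "('g, 'b) monoid_scheme \<Rightarrow> 'g \<Rightarrow> ('g \<Rightarrow> 'a::zero) \<Rightarrow> 'g \<Rightarrow> 'a" where
  "translate G a c = (\<lambda>x. if x \<in> carrier G then c (inv\<^bsub>G\<^esub> a \<otimes>\<^bsub>G\<^esub> x) else 0)"

lemma fsupp_delta [simp]: "a \<in> A \<Longrightarrow> fsupp A (delta a)"
  by (auto simp: fsupp_def delta_def)

lemma fsupp_add: "fsupp A c \<Longrightarrow> fsupp A e \<Longrightarrow> fsupp A (c + (e :: 'g \<Rightarrow> 'a::monoid_add))"
proof -
  assume "fsupp A c" "fsupp A e"
  moreover have "{x. (c + e) x \<noteq> 0} \<subseteq> {x. c x \<noteq> 0} \<union> {x. e x \<noteq> 0}" by auto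
  ultimately show ?thesis unfolding fsupp_def
    by (metis (no_types, lifting) Un_least finite_UnI finite_subset subset_trans)
qed

lemma fsupp_cscale: "fsupp A c \<Longrightarrow> fsupp A (cscale k c)"
  unfolding fsupp_def cscale_def
  by (rule conjI, rule finite_subset[of _ "{x. c x \<noteq> 0}"]) auto

lemma fsupp_mult: "fsupp A c \<Longrightarrow> fsupp A (\<lambda>x. k * c x :: real)"
  unfolding fsupp_def by (rule conjI, rule finite_subset[of _ "{x. c x \<noteq> 0}"]) auto

lemma fsupp_comp: "fsupp A c \<Longrightarrow> h 0 = 0 \<Longrightarrow> fsupp A (\<lambda>x. h (c x))"
  unfolding fsupp_def by (rule conjI, rule finite_subset[of _ "{x. c x \<noteq> 0}"]) auto

lemma (in group) fsupp_translate:
  assumes "fsupp (carrier G) c" "a \<in> carrier G" shows "fsupp (carrier G) (translate G a c)"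
proof -
  have "{x. translate G a c x \<noteq> 0} \<subseteq> (\<lambda>x. a \<otimes> x) ` {x. c x \<noteq> 0}"
  proof
    fix x assume "x \<in> {x. translate G a c x \<noteq> 0}"
    then have "x \<in> carrier G" "c (inv a \<otimes> x) \<noteq> 0" by (auto simp: translate_def split: if_splits)
    moreover then have "x = a \<otimes> (inv a \<otimes> x)" using assms(2) by (simp add: m_assoc[symmetric])
    ultimately show "x \<in> (\<lambda>x. a \<otimes> x) ` {x. c x \<noteq> 0}" by blast
  qed
  then show ?thesis using assms unfolding fsupp_def
    by (auto intro: finite_subset simp: translate_def split: if_splits)
qed

lemma (in group) translate_translate:
  assumes "a \<in> carrier G" "b \<in> carrier G"
  shows "translate G a (translate G b c) = translate G (a \<otimes> b) c"
  using assms by (auto simp: translate_def fun_eq_iff inv_mult_group m_assoc)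

lemma (in group) translate_one:
  assumes "fsupp (carrier G) c" shows "translate G \<one> c = c"
  using assms by (auto simp: translate_def fsupp_def fun_eq_iff)

lemma (in group) translate_delta:
  assumes "a \<in> carrier G" shows "translate G a (delta \<one>) = delta a"
proof
  fix x
  have "inv a \<otimes> x = \<one> \<longleftrightarrow> x = a" if "x \<in> carrier G"
    using that assms by (metis inv_closed inv_equality inv_inv l_inv)
  then show "translate G a (delta \<one>) x = delta a x" using assms by (auto simp: translate_def delta_def)
qed

lemma delta_expansion:
  fixes c :: "'g \<Rightarrow> complex"
  assumes "finite F" "\<And>x. x \<notin> F \<Longrightarrow> c x = 0" shows "c = (\<Sum>a\<in>F. cscale (c a) (delta a))"
proof
  fix x
  have "(\<Sum>a\<in>F. cscale (c a) (delta a)) x = (\<Sum>a\<in>F. c a * delta a x)"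
    by (induction F rule: infinite_finite_induct) (auto simp: cscale_def)
  also have "\<dots> = (\<Sum>a\<in>F. if a = x then c x else 0)"
    by (rule sum.cong) (auto simp: delta_def)
  finally show "c x = (\<Sum>a\<in>F. cscale (c a) (delta a)) x" using assms by (simp add: sum.delta')
qed

text \<open>An abstract model of the \<open>L2\<close> form of fields: a possibly degenerate real
  inner product on coefficients for which left translation grows more slowly than every exponential.
  \<open>B\<close> is real, so the complex Hilbert space that strong property (T) demands is
  assembled from real and imaginary parts.\<close>

locale group_form = wgroup G S for G :: "('g, 'b) monoid_scheme" (structure) and S +
  fixes B :: "('g \<Rightarrow> real) \<Rightarrow> ('g \<Rightarrow> real) \<Rightarrow> real"
  assumes B_add: "fsupp (carrier G) c \<Longrightarrow> fsupp (carrier G) e \<Longrightarrow> fsupp (carrier G) f \<Longrightarrow>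
      B (c + e) f = B c f + B e f"
    and B_scale: "fsupp (carrier G) c \<Longrightarrow> fsupp (carrier G) f \<Longrightarrow> B (\<lambda>x. r * c x) f = r * B c f"
    and B_sym: "fsupp (carrier G) c \<Longrightarrow> fsupp (carrier G) f \<Longrightarrow> B c f = B f c"
    and B_nonneg: "fsupp (carrier G) c \<Longrightarrow> B c c \<ge> 0"
    and B_growth: "t > 0 \<Longrightarrow> \<exists>L. \<forall>a\<in>carrier G. \<forall>c. fsupp (carrier G) c \<longrightarrow>
      B (translate G a c) (translate G a c) \<le> L * exp (t * real (word_length G S a)) * B c c"
begin

definition V :: "('g \<Rightarrow> complex) set" where "V = {c. fsupp (carrier G) c}"

definition re :: "('g \<Rightarrow> complex) \<Rightarrow> 'g \<Rightarrow> real" where "re c = (\<lambda>x. Re (c x))"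
definition im :: "('g \<Rightarrow> complex) \<Rightarrow> 'g \<Rightarrow> real" where "im c = (\<lambda>x. Im (c x))"

text \<open>The sesquilinear extension of \<open>B\<close>, linear in the first argument.\<close>

definition ip :: "('g \<Rightarrow> complex) \<Rightarrow> ('g \<Rightarrow> complex) \<Rightarrow> complex" where
  "ip c e = Complex (B (re c) (re e) + B (im c) (im e)) (B (im c) (re e) - B (re c) (im e))"

lemma re_im_fsupp: "c \<in> V \<Longrightarrow> fsupp (carrier G) (re c)" "c \<in> V \<Longrightarrow> fsupp (carrier G) (im c)"
  by (auto simp: V_def re_def im_def intro: fsupp_comp)

lemma re_im_add: "re (c + e) = re c + re e" "im (c + e) = im c + im e"
  by (auto simp: re_def im_def)

lemma re_im_scale:
  "re (cscale k c) = (\<lambda>x. Re k * re c x) + (\<lambda>x. (- Im k) * im c x)"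
  "im (cscale k c) = (\<lambda>x. Re k * im c x) + (\<lambda>x. Im k * re c x)"
  by (auto simp: re_def im_def cscale_def fun_eq_iff)

lemma ip_cscale:
  assumes "c \<in> V" "f \<in> V" shows "ip (cscale k c) f = k * ip c f"
proof -
  note s = re_im_fsupp[OF assms(1)] re_im_fsupp[OF assms(2)]
  show ?thesis
    unfolding ip_def re_im_scale
    by (simp only: B_add B_scale s fsupp_mult) (simp add: complex_eq_iff algebra_simps)
qed

text \<open>The group is countable, so an index type that is merely infinite has room for all \<open>delta a\<close>.\<close>

definition idx :: "'g \<Rightarrow> 'i::infinite" where
  "idx = (SOME f. inj_on f (carrier G))"

lemma inj_idx: "inj_on (idx :: 'g \<Rightarrow> 'i::infinite) (carrier G)"
proof -
  obtain f :: "nat \<Rightarrow> 'i" where "inj f"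
    using infinite_countable_subset[OF infinite_UNIV] by blast
  moreover have "inj_on (to_nat_on (carrier G)) (carrier G)"
    using carrier_countable by (rule inj_on_to_nat_on)
  ultimately have "inj_on (f \<circ> to_nat_on (carrier G)) (carrier G)"
    by (meson comp_inj_on inj_on_subset subset_UNIV)
  then show ?thesis unfolding idx_def by (rule someI[where P = "\<lambda>f. inj_on f (carrier G)"])
qed

text \<open>Indices outside the image of \<open>idx\<close> receive the zero vector; they only add
  zero coordinates.\<close>

definition dvec :: "'i::infinite \<Rightarrow> 'g \<Rightarrow> complex" where
  "dvec i = (if \<exists>a\<in>carrier G. idx a = i then delta (THE a. a \<in> carrier G \<and> idx a = i) else 0)"

lemma dvec_idx:
  assumes "a \<in> carrier G" shows "dvec (idx a :: 'i::infinite) = delta a"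
proof -
  have "(THE b. b \<in> carrier G \<and> idx b = (idx a :: 'i)) = a"
    using assms inj_onD[OF inj_idx[where ?'i = 'i]] by (intro the_equality) auto
  then show ?thesis using assms by (auto simp: dvec_def)
qed

lemma delta_V: "a \<in> carrier G \<Longrightarrow> delta a \<in> V" by (simp add: V_def)

sublocale H: semi_ip_space V ip "dvec :: 'i::infinite \<Rightarrow> 'g \<Rightarrow> complex"
proof
  show z: "0 \<in> V" by (simp add: V_def fsupp_def)
  show "c + e \<in> V" if "c \<in> V" "e \<in> V" for c e using that by (auto simp: V_def fsupp_add)
  show "cscale k c \<in> V" if "c \<in> V" for c k using that by (auto simp: V_def fsupp_cscale)
  show "ip e c = cnj (ip c e)" if "c \<in> V" "e \<in> V" for c e
    using that re_im_fsupp B_sym by (simp add: ip_def complex_eq_iff)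
  show "ip (c + e) f = ip c f + ip e f" if "c \<in> V" "e \<in> V" "f \<in> V" for c e f
    using re_im_fsupp[OF that(1)] re_im_fsupp[OF that(2)] re_im_fsupp[OF that(3)]
    by (simp add: ip_def re_im_add B_add complex_eq_iff del: plus_fun_apply)
  show "ip (cscale k c) f = k * ip c f" if "c \<in> V" "f \<in> V" for c f k using ip_cscale that .
  show "0 \<le> Re (ip c c)" if "c \<in> V" for c
    using re_im_fsupp[OF that] B_nonneg by (simp add: ip_def)
  show dm: "dvec i \<in> V" for i :: 'i
  proof (cases "\<exists>a\<in>carrier G. idx a = i")
    case True
    then obtain a where a: "a \<in> carrier G" "idx a = i" by blast
    have "dvec i = delta a" using dvec_idx[OF a(1), where ?'i = 'i] unfolding a(2) .
    then show ?thesis by (simp only: delta_V[OF a(1)])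
  next
    case False
    then show ?thesis using z by (simp add: dvec_def)
  qed
  show "\<exists>(F :: 'i set) k. finite F \<and> c = (\<Sum>i\<in>F. cscale (k i) (dvec i))" if c: "c \<in> V" for c
  proof -
    let ?A = "{x. c x \<noteq> 0}"
    have A: "finite ?A" "?A \<subseteq> carrier G" using c by (auto simp: V_def fsupp_def)
    have inj: "inj_on (idx :: 'g \<Rightarrow> 'i) ?A" by (rule inj_on_subset[OF inj_idx A(2)])
    have "c = (\<Sum>a\<in>?A. cscale (c a) (delta a))" by (rule delta_expansion) (use A in auto)
    also have "\<dots> = (\<Sum>a\<in>?A. cscale (c (inv_into ?A idx (idx a :: 'i))) (dvec (idx a :: 'i)))"
    proof (rule sum.cong)
      fix a assume a: "a \<in> ?A"
      then have "a \<in> carrier G" using A by blast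
      then show "cscale (c a) (delta a) = cscale (c (inv_into ?A idx (idx a :: 'i))) (dvec (idx a :: 'i))"
        using dvec_idx[of a, where ?'i = 'i] inv_into_f_f[OF inj a] by simp
    qed simp
    also have "\<dots> = (\<Sum>i\<in>(idx :: 'g \<Rightarrow> 'i) ` ?A. cscale (c (inv_into ?A idx i)) (dvec i))"
      using inj by (subst sum.reindex) auto
    finally have eq: "c = (\<Sum>i\<in>(idx :: 'g \<Rightarrow> 'i) ` ?A. cscale (c (inv_into ?A idx i)) (dvec i))" .
    define F k where "F = (idx :: 'g \<Rightarrow> 'i) ` ?A" and "k = (\<lambda>i :: 'i. c (inv_into ?A idx i))"
    have "finite F" "c = (\<Sum>i\<in>F. cscale (k i) (dvec i))"
      unfolding F_def k_def using A(1) by (simp, intro eq)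
    then show ?thesis by blast
  qed
qed

lemma translate_bop:
  assumes t: "t > 0"
  shows "\<exists>L\<ge>0. \<forall>a\<in>carrier G. H.bop (translate G a) (L * exp (t * real (len a)))"
proof -
  \<comment> \<open>The rate is \<open>2 * t\<close> because \<open>B c c\<close> is the square of
    the norm.\<close>
  obtain L where L: "\<And>a c. a \<in> carrier G \<Longrightarrow> fsupp (carrier G) c \<Longrightarrow>
      B (translate G a c) (translate G a c) \<le> L * exp (2 * t * real (len a)) * B c c"
    using B_growth[of "2 * t"] t by auto
  have "H.bop (translate G a) (sqrt \<bar>L\<bar> * exp (t * real (len a)))" if a: "a \<in> carrier G" for a
    unfolding H.bop_def
  proof (intro conjI ballI allI)
    fix c assume c: "c \<in> V"
    show "translate G a c \<in> V" using c a fsupp_translate by (simp add: V_def)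
    have ri: "re (translate G a c) = translate G a (re c)" "im (translate G a c) = translate G a (im c)"
      by (auto simp: re_def im_def translate_def)
    have "Re (ip (translate G a c) (translate G a c)) \<le> \<bar>L\<bar> * exp (2 * t * real (len a)) * Re (ip c c)"
    proof -
      have "B (translate G a e) (translate G a e) \<le> \<bar>L\<bar> * exp (2 * t * real (len a)) * B e e"
        if "fsupp (carrier G) e" for e
        by (rule order_trans[OF L[OF a that]]) (intro mult_right_mono B_nonneg that, auto)
      from this[OF re_im_fsupp(1)[OF c]] this[OF re_im_fsupp(2)[OF c]]
      show ?thesis by (simp add: ip_def ri algebra_simps)
    qed
    then have "sqrt (Re (ip (translate G a c) (translate G a c)))
        \<le> sqrt (\<bar>L\<bar> * exp (2 * t * real (len a)) * Re (ip c c))" by simp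
    also have "\<dots> = sqrt \<bar>L\<bar> * exp (t * real (len a)) * sqrt (Re (ip c c))"
    proof -
      have "exp (2 * t * real (len a)) = (exp (t * real (len a)))\<^sup>2"
        by (simp add: power2_eq_square exp_add[symmetric])
      then show ?thesis by (simp add: real_sqrt_mult)
    qed
    finally show "H.nrm (translate G a c) \<le> sqrt \<bar>L\<bar> * exp (t * real (len a)) * H.nrm c"
      by (simp add: H.nrm_def)
  qed (auto simp: translate_def cscale_def)
  then show ?thesis by (intro exI[of _ "sqrt \<bar>L\<bar>"]) auto
qed

lemma nrm_of_real: "fsupp (carrier G) c \<Longrightarrow> H.nrm (\<lambda>x. complex_of_real (c x)) = sqrt (B c c)"
proof -
  assume c: "fsupp (carrier G) c"
  have "(\<lambda>x. 0 * c x) = (0 :: 'g \<Rightarrow> real)" by auto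
  then have "B 0 0 = 0" using B_scale[OF c, of 0 0] by (simp add: fsupp_def)
  moreover have "re (\<lambda>x. complex_of_real (c x)) = c" "im (\<lambda>x. complex_of_real (c x)) = 0"
    by (auto simp: re_def im_def)
  ultimately show ?thesis by (simp add: H.nrm_def ip_def)
qed

text \<open>Let the group act on the completion by translation and apply the averages to the class
  \<open>z\<close> of \<open>delta \<one>\<close>: the result is the class of \<open>m n\<close>
  itself. Convergence at rate \<open>q\<close> to \<open>P z\<close> bounds the successive
  differences and, because \<open>P z\<close> is invariant, also the failure of invariance.\<close>

theorem averages_converge:
  fixes \<E> :: "'i::infinite cspace set"
  assumes E10: "E10_properties \<E>" and \<mu>: "averaging_sequence G S \<E> \<mu>"
  defines "m \<equiv> \<lambda>n x. pmf (\<mu> n) x"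
  shows "\<exists>q C n0. 0 < q \<and> q < 1 \<and> (\<forall>n\<ge>n0. sqrt (B (m n - m (Suc n)) (m n - m (Suc n))) \<le> C * q ^ n) \<and>
     (\<forall>a\<in>carrier G. \<exists>C. \<forall>n\<ge>n0.
        sqrt (B (translate G a (m n) - m n) (translate G a (m n) - m n)) \<le> C * q ^ n)"
proof -
  let ?X = "(H.carrierH, H.normH) :: 'i cspace"
  have hil: "chilbert ?X" by (rule H.chilbert_completion)
  then have ban: "cbanach ?X" by (simp add: chilbert_def)
  have "?X \<in> \<E>" using E10 hil by (simp add: E10_properties_def)
  then obtain t q where tq: "t > 0" "q > 0" "q < 1"
    and conv: "\<And>\<pi>. representation G ?X \<pi> \<Longrightarrow> subexp_norm_growth G S ?X \<pi> t \<Longrightarrow>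
       \<exists>P n0. projection_onto ?X (invariant_vectors G ?X \<pi>) P \<and>
              (\<forall>n\<ge>n0. op_norm ?X (\<lambda>x. averaged_op \<pi> (\<mu> n) x - P x) < q ^ n)"
    using \<mu> unfolding averaging_sequence_def by blast
  define \<pi> where "\<pi> = (\<lambda>a. H.ext (translate G a) :: 'i cop)"
  obtain L where L: "L \<ge> 0" "\<And>a. a \<in> carrier G \<Longrightarrow> H.bop (translate G a) (L * exp (t * real (len a)))"
    using translate_bop[OF tq(1)] by blast
  have rep: "representation G ?X \<pi>"
    unfolding representation_def fst_conv \<pi>_def
  proof (intro conjI ballI)
    fix a assume "a \<in> carrier G"
    then show "bounded_op ?X (H.ext (translate G a))" using L(2) H.bounded_op_ext by blast
  next
    fix x :: "'i cvec" assume "x \<in> H.carrierH"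
    then show "H.ext (translate G \<one>) x = x" by (intro H.ext_id) (auto simp: V_def translate_one)
  next
    fix a b and x :: "'i cvec" assume ab: "a \<in> carrier G" "b \<in> carrier G" and x: "x \<in> H.carrierH"
    then show "H.ext (translate G (a \<otimes> b)) x = H.ext (translate G a) (H.ext (translate G b) x)"
      using L(2)[of a] L(2)[of b] L(2)[of "a \<otimes> b"]
      by (intro H.ext_comp) (auto simp: translate_translate)
  qed
  have "subexp_norm_growth G S ?X \<pi> t"
    unfolding subexp_norm_growth_def \<pi>_def using L by (intro exI[of _ L] ballI H.op_norm_ext_le) auto
  from conv[OF rep this] obtain P n0 where
    P: "projection_onto ?X (invariant_vectors G ?X \<pi>) P"
    and n0: "\<And>n. n \<ge> n0 \<Longrightarrow> op_norm ?X (\<lambda>x. averaged_op \<pi> (\<mu> n) x - P x) < q ^ n" by blast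
  define M where "M n = (\<lambda>x. complex_of_real (m n x))" for n
  define z :: "'i cvec" where "z = H.emb (delta \<one>)"
  have one: "delta \<one> \<in> V" by (simp add: delta_V)
  have zH: "z \<in> H.carrierH" using one by (simp add: z_def)
  have sup: "set_pmf (\<mu> n) \<subseteq> {x \<in> carrier G. len x \<le> n}" for n
    using \<mu> by (simp add: averaging_sequence_def)
  have fin: "finite (set_pmf (\<mu> n))" for n using finite_subset[OF sup ball_finite] .
  have mfs: "fsupp (carrier G) (m n)" for n
    using fin[of n] sup[of n] by (auto simp: fsupp_def m_def pmf_eq_0_set_pmf)
  have MV: "M n \<in> V" for n using fsupp_comp[OF mfs, of complex_of_real n] by (simp add: V_def M_def)
  have av: "averaged_op \<pi> (\<mu> n) z = H.emb (M n)" for n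
  proof -
    have "averaged_op \<pi> (\<mu> n) z = (\<Sum>a\<in>set_pmf (\<mu> n). H.emb (cscale (M n a) (delta a)))"
      unfolding averaged_op_def
    proof (rule sum.cong)
      fix a assume "a \<in> set_pmf (\<mu> n)"
      then have a: "a \<in> carrier G" using sup by blast
      have eq: "\<pi> a z = H.emb (delta a)"
        unfolding \<pi>_def z_def H.ext_emb[OF L(2)[OF a] one] by (simp only: translate_delta[OF a])
      show "cscale (complex_of_real (pmf (\<mu> n) a)) (\<pi> a z) = H.emb (cscale (M n a) (delta a))"
        unfolding M_def m_def eq by (rule H.emb_scale[OF delta_V[OF a], symmetric])
    qed simp
    also have "\<dots> = H.emb (\<Sum>a\<in>set_pmf (\<mu> n). cscale (M n a) (delta a))"
    proof (rule H.emb_sum[symmetric])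
      show "cscale (M n a) (delta a) \<in> V" if "a \<in> set_pmf (\<mu> n)" for a
        using sup[of n] that by (intro H.scale_mem delta_V) auto
    qed
    also have "(\<Sum>a\<in>set_pmf (\<mu> n). cscale (M n a) (delta a)) = M n"
      by (rule delta_expansion[symmetric]) (use fin in \<open>auto simp: M_def m_def pmf_eq_0_set_pmf\<close>)
    finally show ?thesis .
  qed
  have bP: "bounded_op ?X P" and Pinv: "\<And>x. x \<in> H.carrierH \<Longrightarrow> P x \<in> invariant_vectors G ?X \<pi>"
    using P unfolding projection_onto_def by auto
  have bav: "bounded_op ?X (averaged_op \<pi> (\<mu> n))" for n
    unfolding averaged_op_def
  proof (intro bounded_op_sum[OF ban] bounded_op_cscale[OF ban])
    fix a assume "a \<in> set_pmf (\<mu> n)"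
    then have "a \<in> carrier G" using sup by blast
    then show "bounded_op ?X (\<pi> a)" using rep by (simp add: representation_def)
  qed
  have Pz: "P z \<in> H.carrierH" using bounded_opD(1)[OF bP zH] .
  have est: "H.normH (H.emb (M n) - P z) \<le> q ^ n * H.normH z" if "n \<ge> n0" for n
  proof -
    have "H.normH (averaged_op \<pi> (\<mu> n) z - P z)
        \<le> op_norm ?X (\<lambda>x. averaged_op \<pi> (\<mu> n) x - P x) * H.normH z"
      using op_norm_bound[OF ban bounded_op_diff[OF ban bav bP], of z] zH by simp
    also have "\<dots> \<le> q ^ n * H.normH z" using n0[OF that] zH by (intro mult_right_mono) auto
    finally show ?thesis by (simp only: av)
  qed
  define C where "C = H.normH z"
  have C: "C \<ge> 0" using zH by (simp add: C_def)
  have sub: "H.normH (x - y) \<le> H.normH (x - w) + H.normH (y - w)"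
    if "x \<in> H.carrierH" "y \<in> H.carrierH" "w \<in> H.carrierH" for x y w :: "'i cvec"
  proof -
    have e: "x - y = (x - w) + cscale (-1) (y - w)" by (auto simp: cscale_def fun_eq_iff)
    show ?thesis unfolding e
      using H.normH_triangle[of "x - w" "cscale (-1) (y - w)"] H.normH_scale[of "y - w" "-1"] that by simp
  qed
  have r1: "sqrt (B (m n - m (Suc n)) (m n - m (Suc n))) \<le> 2 * C * q ^ n" if n: "n \<ge> n0" for n
  proof -
    have "(\<lambda>x. complex_of_real ((m n - m (Suc n)) x)) = M n - M (Suc n)" by (auto simp: M_def)
    moreover have "fsupp (carrier G) (m n - m (Suc n))"
      using fsupp_add[OF mfs[of n] fsupp_mult[OF mfs[of "Suc n"], of "-1"]]
      by (simp add: fun_diff_def plus_fun_def)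
    ultimately have "sqrt (B (m n - m (Suc n)) (m n - m (Suc n))) = H.nrm (M n - M (Suc n))"
      using nrm_of_real by metis
    also have "\<dots> = H.normH (H.emb (M n) - H.emb (M (Suc n)) :: 'i cvec)"
      by (simp only: H.emb_diff[OF MV MV, symmetric] H.normH_emb[OF H.diff_mem[OF MV MV]])
    also have "\<dots> \<le> q ^ n * C + q ^ Suc n * C"
      using sub[OF H.emb_mem[OF MV] H.emb_mem[OF MV] Pz, of n "Suc n"] est[of n] est[of "Suc n"] n
      unfolding C_def by linarith
    also have "\<dots> \<le> 2 * C * q ^ n"
      using mult_right_mono[OF power_decreasing[of n "Suc n" q] C] tq by simp
    finally show ?thesis .
  qed
  have r2: "sqrt (B (translate G a (m n) - m n) (translate G a (m n) - m n))
      \<le> (L * exp (t * real (len a)) + 1) * C * q ^ n" if a: "a \<in> carrier G" and n: "n \<ge> n0" for a n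
  proof -
    let ?K = "L * exp (t * real (len a))"
    note bopa = L(2)[OF a]
    have TV: "translate G a (M n) \<in> V" using bopa MV by (simp add: H.bop_def)
    have "(\<lambda>x. complex_of_real ((translate G a (m n) - m n) x)) = translate G a (M n) - M n"
      by (auto simp: M_def translate_def)
    moreover have "fsupp (carrier G) (translate G a (m n) - m n)"
      using fsupp_add[OF fsupp_translate[OF mfs[of n] a] fsupp_mult[OF mfs[of n], of "-1"]]
      by (simp add: fun_diff_def plus_fun_def)
    ultimately have "sqrt (B (translate G a (m n) - m n) (translate G a (m n) - m n))
        = H.nrm (translate G a (M n) - M n)"
      using nrm_of_real by metis
    also have "\<dots> = H.normH (H.emb (translate G a (M n)) - H.emb (M n) :: 'i cvec)"
      by (simp only: H.emb_diff[OF TV MV, symmetric] H.normH_emb[OF H.diff_mem[OF TV MV]])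
    also have "\<dots> \<le> H.normH (H.emb (translate G a (M n)) - P z) + H.normH (H.emb (M n) - P z)"
      by (rule sub) (use TV MV Pz in simp_all)
    also have "\<dots> \<le> ?K * H.normH (H.emb (M n) - P z) + H.normH (H.emb (M n) - P z)"
    proof (rule add_right_mono)
      show "H.normH (H.emb (translate G a (M n)) - P z) \<le> ?K * H.normH (H.emb (M n) - P z)"
      proof -
      \<comment> \<open>Invariance of the limit turns the defect into the translate of
        \<open>H.emb (M n) - P z\<close>, which the norm of the translation controls.\<close>
      have "P z = H.ext (translate G a) (P z)"
        using Pinv[OF zH] a by (simp add: invariant_vectors_def \<pi>_def)
      then have "H.emb (translate G a (M n)) - P z
          = H.ext (translate G a) (H.emb (M n)) - H.ext (translate G a) (P z)"
        using H.ext_emb[OF bopa MV] by metis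
      also have "\<dots> = H.ext (translate G a) (H.emb (M n) - P z)"
        using H.ext_add[OF bopa H.emb_mem[OF MV] H.carrierH_closed(3)[OF Pz], of n "-1"]
          H.ext_scale[OF bopa Pz, of "-1"] by (simp only: cscale_diff_eq)
      finally have e: "H.emb (translate G a (M n)) - P z = H.ext (translate G a) (H.emb (M n) - P z)" .
      show ?thesis
        unfolding e by (rule H.ext_norm[OF bopa H.carrierH_closed(4)[OF H.emb_mem[OF MV] Pz]])
      qed
    qed
    also have "?K * H.normH (H.emb (M n) - P z) + H.normH (H.emb (M n) - P z)
        = (?K + 1) * H.normH (H.emb (M n) - P z)" by (simp add: distrib_right)
    also have "\<dots> \<le> (?K + 1) * (q ^ n * C)"
      using est[OF n] L(1) unfolding C_def by (intro mult_left_mono) auto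
    finally show ?thesis by (simp add: mult_ac)
  qed
  show ?thesis using tq r1 r2 by blast
qed

end

section \<open>Iterated directional derivatives\<close>

abbreviation fd :: "('a::real_normed_vector \<Rightarrow> 'b::real_normed_vector) \<Rightarrow> 'a \<Rightarrow> 'a \<Rightarrow> 'b" where
  "fd f x \<equiv> frechet_derivative f (at x)"

lemma fd_works: "f differentiable at x \<Longrightarrow> (f has_derivative fd f x) (at x)"
  by (simp add: frechet_derivative_works)

lemma fd_eqI: "(f has_derivative D) (at x) \<Longrightarrow> fd f x = D"
  using frechet_derivative_at by metis

lemma fd_linear: "f differentiable at x \<Longrightarrow> linear (fd f x)"
  using fd_works has_derivative_linear by blast

lemma fd_basis:
  fixes f :: "'a::euclidean_space \<Rightarrow> 'b::real_normed_vector"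
  assumes "f differentiable at x" shows "fd f x v = (\<Sum>b\<in>Basis. (v \<bullet> b) *\<^sub>R fd f x b)"
proof -
  interpret linear "fd f x" by (rule fd_linear[OF assms])
  have "fd f x v = fd f x (\<Sum>b\<in>Basis. (v \<bullet> b) *\<^sub>R b)" by (simp add: euclidean_representation)
  then show ?thesis by (simp add: sum scale)
qed

lemma fd_cong:
  assumes "open S" "x \<in> S" "\<And>y. y \<in> S \<Longrightarrow> f y = g y" "f differentiable at x"
  shows "g differentiable at x" "fd g x = fd f x"
proof -
  have "(g has_derivative fd f x) (at x)"
    using has_derivative_transform_within_open[OF fd_works[OF assms(4)] assms(1,2)] assms(3) by blast
  then show "g differentiable at x" "fd g x = fd f x"
    by (auto simp: differentiable_def fd_eqI)
qed

lemma Ck_holder_on_cong: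
  assumes "open S" "\<And>x. x \<in> S \<Longrightarrow> f x = g x" "Ck_holder_on n s S f"
  shows "Ck_holder_on n s S g"
  using assms
proof (induction n arbitrary: f g)
  case 0
  have c: "continuous_on S g" using 0 by (simp cong: continuous_on_cong)
  show ?case
    unfolding Ck_holder_on.simps
  proof (intro conjI impI c ballI)
    fix x assume "s > 0" "x \<in> S"
    then obtain e C where "e > 0" "\<forall>y\<in>S \<inter> ball x e. \<forall>z\<in>S \<inter> ball x e. norm (f y - f z) \<le> C * dist y z powr s"
      using 0(3) by auto
    then show "\<exists>e>0. \<exists>C. \<forall>y\<in>S \<inter> ball x e. \<forall>z\<in>S \<inter> ball x e. norm (g y - g z) \<le> C * dist y z powr s"
      using 0(2) by (intro exI[of _ e] conjI exI[of _ C]) auto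
  qed
next
  case (Suc n)
  have d: "f differentiable at x" if "x \<in> S" for x using Suc.prems that by simp
  show ?case
    unfolding Ck_holder_on.simps
  proof (intro conjI ballI allI)
    show "g differentiable at x" if "x \<in> S" for x
      using fd_cong(1)[OF Suc.prems(1) that _ d[OF that]] Suc.prems(2) by blast
    show "Ck_holder_on n s S (\<lambda>x. fd g x v)" for v
    proof (rule Suc.IH[OF Suc.prems(1)])
      show "fd f x v = fd g x v" if "x \<in> S" for x
        using fd_cong(2)[OF Suc.prems(1) that _ d[OF that]] Suc.prems(2) by metis
      show "Ck_holder_on n s S (\<lambda>x. fd f x v)" using Suc.prems(3) by simp
    qed
  qed
qed

lemma Ck_holder_on_subset:
  assumes "Ck_holder_on n s S f" "T \<subseteq> S" shows "Ck_holder_on n s T f"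
  using assms
proof (induction n arbitrary: f)
  case 0
  have c: "continuous_on T f" using 0 continuous_on_subset by (simp, blast)
  show ?case
    unfolding Ck_holder_on.simps
  proof (intro conjI impI c ballI)
    fix x assume "s > 0" "x \<in> T"
    then have "x \<in> S" using 0 by blast
    then have "\<exists>e>0. \<exists>C. \<forall>y\<in>S \<inter> ball x e. \<forall>z\<in>S \<inter> ball x e. norm (f y - f z) \<le> C * dist y z powr s"
      using 0(1) \<open>s > 0\<close> by simp
    then obtain e C where "e > 0" "\<forall>y\<in>S \<inter> ball x e. \<forall>z\<in>S \<inter> ball x e. norm (f y - f z) \<le> C * dist y z powr s"
      by blast
    then show "\<exists>e>0. \<exists>C. \<forall>y\<in>T \<inter> ball x e. \<forall>z\<in>T \<inter> ball x e. norm (f y - f z) \<le> C * dist y z powr s"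
      using 0(2) by (intro exI[of _ e] conjI exI[of _ C]) auto
  qed
qed auto

lemma Ck_holder_on_local:
  assumes "\<And>x. x \<in> S \<Longrightarrow> \<exists>U. open U \<and> x \<in> U \<and> Ck_holder_on n s U f"
  shows "Ck_holder_on n s S f"
  using assms
proof (induction n arbitrary: f)
  case 0
  have c: "continuous_on S f"
  proof (rule continuous_at_imp_continuous_on, rule ballI)
    fix x assume "x \<in> S"
    from 0[OF this] obtain U where "open U" "x \<in> U" "continuous_on U f" by auto
    then show "isCont f x" using continuous_on_eq_continuous_at by blast
  qed
  show ?case
    unfolding Ck_holder_on.simps
  proof (intro conjI impI c ballI)
    fix x assume s: "s > 0" and x: "x \<in> S"
    obtain U where U: "open U" "x \<in> U" "Ck_holder_on 0 s U f" using 0[OF x] by blast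
    then obtain e C where e: "e > 0" "\<forall>y\<in>U \<inter> ball x e. \<forall>z\<in>U \<inter> ball x e. norm (f y - f z) \<le> C * dist y z powr s"
      using s by auto
    obtain d where d: "d > 0" "ball x d \<subseteq> U" using U open_contains_ball by blast
    have "S \<inter> ball x (min d e) \<subseteq> U \<inter> ball x e" using d by auto
    then show "\<exists>e>0. \<exists>C. \<forall>y\<in>S \<inter> ball x e. \<forall>z\<in>S \<inter> ball x e. norm (f y - f z) \<le> C * dist y z powr s"
      using e d by (intro exI[of _ "min d e"] conjI exI[of _ C]) (auto simp: subset_iff)
  qed
next
  case (Suc n)
  show ?case
    unfolding Ck_holder_on.simps
  proof (intro conjI ballI allI)
    show "f differentiable at x" if "x \<in> S" for x using Suc.prems[OF that] by auto
    show "Ck_holder_on n s S (\<lambda>x. fd f x v)" for v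
    proof (rule Suc.IH)
      fix x assume "x \<in> S"
      from Suc.prems[OF this] show "\<exists>U. open U \<and> x \<in> U \<and> Ck_holder_on n s U (\<lambda>x. fd f x v)" by auto
    qed
  qed
qed

lemma Ck_on_Suc: "Ck_on (Suc n) S f \<Longrightarrow> Ck_on n S f"
proof (induction n arbitrary: f)
  case 0
  then show ?case
    by (auto intro!: continuous_at_imp_continuous_on differentiable_imp_continuous_within)
next
  case (Suc n)
  show ?case
    unfolding Ck_holder_on.simps(2)[of n]
  proof (intro conjI ballI allI)
    show "f differentiable at x" if "x \<in> S" for x using Suc.prems that by simp
    show "Ck_on n S (\<lambda>x. fd f x v)" for v
      by (rule Suc.IH) (use Suc.prems Ck_holder_on.simps(2) in blast)
  qed
qed

lemma Ck_on_le: "Ck_on n S f \<Longrightarrow> m \<le> n \<Longrightarrow> Ck_on m S f"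
proof (induction n)
  case (Suc n)
  then show ?case using Ck_on_Suc le_Suc_eq by metis
qed simp

lemma Ck_on_continuous: "Ck_on n S f \<Longrightarrow> continuous_on S f"
  using Ck_on_le[of n S f 0] by simp

lemma Ck_holder_on_const: "Ck_holder_on n s S (\<lambda>_. c)"
proof (induction n arbitrary: c)
  case 0
  then show ?case by (auto intro!: exI[of _ 1])
next
  case (Suc n)
  have "fd (\<lambda>_. c) x = (\<lambda>_. 0)" for x :: 'a by (rule fd_eqI) (rule has_derivative_const)
  then show ?case using Suc by simp
qed

lemma Ck_holder_on_add:
  assumes "open S" "Ck_holder_on n s S f" "Ck_holder_on n s S g"
  shows "Ck_holder_on n s S (\<lambda>x. f x + g x)"
  using assms
proof (induction n arbitrary: f g)
  case 0
  have c: "continuous_on S (\<lambda>x. f x + g x)" using 0 by (auto intro: continuous_on_add)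
  show ?case
    unfolding Ck_holder_on.simps
  proof (intro conjI impI c ballI)
    fix x assume s: "s > 0" "x \<in> S"
    obtain e C where e: "e > 0" "\<forall>y\<in>S \<inter> ball x e. \<forall>z\<in>S \<inter> ball x e. norm (f y - f z) \<le> C * dist y z powr s"
      using 0(2) s by auto
    obtain e' C' where e': "e' > 0" "\<forall>y\<in>S \<inter> ball x e'. \<forall>z\<in>S \<inter> ball x e'. norm (g y - g z) \<le> C' * dist y z powr s"
      using 0(3) s by auto
    have "norm (f y + g y - (f z + g z)) \<le> (C + C') * dist y z powr s"
      if "y \<in> S \<inter> ball x (min e e')" "z \<in> S \<inter> ball x (min e e')" for y z
    proof -
      have "norm (f y + g y - (f z + g z)) \<le> norm (f y - f z) + norm (g y - g z)"
        by (metis add_diff_add norm_triangle_ineq)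
      also have "\<dots> \<le> C * dist y z powr s + C' * dist y z powr s"
        using e e' that by (intro add_mono) auto
      finally show ?thesis by (simp add: distrib_right)
    qed
    then show "\<exists>e>0. \<exists>C. \<forall>y\<in>S \<inter> ball x e. \<forall>z\<in>S \<inter> ball x e.
        norm (f y + g y - (f z + g z)) \<le> C * dist y z powr s"
      using e e' by (intro exI[of _ "min e e'"] conjI exI[of _ "C + C'"]) auto
  qed
next
  case (Suc n)
  have d: "f differentiable at x" "g differentiable at x" if "x \<in> S" for x using Suc.prems that by auto
  have h: "((\<lambda>x. f x + g x) has_derivative (\<lambda>v. fd f x v + fd g x v)) (at x)" if "x \<in> S" for x
    by (intro has_derivative_add fd_works d that)
  show ?case
    unfolding Ck_holder_on.simps
  proof (intro conjI ballI allI)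
    show "(\<lambda>x. f x + g x) differentiable at x" if "x \<in> S" for x using d[OF that] by simp
    show "Ck_holder_on n s S (\<lambda>x. fd (\<lambda>x. f x + g x) x v)" for v
    proof (rule Ck_holder_on_cong[OF Suc.prems(1)])
      show "fd f x v + fd g x v = fd (\<lambda>x. f x + g x) x v" if "x \<in> S" for x
        using fd_eqI[OF h[OF that]] by simp
      show "Ck_holder_on n s S (\<lambda>x. fd f x v + fd g x v)"
        using Suc.prems by (intro Suc.IH) auto
    qed
  qed
qed

lemma Ck_holder_on_linear:
  assumes L: "bounded_linear L" and "open S" "Ck_holder_on n s S f"
  shows "Ck_holder_on n s S (\<lambda>x. L (f x))"
  using assms(2-)
proof (induction n arbitrary: f)
  case 0
  have c: "continuous_on S (\<lambda>x. L (f x))"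
    using 0 bounded_linear.continuous_on[OF L] by auto
  obtain K where K: "\<And>x. norm (L x) \<le> norm x * K" "K \<ge> 0"
    using bounded_linear.nonneg_bounded[OF L] by auto
  show ?case
    unfolding Ck_holder_on.simps
  proof (intro conjI impI c ballI)
    fix x assume s: "s > 0" "x \<in> S"
    obtain e C where e: "e > 0" "\<forall>y\<in>S \<inter> ball x e. \<forall>z\<in>S \<inter> ball x e. norm (f y - f z) \<le> C * dist y z powr s"
      using 0(2) s by auto
    have "norm (L (f y) - L (f z)) \<le> (K * C) * dist y z powr s"
      if "y \<in> S \<inter> ball x e" "z \<in> S \<inter> ball x e" for y z
    proof -
      have "norm (L (f y) - L (f z)) \<le> norm (f y - f z) * K"
        using K(1)[of "f y - f z"] by (simp add: bounded_linear.linear[OF L] linear_diff)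
      also have "\<dots> \<le> (C * dist y z powr s) * K" using e that K by (intro mult_right_mono) auto
      finally show ?thesis by (simp add: mult_ac)
    qed
    then show "\<exists>e>0. \<exists>C. \<forall>y\<in>S \<inter> ball x e. \<forall>z\<in>S \<inter> ball x e.
        norm (L (f y) - L (f z)) \<le> C * dist y z powr s"
      using e by (intro exI[of _ "e"] conjI exI[of _ "K * C"]) auto
  qed
next
  case (Suc n)
  have d: "f differentiable at x" if "x \<in> S" for x using Suc.prems that by auto
  have h: "((\<lambda>x. L (f x)) has_derivative (\<lambda>v. L (fd f x v))) (at x)" if "x \<in> S" for x
    by (intro bounded_linear.has_derivative[OF L] fd_works d that)
  show ?case
    unfolding Ck_holder_on.simps
  proof (intro conjI ballI allI)
    show "(\<lambda>x. L (f x)) differentiable at x" if "x \<in> S" for x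
      using h[OF that] differentiable_def by blast
    show "Ck_holder_on n s S (\<lambda>x. fd (\<lambda>x. L (f x)) x v)" for v
    proof (rule Ck_holder_on_cong[OF Suc.prems(1)])
      show "L (fd f x v) = fd (\<lambda>x. L (f x)) x v" if "x \<in> S" for x
        using fd_eqI[OF h[OF that]] by simp
      show "Ck_holder_on n s S (\<lambda>x. L (fd f x v))"
        using Suc.prems by (intro Suc.IH) auto
    qed
  qed
qed

lemma Ck_holder_on_sum:
  assumes "open S" "\<And>i. i \<in> I \<Longrightarrow> Ck_holder_on n s S (f i)"
  shows "Ck_holder_on n s S (\<lambda>x. \<Sum>i\<in>I. f i x)"
  using assms(2)
proof (induction I rule: infinite_finite_induct)
  case (insert i I)
  then have "Ck_holder_on n s S (\<lambda>x. f i x + (\<Sum>i\<in>I. f i x))"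
    by (intro Ck_holder_on_add assms(1)) auto
  then show ?case using insert by simp
qed (simp_all only: sum.infinite sum.empty Ck_holder_on_const not_False_eq_True)

lemma Ck_holder_on_SucI_Basis:
  fixes f :: "'a::euclidean_space \<Rightarrow> 'b::real_normed_vector"
  assumes S: "open S" and d: "\<And>x. x \<in> S \<Longrightarrow> f differentiable at x"
    and b: "\<And>b. b \<in> Basis \<Longrightarrow> Ck_holder_on n s S (\<lambda>x. fd f x b)"
  shows "Ck_holder_on (Suc n) s S f"
  unfolding Ck_holder_on.simps
proof (intro conjI ballI allI d)
  fix v
  show "Ck_holder_on n s S (\<lambda>x. fd f x v)"
  proof (rule Ck_holder_on_cong[OF S])
    show "(\<Sum>b\<in>Basis. (v \<bullet> b) *\<^sub>R fd f x b) = fd f x v" if "x \<in> S" for x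
      using fd_basis[OF d[OF that]] by metis
    show "Ck_holder_on n s S (\<lambda>x. \<Sum>b\<in>Basis. (v \<bullet> b) *\<^sub>R fd f x b)"
      by (intro Ck_holder_on_sum S Ck_holder_on_linear[of "\<lambda>y. _ *\<^sub>R y"] b)
        (rule bounded_linear_scaleR_right)
  qed
qed

lemma Ck_on_mult:
  fixes f g :: "'a::euclidean_space \<Rightarrow> real"
  assumes "open S" "Ck_on n S f" "Ck_on n S g" shows "Ck_on n S (\<lambda>x. f x * g x)"
  using assms
proof (induction n arbitrary: f g)
  case 0
  then show ?case by (auto intro: continuous_on_mult)
next
  case (Suc n)
  have d: "f differentiable at x" "g differentiable at x" if "x \<in> S" for x using Suc.prems that by auto
  have h: "((\<lambda>x. f x * g x) has_derivative (\<lambda>v. f x * fd g x v + fd f x v * g x)) (at x)" if "x \<in> S" for x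
    by (intro has_derivative_mult fd_works d that)
  show ?case
    unfolding Ck_holder_on.simps
  proof (intro conjI ballI allI)
    show "(\<lambda>x. f x * g x) differentiable at x" if "x \<in> S" for x using d[OF that] by simp
    show "Ck_on n S (\<lambda>x. fd (\<lambda>x. f x * g x) x v)" for v
    proof (rule Ck_holder_on_cong[OF Suc.prems(1)])
      show "f x * fd g x v + fd f x v * g x = fd (\<lambda>x. f x * g x) x v" if "x \<in> S" for x
        using fd_eqI[OF h[OF that]] by simp
      show "Ck_on n S (\<lambda>x. f x * fd g x v + fd f x v * g x)"
        using Suc.prems Ck_on_Suc[OF Suc.prems(2)] Ck_on_Suc[OF Suc.prems(3)]
        by (intro Ck_holder_on_add Suc.IH) auto
    qed
  qed
qed

lemma Ck_on_inner: "open S \<Longrightarrow> Ck_on n S F \<Longrightarrow> Ck_on n S (\<lambda>x. F x \<bullet> b)"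
  by (rule Ck_holder_on_linear[OF bounded_linear_inner_left])

lemma fd_compose:
  assumes F: "F differentiable at x" and h: "h differentiable at (F x)"
  shows "(\<lambda>y. h (F y)) differentiable at x" "fd (\<lambda>y. h (F y)) x v = fd h (F x) (fd F x v)"
proof -
  have "((\<lambda>y. h (F y)) has_derivative (\<lambda>v. fd h (F x) (fd F x v))) (at x)"
    using has_derivative_compose[OF fd_works[OF F] fd_works[OF h]] .
  then show "(\<lambda>y. h (F y)) differentiable at x" "fd (\<lambda>y. h (F y)) x v = fd h (F x) (fd F x v)"
    using fd_eqI by (auto simp: differentiable_def fd_eqI)
qed

lemma Ck_on_compose:
  fixes h :: "'b::euclidean_space \<Rightarrow> real" and F :: "'a::euclidean_space \<Rightarrow> 'b"
  assumes "open S" "open T" "Ck_on n S F" "Ck_on n T h" "F ` S \<subseteq> T"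
  shows "Ck_on n S (\<lambda>x. h (F x))"
  using assms
proof (induction n arbitrary: h)
  case 0
  then show ?case by (auto intro: continuous_on_compose2)
next
  case (Suc n)
  have d: "F differentiable at x" "h differentiable at (F x)" if "x \<in> S" for x
    using Suc.prems that by auto
  show ?case
    unfolding Ck_holder_on.simps
  proof (intro conjI ballI allI)
    show "(\<lambda>x. h (F x)) differentiable at x" if "x \<in> S" for x using fd_compose(1) d that by blast
    show "Ck_on n S (\<lambda>x. fd (\<lambda>x. h (F x)) x v)" for v
    proof (rule Ck_holder_on_cong[OF Suc.prems(1)])
      show "(\<Sum>b\<in>Basis. (fd F x v \<bullet> b) * fd h (F x) b) = fd (\<lambda>x. h (F x)) x v" if "x \<in> S" for x
        using fd_compose(2)[OF d[OF that]] fd_basis[OF d(2)[OF that], of "fd F x v"] by simp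
      show "Ck_on n S (\<lambda>x. \<Sum>b\<in>Basis. (fd F x v \<bullet> b) * fd h (F x) b)"
        using Suc.prems Ck_on_Suc[OF Suc.prems(3)]
        by (intro Ck_holder_on_sum Ck_on_mult Ck_on_inner Suc.IH) auto
    qed
  qed
qed

section \<open>Iterated derivatives along lists of directions\<close>

primrec dirs :: "'a::real_normed_vector list \<Rightarrow> ('a \<Rightarrow> real) \<Rightarrow> 'a \<Rightarrow> real" where
  "dirs [] f = f"
| "dirs (v # vs) f = dirs vs (\<lambda>x. fd f x v)"

text \<open>The last direction of a list is differentiated last, so inductions that add an outermost
  derivative work at the right end of the list.\<close>

lemma dirs_snoc: "dirs (vs @ [v]) f x = fd (dirs vs f) x v"
  by (induction vs arbitrary: f) auto

lemma Ck_on_dirs: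
  assumes "Ck_on n S f" "m + length vs \<le> n" shows "Ck_on m S (dirs vs f)"
  using assms
proof (induction vs arbitrary: f n)
  case Nil
  then show ?case using Ck_on_le by auto
next
  case (Cons v vs)
  then obtain n' where n: "n = Suc n'" by (cases n) auto
  have "Ck_on n' S (\<lambda>x. fd f x v)" using Cons.prems n by simp
  then show ?case using Cons.IH[of n'] Cons.prems n by simp
qed

lemma dirs_cong:
  assumes "open S" "\<And>x. x \<in> S \<Longrightarrow> f x = g x" "Ck_on n S f" "length vs \<le> n" "x \<in> S"
  shows "dirs vs f x = dirs vs g x"
  using assms
proof (induction vs arbitrary: f g n)
  case (Cons v vs)
  then obtain n' where n: "n = Suc n'" by (cases n) auto
  have d: "f differentiable at x" if "x \<in> S" for x using Cons.prems that n by simp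
  have "dirs vs (\<lambda>x. fd f x v) x = dirs vs (\<lambda>x. fd g x v) x"
  proof (rule Cons.IH[of _ _ n'])
    show "fd f x v = fd g x v" if "x \<in> S" for x
      using fd_cong(2)[OF Cons.prems(1) that _ d[OF that]] Cons.prems(2) by metis
  qed (use Cons.prems n in auto)
  then show ?case by simp
qed simp

lemma dirs_add:
  assumes "open S" "Ck_on n S f" "Ck_on n S g" "length vs \<le> n" "x \<in> S"
  shows "dirs vs (\<lambda>x. f x + g x) x = dirs vs f x + dirs vs g x"
  using assms
proof (induction vs arbitrary: f g n)
  case (Cons v vs)
  then obtain n' where n: "n = Suc n'" by (cases n) auto
  have d: "f differentiable at x" "g differentiable at x" if "x \<in> S" for x using Cons.prems that n by auto
  have c: "Ck_on n' S (\<lambda>x. fd f x v)" "Ck_on n' S (\<lambda>x. fd g x v)" using Cons.prems n by auto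
  have "dirs vs (\<lambda>x. fd (\<lambda>x. f x + g x) x v) x = dirs vs (\<lambda>x. fd f x v + fd g x v) x"
  proof (rule dirs_cong[OF Cons.prems(1), symmetric])
    show "fd f x v + fd g x v = fd (\<lambda>x. f x + g x) x v" if "x \<in> S" for x
      using fd_eqI[OF has_derivative_add[OF fd_works[OF d(1)[OF that]] fd_works[OF d(2)[OF that]]]] by simp
    show "Ck_on n' S (\<lambda>x. fd f x v + fd g x v)" by (intro Ck_holder_on_add c Cons.prems)
  qed (use Cons.prems n in auto)
  also have "\<dots> = dirs vs (\<lambda>x. fd f x v) x + dirs vs (\<lambda>x. fd g x v) x"
    using Cons.prems n by (intro Cons.IH[of n'] c) auto
  finally show ?case by simp
qed simp

lemma dirs_cmult:
  assumes "open S" "Ck_on n S f" "length vs \<le> n" "x \<in> S"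
  shows "dirs vs (\<lambda>x. c * f x) x = c * dirs vs f x"
  using assms
proof (induction vs arbitrary: f n)
  case (Cons v vs)
  then obtain n' where n: "n = Suc n'" by (cases n) auto
  have d: "f differentiable at x" if "x \<in> S" for x using Cons.prems that n by auto
  have c: "Ck_on n' S (\<lambda>x. fd f x v)" using Cons.prems n by auto
  have "dirs vs (\<lambda>x. fd (\<lambda>x. c * f x) x v) x = dirs vs (\<lambda>x. c * fd f x v) x"
  proof (rule dirs_cong[OF Cons.prems(1), symmetric])
    show "c * fd f x v = fd (\<lambda>x. c * f x) x v" if "x \<in> S" for x
      using fd_eqI[OF has_derivative_mult_right[OF fd_works[OF d[OF that]], of c]] by simp
    show "Ck_on n' S (\<lambda>x. c * fd f x v)"
      by (intro Ck_on_mult c Cons.prems Ck_holder_on_const)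
  qed (use Cons.prems n in auto)
  also have "\<dots> = c * dirs vs (\<lambda>x. fd f x v) x"
    using Cons.prems n by (intro Cons.IH[of n'] c) auto
  finally show ?case by simp
qed simp

lemma dirs_zero: "dirs vs (\<lambda>_. 0) x = 0"
proof (induction vs)
  case (Cons v vs)
  have "fd (\<lambda>_. 0::real) x = (\<lambda>_. 0)" for x :: 'a by (rule fd_eqI) (rule has_derivative_const)
  then show ?case using Cons by simp
qed simp

lemma dirs_sum:
  assumes "open S" "\<And>i. i \<in> I \<Longrightarrow> Ck_on n S (f i)" "length vs \<le> n" "x \<in> S"
  shows "dirs vs (\<lambda>x. \<Sum>i\<in>I. f i x) x = (\<Sum>i\<in>I. dirs vs (f i) x)"
  using assms(2)
proof (induction I rule: infinite_finite_induct)
  case (insert i I)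
  have "dirs vs (\<lambda>x. f i x + (\<Sum>i\<in>I. f i x)) x = dirs vs (f i) x + dirs vs (\<lambda>x. \<Sum>i\<in>I. f i x) x"
    using insert.prems assms by (intro dirs_add[of S n] Ck_holder_on_sum) auto
  then show ?case using insert by simp
qed (simp_all add: dirs_zero)

definition blists :: "nat \<Rightarrow> 'a::euclidean_space list set" where
  "blists j = {vs. set vs \<subseteq> Basis \<and> length vs = j}"

text \<open>Leading symbol of \<open>h \<mapsto> m (h \<circ> F)\<close>: only the derivatives of top order of \<open>h\<close> are multiplied by
  a constant that is explicit in \<open>m\<close> and \<open>D F\<close>.\<close>

lemma dirs_symbol_bound:
  fixes F :: "'a::euclidean_space \<Rightarrow> 'b::euclidean_space" and m :: "'a \<Rightarrow> real"
  assumes open_sets: "open S" "open T" and F: "Ck_on j S F" "F ` S \<subseteq> T"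
    and K: "compact K" "K \<subseteq> S" and m: "Ck_on j S m" and mu: "\<And>x. x \<in> K \<Longrightarrow> \<bar>m x\<bar> \<le> \<mu>"
    and DF: "\<And>x b b'. x \<in> K \<Longrightarrow> b \<in> Basis \<Longrightarrow> b' \<in> Basis \<Longrightarrow> \<bar>fd F x b \<bullet> b'\<bar> \<le> \<beta>"
    and \<beta>: "\<beta> \<ge> 0" and \<mu>: "\<mu> \<ge> 0" and vs: "vs \<in> blists j"
  shows "\<exists>R\<ge>0. \<forall>h. Ck_on j T h \<longrightarrow> (\<forall>x\<in>K. \<forall>P\<ge>0. \<forall>Q\<ge>0.
     (\<forall>ws\<in>blists j. \<bar>dirs ws h (F x)\<bar> \<le> P) \<longrightarrow> (\<forall>i<j. \<forall>ws\<in>blists i. \<bar>dirs ws h (F x)\<bar> \<le> Q) \<longrightarrow>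
     \<bar>dirs vs (\<lambda>x. m x * h (F x)) x\<bar> \<le> \<mu> * (\<beta> * DIM('b)) ^ j * P + R * Q)"
  using F m mu vs \<mu>
proof (induction j arbitrary: m vs \<mu>)
  case 0
  have "\<bar>m x * h (F x)\<bar> \<le> \<mu> * P" if "x \<in> K" "\<bar>h (F x)\<bar> \<le> P" for x P and h :: "'b \<Rightarrow> real"
    unfolding abs_mult using 0(4,6) that by (intro mult_mono) auto
  then show ?case using 0 by (intro exI[of _ 0]) (auto simp: blists_def)
next
  case (Suc j)
  obtain b vs' where vs: "vs = b # vs'" "b \<in> Basis" "vs' \<in> blists j"
    using Suc.prems(5) by (cases vs) (auto simp: blists_def)
  have Fd: "F differentiable at x" and md: "m differentiable at x" if "x \<in> S" for x
    using Suc.prems that by auto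
  have F': "Ck_on j S F" and m': "Ck_on j S m" using Ck_on_Suc Suc.prems by blast+
  have cm: "Ck_on j S (\<lambda>x. fd m x b)" using Suc.prems by simp
  have cF: "Ck_on j S (\<lambda>x. m x * (fd F x b \<bullet> b'))" for b'
    using Suc.prems m' by (intro Ck_on_mult Ck_on_inner open_sets) auto
  have "continuous_on K (\<lambda>x. fd m x b)"
    using Ck_on_continuous[OF cm] K(2) continuous_on_subset by blast
  then have "bounded ((\<lambda>x. fd m x b) ` K)"
    using K(1) by (intro compact_imp_bounded compact_continuous_image)
  then obtain \<mu>1 where mu1: "\<mu>1 > 0" "\<forall>y\<in>(\<lambda>x. fd m x b) ` K. norm y \<le> \<mu>1"
    unfolding bounded_pos by blast
  then have mu1: "\<And>x. x \<in> K \<Longrightarrow> \<bar>fd m x b\<bar> \<le> \<mu>1" "\<mu>1 \<ge> 0" by auto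
  \<comment> \<open>If the derivative falls on the multiplier \<open>m\<close>, one direction is
    spent and \<open>h\<close> is differentiated at most \<open>j\<close> times, one below the top
    order.\<close>
  have IH1: "\<exists>R\<ge>0. \<forall>h. Ck_on j T h \<longrightarrow> (\<forall>x\<in>K. \<forall>P\<ge>0. \<forall>Q\<ge>0.
     (\<forall>ws\<in>blists j. \<bar>dirs ws h (F x)\<bar> \<le> P) \<longrightarrow> (\<forall>i<j. \<forall>ws\<in>blists i. \<bar>dirs ws h (F x)\<bar> \<le> Q) \<longrightarrow>
     \<bar>dirs vs' (\<lambda>x. fd m x b * h (F x)) x\<bar> \<le> \<mu>1 * (\<beta> * DIM('b)) ^ j * P + R * Q)"
    by (rule Suc.IH) (use F' Suc.prems(2) cm mu1 vs in auto)
  obtain R1 where R1: "R1 \<ge> 0" "\<And>h x P Q. Ck_on j T h \<Longrightarrow> x \<in> K \<Longrightarrow> P \<ge> 0 \<Longrightarrow> Q \<ge> 0 \<Longrightarrow>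
     (\<forall>ws\<in>blists j. \<bar>dirs ws h (F x)\<bar> \<le> P) \<Longrightarrow> (\<forall>i<j. \<forall>ws\<in>blists i. \<bar>dirs ws h (F x)\<bar> \<le> Q) \<Longrightarrow>
     \<bar>dirs vs' (\<lambda>x. fd m x b * h (F x)) x\<bar> \<le> \<mu>1 * (\<beta> * DIM('b)) ^ j * P + R1 * Q"
    using IH1 by blast
  \<comment> \<open>If the derivative falls on \<open>h (F x)\<close>, the chain rule makes
    \<open>m x * (fd F x b \<bullet> b')\<close> the new multiplier: its bound gains one factor
    \<open>\<beta>\<close>, and the sum over \<open>b'\<close> will give the factor
    \<open>DIM('b)\<close>.\<close>
  define Z where "Z b' R \<longleftrightarrow> (\<forall>h. Ck_on j T h \<longrightarrow> (\<forall>x\<in>K. \<forall>P\<ge>0. \<forall>Q\<ge>0.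
     (\<forall>ws\<in>blists j. \<bar>dirs ws h (F x)\<bar> \<le> P) \<longrightarrow> (\<forall>i<j. \<forall>ws\<in>blists i. \<bar>dirs ws h (F x)\<bar> \<le> Q) \<longrightarrow>
     \<bar>dirs vs' (\<lambda>x. (m x * (fd F x b \<bullet> b')) * h (F x)) x\<bar> \<le> (\<mu> * \<beta>) * (\<beta> * DIM('b)) ^ j * P + R * Q))"
    for b' and R :: real
  have "\<exists>R\<ge>0. Z b' R" if b': "b' \<in> Basis" for b'
    unfolding Z_def
  proof (rule Suc.IH)
    show "\<bar>m x * (fd F x b \<bullet> b')\<bar> \<le> \<mu> * \<beta>" if "x \<in> K" for x
      unfolding abs_mult using Suc.prems(4,6) that DF vs b' by (intro mult_mono) auto
  qed (use F' Suc.prems(2,6) cF vs \<beta> in auto)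
  then have "\<forall>b'\<in>Basis. \<exists>R. R \<ge> 0 \<and> Z b' R" by blast
  from bchoice[OF this] obtain R where R0: "\<forall>b'\<in>Basis. R b' \<ge> 0 \<and> Z b' (R b')" ..
  then have R: "\<And>b'. b' \<in> Basis \<Longrightarrow> R b' \<ge> 0"
    "\<And>b' h x P Q. b' \<in> Basis \<Longrightarrow> Ck_on j T h \<Longrightarrow> x \<in> K \<Longrightarrow> P \<ge> 0 \<Longrightarrow> Q \<ge> 0 \<Longrightarrow>
     (\<forall>ws\<in>blists j. \<bar>dirs ws h (F x)\<bar> \<le> P) \<Longrightarrow> (\<forall>i<j. \<forall>ws\<in>blists i. \<bar>dirs ws h (F x)\<bar> \<le> Q) \<Longrightarrow>
     \<bar>dirs vs' (\<lambda>x. (m x * (fd F x b \<bullet> b')) * h (F x)) x\<bar> \<le> (\<mu> * \<beta>) * (\<beta> * DIM('b)) ^ j * P + R b' * Q"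
    unfolding Z_def by blast+
  define RR where "RR = \<mu>1 * (\<beta> * DIM('b)) ^ j + R1 + (\<Sum>b'\<in>Basis. R b')"
  have RR: "RR \<ge> 0" unfolding RR_def using \<beta> mu1 R1 R by (intro add_nonneg_nonneg sum_nonneg) auto
  show ?case
  proof (intro exI[of _ RR] conjI RR allI impI ballI)
    fix h x P Q
    assume h: "Ck_on (Suc j) T h" and x: "x \<in> K" and PQ: "(P::real) \<ge> 0" "(Q::real) \<ge> 0"
      and top: "\<forall>ws\<in>blists (Suc j). \<bar>dirs ws h (F x)\<bar> \<le> P"
      and low: "\<forall>i<Suc j. \<forall>ws\<in>blists i. \<bar>dirs ws h (F x)\<bar> \<le> Q"
    have hd: "h differentiable at y" if "y \<in> T" for y using h that by simp
    have h': "Ck_on j T h" using Ck_on_Suc h by blast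
    have ch: "Ck_on j T (\<lambda>y. fd h y b')" for b' using h by simp
    have xS: "x \<in> S" using x K by blast
    have c1: "Ck_on j S (\<lambda>x. fd m x b * h (F x))"
      by (rule Ck_on_mult[OF open_sets(1) cm Ck_on_compose[OF open_sets F' h' Suc.prems(2)]])
    have c2: "Ck_on j S (\<lambda>x. (m x * (fd F x b \<bullet> b')) * fd h (F x) b')" for b'
      by (rule Ck_on_mult[OF open_sets(1) cF Ck_on_compose[OF open_sets F' ch Suc.prems(2)]])
    have eq: "fd (\<lambda>x. m x * h (F x)) y b = fd m y b * h (F y)
        + (\<Sum>b'\<in>Basis. (m y * (fd F y b \<bullet> b')) * fd h (F y) b')" if y: "y \<in> S" for y
    proof -
      have Ty: "F y \<in> T" using y Suc.prems(2) by auto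
      have "((\<lambda>x. m x * h (F x)) has_derivative (\<lambda>v. m y * fd (\<lambda>x. h (F x)) y v + fd m y v * h (F y))) (at y)"
        by (rule has_derivative_mult[OF fd_works[OF md[OF y]]
              fd_works[OF fd_compose(1)[OF Fd[OF y] hd[OF Ty]]]])
      from fd_eqI[OF this]
      have "fd (\<lambda>x. m x * h (F x)) y b = m y * fd h (F y) (fd F y b) + fd m y b * h (F y)"
        using fd_compose(2)[OF Fd[OF y] hd[OF Ty], of b] by simp
      then show ?thesis
        using fd_basis[OF hd[OF Ty], of "fd F y b"] by (simp add: sum_distrib_left mult.assoc)
    qed
    have "dirs vs (\<lambda>x. m x * h (F x)) x = dirs vs' (\<lambda>y. fd m y b * h (F y)
        + (\<Sum>b'\<in>Basis. (m y * (fd F y b \<bullet> b')) * fd h (F y) b')) x"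
      unfolding vs(1) dirs.simps
    proof (rule dirs_cong[OF open_sets(1), symmetric])
      show "Ck_on j S (\<lambda>y. fd m y b * h (F y) + (\<Sum>b'\<in>Basis. (m y * (fd F y b \<bullet> b')) * fd h (F y) b'))"
        by (intro Ck_holder_on_add Ck_holder_on_sum open_sets c1 c2)
    qed (use eq xS vs in \<open>auto simp: blists_def\<close>)
    also have "\<dots> = dirs vs' (\<lambda>y. fd m y b * h (F y)) x
        + (\<Sum>b'\<in>Basis. dirs vs' (\<lambda>y. (m y * (fd F y b \<bullet> b')) * fd h (F y) b') x)"
      using xS vs by (subst dirs_add[OF open_sets(1) c1 Ck_holder_on_sum[OF open_sets(1) c2]]
          , simp_all add: blists_def, subst dirs_sum[OF open_sets(1) c2], auto)
    finally have e: "dirs vs (\<lambda>x. m x * h (F x)) x = dirs vs' (\<lambda>y. fd m y b * h (F y)) x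
        + (\<Sum>b'\<in>Basis. dirs vs' (\<lambda>y. (m y * (fd F y b \<bullet> b')) * fd h (F y) b') x)" .
    have "\<bar>dirs vs (\<lambda>x. m x * h (F x)) x\<bar> \<le> \<bar>dirs vs' (\<lambda>y. fd m y b * h (F y)) x\<bar>
        + (\<Sum>b'\<in>Basis. \<bar>dirs vs' (\<lambda>y. (m y * (fd F y b \<bullet> b')) * fd h (F y) b') x\<bar>)"
      unfolding e by (rule order_trans[OF abs_triangle_ineq add_left_mono[OF sum_abs]])
    also have "\<dots> \<le> (\<mu>1 * (\<beta> * DIM('b)) ^ j * Q + R1 * Q)
        + (\<Sum>b'\<in>(Basis::'b set). (\<mu> * \<beta>) * (\<beta> * DIM('b)) ^ j * P + R b' * Q)"
    proof (intro add_mono sum_mono)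
      \<comment> \<open>Order \<open>j\<close> is below the top order \<open>Suc j\<close> of
        \<open>h\<close>, so the bound \<open>Q\<close> takes the place of \<open>P\<close> in this
        term.\<close>
      show "\<bar>dirs vs' (\<lambda>y. fd m y b * h (F y)) x\<bar> \<le> \<mu>1 * (\<beta> * DIM('b)) ^ j * Q + R1 * Q"
        by (rule R1(2)[OF h' x PQ(2,2)]) (use low less_SucI in blast)+
      fix b' :: 'b assume b': "b' \<in> Basis"
      have cons: "dirs ws (\<lambda>y. fd h y b') = dirs (b' # ws) h" for ws by simp
      show "\<bar>dirs vs' (\<lambda>y. (m y * (fd F y b \<bullet> b')) * fd h (F y) b') x\<bar>
          \<le> (\<mu> * \<beta>) * (\<beta> * DIM('b)) ^ j * P + R b' * Q"
      proof (rule R(2)[OF b' ch x PQ])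
        show "\<forall>ws\<in>blists j. \<bar>dirs ws (\<lambda>y. fd h y b') (F x)\<bar> \<le> P"
          unfolding cons using top b' by (auto simp: blists_def simp del: dirs.simps)
        show "\<forall>i<j. \<forall>ws\<in>blists i. \<bar>dirs ws (\<lambda>y. fd h y b') (F x)\<bar> \<le> Q"
        proof (intro allI impI ballI)
          fix i and ws :: "'b list" assume "i < j" "ws \<in> blists i"
          then have "Suc i < Suc j" "b' # ws \<in> blists (Suc i)" using b' by (auto simp: blists_def)
          then show "\<bar>dirs ws (\<lambda>y. fd h y b') (F x)\<bar> \<le> Q" unfolding cons using low by blast
        qed
      qed
    qed
    also have "\<dots> = \<mu> * (\<beta> * DIM('b)) ^ Suc j * P + RR * Q"
      by (simp add: sum.distrib RR_def sum_distrib_left[symmetric] sum_distrib_right[symmetric] algebra_simps)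
    finally show "\<bar>dirs vs (\<lambda>x. m x * h (F x)) x\<bar> \<le> \<mu> * (\<beta> * DIM('b)) ^ Suc j * P + RR * Q" .
  qed
qed

section \<open>A change of variables inequality\<close>

lemma emeasure_ball_scale:
  fixes x y :: "'a::euclidean_space"
  assumes "r \<ge> 0" "k \<ge> 0"
  shows "emeasure lborel (ball y (k * r)) = ennreal (k ^ DIM('a)) * emeasure lborel (ball x r)"
  using assms
  by (simp add: emeasure_ball power_mult_distrib ennreal_mult[symmetric] mult_ac)

text \<open>Subadditivity takes the form of an integral over \<open>count_space I\<close> so that a
  common factor can be pulled out and the rest compared with the measure of a disjoint
  union.\<close>

lemma emeasure_UN_countable_le:
  assumes [measurable]: "\<And>i. i \<in> I \<Longrightarrow> X i \<in> sets M" and I: "countable I"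
  shows "emeasure M (\<Union>i\<in>I. X i) \<le> (\<integral>\<^sup>+i. emeasure M (X i) \<partial>count_space I)"
proof -
  have U: "(\<Union>i\<in>I. X i) \<in> sets M" using I by (intro sets.countable_UN'') auto
  have "indicator (\<Union>i\<in>I. X i) x \<le> (\<integral>\<^sup>+i. indicator (X i) x \<partial>count_space I)" for x
  proof (cases "\<exists>j\<in>I. x \<in> X j")
    case True
    then obtain j where j: "j \<in> I" "x \<in> X j" by blast
    have "1 = (\<integral>\<^sup>+i. indicator {j} i \<partial>count_space I)" using j by (subst nn_integral_indicator) auto
    also have "\<dots> \<le> (\<integral>\<^sup>+i. indicator (X i) x \<partial>count_space I)"
      using j by (intro nn_integral_mono) (auto simp: indicator_def)
    finally show ?thesis by (simp add: indicator_def)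
  qed (auto simp: indicator_def)
  then have "(\<integral>\<^sup>+x. indicator (\<Union>i\<in>I. X i) x \<partial>M) \<le> (\<integral>\<^sup>+x. (\<integral>\<^sup>+i. indicator (X i) x \<partial>count_space I) \<partial>M)"
    by (intro nn_integral_mono)
  also have "\<dots> = (\<integral>\<^sup>+i. (\<integral>\<^sup>+x. indicator (X i) x \<partial>M) \<partial>count_space I)"
    using I by (subst nn_integral_count_space_nn_integral) auto
  also have "\<dots> = (\<integral>\<^sup>+i. emeasure M (X i) \<partial>count_space I)"
    by (intro nn_integral_cong) simp
  finally show ?thesis using U by simp
qed

text \<open>Only the derivative at the points of \<open>E\<close> matters: cover \<open>E\<close> by small balls centred in \<open>E\<close>
  and pass to a disjoint subfamily whose fivefold enlargements still cover.\<close>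

lemma emeasure_differentiable_image_le:
  fixes f :: "'a::euclidean_space \<Rightarrow> 'a"
  assumes E: "E \<in> sets borel" and fE: "f ` E \<in> sets borel" and \<beta>: "\<beta> > 0"
    and der: "\<And>x. x \<in> E \<Longrightarrow> (f has_derivative f' x) (at x)"
    and bd: "\<And>x v. x \<in> E \<Longrightarrow> norm (f' x v) \<le> \<beta> * norm v"
  shows "emeasure lborel (f ` E) \<le> ennreal ((10 * \<beta>) ^ DIM('a)) * emeasure lborel E"
proof -
  have main: "emeasure lborel (f ` E) \<le> ennreal ((10 * \<beta>) ^ DIM('a)) * emeasure lborel U"
    if U: "open U" "E \<subseteq> U" for U
  proof -
    \<comment> \<open>Near a point of \<open>E\<close> the bound \<open>\<beta>\<close> on the
      derivative there gives the Lipschitz estimate \<open>2 * \<beta>\<close> relative to this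
      centre.\<close>
    have "\<exists>r>0. r \<le> 1 \<and> ball x (5 * r) \<subseteq> U \<and> (\<forall>y\<in>ball x (5 * r). norm (f y - f x) \<le> 2 * \<beta> * norm (y - x))"
      if x: "x \<in> E" for x
    proof -
      obtain d where d: "d > 0" "\<And>y. norm (y - x) < d \<Longrightarrow> norm (f y - f x - f' x (y - x)) \<le> \<beta> * norm (y - x)"
        using der[OF x] \<beta> unfolding has_derivative_at_alt by blast
      obtain e where e: "e > 0" "ball x e \<subseteq> U" using U x open_contains_ball by blast
      define r where "r = min 1 (min (d / 5) (e / 5))"
      have r: "r > 0" "r \<le> 1" "5 * r \<le> d" "5 * r \<le> e" using d e by (auto simp: r_def)
      have "norm (f y - f x) \<le> 2 * \<beta> * norm (y - x)" if "y \<in> ball x (5 * r)" for y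
      proof -
        have "norm (y - x) < d" using that r by (auto simp: dist_norm norm_minus_commute)
        then have "norm (f y - f x) \<le> \<beta> * norm (y - x) + norm (f' x (y - x))"
          using d(2) norm_triangle_ineq[of "f y - f x - f' x (y - x)" "f' x (y - x)"] by fastforce
        then show ?thesis using bd[OF x, of "y - x"] by simp
      qed
      moreover have "ball x (5 * r) \<subseteq> U" using e r by auto
      ultimately show ?thesis using r by blast
    qed
    then obtain r where r: "\<And>x. x \<in> E \<Longrightarrow> r x > 0 \<and> r x \<le> 1" "\<And>x. x \<in> E \<Longrightarrow> ball x (5 * r x) \<subseteq> U"
      "\<And>x y. x \<in> E \<Longrightarrow> y \<in> ball x (5 * r x) \<Longrightarrow> norm (f y - f x) \<le> 2 * \<beta> * norm (y - x)"
      by metis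
    have cov: "E \<subseteq> (\<Union>i\<in>E. ball i (r i))" using r(1) by force
    obtain C where C: "countable C" "C \<subseteq> E"
       "pairwise (\<lambda>i j. disjnt (ball i (r i)) (ball j (r j))) C"
       "E \<subseteq> (\<Union>i\<in>C. ball i (5 * r i))"
      by (rule Vitali_covering_lemma_balls[OF cov r(1)])
    \<comment> \<open>The constant 10 is the 5 of the enlarged balls times the 2 of the estimate at
      the centres.\<close>
    have img: "f ` E \<subseteq> (\<Union>i\<in>C. ball (f i) ((10 * \<beta>) * r i))"
    proof
      fix z assume "z \<in> f ` E"
      then obtain y where y: "y \<in> E" "z = f y" by blast
      then obtain i where i: "i \<in> C" "y \<in> ball i (5 * r i)" using C(4) by blast
      have iE: "i \<in> E" using i C by blast
      have "norm (f y - f i) \<le> 2 * \<beta> * norm (y - i)" using r(3)[OF iE i(2)] .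
      also have "\<dots> < 2 * \<beta> * (5 * r i)"
        using i(2) \<beta> by (intro mult_strict_left_mono) (auto simp: dist_norm norm_minus_commute)
      finally show "z \<in> (\<Union>i\<in>C. ball (f i) ((10 * \<beta>) * r i))"
        using i y by (intro UN_I[of i]) (auto simp: dist_norm norm_minus_commute)
    qed
    have "emeasure lborel (f ` E) \<le> emeasure lborel (\<Union>i\<in>C. ball (f i) ((10 * \<beta>) * r i))"
      using C(1) by (intro emeasure_mono img sets.countable_UN') auto
    also have "\<dots> \<le> (\<integral>\<^sup>+i. emeasure lborel (ball (f i) ((10 * \<beta>) * r i)) \<partial>count_space C)"
      using C(1) by (intro emeasure_UN_countable_le) auto
    also have "\<dots> = (\<integral>\<^sup>+i. ennreal ((10 * \<beta>) ^ DIM('a)) * emeasure lborel (ball i (r i)) \<partial>count_space C)"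
      using \<beta> r(1) C(2) by (intro nn_integral_cong emeasure_ball_scale) (auto simp: subset_iff less_imp_le)
    also have "\<dots> = ennreal ((10 * \<beta>) ^ DIM('a)) * (\<integral>\<^sup>+i. emeasure lborel (ball i (r i)) \<partial>count_space C)"
      by (intro nn_integral_cmult) auto
    also have "(\<integral>\<^sup>+i. emeasure lborel (ball i (r i)) \<partial>count_space C) = emeasure lborel (\<Union>i\<in>C. ball i (r i))"
      using C(1,3) by (intro emeasure_UN_countable[symmetric])
        (auto simp: disjoint_family_on_def pairwise_def disjnt_def)
    also have "\<dots> \<le> emeasure lborel U"
    proof (intro emeasure_mono UN_least)
      fix i assume "i \<in> C"
      then have "i \<in> E" using C by blast
      then show "ball i (r i) \<subseteq> U" using r(1)[of i] r(2)[of i] by (auto simp: subset_iff)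
    qed (use U in auto)
    finally show ?thesis by (simp add: mult_left_mono)
  qed
  show ?thesis
  proof (cases "emeasure lborel E = \<infinity>")
    case True
    then show ?thesis using \<beta> by (simp add: ennreal_mult_top)
  next
    case False
    show ?thesis
    proof (rule ennreal_le_epsilon)
      fix e :: real assume e: "e > 0"
      define c where "c = (10 * \<beta>) ^ DIM('a)"
      have c: "c > 0" using \<beta> by (simp add: c_def)
      \<comment> \<open>Outer regularity passes from open sets to \<open>E\<close> at a cost of
        \<open>e\<close>, after multiplication by \<open>c\<close>.\<close>
      obtain U where U: "open U" "E \<subseteq> U" "emeasure lborel (U - E) < ennreal (e / c)"
        using outer_regular_lborel[OF E, of "e / c"] e c by auto
      have "emeasure lborel (f ` E) \<le> ennreal c * emeasure lborel U" using main[OF U(1,2)] by (simp add: c_def)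
      also have "emeasure lborel U \<le> emeasure lborel E + emeasure lborel (U - E)"
      proof -
        have "U = E \<union> (U - E)" using U by blast
        then show ?thesis using emeasure_subadditive[of E lborel "U - E"] E U by (metis borel_open sets.Diff sets_lborel)
      qed
      also have "\<dots> \<le> emeasure lborel E + ennreal (e / c)" using U(3) by (intro add_left_mono) simp
      finally have "emeasure lborel (f ` E) \<le> ennreal c * (emeasure lborel E + ennreal (e / c))"
        by (simp add: mult_left_mono)
      also have "\<dots> = ennreal c * emeasure lborel E + ennreal e"
        using c e by (simp add: distrib_left ennreal_mult[symmetric])
      finally show "emeasure lborel (f ` E) \<le> ennreal ((10 * \<beta>) ^ DIM('a)) * emeasure lborel E + ennreal e"
        by (simp add: c_def)
    qed
  qed
qed

text \<open>The preimage of a Borel set \<open>E\<close> in \<open>A\<close> under \<open>F\<close>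
  is the image of \<open>E \<inter> T\<close> under \<open>H\<close>, so by the preceding lemma the
  push-forward of Lebesgue measure on \<open>A\<close> is dominated by a multiple of Lebesgue
  measure on \<open>T\<close>. Only the inverse \<open>H\<close> is differentiated, and no Jacobian
  is computed.\<close>

lemma nn_integral_change_le:
  fixes F H :: "'a::euclidean_space \<Rightarrow> 'a" and h :: "'a \<Rightarrow> ennreal"
  assumes A: "A \<in> sets borel" and T: "T \<in> sets borel" and F: "continuous_on A F"
    and FA: "F ` A = T" and H: "\<And>x. x \<in> A \<Longrightarrow> H (F x) = x"
    and \<beta>: "\<beta> > 0" and der: "\<And>y. y \<in> T \<Longrightarrow> (H has_derivative H' y) (at y)"
    and bd: "\<And>y v. y \<in> T \<Longrightarrow> norm (H' y v) \<le> \<beta> * norm v"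
    and h: "(\<lambda>y. indicator T y * h y) \<in> borel_measurable borel"
  shows "(\<integral>\<^sup>+x. indicator A x * h (F x) \<partial>lborel)
     \<le> ennreal ((10 * \<beta>) ^ DIM('a)) * (\<integral>\<^sup>+y. indicator T y * h y \<partial>lborel)"
proof -
  define k where "k = ennreal ((10 * \<beta>) ^ DIM('a))"
  define M where "M = restrict_space lborel A"
  define N where "N = distr M borel F"
  have Fm: "F \<in> measurable M borel"
    unfolding M_def using borel_measurable_continuous_on_restrict[OF F]
    by (simp add: measurable_cong_sets[OF sets_restrict_space_cong[OF sets_lborel]])
  have spM: "space M = A" by (simp add: M_def space_restrict_space)
  have le: "emeasure N E \<le> k * emeasure lborel (E \<inter> T)" if E: "E \<in> sets borel" for E
  proof -
    let ?B = "F -` E \<inter> A"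
    have "?B \<in> sets M" using measurable_sets[OF Fm E] by (simp add: spM)
    then have B: "?B \<in> sets borel" using A by (auto simp: M_def sets_restrict_space)
    have img: "H ` (E \<inter> T) = ?B" using FA H by (force simp: image_iff)
    have "emeasure N E = emeasure M ?B" unfolding N_def using E Fm by (simp add: emeasure_distr spM)
    also have "\<dots> = emeasure lborel ?B"
      unfolding M_def using A by (intro emeasure_restrict_space) auto
    also have "\<dots> = emeasure lborel (H ` (E \<inter> T))" by (simp add: img)
    also have "\<dots> \<le> k * emeasure lborel (E \<inter> T)"
      unfolding k_def
      by (rule emeasure_differentiable_image_le[OF _ _ \<beta> der bd]) (use E T img B in auto)
    finally show ?thesis .
  qed
  define D where "D = density lborel (\<lambda>y. k * indicator T y)"
  have "emeasure N E \<le> emeasure D E" for E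
  proof (cases "E \<in> sets borel")
    case True
    have "emeasure D E = (\<integral>\<^sup>+y. k * indicator (E \<inter> T) y \<partial>lborel)"
      unfolding D_def using True T
      by (subst emeasure_density) (auto intro!: nn_integral_cong simp: indicator_def)
    also have "\<dots> = k * emeasure lborel (E \<inter> T)"
      using True T by (subst nn_integral_cmult) auto
    finally show ?thesis using le[OF True] by simp
  next
    case False
    then show ?thesis by (simp add: N_def emeasure_notin_sets)
  qed
  then have "N \<le> D" by (subst le_measure) (auto simp: N_def D_def le_fun_def)
  have ind: "indicator A x * h (F x) = indicator A x * (indicator T (F x) * h (F x))" for x
    using FA by (auto simp: indicator_def)
  have "(\<integral>\<^sup>+x. indicator A x * h (F x) \<partial>lborel) = (\<integral>\<^sup>+x. (indicator T (F x) * h (F x)) * indicator A x \<partial>lborel)"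
    by (subst ind) (simp add: mult.commute)
  also have "\<dots> = (\<integral>\<^sup>+x. indicator T (F x) * h (F x) \<partial>M)"
    unfolding M_def using A by (subst nn_integral_restrict_space) auto
  also have "\<dots> = (\<integral>\<^sup>+y. indicator T y * h y \<partial>N)"
    unfolding N_def using Fm h by (subst nn_integral_distr) auto
  also have "\<dots> \<le> (\<integral>\<^sup>+y. indicator T y * h y \<partial>D)"
    using \<open>N \<le> D\<close> by (intro nn_integral_mono_measure) (auto simp: N_def D_def)
  also have "\<dots> = (\<integral>\<^sup>+y. (k * indicator T y) * (indicator T y * h y) \<partial>lborel)"
    unfolding D_def using T h by (subst nn_integral_density) auto
  also have "\<dots> = (\<integral>\<^sup>+y. k * (indicator T y * h y) \<partial>lborel)"
    by (intro nn_integral_cong) (auto simp: indicator_def)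
  also have "\<dots> = k * (\<integral>\<^sup>+y. indicator T y * h y \<partial>lborel)"
    using h by (intro nn_integral_cmult) auto
  finally show ?thesis by (simp add: k_def)
qed

section \<open>Metrics in charts\<close>

lemma is_chartD:
  assumes "is_chart c"
  shows "open (fst c)" "open (snd c ` fst c)" "p \<in> fst c \<Longrightarrow> chart_inv c (snd c p) = p"
    "x \<in> snd c ` fst c \<Longrightarrow> snd c (chart_inv c x) = x" "x \<in> snd c ` fst c \<Longrightarrow> chart_inv c x \<in> fst c"
    "continuous_on (fst c) (snd c)" "continuous_on (snd c ` fst c) (chart_inv c)"
  using assms by (auto simp: is_chart_def homeomorphism_def)

locale manifold =
  fixes A :: "('m::t2_space, 'e::euclidean_space) chart set"
  assumes atlas: "smooth_atlas A"
begin

text \<open>Local representative of \<open>f\<close>; it describes \<open>f\<close> only on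
  \<open>lrdom f c c'\<close>, elsewhere its values are arbitrary.\<close>

abbreviation lr :: "('m \<Rightarrow> 'm) \<Rightarrow> ('m, 'e) chart \<Rightarrow> ('m, 'e) chart \<Rightarrow> 'e \<Rightarrow> 'e" where
  "lr f c c' \<equiv> snd c' \<circ> f \<circ> chart_inv c"

definition lrdom :: "('m \<Rightarrow> 'm) \<Rightarrow> ('m, 'e) chart \<Rightarrow> ('m, 'e) chart \<Rightarrow> 'e set" where
  "lrdom f c c' = snd c ` (fst c \<inter> f -` fst c')"

abbreviation cv :: "('m, 'e) chart \<Rightarrow> 'm \<Rightarrow> 'e \<Rightarrow> ('m, 'e) tvec" where "cv \<equiv> coord_vec A"

lemma chart: "c \<in> A \<Longrightarrow> is_chart c"
  using atlas by (simp add: smooth_atlas_def)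

lemmas chartD = is_chartD[OF chart]

lemma chart_at: "\<exists>c\<in>A. p \<in> fst c"
  using atlas by (auto simp: smooth_atlas_def)

lemma Ck_map_id: "Ck_map A n id"
  using atlas by (auto simp: smooth_atlas_def Ck_map_def continuous_on_id)

lemma Ck_map_lr: "Ck_map A n f \<Longrightarrow> c \<in> A \<Longrightarrow> c' \<in> A \<Longrightarrow> Ck_on n (lrdom f c c') (lr f c c')"
  by (simp add: Ck_map_def lrdom_def)

lemma Ck_map_le: "Ck_map A n f \<Longrightarrow> m \<le> n \<Longrightarrow> Ck_map A m f"
  using Ck_on_le unfolding Ck_map_def by blast

lemma lrdom_iff:
  assumes "c \<in> A"
  shows "x \<in> lrdom f c c' \<longleftrightarrow> x \<in> snd c ` fst c \<and> f (chart_inv c x) \<in> fst c'"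
  using chartD(3,4,5)[OF assms] unfolding lrdom_def by (auto simp: image_iff)

lemma lrdomI: "c \<in> A \<Longrightarrow> p \<in> fst c \<Longrightarrow> f p \<in> fst c' \<Longrightarrow> snd c p \<in> lrdom f c c'"
  by (auto simp: lrdom_def)

lemma open_chart_image:
  assumes c: "c \<in> A" and U: "open U" shows "open (snd c ` (fst c \<inter> U))"
proof -
  have "snd c ` (fst c \<inter> U) = snd c ` fst c \<inter> chart_inv c -` U"
    using chartD(3,4,5)[OF c] by (auto simp: image_iff)
  then show ?thesis
    using continuous_on_open_vimage[OF chartD(2)[OF c]] chartD(7)[OF c] U by (metis Int_commute)
qed

lemma open_chart_preimage:
  assumes c: "c \<in> A" and U: "open U" shows "open (fst c \<inter> snd c -` U)"
  using continuous_on_open_vimage[OF chartD(1)[OF c]] chartD(6)[OF c] U by (metis Int_commute)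

lemma open_lrdom:
  assumes "c \<in> A" "c' \<in> A" "continuous_on UNIV f" shows "open (lrdom f c c')"
proof -
  have "open (f -` fst c')" using assms chartD(1) continuous_on_open_vimage[of UNIV f] by auto
  then show ?thesis unfolding lrdom_def by (rule open_chart_image[OF assms(1)])
qed

lemma Ck_map_cont: "Ck_map A n f \<Longrightarrow> continuous_on UNIV f" by (simp add: Ck_map_def)

lemma lr_differentiable:
  assumes "Ck_map A (Suc 0) f" "c \<in> A" "c' \<in> A" "x \<in> lrdom f c c'"
  shows "lr f c c' differentiable at x"
  using Ck_map_lr[OF assms(1-3)] assms(4) by simp

text \<open>With \<open>id\<close> for one of the maps the same statement covers changes of
  charts.\<close>

lemma lr_chain:
  assumes f: "Ck_map A (Suc 0) f" and h: "Ck_map A (Suc 0) h"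
    and c: "c \<in> A" "c' \<in> A" "c'' \<in> A" and p: "p \<in> fst c" "h p \<in> fst c'" "f (h p) \<in> fst c''"
  shows "fd (lr (f \<circ> h) c c'') (snd c p) u = fd (lr f c' c'') (snd c' (h p)) (fd (lr h c c') (snd c p) u)"
    and "lr (f \<circ> h) c c'' differentiable at (snd c p)"
proof -
  have eqp: "lr h c c' (snd c p) = snd c' (h p)" using chartD(3)[OF c(1) p(1)] by simp
  have d1: "lr h c c' differentiable at (snd c p)"
    by (rule lr_differentiable[OF h c(1,2) lrdomI[where f = h, OF c(1) p(1,2)]])
  have d2: "lr f c' c'' differentiable at (lr h c c' (snd c p))"
    unfolding eqp by (rule lr_differentiable[OF f c(2,3)]) (rule lrdomI[where f = f, OF c(2) p(2,3)])
  note comp = fd_compose[OF d1 d2]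
  have xin: "snd c p \<in> lrdom h c c'" by (rule lrdomI[where f = h, OF c(1) p(1,2)])
  have eq: "(\<lambda>y. lr f c' c'' (lr h c c' y)) y = lr (f \<circ> h) c c'' y" if "y \<in> lrdom h c c'" for y
    using that chartD(3)[OF c(2)] lrdom_iff[OF c(1)] by simp
  note cong = fd_cong[where f = "\<lambda>y. lr f c' c'' (lr h c c' y)" and g = "lr (f \<circ> h) c c''",
      OF open_lrdom[OF c(1,2) Ck_map_cont[OF h]] xin eq comp(1)]
  show "lr (f \<circ> h) c c'' differentiable at (snd c p)" by (rule cong(1))
  show "fd (lr (f \<circ> h) c c'') (snd c p) u = fd (lr f c' c'') (snd c' (h p)) (fd (lr h c c') (snd c p) u)"
    using trans[OF fun_cong[OF cong(2), of u] comp(2)[of u]] unfolding eqp .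
qed

lemma lr_self:
  assumes c: "c \<in> A" and p: "p \<in> fst c" shows "fd (lr id c c) (snd c p) u = u"
proof -
  have "fd (lr id c c) (snd c p) = fd (\<lambda>x. x) (snd c p)"
    by (rule fd_cong(2)[OF chartD(2)[OF c]]) (use p chartD(4)[OF c] in auto)
  also have "fd (\<lambda>x. x) (snd c p) = (\<lambda>x. x)" by (rule fd_eqI) (rule has_derivative_ident)
  finally show ?thesis by simp
qed

section \<open>Coordinate vectors and differentials\<close>

lemma cv_apply:
  "c' \<in> A \<Longrightarrow> p \<in> fst c' \<Longrightarrow> cv c p u c' = fd (lr id c c') (snd c p) u"
  "\<not> (c' \<in> A \<and> p \<in> fst c') \<Longrightarrow> cv c p u c' = 0"
  by (auto simp: coord_vec_def)

lemma cv_self: "c \<in> A \<Longrightarrow> p \<in> fst c \<Longrightarrow> cv c p u c = u"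
  using lr_self by (simp add: coord_vec_def)

lemma cv_tangent:
  assumes c: "c \<in> A" and p: "p \<in> fst c" shows "cv c p u \<in> tangent_space A p"
  unfolding tangent_space_def
proof (intro CollectI conjI allI ballI impI)
  show "cv c p u c' = 0" if "\<not> (c' \<in> A \<and> p \<in> fst c')" for c' using that cv_apply(2) by blast
  fix c' c'' assume h: "c' \<in> A" "c'' \<in> A" "p \<in> fst c'" "p \<in> fst c''"
  show "cv c p u c'' = fd (snd c'' \<circ> chart_inv c') (snd c' p) (cv c p u c')"
    using lr_chain(1)[OF Ck_map_id Ck_map_id c h(1,2) p, of u] h by (simp add: cv_apply)
qed

lemma tangent_eq:
  assumes "v \<in> tangent_space A p" "c \<in> A" "p \<in> fst c" shows "v = cv c p (v c)"
proof
  fix c'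
  show "v c' = cv c p (v c) c'"
  proof (cases "c' \<in> A \<and> p \<in> fst c'")
    case True
    have "\<forall>c\<in>A. \<forall>c'\<in>A. p \<in> fst c \<longrightarrow> p \<in> fst c' \<longrightarrow> v c' = fd (snd c' \<circ> chart_inv c) (snd c p) (v c)"
      using assms(1) unfolding tangent_space_def mem_Collect_eq by (rule conjunct2)
    then have "v c' = fd (snd c' \<circ> chart_inv c) (snd c p) (v c)" using True assms(2,3) by blast
    then show ?thesis using True by (simp add: coord_vec_def)
  next
    case False
    have "\<forall>c. \<not> (c \<in> A \<and> p \<in> fst c) \<longrightarrow> v c = 0"
      using assms(1) unfolding tangent_space_def mem_Collect_eq by (rule conjunct1)
    then have "v c' = 0" using False by blast
    then show ?thesis using False by (auto simp: coord_vec_def)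
  qed
qed

lemma lr_linear:
  assumes "Ck_map A (Suc 0) f" "c \<in> A" "c' \<in> A" "p \<in> fst c" "f p \<in> fst c'"
  shows "linear (fd (lr f c c') (snd c p))"
  by (rule fd_linear[OF lr_differentiable[OF assms(1-3) lrdomI]]) (use assms in auto)

lemma cv_add:
  assumes "c \<in> A" "p \<in> fst c" shows "cv c p (u + w) = cv c p u + cv c p w"
proof
  fix c'
  show "cv c p (u + w) c' = (cv c p u + cv c p w) c'"
  proof (cases "c' \<in> A \<and> p \<in> fst c'")
    case True
    then have l: "linear (fd (lr id c c') (snd c p))"
      using lr_linear[OF Ck_map_id assms(1) _ assms(2)] by auto
    show ?thesis using True linear_add[OF l] by (simp add: cv_apply)
  qed (simp add: cv_apply)
qed

lemma cv_scale:
  assumes "c \<in> A" "p \<in> fst c" shows "cv c p (r *\<^sub>R u) = (\<lambda>c'. r *\<^sub>R cv c p u c')"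
proof
  fix c'
  show "cv c p (r *\<^sub>R u) c' = r *\<^sub>R cv c p u c'"
  proof (cases "c' \<in> A \<and> p \<in> fst c'")
    case True
    then have l: "linear (fd (lr id c c') (snd c p))"
      using lr_linear[OF Ck_map_id assms(1) _ assms(2)] by auto
    show ?thesis using True linear_scale[OF l] by (simp add: cv_apply)
  qed (simp add: cv_apply)
qed

lemma cv_eq_0: "c \<in> A \<Longrightarrow> p \<in> fst c \<Longrightarrow> cv c p u = 0 \<longleftrightarrow> u = 0"
  using cv_self[of c p u] cv_scale[of c p 0 u] by (auto simp: zero_fun_def)

text \<open>The chart chosen by \<open>SOME\<close> in \<open>differential\<close> drops out: apply
  the chain rule to \<open>f \<circ> id\<close> through that chart and to
  \<open>id \<circ> f\<close> through \<open>c'\<close>.\<close>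

lemma differential_cv:
  assumes f: "Ck_map A (Suc 0) f" and c: "c \<in> A" "p \<in> fst c" "c' \<in> A" "f p \<in> fst c'"
  shows "differential A f p (cv c p u) = cv c' (f p) (fd (lr f c c') (snd c p) u)"
proof
  fix c''
  define c0 where "c0 = (SOME c. c \<in> A \<and> p \<in> fst c)"
  have c0: "c0 \<in> A" "p \<in> fst c0" using someI_ex[of "\<lambda>c. c \<in> A \<and> p \<in> fst c"] c unfolding c0_def by blast+
  show "differential A f p (cv c p u) c'' = cv c' (f p) (fd (lr f c c') (snd c p) u) c''"
  proof (cases "c'' \<in> A \<and> f p \<in> fst c''")
    case True
    have "differential A f p (cv c p u) c'' = fd (lr f c0 c'') (snd c0 p) (cv c p u c0)"
      using True by (simp add: differential_def Let_def c0_def)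
    also have "\<dots> = fd (lr (f \<circ> id) c c'') (snd c p) u"
      using lr_chain(1)[OF f Ck_map_id c(1) c0(1) _ c(2), of c'' u] c0 True by (simp add: cv_apply)
    also have "\<dots> = fd (lr (id \<circ> f) c c'') (snd c p) u" by simp
    also have "\<dots> = fd (lr id c' c'') (snd c' (f p)) (fd (lr f c c') (snd c p) u)"
      by (rule lr_chain(1)[OF Ck_map_id f]) (use c True in auto)
    also have "\<dots> = cv c' (f p) (fd (lr f c c') (snd c p) u) c''" using True by (simp add: cv_apply)
    finally show ?thesis .
  next
    case False
    then show ?thesis by (auto simp: differential_def Let_def cv_apply)
  qed
qed

lemma differential_tangent:
  assumes f: "Ck_map A (Suc 0) f" and v: "v \<in> tangent_space A p"
  shows "differential A f p v \<in> tangent_space A (f p)"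
proof -
  obtain c c' where c: "c \<in> A" "p \<in> fst c" "c' \<in> A" "f p \<in> fst c'" using chart_at by metis
  show ?thesis
    using differential_cv[OF f c, of "v c"] tangent_eq[OF v c(1,2)] cv_tangent[OF c(3,4)] by simp
qed

lemma Ck_map_comp1:
  assumes f: "Ck_map A (Suc 0) f" and h: "Ck_map A (Suc 0) h"
    and v: "v \<in> tangent_space A p" and fh: "Ck_map A (Suc 0) (f \<circ> h)"
  shows "differential A (f \<circ> h) p v = differential A f (h p) (differential A h p v)"
proof -
  obtain c c' c'' where c: "c \<in> A" "p \<in> fst c" "c' \<in> A" "h p \<in> fst c'" "c'' \<in> A" "f (h p) \<in> fst c''"
    using chart_at by metis
  have v': "v = cv c p (v c)" by (rule tangent_eq[OF v c(1,2)])
  have fhp: "(f \<circ> h) p \<in> fst c''" using c by simp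
  show ?thesis
    apply (subst v', subst (2) v')
    unfolding differential_cv[OF fh c(1,2) c(5) fhp] differential_cv[OF h c(1-4)]
      differential_cv[OF f c(3-6)] lr_chain(1)[OF f h c(1,3,5,2,4,6)] by simp
qed

lemma differential_id:
  assumes v: "v \<in> tangent_space A p" shows "differential A id p v = v"
proof -
  obtain c where c: "c \<in> A" "p \<in> fst c" using chart_at by metis
  have p: "id p \<in> fst c" using c by simp
  have "differential A id p (cv c p (v c)) = cv c (id p) (fd (lr id c c) (snd c p) (v c))"
    by (rule differential_cv[OF Ck_map_id c c(1) p])
  then show ?thesis unfolding lr_self[OF c] id_apply tangent_eq[OF v c, symmetric] .
qed

section \<open>Pull-back and chart coefficients of metrics\<close>

definition pull :: "('m \<Rightarrow> 'm) \<Rightarrow> ('m, 'e) metric_field \<Rightarrow> ('m, 'e) metric_field" where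
  "pull f u = (\<lambda>p v w. u (f p) (differential A f p v) (differential A f p w))"

definition cf :: "('m, 'e) metric_field \<Rightarrow> ('m, 'e) chart \<Rightarrow> 'e \<Rightarrow> 'e \<Rightarrow> 'e \<Rightarrow> real" where
  "cf u c x a b = u (chart_inv c x) (cv c (chart_inv c x) a) (cv c (chart_inv c x) b)"

lemma cf_pull:
  assumes f: "Ck_map A (Suc 0) f" and c: "c \<in> A" "c' \<in> A" and x: "x \<in> lrdom f c c'"
  shows "cf (pull f u) c x a b = cf u c' (lr f c c' x) (fd (lr f c c') x a) (fd (lr f c c') x b)"
proof -
  let ?p = "chart_inv c x"
  have p: "?p \<in> fst c" "f ?p \<in> fst c'" "snd c ?p = x"
    using x c(1) chartD(4,5)[OF c(1)] by (auto simp: lrdom_iff)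
  show ?thesis
    unfolding cf_def pull_def differential_cv[OF f c(1) p(1) c(2) p(2)] p(3)
    using p(2) chartD(3)[OF c(2)] by simp
qed

lemma inner_fieldD:
  assumes "inner_product_field A u" "v \<in> tangent_space A p" "w \<in> tangent_space A p"
  shows "u p v w = u p w v" "v \<noteq> 0 \<Longrightarrow> u p v v > 0" "u p (\<lambda>c. r *\<^sub>R v c) w = r * u p v w"
    "z \<in> tangent_space A p \<Longrightarrow> u p (z + v) w = u p z w + u p v w"
  using assms unfolding inner_product_field_def by blast+

lemma inner_field_0:
  assumes u: "inner_product_field A u" and w: "w \<in> tangent_space A p" shows "u p 0 w = 0"
proof -
  have "(\<lambda>c. 0 *\<^sub>R w c) = (0 :: ('m, 'e) tvec)" by (auto simp: fun_eq_iff)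
  then show ?thesis using inner_fieldD(3)[OF u w w, of 0] by simp
qed

lemma cf_bilinear:
  assumes u: "inner_product_field A u" and c: "c \<in> A" and x: "x \<in> snd c ` fst c"
  shows "cf u c x a b = cf u c x b a" "cf u c x (a + a') b = cf u c x a b + cf u c x a' b"
    "cf u c x (r *\<^sub>R a) b = r * cf u c x a b" "a \<noteq> 0 \<Longrightarrow> cf u c x a a > 0"
proof -
  let ?p = "chart_inv c x"
  have p: "?p \<in> fst c" using chartD(5)[OF c x] .
  note t = cv_tangent[OF c p]
  show "cf u c x a b = cf u c x b a" unfolding cf_def by (rule inner_fieldD(1)[OF u t t])
  show "cf u c x (a + a') b = cf u c x a b + cf u c x a' b"
    unfolding cf_def cv_add[OF c p] by (rule inner_fieldD(4)[OF u t t t])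
  show "cf u c x (r *\<^sub>R a) b = r * cf u c x a b"
    unfolding cf_def cv_scale[OF c p] by (rule inner_fieldD(3)[OF u t t])
  show "cf u c x a a > 0" if "a \<noteq> 0"
    unfolding cf_def by (rule inner_fieldD(2)[OF u t t]) (use cv_eq_0[OF c p] that in blast)
qed

lemma cf_expand:
  assumes u: "inner_product_field A u" and c: "c \<in> A" and x: "x \<in> snd c ` fst c"
  shows "cf u c x a b = (\<Sum>i\<in>Basis. \<Sum>j\<in>Basis. (a \<bullet> i) * (b \<bullet> j) * cf u c x i j)"
proof -
  note B = cf_bilinear[OF assms]
  have l1: "linear (\<lambda>a. cf u c x a b)" for b by (rule linearI) (use B in auto)
  have l2: "linear (\<lambda>b. cf u c x a b)" for a
    by (rule linearI) (simp_all add: B(1)[of a] B(2,3))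
  have e1: "cf u c x a b = (\<Sum>i\<in>Basis. (a \<bullet> i) * cf u c x i b)"
    using linear_sum[OF l1, of "\<lambda>i. (a \<bullet> i) *\<^sub>R i" Basis b] linear_scale[OF l1]
    by (simp add: euclidean_representation)
  have e2: "cf u c x i b = (\<Sum>j\<in>Basis. (b \<bullet> j) * cf u c x i j)" for i
    using linear_sum[OF l2, of i "\<lambda>j. (b \<bullet> j) *\<^sub>R j" Basis] linear_scale[OF l2]
    by (simp add: euclidean_representation)
  show ?thesis
    by (rule trans[OF e1], rule sum.cong[OF refl], subst e2) (simp add: sum_distrib_left mult.assoc)
qed

text \<open>The left inverse \<open>h\<close> shows that the differential of \<open>f\<close> kills
  no nonzero tangent vector, which gives positivity; the other laws come from linearity of the
  differential.\<close>

lemma pull_inner_field: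
  assumes f: "Ck_map A (Suc 0) f" and h: "Ck_map A (Suc 0) h" and hf: "h \<circ> f = id"
    and u: "inner_product_field A u"
  shows "inner_product_field A (pull f u)"
  unfolding inner_product_field_def pull_def
proof (intro allI ballI conjI impI)
  fix p v w assume v: "v \<in> tangent_space A p" and w: "w \<in> tangent_space A p"
  let ?D = "differential A f p"
  note t = differential_tangent[OF f]
  obtain c c' where c: "c \<in> A" "p \<in> fst c" "c' \<in> A" "f p \<in> fst c'" using chart_at by metis
  have lin: "?D (\<lambda>c. r *\<^sub>R v c) = (\<lambda>c. r *\<^sub>R ?D v c)" "z \<in> tangent_space A p \<Longrightarrow> ?D (z + v) = ?D z + ?D v" for r z
  proof -
    note l = lr_linear[OF f c(1,3,2,4)]
    have v': "v = cv c p (v c)" by (rule tangent_eq[OF v c(1,2)])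
    have "(\<lambda>c. r *\<^sub>R v c) = cv c p (r *\<^sub>R v c)" using v' cv_scale[OF c(1,2)] by metis
    then show "?D (\<lambda>c. r *\<^sub>R v c) = (\<lambda>c. r *\<^sub>R ?D v c)"
      using differential_cv[OF f c] v' cv_scale[OF c(3,4)] linear_scale[OF l] by metis
    assume "z \<in> tangent_space A p"
    then have z': "z = cv c p (z c)" by (rule tangent_eq[OF _ c(1,2)])
    have "z + v = cv c p (z c + v c)" using v' z' cv_add[OF c(1,2)] by metis
    then show "?D (z + v) = ?D z + ?D v"
      using differential_cv[OF f c] v' z' cv_add[OF c(3,4)] linear_add[OF l] by metis
  qed
  show "u (f p) (?D v) (?D w) = u (f p) (?D w) (?D v)"
    by (rule inner_fieldD(1)[OF u t[OF v] t[OF w]])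
  show "u (f p) (?D (\<lambda>c. r *\<^sub>R v c)) (?D w) = r * u (f p) (?D v) (?D w)" for r
    unfolding lin(1) by (rule inner_fieldD(3)[OF u t[OF v] t[OF w]])
  show "u (f p) (?D (z + v)) (?D w) = u (f p) (?D z) (?D w) + u (f p) (?D v) (?D w)"
    if z: "z \<in> tangent_space A p" for z
    unfolding lin(2)[OF z] by (rule inner_fieldD(4)[OF u t[OF v] t[OF w] t[OF z]])
  assume v0: "v \<noteq> 0"
  have "differential A h (f p) (?D v) = v"
    using Ck_map_comp1[OF h f v] hf Ck_map_id differential_id[OF v] by simp
  moreover have "differential A h (f p) 0 = 0"
  proof -
    have hfp: "h (f p) \<in> fst c" using hf c by (metis comp_apply id_apply)
    have z: "cv c' (f p) 0 = 0" "cv c (h (f p)) 0 = 0" using cv_eq_0 c hfp by blast+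
    show ?thesis
      using differential_cv[OF h c(3,4,1) hfp, of 0] z linear_0[OF lr_linear[OF h c(3,1,4) hfp]] by simp
  qed
  ultimately have "?D v \<noteq> 0" using v0 by metis
  then show "0 < u (f p) (?D v) (?D v)" by (rule inner_fieldD(2)[OF u t[OF v] t[OF v]])
qed

end

section \<open>Growth of the derivatives of the translated metrics\<close>

text \<open>The sum of the individual constants serves all indices, since each is nonnegative and
  the property persists for larger constants.\<close>

lemma finite_uniform_bound:
  fixes Z :: "'i \<Rightarrow> real \<Rightarrow> bool"
  assumes "finite I" "\<And>i. i \<in> I \<Longrightarrow> \<exists>R\<ge>0. Z i R" "\<And>i R R'. Z i R \<Longrightarrow> R \<le> R' \<Longrightarrow> Z i R'"
  shows "\<exists>R\<ge>0. \<forall>i\<in>I. Z i R"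
proof -
  have "\<forall>i\<in>I. \<exists>R. R \<ge> 0 \<and> Z i R" using assms(2) by blast
  from bchoice[OF this] obtain R where R: "\<forall>i\<in>I. R i \<ge> 0 \<and> Z i (R i)" ..
  have "Z i (\<Sum>i\<in>I. R i)" if "i \<in> I" for i
  proof (rule assms(3))
    show "Z i (R i)" using R that by blast
    show "R i \<le> (\<Sum>i\<in>I. R i)" using R that assms(1) by (intro member_le_sum) auto
  qed
  moreover have "(\<Sum>i\<in>I. R i) \<ge> 0" using R by (intro sum_nonneg) auto
  ultimately show ?thesis by blast
qed

lemma finite_blists: "finite (blists j :: 'a::euclidean_space list set)"
  unfolding blists_def using finite_lists_length_eq[OF finite_Basis, of j] by simp

text \<open>Cubes instead of balls: from each of its points a cube contains, in every coordinate
  direction, a segment of length \<open>r\<close> in one of the two senses, and also subcubes with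
  this point as a vertex. This makes the interpolation work up to the boundary.\<close>

abbreviation bx :: "'e::euclidean_space \<Rightarrow> real \<Rightarrow> 'e set" where
  "bx z r \<equiv> cbox (z - r *\<^sub>R One) (z + r *\<^sub>R One)"

lemma bx_iff: "x \<in> bx z r \<longleftrightarrow> (\<forall>i\<in>Basis. \<bar>(x - z) \<bullet> i\<bar> \<le> r)"
  by (auto simp: mem_box inner_diff_left inner_add_left abs_le_iff algebra_simps)

lemma bx_exists:
  assumes "open U" "z \<in> U" shows "\<exists>r>0. bx z r \<subseteq> U"
proof -
  obtain e where e: "e > 0" "ball z e \<subseteq> U" using assms open_contains_ball by blast
  \<comment> \<open>In this cube the sum of the coordinate deviations, which bounds the norm, is at
    most \<open>e / 2\<close>.\<close>
  define r where "r = e / (2 * DIM('a))"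
  have r: "r > 0" using e by (simp add: r_def)
  have "bx z r \<subseteq> ball z e"
  proof
    fix x assume x: "x \<in> bx z r"
    have "norm (x - z) \<le> (\<Sum>i\<in>Basis. \<bar>(x - z) \<bullet> i\<bar>)" by (rule norm_le_l1)
    also have "\<dots> \<le> (\<Sum>i\<in>(Basis::'a set). r)" using x by (intro sum_mono) (auto simp: bx_iff)
    also have "\<dots> < e" using e by (simp add: r_def)
    finally show "x \<in> ball z e" by (simp add: dist_norm norm_minus_commute)
  qed
  then show ?thesis using r e by blast
qed

locale maction = wgroup G S + manifold A
  for G :: "('g, 'b) monoid_scheme" (structure) and S :: "'g set"
    and A :: "('m::t2_space, 'e::euclidean_space) chart set" +
  fixes g0 :: "('m, 'e) metric_field" and k :: nat and \<alpha> :: "'g \<Rightarrow> 'm \<Rightarrow> 'm"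
  assumes cpt: "compact (UNIV :: 'm set)" and g0: "smooth_metric A g0" and k2: "k \<ge> 2"
    and hom: "\<alpha> \<in> hom G (Diff A k)"
    and growth: "uniform_subexp_growth_of_derivatives G S A g0 \<alpha>"
begin

lemma \<alpha>_mult: "x \<in> carrier G \<Longrightarrow> y \<in> carrier G \<Longrightarrow> \<alpha> (x \<otimes> y) = \<alpha> x \<circ> \<alpha> y"
  using hom by (auto simp: hom_def Diff_def)

lemma \<alpha>_Diff: "x \<in> carrier G \<Longrightarrow> bij (\<alpha> x) \<and> Ck_map A k (\<alpha> x)"
  using hom by (auto simp: hom_def Diff_def)

lemma \<alpha>_one: "\<alpha> \<one> = id"
proof -
  have "\<alpha> \<one> \<circ> \<alpha> \<one> = \<alpha> \<one>" using \<alpha>_mult[of \<one> \<one>] by simp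
  then have "\<alpha> \<one> (\<alpha> \<one> p) = \<alpha> \<one> p" for p by (metis comp_apply)
  then show ?thesis using \<alpha>_Diff[of \<one>] by (auto simp: fun_eq_iff dest: bij_is_inj injD)
qed

lemma \<alpha>_inv: "x \<in> carrier G \<Longrightarrow> \<alpha> (inv x) \<circ> \<alpha> x = id" "x \<in> carrier G \<Longrightarrow> \<alpha> x \<circ> \<alpha> (inv x) = id"
  using \<alpha>_mult[of "inv x" x] \<alpha>_mult[of x "inv x"] \<alpha>_one by auto

lemma \<alpha>_Ck: "x \<in> carrier G \<Longrightarrow> Ck_map A k (\<alpha> x)" using \<alpha>_Diff by blast

lemma \<alpha>_C1: "x \<in> carrier G \<Longrightarrow> Ck_map A (Suc 0) (\<alpha> x)"
  by (rule Ck_map_le[OF \<alpha>_Ck]) (use k2 in auto)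

text \<open>The inverse makes this a left action on fields: \<open>u (x \<otimes> y)\<close> is the
  pull-back of \<open>u y\<close> by \<open>\<alpha> (inv x)\<close>.\<close>

definition u :: "'g \<Rightarrow> ('m, 'e) metric_field" where "u x = pull (\<alpha> (inv x)) g0"

lemma g0_inner: "inner_product_field A g0"
  using g0 by (auto simp: smooth_metric_def Cr_metric_def)

lemma u_inner: "x \<in> carrier G \<Longrightarrow> inner_product_field A (u x)"
  unfolding u_def
  by (rule pull_inner_field[OF \<alpha>_C1 \<alpha>_C1[of x] \<alpha>_inv(2) g0_inner]) auto

lemma differential_mult:
  assumes "x \<in> carrier G" "y \<in> carrier G" "v \<in> tangent_space A p"
  shows "differential A (\<alpha> (x \<otimes> y)) p v = differential A (\<alpha> x) (\<alpha> y p) (differential A (\<alpha> y) p v)"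
  using Ck_map_comp1[OF \<alpha>_C1[OF assms(1)] \<alpha>_C1[OF assms(2)] assms(3)]
    \<alpha>_C1[OF m_closed[OF assms(1,2)]] by (simp add: \<alpha>_mult[OF assms(1,2)])

lemma u_mult:
  assumes "x \<in> carrier G" "y \<in> carrier G" "v \<in> tangent_space A p" "w \<in> tangent_space A p"
  shows "u (x \<otimes> y) p v w = pull (\<alpha> (inv x)) (u y) p v w"
proof -
  have i: "inv (x \<otimes> y) = inv y \<otimes> inv x" using assms inv_mult_group by blast
  have c: "inv y \<in> carrier G" "inv x \<in> carrier G" using assms by auto
  show ?thesis
    unfolding u_def pull_def i differential_mult[OF c assms(3)] differential_mult[OF c assms(4)]
    unfolding \<alpha>_mult[OF c] by simp
qed

lemma cf_u_mult:
  assumes x: "x \<in> carrier G" "y \<in> carrier G" and c: "c \<in> A" "c' \<in> A"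
    and p: "p \<in> lrdom (\<alpha> (inv x)) c c'"
  shows "cf (u (x \<otimes> y)) c p a b
    = cf (u y) c' (lr (\<alpha> (inv x)) c c' p) (fd (lr (\<alpha> (inv x)) c c') p a) (fd (lr (\<alpha> (inv x)) c c') p b)"
proof -
  have q: "chart_inv c p \<in> fst c" using p c(1) chartD(5)[OF c(1)] by (simp add: lrdom_iff)
  have "cf (u (x \<otimes> y)) c p a b = cf (pull (\<alpha> (inv x)) (u y)) c p a b"
    unfolding cf_def by (rule u_mult[OF x cv_tangent[OF c(1) q] cv_tangent[OF c(1) q]])
  then show ?thesis using cf_pull[OF \<alpha>_C1[OF inv_closed[OF x(1)]] c p] by simp
qed

lemma g0_Ck:
  assumes c: "c \<in> A" shows "Ck_on n (snd c ` fst c) (\<lambda>x. cf g0 c x a b)"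
proof -
  have "Cr_metric A (real n) g0" using g0 by (simp add: smooth_metric_def)
  then have "Cr_on (real n) (snd c ` fst c) (\<lambda>x. cf g0 c x a b)"
    using c unfolding Cr_metric_def cf_def by blast
  then show ?thesis by (simp add: Cr_on_def frac_def)
qed

lemma pull_expand:
  assumes f: "Ck_map A (Suc 0) f" and c: "c \<in> A" "c' \<in> A" and x: "x \<in> lrdom f c c'"
    and w: "inner_product_field A w"
  shows "cf (pull f w) c x a b = (\<Sum>i\<in>Basis. \<Sum>j\<in>Basis.
    ((fd (lr f c c') x a \<bullet> i) * (fd (lr f c c') x b \<bullet> j)) * cf w c' (lr f c c' x) i j)"
proof -
  have "lr f c c' x \<in> snd c' ` fst c'" using x c(1) by (auto simp: lrdom_iff)
  then show ?thesis unfolding cf_pull[OF f c x] using cf_expand[OF w c(2)] by simp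
qed

text \<open>One derivative is lost because the differential of \<open>f\<close> enters the
  coefficients. This is why the metrics \<open>u x\<close> are of class
  \<open>k - 1\<close>.\<close>

lemma Ck_on_pull:
  assumes f: "Ck_map A (Suc n) f" and w: "inner_product_field A w"
    and wC: "\<And>c a b. c \<in> A \<Longrightarrow> Ck_on n (snd c ` fst c) (\<lambda>x. cf w c x a b)" and c: "c \<in> A"
  shows "Ck_on n (snd c ` fst c) (\<lambda>x. cf (pull f w) c x a b)"
proof (rule Ck_holder_on_local)
  fix x assume x: "x \<in> snd c ` fst c"
  obtain c' where c': "c' \<in> A" "f (chart_inv c x) \<in> fst c'"
    using chart_at[of "f (chart_inv c x)"] by blast
  let ?U = "lrdom f c c'" and ?F = "lr f c c'"
  have U: "open ?U" by (rule open_lrdom[OF c c'(1) Ck_map_cont[OF f]])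
  have F: "Ck_on (Suc n) ?U ?F" by (rule Ck_map_lr[OF f c c'(1)])
  have f1: "Ck_map A (Suc 0) f" by (rule Ck_map_le[OF f]) simp
  have im: "?F ` ?U \<subseteq> snd c' ` fst c'" using c by (auto simp: lrdom_iff)
  have dF: "Ck_on n ?U (\<lambda>x. fd ?F x a)" for a using F by simp
  have "Ck_on n ?U (\<lambda>x. \<Sum>i\<in>Basis. \<Sum>j\<in>Basis. ((fd ?F x a \<bullet> i) * (fd ?F x b \<bullet> j)) * cf w c' (?F x) i j)"
    by (intro Ck_holder_on_sum Ck_on_mult Ck_on_inner U dF
        Ck_on_compose[OF U chartD(2)[OF c'(1)] Ck_on_Suc[OF F] wC[OF c'(1)] im])
  then have "Ck_on n ?U (\<lambda>x. cf (pull f w) c x a b)"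
    by (rule Ck_holder_on_cong[OF U, rotated]) (simp only: pull_expand[OF f1 c c'(1) _ w])
  then show "\<exists>U. open U \<and> x \<in> U \<and> Ck_on n U (\<lambda>x. cf (pull f w) c x a b)"
    using U x c' c by (intro exI[of _ ?U]) (simp add: lrdom_iff)
qed

lemma u_Ck:
  assumes x: "x \<in> carrier G" and c: "c \<in> A"
  shows "Ck_on (k - 1) (snd c ` fst c) (\<lambda>p. cf (u x) c p a b)"
  unfolding u_def
proof (rule Ck_on_pull[OF _ g0_inner g0_Ck c])
  show "Ck_map A (Suc (k - 1)) (\<alpha> (inv x))" using \<alpha>_Ck[of "inv x"] x k2 by simp
qed

text \<open>\<open>deriv_norm\<close> is a supremum over vectors of length at most 1; rescaling
  turns its bound into a quadratic inequality for all tangent vectors.\<close>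

lemma g0_growth:
  assumes e: "e > 0"
  shows "\<exists>C\<ge>0. \<forall>x\<in>carrier G. \<forall>p. \<forall>v\<in>tangent_space A p.
    g0 (\<alpha> x p) (differential A (\<alpha> x) p v) (differential A (\<alpha> x) p v) \<le> (C * exp (e * real (len x)))\<^sup>2 * g0 p v v"
proof -
  obtain C where C: "\<And>x. x \<in> carrier G \<Longrightarrow> deriv_norm A g0 (\<alpha> x) \<le> ereal (C * exp (e * real (len x)))"
    using growth[unfolded uniform_subexp_growth_of_derivatives_def, rule_format, OF e] by blast
  have "g0 (\<alpha> x p) (differential A (\<alpha> x) p v) (differential A (\<alpha> x) p v) \<le> (\<bar>C\<bar> * exp (e * real (len x)))\<^sup>2 * g0 p v v"
    if x: "x \<in> carrier G" and v: "v \<in> tangent_space A p" for x p v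
  proof -
    let ?D = "differential A (\<alpha> x) p" and ?K = "\<bar>C\<bar> * exp (e * real (len x))"
    obtain c c' where c: "c \<in> A" "p \<in> fst c" "c' \<in> A" "\<alpha> x p \<in> fst c'" using chart_at by metis
    note f = \<alpha>_C1[OF x]
    note l = lr_linear[OF f c(1,3,2,4)]
    have v': "v = cv c p (v c)" by (rule tangent_eq[OF v c(1,2)])
    show ?thesis
    proof (cases "v = 0")
      case True
      have z: "cv c p 0 = 0" "cv c' (\<alpha> x p) 0 = 0" using cv_eq_0 c by blast+
      have "?D v = 0" using differential_cv[OF f c, of 0] z linear_0[OF l] True by simp
      moreover have "g0 (\<alpha> x p) 0 0 = 0"
        using inner_field_0[OF g0_inner cv_tangent[OF c(3,4), of 0]] z by simp
      moreover have "g0 p 0 0 = 0" using inner_field_0[OF g0_inner cv_tangent[OF c(1,2), of 0]] z by simp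
      ultimately show ?thesis using True by simp
    next
      case False
      define s where "s = g0 p v v"
      have s: "s > 0" unfolding s_def by (rule inner_fieldD(2)[OF g0_inner v v False])
      define r where "r = 1 / sqrt s"
      have r: "r > 0" "r * r * s = 1" using s by (auto simp: r_def)
      define w where "w = cv c p (r *\<^sub>R v c)"
      have w: "w \<in> tangent_space A p" unfolding w_def by (rule cv_tangent[OF c(1,2)])
      have w': "w = (\<lambda>c. r *\<^sub>R v c)" unfolding w_def using v' cv_scale[OF c(1,2)] by metis
      have scale2: "h q (\<lambda>c. r *\<^sub>R a c) (\<lambda>c. r *\<^sub>R a c) = r * r * h q a a"
        if "inner_product_field A h" "a \<in> tangent_space A q" "(\<lambda>c. r *\<^sub>R a c) \<in> tangent_space A q" for h q a
        using inner_fieldD(3)[OF that(1,2,3), of r] inner_fieldD(3)[OF that(1,2,2), of r]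
          inner_fieldD(1)[OF that(1,2,3)] by simp
      have "g0 p w w = r * r * s"
        unfolding w' s_def by (rule scale2[OF g0_inner v]) (use w w' in simp)
      then have "w \<in> {v \<in> tangent_space A p. g0 p v v \<le> 1}" using w r by simp
      then have "ereal (sqrt (g0 (\<alpha> x p) (?D w) (?D w))) \<le> deriv_norm A g0 (\<alpha> x)"
        unfolding deriv_norm_def by (intro SUP_upper2[of p] SUP_upper) auto
      also have "\<dots> \<le> ereal ?K"
        by (rule order_trans[OF C[OF x]]) (simp add: mult_right_mono)
      finally have "sqrt (g0 (\<alpha> x p) (?D w) (?D w)) \<le> ?K" by simp
      then have le: "g0 (\<alpha> x p) (?D w) (?D w) \<le> ?K\<^sup>2" by (rule sqrt_le_D)
      have Dw: "?D w = (\<lambda>c. r *\<^sub>R ?D v c)"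
        unfolding w_def using differential_cv[OF f c] v' cv_scale[OF c(3,4)] linear_scale[OF l] by metis
      note t = differential_tangent[OF f]
      have "g0 (\<alpha> x p) (?D w) (?D w) = r * r * g0 (\<alpha> x p) (?D v) (?D v)"
        unfolding Dw by (rule scale2[OF g0_inner t[OF v]]) (use t[OF w] Dw in simp)
      then have "s * (r * r * g0 (\<alpha> x p) (?D v) (?D v)) \<le> s * ?K\<^sup>2"
        using le s by simp
      moreover have "s * (r * r * g0 (\<alpha> x p) (?D v) (?D v)) = g0 (\<alpha> x p) (?D v) (?D v)"
        using r(2) by (metis mult.assoc mult.commute mult_1)
      ultimately have "g0 (\<alpha> x p) (?D v) (?D v) \<le> s * ?K\<^sup>2" by (simp only:)
      then show ?thesis unfolding s_def by (simp only: mult.commute)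
    qed
  qed
  then show ?thesis by (intro exI[of _ "\<bar>C\<bar>"]) auto
qed

end

section \<open>Finite covers by compact coordinate cubes\<close>

type_synonym ('m, 'e) piece = "('m, 'e) chart \<times> 'e \<times> real"

text \<open>The cover \<open>P\<close> takes the place of a partition of unity; its cubes may
  overlap. They are compact, so coefficients and their derivatives are bounded on them, and each
  lies in an open chart image, so derivatives make sense up to the boundary.\<close>

locale pieces = maction G S A g0 k \<alpha>
  for G :: "('g, 'b) monoid_scheme" (structure) and S :: "'g set"
    and A :: "('m::t2_space, 'e::euclidean_space) chart set"
    and g0 :: "('m, 'e) metric_field" and k :: nat and \<alpha> :: "'g \<Rightarrow> 'm \<Rightarrow> 'm" +
  fixes P :: "('m, 'e) piece set"
  assumes P_finite: "finite P"
    and P_chart: "(c, z, r) \<in> P \<Longrightarrow> c \<in> A"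
    and P_pos: "(c, z, r) \<in> P \<Longrightarrow> r > 0"
    and P_sub: "(c, z, r) \<in> P \<Longrightarrow> bx z r \<subseteq> snd c ` fst c"
    and P_cover: "\<exists>c z r. (c, z, r) \<in> P \<and> p \<in> fst c \<and> snd c p \<in> bx z r"
begin

definition overlap ::
  "('m \<Rightarrow> 'm) \<Rightarrow> ('m, 'e) piece \<Rightarrow> ('m, 'e) piece \<Rightarrow> 'e set" where
  "overlap f i j = (case i of (c, z, r) \<Rightarrow> case j of (c', z', r') \<Rightarrow>
     {x \<in> bx z r. x \<in> lrdom f c c' \<and> lr f c c' x \<in> bx z' r'})"

text \<open>The image \<open>L\<close> of a cube in the manifold is compact, hence closed because
  the space is Hausdorff; the overlap is the preimage of \<open>L\<close> in a compact cube.\<close>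

lemma overlap_compact:
  assumes i: "(c, z, r) \<in> P" and j: "(c', z', r') \<in> P" and f: "continuous_on UNIV f"
  shows "compact (overlap f (c, z, r) (c', z', r'))"
proof -
  note c = P_chart[OF i] and c' = P_chart[OF j]
  define L where "L = chart_inv c' ` bx z' r'"
  have "compact L" unfolding L_def
    by (intro compact_continuous_image continuous_on_subset[OF chartD(7)[OF c'] P_sub[OF j]] compact_cbox)
  then have L: "closed L" by (rule compact_imp_closed)
  have cont: "continuous_on (bx z r) (\<lambda>x. f (chart_inv c x))"
    by (rule continuous_on_compose2[OF f continuous_on_subset[OF chartD(7)[OF c] P_sub[OF i]]]) simp
  have "overlap f (c, z, r) (c', z', r') = bx z r \<inter> (\<lambda>x. f (chart_inv c x)) -` L"
  proof (intro Set.set_eqI iffI)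
    fix x assume "x \<in> overlap f (c, z, r) (c', z', r')"
    then have x: "x \<in> bx z r" "x \<in> lrdom f c c'" "lr f c c' x \<in> bx z' r'" by (auto simp: overlap_def)
    then have "f (chart_inv c x) = chart_inv c' (lr f c c' x)"
      using chartD(3)[OF c'] by (simp add: lrdom_iff[OF c])
    then show "x \<in> bx z r \<inter> (\<lambda>x. f (chart_inv c x)) -` L" using x by (auto simp: L_def)
  next
    fix x assume x: "x \<in> bx z r \<inter> (\<lambda>x. f (chart_inv c x)) -` L"
    then obtain y where y: "y \<in> bx z' r'" "f (chart_inv c x) = chart_inv c' y" by (auto simp: L_def)
    have "y \<in> snd c' ` fst c'" using y P_sub[OF j] by blast
    then have "f (chart_inv c x) \<in> fst c'" "snd c' (f (chart_inv c x)) = y"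
      using chartD(4,5)[OF c'] y(2) by auto
    moreover have "x \<in> snd c ` fst c" using x P_sub[OF i] by blast
    ultimately show "x \<in> overlap f (c, z, r) (c', z', r')"
      using x y by (auto simp: overlap_def lrdom_iff[OF c])
  qed
  then show ?thesis
    using continuous_closed_preimage[OF cont closed_cbox L] compact_Int_closed[OF compact_cbox]
    by (metis Int_absorb1 Int_lower1)
qed

lemma overlap_exists:
  assumes i: "(c, z, r) \<in> P" and x: "x \<in> bx z r"
  shows "\<exists>c' z' r'. (c', z', r') \<in> P \<and> x \<in> overlap f (c, z, r) (c', z', r')"
proof -
  obtain c' z' r' where "(c', z', r') \<in> P" "f (chart_inv c x) \<in> fst c'"
    "snd c' (f (chart_inv c x)) \<in> bx z' r'" using P_cover[of "f (chart_inv c x)"] by blast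
  moreover have "x \<in> snd c ` fst c" using x P_sub[OF i] by blast
  ultimately show ?thesis using x
    by (intro exI[of _ c'] exI[of _ z'] exI[of _ r']) (auto simp: overlap_def lrdom_iff[OF P_chart[OF i]])
qed

lemma P_subD: "(c, z, r) \<in> P \<Longrightarrow> x \<in> bx z r \<Longrightarrow> x \<in> snd c ` fst c"
  using P_sub by blast

text \<open>A continuous positive function on the compact product of the cube and the unit sphere
  has a positive minimum and a finite maximum; homogeneity extends the bounds to all
  vectors.\<close>

lemma g0_comparable_piece:
  assumes i: "(c, z, r) \<in> P"
  shows "\<exists>R\<ge>0. \<forall>x\<in>bx z r. \<forall>a. 0 \<le> cf g0 c x a a \<and> (norm a)\<^sup>2 \<le> R * cf g0 c x a a \<and> cf g0 c x a a \<le> R * (norm a)\<^sup>2"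
proof -
  note c = P_chart[OF i]
  let ?K = "bx z r \<times> sphere (0::'e) 1"
  define h where "h = (\<lambda>(x, a). \<Sum>i\<in>Basis. \<Sum>j\<in>Basis. (a \<bullet> i) * (a \<bullet> j) * cf g0 c x i j)"
  have heq: "h (x, a) = cf g0 c x a a" if "x \<in> bx z r" for x a
    unfolding h_def using cf_expand[OF g0_inner c P_subD[OF i that], of a a] by simp
  have cont: "continuous_on (bx z r) (\<lambda>x. cf g0 c x a b)" for a b
    using Ck_on_continuous[OF g0_Ck[OF c, of 0 a b]] P_sub[OF i] by (rule continuous_on_subset)
  have "continuous_on ?K h"
    unfolding h_def case_prod_unfold
    by (intro continuous_intros continuous_on_compose2[OF cont]) auto
  moreover have K: "compact ?K" by (intro compact_Times compact_cbox compact_sphere)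
  ultimately have im: "compact (h ` ?K)" by (rule compact_continuous_image)
  have ne: "?K \<noteq> {}"
  proof -
    obtain b :: 'e where "b \<in> Basis" using nonempty_Basis by blast
    then have "(z, b) \<in> ?K" using P_pos[OF i] by (auto simp: bx_iff)
    then show ?thesis by blast
  qed
  have pos: "h p > 0" if "p \<in> ?K" for p
  proof -
    obtain x a where p1: "p = (x, a)" by (cases p)
    then have p2: "x \<in> bx z r" "norm a = 1" using that by auto
    then have "a \<noteq> 0" by auto
    note p = p1 p2(1) this
    show ?thesis unfolding p(1) heq[OF p(2)] by (rule cf_bilinear(4)[OF g0_inner c P_subD[OF i p(2)] p(3)])
  qed
  obtain m where m: "m \<in> h ` ?K" "\<And>y. y \<in> h ` ?K \<Longrightarrow> m \<le> y"
    using compact_attains_inf[OF im] ne by auto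
  obtain M where M: "\<And>y. y \<in> h ` ?K \<Longrightarrow> y \<le> M"
    using compact_attains_sup[OF im] ne by auto
  have m0: "m > 0" using m(1) pos by auto
  define R where "R = max (1 / m) M"
  have R: "R \<ge> 1 / m" "R \<ge> M" "R > 0" using m0 by (auto simp: R_def less_max_iff_disj)
  have "0 \<le> cf g0 c x a a \<and> (norm a)\<^sup>2 \<le> R * cf g0 c x a a \<and> cf g0 c x a a \<le> R * (norm a)\<^sup>2"
    if x: "x \<in> bx z r" for x a
  proof (cases "a = 0")
    case True
    then show ?thesis using cf_expand[OF g0_inner c P_subD[OF i x], of 0 0] by simp
  next
    case False
    define n where "n = norm a"
    have n: "n > 0" using False by (simp add: n_def)
    define b where "b = (1 / n) *\<^sub>R a"
    have b: "norm b = 1" "a = n *\<^sub>R b" using n by (auto simp: b_def n_def)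
    have hb: "h (x, b) \<in> h ` ?K" using x b by auto
    note B = cf_bilinear[OF g0_inner c P_subD[OF i x]]
    have "cf g0 c x (n *\<^sub>R b) (n *\<^sub>R b) = n * (n * cf g0 c x b b)"
      using B(3)[of n b "n *\<^sub>R b"] B(1)[of b "n *\<^sub>R b"] B(3)[of n b b] by simp
    then have "cf g0 c x a a = n\<^sup>2 * cf g0 c x b b"
      unfolding b(2)[symmetric] by (simp add: power2_eq_square)
    then have e: "cf g0 c x a a = n\<^sup>2 * h (x, b)" using heq[OF x] by simp
    have "m \<le> h (x, b)" "h (x, b) \<le> M" using m(2)[OF hb] M[OF hb] by auto
    moreover have "1 \<le> R * m" using R(1) m0 by (simp add: field_simps)
    moreover have "R * m \<le> R * h (x, b)" using calculation R(3) by (intro mult_left_mono) auto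
    ultimately have "1 \<le> R * h (x, b)" "h (x, b) \<le> R" using R by linarith+
    then have "n\<^sup>2 * 1 \<le> n\<^sup>2 * (R * h (x, b))" "n\<^sup>2 * h (x, b) \<le> n\<^sup>2 * R"
      using mult_left_mono[of 1 "R * h (x, b)" "n\<^sup>2"] mult_left_mono[of "h (x, b)" R "n\<^sup>2"] by simp_all
    moreover have "0 \<le> h (x, b)" using m0 \<open>m \<le> h (x, b)\<close> by simp
    ultimately show ?thesis unfolding e n_def[symmetric] by (simp add: mult_ac)
  qed
  then show ?thesis using R(3) by (intro exI[of _ R]) auto
qed

lemma g0_comparable:
  "\<exists>R\<ge>0. \<forall>c z r x a. (c, z, r) \<in> P \<longrightarrow> x \<in> bx z r \<longrightarrow>
     (norm a)\<^sup>2 \<le> R * cf g0 c x a a \<and> cf g0 c x a a \<le> R * (norm a)\<^sup>2"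
proof -
  define Z where "Z i R = (case i of (c, z, r) \<Rightarrow> \<forall>x\<in>bx z r. \<forall>a. 0 \<le> cf g0 c x a a \<and>
      (norm a)\<^sup>2 \<le> R * cf g0 c x a a \<and> cf g0 c x a a \<le> R * (norm a)\<^sup>2)" for i and R :: real
  have "\<exists>R\<ge>0. \<forall>i\<in>P. Z i R"
  proof (rule finite_uniform_bound[OF P_finite])
    show "\<exists>R\<ge>0. Z i R" if "i \<in> P" for i
      using g0_comparable_piece[of "fst i" "fst (snd i)" "snd (snd i)"] that
      unfolding Z_def by (simp add: case_prod_unfold)
  next
    fix i R R' assume a: "Z i R" and le: "R \<le> R'"
    obtain c z r where i: "i = (c, z, r)" by (cases i)
    have "(norm a)\<^sup>2 \<le> R' * cf g0 c x a a \<and> cf g0 c x a a \<le> R' * (norm a)\<^sup>2"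
      if "0 \<le> cf g0 c x a a" "(norm a)\<^sup>2 \<le> R * cf g0 c x a a" "cf g0 c x a a \<le> R * (norm a)\<^sup>2" for x a
      using that mult_right_mono[OF le that(1)] mult_right_mono[OF le zero_le_power2[of "norm a"]] by linarith
    then show "Z i R'" using a unfolding Z_def i prod.case by blast
  qed
  then obtain R where R: "R \<ge> 0" "\<And>i. i \<in> P \<Longrightarrow> Z i R" by blast
  show ?thesis
    by (rule exI[of _ R]) (use R in \<open>fastforce simp: Z_def\<close>)
qed

text \<open>The growth hypothesis is measured with the base metric; on the cubes that metric is
  comparable to the Euclidean norm, so the hypothesis becomes a bound on derivatives in
  coordinates.\<close>

lemma lr_growth:
  assumes e: "e > 0"
  shows "\<exists>C\<ge>0. \<forall>x\<in>carrier G. \<forall>c z r c' z' r' p a. (c, z, r) \<in> P \<longrightarrow> (c', z', r') \<in> P \<longrightarrow>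
     p \<in> overlap (\<alpha> x) (c, z, r) (c', z', r') \<longrightarrow>
     norm (fd (lr (\<alpha> x) c c') p a) \<le> C * exp (e * real (len x)) * norm a"
proof -
  from g0_growth[OF e] obtain C where C0: "C \<ge> 0" and C1: "\<forall>x\<in>carrier G. \<forall>p. \<forall>v\<in>tangent_space A p.
    g0 (\<alpha> x p) (differential A (\<alpha> x) p v) (differential A (\<alpha> x) p v) \<le> (C * exp (e * real (len x)))\<^sup>2 * g0 p v v"
    by (elim exE conjE)
  note C = C0 C1[rule_format]
  from g0_comparable obtain R where R0: "R \<ge> 0" and R1: "\<forall>c z r x a. (c, z, r) \<in> P \<longrightarrow> x \<in> bx z r \<longrightarrow>
     (norm a)\<^sup>2 \<le> R * cf g0 c x a a \<and> cf g0 c x a a \<le> R * (norm a)\<^sup>2"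
    by (elim exE conjE)
  note R = R0 R1[rule_format]
  have "norm (fd (lr (\<alpha> x) c c') p a) \<le> R * C * exp (e * real (len x)) * norm a"
    if x: "x \<in> carrier G" and i: "(c, z, r) \<in> P" and j: "(c', z', r') \<in> P"
      and p: "p \<in> overlap (\<alpha> x) (c, z, r) (c', z', r')" for x c z r c' z' r' p a
  proof (rule power2_le_imp_le)
    note c = P_chart[OF i] and c' = P_chart[OF j]
    let ?F = "lr (\<alpha> x) c c'" and ?q = "chart_inv c p" and ?E = "C * exp (e * real (len x))"
    have p': "p \<in> bx z r" "p \<in> lrdom (\<alpha> x) c c'" "?F p \<in> bx z' r'" using p by (auto simp: overlap_def)
    have q: "?q \<in> fst c" using chartD(5)[OF c P_subD[OF i p'(1)]] .
    have 1: "(norm (fd ?F p a))\<^sup>2 \<le> R * cf g0 c' (?F p) (fd ?F p a) (fd ?F p a)"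
      using R(2)[OF j p'(3)] by blast
    have "cf g0 c' (?F p) (fd ?F p a) (fd ?F p a) = cf (pull (\<alpha> x) g0) c p a a"
      using cf_pull[OF \<alpha>_C1[OF x] c c' p'(2)] by simp
    also have "\<dots> \<le> ?E\<^sup>2 * cf g0 c p a a"
      unfolding cf_def pull_def by (rule C(2)[OF x cv_tangent[OF c q]])
    also have "\<dots> \<le> ?E\<^sup>2 * (R * (norm a)\<^sup>2)"
      using R(2)[OF i p'(1), of a] by (intro mult_left_mono) auto
    finally have "(norm (fd ?F p a))\<^sup>2 \<le> R * (?E\<^sup>2 * (R * (norm a)\<^sup>2))"
      by (rule order_trans[OF 1 mult_left_mono[OF _ R(1)]])
    also have "\<dots> = (R * C * exp (e * real (len x)) * norm a)\<^sup>2" by (simp add: power_mult_distrib power2_eq_square)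
    finally show "(norm (fd ?F p a))\<^sup>2 \<le> (R * C * exp (e * real (len x)) * norm a)\<^sup>2" .
    show "0 \<le> R * C * exp (e * real (len x)) * norm a" using R(1) C(1) by simp
  qed
  then show ?thesis using R(1) C(1) by (intro exI[of _ "R * C"]) auto
qed

section \<open>Higher derivatives of the metrics \<open>u x\<close>\<close>

definition bnd :: "nat \<Rightarrow> 'g \<Rightarrow> real \<Rightarrow> bool" where
  "bnd j x b \<longleftrightarrow> (\<forall>c z r p. (c, z, r) \<in> P \<longrightarrow> p \<in> bx z r \<longrightarrow> (\<forall>a\<in>Basis. \<forall>a'\<in>Basis. \<forall>vs\<in>blists j.
     \<bar>dirs vs (\<lambda>y. cf (u x) c y a a') p\<bar> \<le> b))"

lemma bnd_mono: "bnd j x b \<Longrightarrow> b \<le> b' \<Longrightarrow> bnd j x b'"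
  unfolding bnd_def by (meson order_trans)

lemma bnd_exists:
  assumes x: "x \<in> carrier G" and j: "j \<le> k - 1" shows "\<exists>b\<ge>0. bnd j x b"
proof -
  define I where "I = P \<times> (Basis :: 'e set) \<times> (Basis :: 'e set) \<times> (blists j :: 'e list set)"
  define Z where "Z i R = (case i of ((c, z, r), a, a', vs) \<Rightarrow>
     \<forall>p\<in>bx z r. \<bar>dirs vs (\<lambda>y. cf (u x) c y a a') p\<bar> \<le> R)" for i :: "('m, 'e) piece \<times> 'e \<times> 'e \<times> 'e list" and R :: real
  have "\<exists>R\<ge>0. \<forall>i\<in>I. Z i R"
  proof (rule finite_uniform_bound)
    show "finite I" unfolding I_def by (intro finite_cartesian_product finite_Basis P_finite finite_blists)
    fix i assume "i \<in> I"
    then obtain c z r a a' vs where i: "i = ((c, z, r), a, a', vs)" "(c, z, r) \<in> P" "vs \<in> blists j"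
      by (auto simp: I_def)
    have "Ck_on 0 (snd c ` fst c) (dirs vs (\<lambda>y. cf (u x) c y a a'))"
      by (rule Ck_on_dirs[OF u_Ck[OF x P_chart[OF i(2)]]]) (use i j in \<open>auto simp: blists_def\<close>)
    from continuous_on_subset[OF Ck_on_continuous[OF this] P_sub[OF i(2)]]
    have "continuous_on (bx z r) (dirs vs (\<lambda>y. cf (u x) c y a a'))" .
    then have "bounded (dirs vs (\<lambda>y. cf (u x) c y a a') ` bx z r)"
      by (intro compact_imp_bounded compact_continuous_image compact_cbox)
    then obtain B where "B > 0" "\<forall>y\<in>dirs vs (\<lambda>y. cf (u x) c y a a') ` bx z r. norm y \<le> B"
      unfolding bounded_pos by blast
    then show "\<exists>R\<ge>0. Z i R" unfolding i Z_def prod.case by (intro exI[of _ B]) auto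
  next
    show "Z i R'" if "Z i R" "R \<le> R'" for i R R'
      using that unfolding Z_def by (cases i) (auto intro: order_trans)
  qed
  then obtain R where R: "R \<ge> 0" "\<And>i. i \<in> I \<Longrightarrow> Z i R" by blast
  have "bnd j x R"
    unfolding bnd_def
  proof (intro allI impI ballI)
    fix c z r p a a' vs
    assume "(c, z, r) \<in> P" and p: "p \<in> bx z r" and "(a::'e) \<in> Basis" "(a'::'e) \<in> Basis" "(vs::'e list) \<in> blists j"
    then have "((c, z, r), a, a', vs) \<in> I" by (simp add: I_def)
    from R(2)[OF this] p show "\<bar>dirs vs (\<lambda>y. cf (u x) c y a a') p\<bar> \<le> R" by (simp add: Z_def)
  qed
  then show ?thesis using R(1) by blast
qed

text \<open>The coefficients of \<open>u (x \<otimes> y)\<close> are those of \<open>u y\<close>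
  composed with a local representative and multiplied by two of its first derivatives. Derivatives
  of top order cost \<open>j\<close> more first derivatives, of subexponential size in
  \<open>x\<close>; everything else goes into a constant \<open>R\<close> depending on
  \<open>x\<close>, which \<open>subexp_blocks\<close> tolerates.\<close>

lemma bnd_step:
  assumes j: "j \<le> k - 1" and e: "e > 0"
  shows "\<exists>C. \<forall>x\<in>carrier G. \<exists>R. \<forall>y\<in>carrier G. \<forall>b b'. b \<ge> 0 \<longrightarrow> b' \<ge> 0 \<longrightarrow>
    bnd j y b \<longrightarrow> (\<forall>i<j. bnd i y b') \<longrightarrow> bnd j (x \<otimes> y) (C * exp (e * real (len x)) * b + R * b')"
proof -
  \<comment> \<open>The leading term is a product of \<open>j + 2\<close> first derivatives, which
    share the rate \<open>e\<close>.\<close>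
  define h where "h = e / real (j + 2)"
  have h: "h > 0" using e by (simp add: h_def)
  from lr_growth[OF h] obtain C where C0: "C \<ge> 0"
    and C1: "\<forall>x\<in>carrier G. \<forall>c z r c' z' r' p a. (c, z, r) \<in> P \<longrightarrow> (c', z', r') \<in> P \<longrightarrow>
     p \<in> overlap (\<alpha> x) (c, z, r) (c', z', r') \<longrightarrow>
     norm (fd (lr (\<alpha> x) c c') p a) \<le> C * exp (h * real (len x)) * norm a"
    by (elim exE conjE)
  note C = C0 C1[rule_format]
  let ?d = "real DIM('e)"
  have "\<exists>R. \<forall>y\<in>carrier G. \<forall>b b'. b \<ge> 0 \<longrightarrow> b' \<ge> 0 \<longrightarrow> bnd j y b \<longrightarrow> (\<forall>i<j. bnd i y b') \<longrightarrow>
      bnd j (x \<otimes> y) ((?d * C) ^ (j + 2) * exp (e * real (len x)) * b + R * b')"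
    if x: "x \<in> carrier G" for x
  proof -
    let ?f = "\<alpha> (inv x)"
    have ix: "inv x \<in> carrier G" using x by simp
    define \<beta> where "\<beta> = C * exp (h * real (len x))"
    have \<beta>: "\<beta> \<ge> 0" using C(1) by (simp add: \<beta>_def)
    define I where "I = P \<times> P \<times> (Basis :: 'e set) \<times> (Basis :: 'e set) \<times> (Basis :: 'e set) \<times> (Basis :: 'e set) \<times> (blists j :: 'e list set)"
    \<comment> \<open>Quantifying over all \<open>w\<close> before \<open>R\<close> is applied makes
      \<open>R\<close> depend on \<open>x\<close> but not on \<open>y\<close>.\<close>
    define Z where "Z i R = (case i of ((c, z, r), (c', z', r'), a, a', l, l', vs) \<Rightarrow>
      \<forall>w. Ck_on j (snd c' ` fst c') w \<longrightarrow> (\<forall>p\<in>overlap ?f (c, z, r) (c', z', r'). \<forall>b\<ge>0. \<forall>b'\<ge>0.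
       (\<forall>ws\<in>blists j. \<bar>dirs ws w (lr ?f c c' p)\<bar> \<le> b) \<longrightarrow>
       (\<forall>i<j. \<forall>ws\<in>blists i. \<bar>dirs ws w (lr ?f c c' p)\<bar> \<le> b') \<longrightarrow>
       \<bar>dirs vs (\<lambda>y. ((fd (lr ?f c c') y a \<bullet> l) * (fd (lr ?f c c') y a' \<bullet> l')) * w (lr ?f c c' y)) p\<bar>
         \<le> \<beta>\<^sup>2 * (\<beta> * ?d) ^ j * b + R * b'))"
      for i :: "('m, 'e) piece \<times> ('m, 'e) piece \<times> 'e \<times> 'e \<times> 'e \<times> 'e \<times> 'e list" and R :: real
    have "\<exists>R\<ge>0. \<forall>i\<in>I. Z i R"
    proof (rule finite_uniform_bound)
      show "finite I" unfolding I_def by (intro finite_cartesian_product finite_Basis P_finite finite_blists)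
      fix i assume "i \<in> I"
      then obtain c z r c' z' r' a a' l l' vs where i: "i = ((c, z, r), (c', z', r'), a, a', l, l', vs)"
        and P: "(c, z, r) \<in> P" "(c', z', r') \<in> P"
        and B: "a \<in> Basis" "a' \<in> Basis" "l \<in> Basis" "l' \<in> Basis" and vs: "vs \<in> blists j"
        by (auto simp: I_def)
      note c = P_chart[OF P(1)] P_chart[OF P(2)]
      let ?F = "lr ?f c c'" and ?U = "lrdom ?f c c'" and ?K = "overlap ?f (c, z, r) (c', z', r')"
      have U: "open ?U" by (rule open_lrdom[OF c Ck_map_cont[OF \<alpha>_Ck[OF ix]]])
      have F: "Ck_on k ?U ?F" by (rule Ck_map_lr[OF \<alpha>_Ck[OF ix] c])
      have Fj: "Ck_on (Suc j) ?U ?F" by (rule Ck_on_le[OF F]) (use j k2 in auto)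
      have dF: "Ck_on j ?U (\<lambda>y. fd ?F y a)" for a using Fj by simp
      have bd: "\<bar>fd ?F p b \<bullet> b'\<bar> \<le> \<beta>" if "p \<in> ?K" "b \<in> Basis" "b' \<in> Basis" for p b b'
      proof -
        have "\<bar>fd ?F p b \<bullet> b'\<bar> \<le> norm (fd ?F p b)" using Basis_le_norm[OF that(3)] .
        also have "\<dots> \<le> \<beta>" using C(2)[OF ix P that(1), of b] that(2) x by (simp add: \<beta>_def len_inv)
        finally show ?thesis .
      qed
      have "\<exists>R\<ge>0. \<forall>w. Ck_on j (snd c' ` fst c') w \<longrightarrow> (\<forall>p\<in>?K. \<forall>b\<ge>0. \<forall>b'\<ge>0.
       (\<forall>ws\<in>blists j. \<bar>dirs ws w (?F p)\<bar> \<le> b) \<longrightarrow>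
       (\<forall>i<j. \<forall>ws\<in>blists i. \<bar>dirs ws w (?F p)\<bar> \<le> b') \<longrightarrow>
       \<bar>dirs vs (\<lambda>y. ((fd ?F y a \<bullet> l) * (fd ?F y a' \<bullet> l')) * w (?F y)) p\<bar>
         \<le> \<beta>\<^sup>2 * (\<beta> * ?d) ^ j * b + R * b')"
      proof (rule dirs_symbol_bound[OF U chartD(2)[OF c(2)] Ck_on_Suc[OF Fj]])
        show "?F ` ?U \<subseteq> snd c' ` fst c'" using c by (auto simp: lrdom_iff)
        show "compact ?K" by (rule overlap_compact[OF P Ck_map_cont[OF \<alpha>_Ck[OF ix]]])
        show "?K \<subseteq> ?U" by (auto simp: overlap_def)
        show "Ck_on j ?U (\<lambda>y. (fd ?F y a \<bullet> l) * (fd ?F y a' \<bullet> l'))"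
          by (intro Ck_on_mult Ck_on_inner U dF)
        show "\<bar>(fd ?F p a \<bullet> l) * (fd ?F p a' \<bullet> l')\<bar> \<le> \<beta>\<^sup>2" if "p \<in> ?K" for p
          unfolding abs_mult power2_eq_square using bd[OF that] B \<beta> by (intro mult_mono) auto
      qed (use bd \<beta> vs in auto)
      then show "\<exists>R\<ge>0. Z i R" unfolding Z_def i prod.case .
    next
      fix i R R' assume Z: "Z i R" and le: "R \<le> R'"
      obtain c z r c' z' r' a a' l l' vs where i: "i = ((c, z, r), (c', z', r'), a, a', l, l', vs)"
        by (cases i) auto
      show "Z i R'"
        unfolding Z_def i prod.case
      proof (intro allI impI ballI)
        fix w p and b b' :: real
        assume *: "Ck_on j (snd c' ` fst c') w" "p \<in> overlap ?f (c, z, r) (c', z', r')" "0 \<le> b" "0 \<le> b'"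
          "\<forall>ws\<in>blists j. \<bar>dirs ws w (lr ?f c c' p)\<bar> \<le> b" "\<forall>i<j. \<forall>ws\<in>blists i. \<bar>dirs ws w (lr ?f c c' p)\<bar> \<le> b'"
        have "\<bar>dirs vs (\<lambda>y. ((fd (lr ?f c c') y a \<bullet> l) * (fd (lr ?f c c') y a' \<bullet> l')) * w (lr ?f c c' y)) p\<bar>
         \<le> \<beta>\<^sup>2 * (\<beta> * ?d) ^ j * b + R * b'"
          using Z * unfolding Z_def i prod.case by blast
        also have "\<dots> \<le> \<beta>\<^sup>2 * (\<beta> * ?d) ^ j * b + R' * b'"
          using mult_right_mono[OF le *(4)] by simp
        finally show "\<bar>dirs vs (\<lambda>y. ((fd (lr ?f c c') y a \<bullet> l) * (fd (lr ?f c c') y a' \<bullet> l')) * w (lr ?f c c' y)) p\<bar>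
         \<le> \<beta>\<^sup>2 * (\<beta> * ?d) ^ j * b + R' * b'" .
      qed
    qed
    then obtain R where R: "R \<ge> 0" "\<And>i. i \<in> I \<Longrightarrow> Z i R" by blast
    have "bnd j (x \<otimes> y) ((?d * C) ^ (j + 2) * exp (e * real (len x)) * b + (?d\<^sup>2 * R) * b')"
      if y: "y \<in> carrier G" and b: "b \<ge> 0" "b' \<ge> 0" "bnd j y b" "\<forall>i<j. bnd i y b'" for y b b'
      unfolding bnd_def
    proof (intro allI impI ballI)
      fix c z r p a a' vs
      assume P1: "(c, z, r) \<in> P" and p: "p \<in> bx z r" and B: "(a::'e) \<in> Basis" "(a'::'e) \<in> Basis"
        and vs: "(vs::'e list) \<in> blists j"
      obtain c' z' r' where P2: "(c', z', r') \<in> P" and pK: "p \<in> overlap ?f (c, z, r) (c', z', r')"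
        using overlap_exists[OF P1 p] by blast
      note c = P_chart[OF P1] P_chart[OF P2]
      let ?F = "lr ?f c c'" and ?U = "lrdom ?f c c'"
      have pU: "p \<in> ?U" and Fp: "?F p \<in> bx z' r'" using pK by (auto simp: overlap_def)
      have U: "open ?U" by (rule open_lrdom[OF c Ck_map_cont[OF \<alpha>_Ck[OF ix]]])
      define t where "t l l' = (\<lambda>q. ((fd ?F q a \<bullet> l) * (fd ?F q a' \<bullet> l')) * cf (u y) c' (?F q) l l')" for l l'
      have wC: "Ck_on j (snd c' ` fst c') (\<lambda>q. cf (u y) c' q l l')" for l l'
        by (rule Ck_on_le[OF u_Ck[OF y c(2)] j])
      have F: "Ck_on k ?U ?F" by (rule Ck_map_lr[OF \<alpha>_Ck[OF ix] c])
      have Fj: "Ck_on (Suc j) ?U ?F" by (rule Ck_on_le[OF F]) (use j k2 in auto)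
      have dF: "Ck_on j ?U (\<lambda>y. fd ?F y a)" for a using Fj by simp
      have im: "?F ` ?U \<subseteq> snd c' ` fst c'" using c by (auto simp: lrdom_iff)
      have tC: "Ck_on j ?U (t l l')" for l l'
        unfolding t_def
        by (intro Ck_on_mult Ck_on_inner U dF Ck_on_compose[OF U chartD(2)[OF c(2)] Ck_on_Suc[OF Fj] wC im])
      have "dirs vs (\<lambda>q. cf (u (x \<otimes> y)) c q a a') p = dirs vs (\<lambda>q. \<Sum>l\<in>Basis. \<Sum>l'\<in>Basis. t l l' q) p"
      proof (rule dirs_cong[OF U _ _ _ pU, symmetric])
        show "(\<Sum>l\<in>Basis. \<Sum>l'\<in>Basis. t l l' q) = cf (u (x \<otimes> y)) c q a a'" if q: "q \<in> ?U" for q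
        proof -
          have "?F q \<in> snd c' ` fst c'" using im q by blast
          then show ?thesis
            unfolding cf_u_mult[OF x y c q] t_def using cf_expand[OF u_inner[OF y] c(2)] by simp
        qed
        show "Ck_on j ?U (\<lambda>q. \<Sum>l\<in>Basis. \<Sum>l'\<in>Basis. t l l' q)"
          by (intro Ck_holder_on_sum U tC)
      qed (use vs in \<open>simp add: blists_def\<close>)
      also have "\<dots> = (\<Sum>l\<in>Basis. \<Sum>l'\<in>Basis. dirs vs (t l l') p)"
        using vs pU by (subst dirs_sum[OF U Ck_holder_on_sum[OF U tC]])
          (auto simp: blists_def intro!: sum.cong dirs_sum[OF U tC])
      finally have eq: "dirs vs (\<lambda>q. cf (u (x \<otimes> y)) c q a a') p = (\<Sum>l\<in>Basis. \<Sum>l'\<in>Basis. dirs vs (t l l') p)" .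
      have tb: "\<bar>dirs vs (t l l') p\<bar> \<le> \<beta>\<^sup>2 * (\<beta> * ?d) ^ j * b + R * b'" if l: "l \<in> Basis" "l' \<in> Basis" for l l'
      proof -
        have "((c, z, r), (c', z', r'), a, a', l, l', vs) \<in> I" using P1 P2 B l vs by (simp add: I_def)
        from R(2)[OF this] have Z: "\<forall>w. Ck_on j (snd c' ` fst c') w \<longrightarrow> (\<forall>p\<in>overlap ?f (c, z, r) (c', z', r'). \<forall>b\<ge>0. \<forall>b'\<ge>0.
       (\<forall>ws\<in>blists j. \<bar>dirs ws w (lr ?f c c' p)\<bar> \<le> b) \<longrightarrow>
       (\<forall>i<j. \<forall>ws\<in>blists i. \<bar>dirs ws w (lr ?f c c' p)\<bar> \<le> b') \<longrightarrow>
       \<bar>dirs vs (\<lambda>y. ((fd (lr ?f c c') y a \<bullet> l) * (fd (lr ?f c c') y a' \<bullet> l')) * w (lr ?f c c' y)) p\<bar>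
         \<le> \<beta>\<^sup>2 * (\<beta> * ?d) ^ j * b + R * b')" unfolding Z_def prod.case .
        have "\<forall>ws\<in>blists j. \<bar>dirs ws (\<lambda>q. cf (u y) c' q l l') (?F p)\<bar> \<le> b"
          using b(3) P2 Fp l unfolding bnd_def by blast
        moreover have "\<forall>i<j. \<forall>ws\<in>blists i. \<bar>dirs ws (\<lambda>q. cf (u y) c' q l l') (?F p)\<bar> \<le> b'"
          using b(4) P2 Fp l unfolding bnd_def by blast
        ultimately show ?thesis
          using Z[rule_format, OF wC[of l l'] pK b(1,2)] unfolding t_def by blast
      qed
      have "\<bar>dirs vs (\<lambda>q. cf (u (x \<otimes> y)) c q a a') p\<bar> \<le> (\<Sum>l\<in>Basis. \<Sum>l'\<in>Basis. \<bar>dirs vs (t l l') p\<bar>)"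
        unfolding eq by (rule order_trans[OF sum_abs]) (intro sum_mono sum_abs)
      also have "\<dots> \<le> (\<Sum>l\<in>(Basis::'e set). \<Sum>l'\<in>(Basis::'e set). \<beta>\<^sup>2 * (\<beta> * ?d) ^ j * b + R * b')"
        by (intro sum_mono tb)
      \<comment> \<open>Of the factors \<open>?d\<close>, two come from the sums over
        \<open>l\<close> and \<open>l'\<close>, and \<open>j\<close> from the symbol bound.\<close>
      also have "\<dots> = (?d * \<beta>) ^ (j + 2) * b + (?d\<^sup>2 * R) * b'"
        by (simp add: power_add power_mult_distrib power2_eq_square algebra_simps)
      also have "(?d * \<beta>) ^ (j + 2) = (?d * C) ^ (j + 2) * exp (h * real (len x)) ^ (j + 2)"
        unfolding \<beta>_def by (simp only: mult.assoc[symmetric] power_mult_distrib)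
      also have "exp (h * real (len x)) ^ (j + 2) = exp (e * real (len x))"
        unfolding exp_of_nat_mult[symmetric] by (simp add: h_def)
      finally show "\<bar>dirs vs (\<lambda>q. cf (u (x \<otimes> y)) c q a a') p\<bar>
        \<le> (?d * C) ^ (j + 2) * exp (e * real (len x)) * b + (?d\<^sup>2 * R) * b'" .
    qed
    then show ?thesis by blast
  qed
  then show ?thesis by blast
qed

text \<open>Strong induction on the order: the growth of all lower orders together is the hypothesis
  \<open>bndQ\<close> of \<open>subexp_blocks\<close>.\<close>

lemma bnd_growth:
  assumes "j \<le> k - 1" "e > 0"
  shows "\<exists>C. \<forall>x\<in>carrier G. bnd j x (C * exp (e * real (len x)))"
  using assms
proof (induction j arbitrary: e rule: less_induct)
  case (less j)
  show ?case
  proof (rule subexp_blocks[where bndQ = "\<lambda>x b. \<forall>i<j. bnd i x b"])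
    show "bnd j x b'" if "bnd j x b" "b \<le> b'" for x b b' using bnd_mono that .
    show "\<exists>b. bnd j \<one> b" using bnd_exists[of \<one> j] less.prems by auto
    show "\<forall>i<j. bnd i x b'" if "\<forall>i<j. bnd i x b" "b \<le> b'" for x b b' using bnd_mono that by blast
    show "e > 0" by fact
    show "\<exists>C. \<forall>x\<in>carrier G. \<exists>R. \<forall>y\<in>carrier G. \<forall>b b'. b \<ge> 0 \<longrightarrow> b' \<ge> 0 \<longrightarrow>
      bnd j y b \<longrightarrow> (\<forall>i<j. bnd i y b') \<longrightarrow> bnd j (x \<otimes> y) (C * exp (e * real (len x)) * b + R * b')"
      if "e > 0" for e by (rule bnd_step[OF less.prems(1) that])
    show "\<exists>C. \<forall>x\<in>carrier G. \<forall>i<j. bnd i x (C * exp (e * real (len x)))" if e: "e > 0" for e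
    proof -
      have "\<exists>C\<ge>0. \<forall>i\<in>{..<j}. \<forall>x\<in>carrier G. bnd i x (C * exp (e * real (len x)))"
      proof (rule finite_uniform_bound)
        fix i assume "i \<in> {..<j}"
        then obtain C where "\<forall>x\<in>carrier G. bnd i x (C * exp (e * real (len x)))"
          using less.IH[of i e] less.prems e by auto
        then have C: "bnd i x (C * exp (e * real (len x)))" if "x \<in> carrier G" for x using that by blast
        have "bnd i x (\<bar>C\<bar> * exp (e * real (len x)))" if "x \<in> carrier G" for x
          by (rule bnd_mono[OF C[OF that]]) (simp add: mult_right_mono)
        then show "\<exists>C\<ge>0. \<forall>x\<in>carrier G. bnd i x (C * exp (e * real (len x)))" by (intro exI[of _ "\<bar>C\<bar>"]) auto
      next
        fix i and R R' :: real
        assume R: "\<forall>x\<in>carrier G. bnd i x (R * exp (e * real (len x)))" and le: "R \<le> R'"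
        show "\<forall>x\<in>carrier G. bnd i x (R' * exp (e * real (len x)))"
        proof
          fix x assume "x \<in> carrier G"
          then have "bnd i x (R * exp (e * real (len x)))" using R by blast
          then show "bnd i x (R' * exp (e * real (len x)))"
            by (rule bnd_mono) (simp add: le mult_right_mono)
        qed
      qed simp
      then show ?thesis by blast
    qed
  qed
qed

end

section \<open>Interpolation between decay and growth\<close>

lemma fd_line:
  assumes "w differentiable at (x + t *\<^sub>R v)"
  shows "((\<lambda>t. w (x + t *\<^sub>R v)) has_real_derivative fd w (x + t *\<^sub>R v) v) (at t)"
proof -
  have "((\<lambda>t. x + t *\<^sub>R v) has_derivative (\<lambda>h. h *\<^sub>R v)) (at t)"
    by (auto intro!: derivative_eq_intros)
  from has_derivative_compose[OF this fd_works[OF assms]]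
  have "((\<lambda>t. w (x + t *\<^sub>R v)) has_derivative (\<lambda>h. fd w (x + t *\<^sub>R v) (h *\<^sub>R v))) (at t)" .
  moreover have "(\<lambda>h. fd w (x + t *\<^sub>R v) (h *\<^sub>R v)) = (\<lambda>h. fd w (x + t *\<^sub>R v) v * h)"
    using linear_scale[OF fd_linear[OF assms]] by (auto simp: fun_eq_iff mult.commute)
  ultimately show ?thesis by (simp add: has_field_derivative_def)
qed

text \<open>Landau's inequality: on a segment of length \<open>h\<close> some point has derivative
  at most \<open>2 * M / h\<close>, and the second derivative changes this by at most
  \<open>h * K\<close> on the way back to \<open>x\<close>.\<close>

lemma derivative_interpolation:
  fixes w :: "'a::euclidean_space \<Rightarrow> real"
  assumes w: "\<And>x. x \<in> bx z r \<Longrightarrow> w differentiable at x"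
    and w2: "\<And>x. x \<in> bx z r \<Longrightarrow> (\<lambda>y. fd w y b) differentiable at x"
    and b: "b \<in> Basis" and h: "0 < h" "h \<le> r"
    and bw: "\<And>x. x \<in> bx z r \<Longrightarrow> \<bar>w x\<bar> \<le> M"
    and bw2: "\<And>x. x \<in> bx z r \<Longrightarrow> \<bar>fd (\<lambda>y. fd w y b) x b\<bar> \<le> K"
    and x: "x \<in> bx z r"
  shows "\<bar>fd w x b\<bar> \<le> 2 * M / h + h * K"
proof -
  \<comment> \<open>The sense in which the segment from \<open>x\<close> heads for the centre in the
    direction \<open>b\<close>, so that it stays in the cube for all lengths up to
    \<open>r\<close>.\<close>
  define s where "s = (if (x - z) \<bullet> b \<le> 0 then 1 else -1 :: real)"
  have s: "\<bar>s\<bar> = 1" by (simp add: s_def)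
  have inb: "x + t *\<^sub>R (s *\<^sub>R b) \<in> bx z r" if t: "0 \<le> t" "t \<le> h" for t
    unfolding bx_iff
  proof
    fix i :: 'a assume i: "i \<in> Basis"
    have xi: "\<bar>(x - z) \<bullet> i\<bar> \<le> r" using x i by (simp add: bx_iff)
    have e: "(x + t *\<^sub>R (s *\<^sub>R b) - z) \<bullet> i = (x - z) \<bullet> i + t * s * (if i = b then 1 else 0)"
      using inner_Basis[OF b i] by (simp add: inner_diff_left inner_add_left)
    show "\<bar>(x + t *\<^sub>R (s *\<^sub>R b) - z) \<bullet> i\<bar> \<le> r"
    proof (cases "i = b")
      case True
      then show ?thesis unfolding e using xi t h by (auto simp: s_def abs_le_iff)
    next
      case False
      then show ?thesis unfolding e using xi by simp
    qed
  qed
  let ?l = "\<lambda>t. x + t *\<^sub>R (s *\<^sub>R b)"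
  have fs: "fd w y (s *\<^sub>R b) = s * fd w y b" if "y \<in> bx z r" for y
    using linear_scale[OF fd_linear[OF w[OF that]]] by simp
  have d1: "((\<lambda>t. w (?l t)) has_real_derivative s * fd w (?l t) b) (at t)" if "0 \<le> t" "t \<le> h" for t
    using fd_line[OF w[OF inb[OF that]]] fs[OF inb[OF that]] by simp
  obtain t where t: "0 < t" "t < h" "w (?l h) - w (?l 0) = (h - 0) * (s * fd w (?l t) b)"
    using MVT2[OF h(1) d1] by auto
  have "h * \<bar>fd w (?l t) b\<bar> = \<bar>w (?l h) - w (?l 0)\<bar>" using t(3) s h by (simp add: abs_mult)
  also have "\<dots> \<le> 2 * M" using bw[OF inb[of h]] bw[OF inb[of 0]] h by simp
  finally have 1: "\<bar>fd w (?l t) b\<bar> \<le> 2 * M / h" using h by (simp add: field_simps)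
  have fs2: "fd (\<lambda>y. fd w y b) y (s *\<^sub>R b) = s * fd (\<lambda>y. fd w y b) y b" if "y \<in> bx z r" for y
    using linear_scale[OF fd_linear[OF w2[OF that]]] by simp
  have d2: "((\<lambda>t. fd w (?l t) b) has_real_derivative s * fd (\<lambda>y. fd w y b) (?l t) b) (at t)"
    if "0 \<le> t" "t \<le> h" for t
    using fd_line[OF w2[OF inb[OF that]]] fs2[OF inb[OF that]] by simp
  obtain t' where t': "0 < t'" "t' < t"
    "fd w (?l t) b - fd w (?l 0) b = (t - 0) * (s * fd (\<lambda>y. fd w y b) (?l t') b)"
    using MVT2[OF t(1), of "\<lambda>t. fd w (?l t) b" "\<lambda>t. s * fd (\<lambda>y. fd w y b) (?l t) b"] d2 t(2) by auto
  have "\<bar>fd w (?l t) b - fd w x b\<bar> = t * \<bar>fd (\<lambda>y. fd w y b) (?l t') b\<bar>"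
    using t' t(1) s by (simp add: abs_mult)
  also have "\<dots> \<le> h * K"
    using bw2[OF inb[of t']] t t' h by (intro mult_mono) auto
  finally show ?thesis using 1 by linarith
qed

lemma bx_convex: "convex (bx z r)" by (rule convex_box)

lemma bx_lipschitz:
  fixes w :: "'a::euclidean_space \<Rightarrow> real" and K :: real
  assumes w: "\<And>x. x \<in> bx z r \<Longrightarrow> w differentiable at x"
    and K: "\<And>x b. x \<in> bx z r \<Longrightarrow> b \<in> Basis \<Longrightarrow> \<bar>fd w x b\<bar> \<le> K"
    and x: "x \<in> bx z r" and y: "y \<in> bx z r"
  shows "\<bar>w y - w x\<bar> \<le> K * (\<Sum>b\<in>Basis. \<bar>(y - x) \<bullet> b\<bar>)"
proof -
  have inb: "x + t *\<^sub>R (y - x) \<in> bx z r" if "0 \<le> t" "t \<le> 1" for t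
    using convexD_alt[OF bx_convex x y that] by (simp add: algebra_simps)
  have der: "((\<lambda>t. w (x + t *\<^sub>R (y - x))) has_real_derivative fd w (x + t *\<^sub>R (y - x)) (y - x)) (at t)"
    if "0 \<le> t" "t \<le> 1" for t by (rule fd_line[OF w[OF inb[OF that]]])
  from MVT2[OF zero_less_one der] obtain t where t: "0 < t" "t < 1"
    "w (x + 1 *\<^sub>R (y - x)) - w (x + 0 *\<^sub>R (y - x)) = (1 - 0) * fd w (x + t *\<^sub>R (y - x)) (y - x)"
    by blast
  let ?p = "x + t *\<^sub>R (y - x)"
  have p: "?p \<in> bx z r" using inb t by simp
  have "\<bar>w y - w x\<bar> = \<bar>\<Sum>b\<in>Basis. ((y - x) \<bullet> b) *\<^sub>R fd w ?p b\<bar>"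
    using t(3) fd_basis[OF w[OF p], of "y - x"] by simp
  also have "\<dots> \<le> (\<Sum>b\<in>Basis. \<bar>(y - x) \<bullet> b\<bar> * K)"
    by (rule order_trans[OF sum_abs]) (auto intro!: sum_mono mult_left_mono K p simp: abs_mult)
  also have "\<dots> = K * (\<Sum>b\<in>Basis. \<bar>(y - x) \<bullet> b\<bar>)" by (simp add: sum_distrib_left mult.commute)
  finally show ?thesis .
qed

lemma bx_lipschitz_norm:
  fixes w :: "'a::euclidean_space \<Rightarrow> real" and K :: real
  assumes w: "\<And>x. x \<in> bx z r \<Longrightarrow> w differentiable at x"
    and K: "\<And>x b. x \<in> bx z r \<Longrightarrow> b \<in> Basis \<Longrightarrow> \<bar>fd w x b\<bar> \<le> K" and K0: "K \<ge> 0"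
    and x: "x \<in> bx z r" and y: "y \<in> bx z r"
  shows "\<bar>w y - w x\<bar> \<le> DIM('a) * K * norm (y - x)"
proof -
  have "\<bar>w y - w x\<bar> \<le> K * (\<Sum>b\<in>Basis. \<bar>(y - x) \<bullet> b\<bar>)" by (rule bx_lipschitz[OF w K x y])
  also have "\<dots> \<le> K * (\<Sum>b\<in>(Basis::'a set). norm (y - x))"
    by (intro mult_left_mono sum_mono K0 Basis_le_norm)
  finally show ?thesis by (simp add: mult_ac)
qed

text \<open>With partial derivatives at most \<open>K\<close>, \<open>w\<close> keeps half of its
  size at \<open>x\<close> on a subcube of side \<open>\<rho>\<close> with vertex \<open>x\<close>;
  integrating the square over this subcube gives the estimate.\<close>

lemma sup_from_L2:
  fixes w :: "'a::euclidean_space \<Rightarrow> real" and K r \<eta> :: real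
  assumes w: "\<And>x. x \<in> bx z r \<Longrightarrow> w differentiable at x"
    and K: "\<And>x b. x \<in> bx z r \<Longrightarrow> b \<in> Basis \<Longrightarrow> \<bar>fd w x b\<bar> \<le> K" and K0: "K > 0"
    and x: "x \<in> bx z r" and r: "r > 0" and \<eta>: "\<eta> \<ge> 0"
    and L2: "(\<integral>\<^sup>+y. indicator (bx z r) y * ennreal ((w y)\<^sup>2) \<partial>lborel) \<le> ennreal \<eta>"
    and \<rho>: "\<rho> = min r (\<bar>w x\<bar> / (2 * DIM('a) * K))"
  shows "(\<bar>w x\<bar> / 2)\<^sup>2 * \<rho> ^ DIM('a) \<le> \<eta>"
proof -
  have \<rho>0: "\<rho> \<ge> 0" "\<rho> \<le> r" "DIM('a) * K * \<rho> \<le> \<bar>w x\<bar> / 2"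
  proof -
    show "\<rho> \<ge> 0" using r K0 by (simp add: \<rho>)
    show "\<rho> \<le> r" by (simp add: \<rho>)
    have "DIM('a) * K * \<rho> \<le> DIM('a) * K * (\<bar>w x\<bar> / (2 * DIM('a) * K))"
      using K0 by (intro mult_left_mono) (auto simp: \<rho>)
    then show "DIM('a) * K * \<rho> \<le> \<bar>w x\<bar> / 2" using K0 by (simp add: field_simps)
  qed
  \<comment> \<open>Lower corner of the subcube: in each coordinate the subcube extends from
    \<open>x\<close> towards the centre, hence stays in \<open>bx z r\<close>.\<close>
  define l where "l = (\<Sum>b\<in>Basis. (if (x - z) \<bullet> b \<le> 0 then x \<bullet> b else x \<bullet> b - \<rho>) *\<^sub>R b)"
  have l: "l \<bullet> b = (if (x - z) \<bullet> b \<le> 0 then x \<bullet> b else x \<bullet> b - \<rho>)" if "b \<in> Basis" for b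
    unfolding l_def using that by simp
  let ?Q = "cbox l (l + \<rho> *\<^sub>R One)"
  have Q: "y \<in> bx z r" "(\<Sum>b\<in>Basis. \<bar>(y - x) \<bullet> b\<bar>) \<le> DIM('a) * \<rho>" if y: "y \<in> ?Q" for y
  proof -
    have yb: "l \<bullet> b \<le> y \<bullet> b \<and> y \<bullet> b \<le> l \<bullet> b + \<rho>" if "b \<in> Basis" for b
      using y that by (auto simp: mem_box inner_add_left)
    have xb: "\<bar>(x - z) \<bullet> b\<bar> \<le> r" if "b \<in> Basis" for b using x that by (simp add: bx_iff)
    show "y \<in> bx z r"
      unfolding bx_iff
    proof
      fix b :: 'a assume b: "b \<in> Basis"
      show "\<bar>(y - z) \<bullet> b\<bar> \<le> r"
        using yb[OF b] xb[OF b] l[OF b] \<rho>0 by (auto simp: inner_diff_left abs_le_iff split: if_splits)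
    qed
    have "(\<Sum>b\<in>Basis. \<bar>(y - x) \<bullet> b\<bar>) \<le> (\<Sum>b\<in>(Basis::'a set). \<rho>)"
    proof (rule sum_mono)
      fix b :: 'a assume b: "b \<in> Basis"
      show "\<bar>(y - x) \<bullet> b\<bar> \<le> \<rho>"
        using yb[OF b] l[OF b] \<rho>0 by (auto simp: inner_diff_left abs_le_iff split: if_splits)
    qed
    then show "(\<Sum>b\<in>Basis. \<bar>(y - x) \<bullet> b\<bar>) \<le> DIM('a) * \<rho>" by simp
  qed
  have low: "(\<bar>w x\<bar> / 2)\<^sup>2 \<le> (w y)\<^sup>2" if y: "y \<in> ?Q" for y
  proof -
    have "\<bar>w y - w x\<bar> \<le> K * (\<Sum>b\<in>Basis. \<bar>(y - x) \<bullet> b\<bar>)" by (rule bx_lipschitz[OF w K x Q(1)[OF y]])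
    also have "\<dots> \<le> K * (DIM('a) * \<rho>)" using Q(2)[OF y] K0 by (intro mult_left_mono) auto
    also have "\<dots> \<le> \<bar>w x\<bar> / 2" using \<rho>0(3) by (simp add: mult_ac)
    finally have "\<bar>w x\<bar> / 2 \<le> \<bar>w y\<bar>" by linarith
    then have "(\<bar>w x\<bar> / 2)\<^sup>2 \<le> \<bar>w y\<bar>\<^sup>2" by (intro power_mono) auto
    then show ?thesis by simp
  qed
  have "ennreal ((\<bar>w x\<bar> / 2)\<^sup>2 * \<rho> ^ DIM('a)) = ennreal ((\<bar>w x\<bar> / 2)\<^sup>2) * emeasure lborel ?Q"
    using \<rho>0(1) by (subst emeasure_lborel_cbox) (auto simp: inner_add_left ennreal_mult)
  also have "\<dots> = (\<integral>\<^sup>+y. ennreal ((\<bar>w x\<bar> / 2)\<^sup>2) * indicator ?Q y \<partial>lborel)"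
    by (subst nn_integral_cmult_indicator) auto
  also have "\<dots> \<le> (\<integral>\<^sup>+y. indicator (bx z r) y * ennreal ((w y)\<^sup>2) \<partial>lborel)"
  proof (rule nn_integral_mono)
    fix y
    show "ennreal ((\<bar>w x\<bar> / 2)\<^sup>2) * indicator ?Q y \<le> indicator (bx z r) y * ennreal ((w y)\<^sup>2)"
    proof (cases "y \<in> ?Q")
      case True
      then show ?thesis using Q(1)[OF True] low[OF True] by (simp add: ennreal_leI del: power_divide)
    qed simp
  qed
  finally have "ennreal ((\<bar>w x\<bar> / 2)\<^sup>2 * \<rho> ^ DIM('a)) \<le> ennreal \<eta>" using L2 by (rule order_trans)
  then show ?thesis using \<eta> by simp
qed

section \<open>Exponential decay against subexponential growth\<close>

definition expdec :: "'a set \<Rightarrow> (nat \<Rightarrow> 'a \<Rightarrow> real) \<Rightarrow> bool" where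
  "expdec X f \<longleftrightarrow> (\<exists>C q. 0 \<le> C \<and> 0 < q \<and> q < 1 \<and> (\<forall>n. \<forall>x\<in>X. \<bar>f n x\<bar> \<le> C * q ^ n))"

definition subexp :: "'a set \<Rightarrow> (nat \<Rightarrow> 'a \<Rightarrow> real) \<Rightarrow> bool" where
  "subexp X f \<longleftrightarrow> (\<forall>e>0. \<exists>C\<ge>0. \<forall>n. \<forall>x\<in>X. \<bar>f n x\<bar> \<le> C * exp (e * real n))"

text \<open>Landau's inequality with a step that shrinks with \<open>n\<close>, but more slowly than
  the function does.\<close>

lemma expdec_derivative:
  fixes w :: "nat \<Rightarrow> 'a::euclidean_space \<Rightarrow> real"
  assumes w: "\<And>n x. x \<in> bx z r \<Longrightarrow> w n differentiable at x"
    and w2: "\<And>n x. x \<in> bx z r \<Longrightarrow> (\<lambda>y. fd (w n) y b) differentiable at x"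
    and b: "b \<in> Basis" and r: "r > 0"
    and dec: "expdec (bx z r) w" and sub: "subexp (bx z r) (\<lambda>n x. fd (\<lambda>y. fd (w n) y b) x b)"
  shows "expdec (bx z r) (\<lambda>n x. fd (w n) x b)"
proof -
  obtain C q where C: "0 \<le> C" "0 < q" "q < 1" "\<And>n x. x \<in> bx z r \<Longrightarrow> \<bar>w n x\<bar> \<le> C * q ^ n"
    using dec unfolding expdec_def by blast
  \<comment> \<open>With steps of size \<open>p ^ n\<close> the first term decays like
    \<open>q ^ n / p ^ n = p ^ n\<close>; if the second derivative grows like
    \<open>(1 / t) ^ n\<close>, the second term decays like
    \<open>p ^ n / t ^ n = t ^ n\<close>.\<close>
  define p where "p = sqrt q"
  define t where "t = sqrt p"
  have p: "0 < p" "p < 1" "p * p = q" using C by (auto simp: p_def)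
  have t: "0 < t" "t < 1" "t * t = p" using p by (auto simp: t_def)
  have pt: "p \<le> t" using t by (simp add: t(3)[symmetric] mult_le_cancel_left1)
  have lnt: "ln t < 0" using t by simp
  then obtain C' where C': "C' \<ge> 0" "\<And>n x. x \<in> bx z r \<Longrightarrow>
      \<bar>fd (\<lambda>y. fd (w n) y b) x b\<bar> \<le> C' * exp (- ln t * real n)"
    using sub unfolding subexp_def by (metis neg_0_less_iff_less)
  have et: "exp (- ln t * real n) = (1 / t) ^ n" for n
    using t by (simp add: exp_minus exp_of_nat2_mult inverse_eq_divide power_divide)
  have "\<bar>fd (w n) x b\<bar> \<le> (2 * C / r + r * C') * t ^ n" if x: "x \<in> bx z r" for n x
  proof -
    have "\<bar>fd (w n) x b\<bar> \<le> 2 * (C * q ^ n) / (r * p ^ n) + (r * p ^ n) * (C' * exp (- ln t * real n))"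
    proof (rule derivative_interpolation[OF w w2 b _ _ C(4) C'(2) x])
      show "0 < r * p ^ n" using r p by simp
      show "r * p ^ n \<le> r" using r p by (simp add: power_le_one mult_le_cancel_left2)
    qed
    also have "2 * (C * q ^ n) / (r * p ^ n) = 2 * C / r * p ^ n"
      using p r by (simp add: p(3)[symmetric] power_mult_distrib)
    also have "\<dots> \<le> 2 * C / r * t ^ n"
      using pt p C r by (intro mult_left_mono power_mono) auto
    also have "(r * p ^ n) * (C' * exp (- ln t * real n)) = r * C' * t ^ n"
      using t unfolding et by (simp add: t(3)[symmetric] power_mult_distrib power_divide)
    finally show ?thesis by (simp add: distrib_right)
  qed
  then show ?thesis unfolding expdec_def using C C' t r
    by (intro exI[of _ "2 * C / r + r * C'"] exI[of _ t]) auto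
qed

lemma expdec_from_L2:
  fixes w :: "nat \<Rightarrow> 'a::euclidean_space \<Rightarrow> real"
  assumes w: "\<And>n x. x \<in> bx z r \<Longrightarrow> w n differentiable at x" and r: "r > 0"
    and sub: "\<And>b. b \<in> Basis \<Longrightarrow> subexp (bx z r) (\<lambda>n x. fd (w n) x b)"
    and L2: "\<And>n. (\<integral>\<^sup>+y. indicator (bx z r) y * ennreal ((w n y)\<^sup>2) \<partial>lborel) \<le> ennreal (C * q ^ n)"
    and C: "C \<ge> 0" and q: "0 < q" "q < 1"
  shows "expdec (bx z r) w"
proof -
  let ?d = "DIM('a)"
  \<comment> \<open>The estimate will bound the power \<open>?d + 2\<close> of the values, and half
    of the decay is spent on the slopes; hence the root of order
    \<open>2 * (?d + 2)\<close>.\<close>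
  define p where "p = root (2 * (?d + 2)) q"
  have p: "0 < p" "p < 1" using q by (auto simp: p_def)
  have pq: "p ^ (2 * (?d + 2)) = q" unfolding p_def using q by (intro real_root_pow_pos2) auto
  \<comment> \<open>Slopes enter with the power \<open>?d\<close>; at this rate they use up exactly
    the square root of \<open>q ^ n\<close>.\<close>
  define e where "e = - ln q / (2 * ?d)"
  have e: "e > 0" using q by (simp add: e_def divide_neg_pos)
  have "\<exists>K\<ge>0. \<forall>b\<in>Basis. \<forall>n. \<forall>x\<in>bx z r. \<bar>fd (w n) x b\<bar> \<le> K * exp (e * real n)"
  proof (rule finite_uniform_bound[OF finite_Basis])
    show "\<exists>K\<ge>0. \<forall>n. \<forall>x\<in>bx z r. \<bar>fd (w n) x b\<bar> \<le> K * exp (e * real n)" if "b \<in> Basis" for b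
      using sub[OF that] e unfolding subexp_def by blast
    fix b :: 'a and R R' :: real
    assume *: "\<forall>n. \<forall>x\<in>bx z r. \<bar>fd (w n) x b\<bar> \<le> R * exp (e * real n)" and le: "R \<le> R'"
    show "\<forall>n. \<forall>x\<in>bx z r. \<bar>fd (w n) x b\<bar> \<le> R' * exp (e * real n)"
    proof (intro allI ballI)
      fix n x assume "x \<in> bx z r"
      then have "\<bar>fd (w n) x b\<bar> \<le> R * exp (e * real n)" using * by blast
      also have "\<dots> \<le> R' * exp (e * real n)" using le by (simp add: mult_right_mono)
      finally show "\<bar>fd (w n) x b\<bar> \<le> R' * exp (e * real n)" .
    qed
  qed
  then obtain K0 where K0: "K0 \<ge> 0" "\<And>b n x. b \<in> Basis \<Longrightarrow> x \<in> bx z r \<Longrightarrow> \<bar>fd (w n) x b\<bar> \<le> K0 * exp (e * real n)"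
    by blast
  \<comment> \<open>The 1 makes \<open>K\<close> positive, since it becomes a denominator.\<close>
  define K where "K = K0 + 1"
  have K: "K > 0" "\<And>b n x. b \<in> Basis \<Longrightarrow> x \<in> bx z r \<Longrightarrow> \<bar>fd (w n) x b\<bar> \<le> K * exp (e * real n)"
  proof -
    show "K > 0" using K0 by (simp add: K_def)
    fix b :: 'a and n x assume "b \<in> Basis" "x \<in> bx z r"
    from K0(2)[OF this, of n] show "\<bar>fd (w n) x b\<bar> \<le> K * exp (e * real n)"
      unfolding K_def distrib_right by (rule order_trans) simp
  qed
  define M1 where "M1 = 4 * C * (2 * ?d * K) ^ ?d"
  define M2 where "M2 = 4 * C / r ^ ?d"
  \<comment> \<open>At least 1, so that \<open>M1\<close> and \<open>M2\<close> are bounded by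
    powers of \<open>M\<close> and roots can be taken.\<close>
  define M where "M = 1 + M1 + M2"
  have M12: "M1 \<ge> 0" "M2 \<ge> 0" using C K r by (auto simp: M1_def M2_def)
  have M: "M \<ge> 1" "M1 \<le> M" "M2 \<le> M" using M12 by (auto simp: M_def)
  have "\<bar>w n x\<bar> \<le> M * p ^ n" if x: "x \<in> bx z r" for n x
  proof -
    define a where "a = \<bar>w n x\<bar>"
    define Kn where "Kn = K * exp (e * real n)"
    have Kn: "Kn > 0" using K by (simp add: Kn_def)
    define \<rho> where "\<rho> = min r (a / (2 * ?d * Kn))"
    have a0: "a \<ge> 0" by (simp add: a_def)
    have K2: "\<bar>fd (w n) x b\<bar> \<le> Kn" if "x \<in> bx z r" "b \<in> Basis" for x b
      unfolding Kn_def by (rule K(2)[OF that(2,1)])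
    have main: "(a / 2)\<^sup>2 * \<rho> ^ ?d \<le> C * q ^ n"
      unfolding a_def
    proof (rule sup_from_L2[where K = Kn, OF w K2 Kn x r])
      show "0 \<le> C * q ^ n" using C q by simp
      show "\<rho> = min r (\<bar>w n x\<bar> / (2 * ?d * Kn))" by (simp add: \<rho>_def a_def)
    qed (assumption | rule L2)+
    have pn: "p ^ n > 0" using p by simp
    have expd: "exp (e * real n) ^ ?d * q ^ n = (p ^ n) ^ (?d + 2)"
    proof -
      have "exp (e * real n) ^ ?d = exp (real ?d * (e * real n))" by (simp only: exp_of_nat_mult)
      also have "real ?d * (e * real n) = real n * (- ln q / 2)" by (simp add: e_def)
      also have "exp (real n * (- ln q / 2)) = exp (- ln q / 2) ^ n" by (rule exp_of_nat_mult)
      finally have "exp (e * real n) ^ ?d * q ^ n = (exp (- ln q / 2) * q) ^ n" by (simp add: power_mult_distrib)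
      also have "exp (- ln q / 2) * q = exp (ln q / 2)"
      proof -
        have "exp (- ln q / 2) * exp (ln q) = exp (ln q / 2)" by (simp add: exp_add[symmetric])
        then show ?thesis using q by simp
      qed
      also have "exp (ln q / 2) = p ^ (?d + 2)"
      proof (rule power2_eq_imp_eq)
        have "(exp (ln q / 2))\<^sup>2 = q" using q by (simp add: power2_eq_square exp_add[symmetric])
        moreover have "(p ^ (?d + 2))\<^sup>2 = p ^ (2 * (?d + 2))"
          unfolding power_mult[symmetric] by (simp only: mult.commute)
        ultimately show "(exp (ln q / 2))\<^sup>2 = (p ^ (?d + 2))\<^sup>2" using pq by (simp only:)
      qed (use p in auto)
      finally have "exp (e * real n) ^ ?d * q ^ n = (p ^ (?d + 2)) ^ n" .
      also have "\<dots> = (p ^ n) ^ (?d + 2)" unfolding power_mult[symmetric] by (simp only: mult.commute)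
      finally show ?thesis .
    qed
    have qp2: "q ^ n \<le> (p ^ n)\<^sup>2"
    proof -
      have "q \<le> p\<^sup>2" unfolding pq[symmetric] using p by (intro power_decreasing) auto
      then have "q ^ n \<le> (p\<^sup>2) ^ n" using q by (intro power_mono) auto
      then show ?thesis by (simp add: power_mult[symmetric] mult.commute)
    qed
    show ?thesis
    \<comment> \<open>Either the subcube has the full side \<open>r\<close> and the estimate is
      quadratic in \<open>a\<close>, or its side is proportional to \<open>a\<close> and the
      estimate has degree \<open>?d + 2\<close>.\<close>
    proof (cases "r \<le> a / (2 * ?d * Kn)")
      case True
      then have "\<rho> = r" by (simp add: \<rho>_def)
      then have "a\<^sup>2 \<le> M2 * q ^ n" using main r by (simp add: M2_def field_simps power2_eq_square)
      also have "\<dots> \<le> M\<^sup>2 * (p ^ n)\<^sup>2"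
      proof (intro mult_mono qp2)
        show "M2 \<le> M\<^sup>2" using M self_le_power[of M 2] by simp
      qed (use M q in auto)
      finally have "a\<^sup>2 \<le> (M * p ^ n)\<^sup>2" by (simp add: power_mult_distrib)
      then show ?thesis unfolding a_def[symmetric] by (rule power2_le_imp_le) (use M pn in auto)
    next
      case False
      then have "\<rho> = a / (2 * ?d * Kn)" by (simp add: \<rho>_def)
      then have "(a / 2)\<^sup>2 * (a ^ ?d / (2 * ?d * Kn) ^ ?d) \<le> C * q ^ n" using main by (simp only: power_divide)
      then have "a ^ (?d + 2) \<le> 4 * C * (2 * ?d * Kn) ^ ?d * q ^ n"
        using Kn by (simp add: field_simps power_add power2_eq_square)
      also have "\<dots> = M1 * (exp (e * real n) ^ ?d * q ^ n)"
        by (simp add: M1_def Kn_def power_mult_distrib mult_ac)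
      also have "\<dots> = M1 * (p ^ n) ^ (?d + 2)" by (simp only: expd)
      also have "\<dots> \<le> M ^ (?d + 2) * (p ^ n) ^ (?d + 2)"
      proof (rule mult_right_mono)
        show "M1 \<le> M ^ (?d + 2)" by (rule order_trans[OF M(2) self_le_power[OF M(1)]]) simp
      qed (use pn in simp)
      finally have "a ^ (?d + 2) \<le> (M * p ^ n) ^ (?d + 2)" by (simp only: power_mult_distrib)
      then show ?thesis unfolding a_def[symmetric]
        by (rule power_le_imp_le_base[of _ "?d + 1", unfolded Suc_eq_plus1 add.assoc one_add_one])
          (use M pn in auto)
    qed
  qed
  then show ?thesis unfolding expdec_def using p M by (intro exI[of _ M] exI[of _ p]) auto
qed

text \<open>Split the absolute difference into its powers \<open>1 - s\<close> and \<open>s\<close>;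
  bound the first by the decay of \<open>w\<close> and the second by the Lipschitz constants, whose
  growth is slower.\<close>

lemma expdec_holder:
  fixes w :: "nat \<Rightarrow> 'a::euclidean_space \<Rightarrow> real"
  assumes w: "\<And>n x. x \<in> bx z r \<Longrightarrow> w n differentiable at x"
    and dec: "expdec (bx z r) w" and sub: "\<And>b. b \<in> Basis \<Longrightarrow> subexp (bx z r) (\<lambda>n x. fd (w n) x b)"
    and s: "0 \<le> s" "s < 1"
  shows "\<exists>C q. 0 \<le> C \<and> 0 < q \<and> q < 1 \<and> (\<forall>n. \<forall>x\<in>bx z r. \<forall>y\<in>bx z r.
    \<bar>w n y - w n x\<bar> \<le> C * q ^ n * dist y x powr s)"
proof -
  obtain C q where C: "0 \<le> C" "0 < q" "q < 1" "\<And>n x. x \<in> bx z r \<Longrightarrow> \<bar>w n x\<bar> \<le> C * q ^ n"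
    using dec unfolding expdec_def by blast
  \<comment> \<open>The power \<open>s\<close> contributes growth at rate \<open>s * e\<close>, at
    most \<open>e\<close>, which is half of the decay rate \<open>- (1 - s) * ln q\<close> of the
    other power; the second half is left for \<open>p\<close>.\<close>
  define e where "e = - (1 - s) * ln q / 2"
  have e: "e > 0" using mult_neg_neg[of "s - 1" "ln q"] C s by (simp add: e_def)
  have "\<exists>K\<ge>0. \<forall>b\<in>Basis. \<forall>n. \<forall>x\<in>bx z r. \<bar>fd (w n) x b\<bar> \<le> K * exp (e * real n)"
  proof (rule finite_uniform_bound[OF finite_Basis])
    show "\<exists>K\<ge>0. \<forall>n. \<forall>x\<in>bx z r. \<bar>fd (w n) x b\<bar> \<le> K * exp (e * real n)" if "b \<in> Basis" for b
      using sub[OF that] e unfolding subexp_def by blast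
    fix b :: 'a and R R' :: real
    assume *: "\<forall>n. \<forall>x\<in>bx z r. \<bar>fd (w n) x b\<bar> \<le> R * exp (e * real n)" and le: "R \<le> R'"
    show "\<forall>n. \<forall>x\<in>bx z r. \<bar>fd (w n) x b\<bar> \<le> R' * exp (e * real n)"
    proof (intro allI ballI)
      fix n x assume "x \<in> bx z r"
      then have "\<bar>fd (w n) x b\<bar> \<le> R * exp (e * real n)" using * by blast
      also have "\<dots> \<le> R' * exp (e * real n)" using le by (simp add: mult_right_mono)
      finally show "\<bar>fd (w n) x b\<bar> \<le> R' * exp (e * real n)" .
    qed
  qed
  then obtain K where K: "K \<ge> 0" "\<And>b n x. b \<in> Basis \<Longrightarrow> x \<in> bx z r \<Longrightarrow> \<bar>fd (w n) x b\<bar> \<le> K * exp (e * real n)"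
    by blast
  define p where "p = q powr ((1 - s) / 2)"
  have p: "0 < p" "p < 1" using C s by (auto simp: p_def powr_def mult_pos_neg)
  define M where "M = (2 * C) powr (1 - s) * (DIM('a) * K) powr s"
  have "\<bar>w n y - w n x\<bar> \<le> M * p ^ n * dist y x powr s" if x: "x \<in> bx z r" and y: "y \<in> bx z r" for n x y
  proof (cases "w n y = w n x")
    case True
    then show ?thesis using p by (simp add: M_def)
  next
    case False
    define D where "D = \<bar>w n y - w n x\<bar>"
    have D: "D > 0" using False by (simp add: D_def)
    have D1: "D \<le> 2 * C * q ^ n" using C(4)[OF x, of n] C(4)[OF y, of n] unfolding D_def by linarith
    have K2: "\<bar>fd (w n) x b\<bar> \<le> K * exp (e * real n)" if "x \<in> bx z r" "b \<in> Basis" for x b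
      by (rule K(2)[OF that(2,1)])
    have D2: "D \<le> DIM('a) * K * exp (e * real n) * dist y x"
      using bx_lipschitz_norm[OF w K2 _ x y] K(1) by (simp add: D_def dist_norm mult.assoc)
    have "D = D powr (1 - s) * D powr s" using D by (simp add: powr_add[symmetric])
    also have "\<dots> \<le> (2 * C * q ^ n) powr (1 - s) * (DIM('a) * K * exp (e * real n) * dist y x) powr s"
      using D D1 D2 s by (intro mult_mono powr_mono2) auto
    also have "(2 * C * q ^ n) powr (1 - s) = (2 * C) powr (1 - s) * (q ^ n) powr (1 - s)"
      by (rule powr_mult)
    also have "(DIM('a) * K * exp (e * real n) * dist y x) powr s
        = (DIM('a) * K) powr s * exp (e * real n) powr s * dist y x powr s"
      using K by (simp add: powr_mult)
    also have "(q ^ n) powr (1 - s) * exp (e * real n) powr s \<le> p ^ n"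
    proof -
      have "(q ^ n) powr (1 - s) = exp (real n * ((1 - s) * ln q))"
        using C by (simp add: powr_def ln_realpow mult_ac)
      moreover have "exp (e * real n) powr s = exp (s * (e * real n))" by (simp add: powr_def)
      moreover have "p ^ n = exp (real n * ((1 - s) / 2 * ln q))"
      proof -
        have "p = exp ((1 - s) / 2 * ln q)" using C by (simp add: p_def powr_def)
        then show ?thesis by (simp only: exp_of_nat_mult)
      qed
      moreover have "real n * ((1 - s) * ln q) + s * (e * real n) \<le> real n * ((1 - s) / 2 * ln q)"
      proof -
        have "s * e \<le> 1 * e" using s e by (intro mult_right_mono) auto
        then have "(1 - s) * ln q + s * e \<le> (1 - s) / 2 * ln q" by (simp add: e_def field_simps)
        from mult_left_mono[OF this, of "real n"] show ?thesis by (simp add: algebra_simps)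
      qed
      ultimately show ?thesis by (simp add: exp_add[symmetric])
    qed
    then have "(2 * C) powr (1 - s) * (q ^ n) powr (1 - s)
       * ((DIM('a) * K) powr s * exp (e * real n) powr s * dist y x powr s) \<le> M * p ^ n * dist y x powr s"
    proof -
      have "(2 * C) powr (1 - s) * (q ^ n) powr (1 - s)
       * ((DIM('a) * K) powr s * exp (e * real n) powr s * dist y x powr s)
       = M * ((q ^ n) powr (1 - s) * exp (e * real n) powr s) * dist y x powr s"
        by (simp add: M_def mult_ac)
      also have "\<dots> \<le> M * p ^ n * dist y x powr s"
        using \<open>(q ^ n) powr (1 - s) * exp (e * real n) powr s \<le> p ^ n\<close>
        by (intro mult_right_mono mult_left_mono) (auto simp: M_def)
      finally show ?thesis .
    qed
    finally show ?thesis by (simp add: D_def)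
  qed
  then show ?thesis using p by (intro exI[of _ M] exI[of _ p]) (auto simp: M_def)
qed

lemma geometric_Cauchy:
  fixes a :: "nat \<Rightarrow> real"
  assumes C: "0 \<le> C" "0 < q" "q < 1" and d: "\<And>n. \<bar>a (Suc n) - a n\<bar> \<le> C * q ^ n"
  shows "\<exists>l. a \<longlonglongrightarrow> l \<and> (\<forall>n. \<bar>l - a n\<bar> \<le> C / (1 - q) * q ^ n)"
proof -
  have part: "\<bar>a (n + j) - a n\<bar> \<le> C / (1 - q) * q ^ n" for n j
  proof -
    have "a (n + j) - a n = (\<Sum>i<j. a (Suc (n + i)) - a (n + i))"
      by (induction j) auto
    then have "\<bar>a (n + j) - a n\<bar> \<le> (\<Sum>i<j. \<bar>a (Suc (n + i)) - a (n + i)\<bar>)" by simp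
    also have "\<dots> \<le> (\<Sum>i<j. C * q ^ (n + i))" by (intro sum_mono d)
    also have "\<dots> = C * q ^ n * (\<Sum>i<j. q ^ i)" by (simp add: sum_distrib_left power_add mult_ac)
    also have "\<dots> \<le> C * q ^ n * (1 / (1 - q))"
    proof (intro mult_left_mono)
      have "(\<Sum>i<j. q ^ i) = (1 - q ^ j) / (1 - q)" using C by (simp add: sum_gp_strict)
      also have "\<dots> \<le> 1 / (1 - q)" using C by (intro divide_right_mono) auto
      finally show "(\<Sum>i<j. q ^ i) \<le> 1 / (1 - q)" .
    qed (use C in auto)
    finally show ?thesis by simp
  qed
  have lim0: "(\<lambda>n. C / (1 - q) * q ^ n) \<longlonglongrightarrow> 0"
    using C by (intro tendsto_mult_right_zero LIMSEQ_power_zero) auto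
  have "Cauchy a"
  proof (rule CauchyI')
    fix e :: real assume "e > 0"
    then obtain N where N: "C / (1 - q) * q ^ N < e"
      using order_tendstoD(2)[OF lim0, of e] by (auto simp: eventually_sequentially)
    show "\<exists>M. \<forall>m\<ge>M. \<forall>n>m. dist (a m) (a n) < e"
    proof (intro exI[of _ N] allI impI)
      fix m n assume mn: "m \<ge> N" "n > m"
      have "\<bar>a (m + (n - m)) - a m\<bar> \<le> C / (1 - q) * q ^ m" by (rule part)
      also have "\<dots> \<le> C / (1 - q) * q ^ N" using C mn by (intro mult_left_mono power_decreasing) auto
      finally show "dist (a m) (a n) < e" using N mn by (simp add: dist_real_def abs_minus_commute)
    qed
  qed
  then obtain l where l: "a \<longlonglongrightarrow> l" using convergent_eq_Cauchy by (metis Cauchy_convergent_iff convergent_def)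
  have "\<bar>l - a n\<bar> \<le> C / (1 - q) * q ^ n" for n
  proof (rule LIMSEQ_le_const2)
    show "(\<lambda>j. \<bar>a (n + j) - a n\<bar>) \<longlonglongrightarrow> \<bar>l - a n\<bar>"
      using LIMSEQ_ignore_initial_segment[OF l, of n] by (intro tendsto_intros) (simp add: add.commute)
  qed (use part in blast)
  then show ?thesis using l by blast
qed

section \<open>Regularity of limits\<close>

definition holder_bound :: "'a::metric_space set \<Rightarrow> real \<Rightarrow> real \<Rightarrow> ('a \<Rightarrow> real) \<Rightarrow> bool" where
  "holder_bound V s C f \<longleftrightarrow> (\<forall>x\<in>V. \<forall>y\<in>V. \<bar>f y - f x\<bar> \<le> C * dist y x powr s)"

text \<open>Induction on the order: the basis derivatives converge geometrically, hence uniformly,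
  so their limits are the derivatives of \<open>g\<close>, and they satisfy the same hypotheses one
  order lower. At order zero the Hoelder constants of the increments form a geometric series on top
  of that of \<open>f 0\<close>.\<close>

lemma Ck_holder_on_limit:
  fixes f :: "nat \<Rightarrow> 'a::euclidean_space \<Rightarrow> real"
  assumes V: "open V" "convex V" "V \<noteq> {}"
    and fC: "\<And>n. Ck_on m V (f n)"
    and dec: "\<And>i vs. i \<le> m \<Longrightarrow> vs \<in> blists i \<Longrightarrow> expdec V (\<lambda>n x. dirs vs (f (Suc n)) x - dirs vs (f n) x)"
    and hol: "\<And>vs. vs \<in> blists m \<Longrightarrow> \<exists>C q. 0 \<le> C \<and> 0 < q \<and> q < 1 \<and>
       (\<forall>n. holder_bound V s (C * q ^ n) (\<lambda>x. dirs vs (f (Suc n)) x - dirs vs (f n) x))"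
    and hol0: "\<And>vs. vs \<in> blists m \<Longrightarrow> \<exists>C. holder_bound V s C (dirs vs (f 0))"
    and lim: "\<And>x. x \<in> V \<Longrightarrow> (\<lambda>n. f n x) \<longlonglongrightarrow> g x"
  shows "Ck_holder_on m s V g"
  using fC dec hol hol0 lim
proof (induction m arbitrary: f g)
  case 0
  have nil: "[] \<in> blists 0" by (simp add: blists_def)
  obtain C q where C: "0 \<le> C" "0 < q" "q < 1" "\<And>n x. x \<in> V \<Longrightarrow> \<bar>f (Suc n) x - f n x\<bar> \<le> C * q ^ n"
    using "0.prems"(2)[OF le_refl nil] unfolding expdec_def by auto
  have close: "\<bar>g x - f n x\<bar> \<le> C / (1 - q) * q ^ n" if "x \<in> V" for x n
    using geometric_Cauchy[OF C(1-3), of "\<lambda>n. f n x"] C(4)[OF that] "0.prems"(5)[OF that] LIMSEQ_unique by blast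
  have lim0: "(\<lambda>n. C / (1 - q) * q ^ n) \<longlonglongrightarrow> 0"
    using C by (intro tendsto_mult_right_zero LIMSEQ_power_zero) auto
  have "uniform_limit V f g sequentially"
  proof (rule uniform_limitI)
    fix e :: real assume "e > 0"
    then have "\<forall>\<^sub>F n in sequentially. C / (1 - q) * q ^ n < e" using order_tendstoD(2)[OF lim0] by blast
    then show "\<forall>\<^sub>F n in sequentially. \<forall>x\<in>V. dist (f n x) (g x) < e"
    proof eventually_elim
      case (elim n)
      then show ?case using close le_less_trans by (fastforce simp: dist_real_def abs_minus_commute)
    qed
  qed
  then have cont: "continuous_on V g"
    by (rule uniform_limit_theorem[rotated]) (use "0.prems"(1) in auto)
  obtain C' q' where C': "0 \<le> C'" "0 < q'" "q' < 1"
    "\<And>n x y. x \<in> V \<Longrightarrow> y \<in> V \<Longrightarrow> \<bar>f (Suc n) y - f n y - (f (Suc n) x - f n x)\<bar> \<le> C' * q' ^ n * dist y x powr s"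
    using "0.prems"(3)[OF nil] unfolding holder_bound_def by auto
  obtain C0 where C0: "\<And>x y. x \<in> V \<Longrightarrow> y \<in> V \<Longrightarrow> \<bar>f 0 y - f 0 x\<bar> \<le> C0 * dist y x powr s"
    using "0.prems"(4)[OF nil] unfolding holder_bound_def by auto
  have hg: "\<bar>g y - g x\<bar> \<le> (C0 + C' / (1 - q')) * dist y x powr s" if xy: "x \<in> V" "y \<in> V" for x y
  proof -
    define a where "a n = f n y - f n x" for n
    have "\<bar>a (Suc n) - a n\<bar> \<le> (C' * dist y x powr s) * q' ^ n" for n
      using C'(4)[OF xy, of n] by (simp add: a_def algebra_simps)
    from geometric_Cauchy[OF _ C'(2,3) this] C'(1) obtain l
      where l0: "a \<longlonglongrightarrow> l" "\<forall>n. \<bar>l - a n\<bar> \<le> C' * dist y x powr s / (1 - q') * q' ^ n" by auto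
    then have l: "a \<longlonglongrightarrow> l" "\<bar>l - a 0\<bar> \<le> C' * dist y x powr s / (1 - q') * q' ^ 0" by blast+
    have "a \<longlonglongrightarrow> g y - g x" unfolding a_def using "0.prems"(5) xy by (intro tendsto_diff) auto
    then have "l = g y - g x" using l(1) LIMSEQ_unique by blast
    then have "\<bar>g y - g x\<bar> \<le> \<bar>a 0\<bar> + C' * dist y x powr s / (1 - q')" using l(2) by simp
    also have "\<bar>a 0\<bar> \<le> C0 * dist y x powr s" using C0[OF xy] by (simp add: a_def)
    finally show ?thesis by (simp add: distrib_right)
  qed
  show ?case
    unfolding Ck_holder_on.simps
  proof (intro conjI cont impI ballI)
    fix x assume "x \<in> V"
    show "\<exists>e>0. \<exists>C. \<forall>y\<in>V \<inter> ball x e. \<forall>z\<in>V \<inter> ball x e. norm (g y - g z) \<le> C * dist y z powr s"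
      using hg by (intro exI[of _ 1] conjI exI[of _ "C0 + C' / (1 - q')"]) auto
  qed
next
  case (Suc m)
  have fd': "f n differentiable at x" if "x \<in> V" for n x using Suc.prems(1)[of n] that by simp
  have one: "[b] \<in> blists 1" if "b \<in> Basis" for b :: 'a using that by (simp add: blists_def)
  have cons: "b # vs \<in> blists (Suc i)" if "b \<in> Basis" "vs \<in> blists i" for b :: 'a and vs i
    using that by (simp add: blists_def)
  \<comment> \<open>Constant and rate are paired so that one choice yields both as functions of the
    direction.\<close>
  have "\<exists>Cq. 0 \<le> fst Cq \<and> 0 < snd Cq \<and> snd Cq < 1 \<and>
      (\<forall>n. \<forall>x\<in>V. \<bar>fd (f (Suc n)) x b - fd (f n) x b\<bar> \<le> fst Cq * snd Cq ^ n)" if "b \<in> Basis" for b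
    using Suc.prems(2)[OF _ one[OF that]] unfolding expdec_def by (auto simp: dirs.simps)
  then obtain Cq where Cq0: "\<forall>b\<in>Basis. 0 \<le> fst (Cq b) \<and> 0 < snd (Cq b) \<and> snd (Cq b) < 1 \<and>
      (\<forall>n. \<forall>x\<in>V. \<bar>fd (f (Suc n)) x b - fd (f n) x b\<bar> \<le> fst (Cq b) * snd (Cq b) ^ n)"
    using bchoice[of Basis "\<lambda>b Cq. 0 \<le> fst Cq \<and> 0 < snd Cq \<and> snd Cq < 1 \<and>
      (\<forall>n. \<forall>x\<in>V. \<bar>fd (f (Suc n)) x b - fd (f n) x b\<bar> \<le> fst Cq * snd Cq ^ n)"] by blast
  define C q where "C b = fst (Cq b)" and "q b = snd (Cq b)" for b
  have Cq: "0 \<le> C b" "0 < q b" "q b < 1"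
     "\<And>n x. x \<in> V \<Longrightarrow> \<bar>fd (f (Suc n)) x b - fd (f n) x b\<bar> \<le> C b * q b ^ n" if "b \<in> Basis" for b
    using Cq0 that unfolding C_def q_def by auto
  define h where "h b x = lim (\<lambda>n. fd (f n) x b)" for b x
  have h: "(\<lambda>n. fd (f n) x b) \<longlonglongrightarrow> h b x" "\<bar>h b x - fd (f n) x b\<bar> \<le> C b / (1 - q b) * q b ^ n"
    if b: "b \<in> Basis" and x: "x \<in> V" for b x n
  proof -
    obtain l where l: "(\<lambda>n. fd (f n) x b) \<longlonglongrightarrow> l" "\<And>n. \<bar>l - fd (f n) x b\<bar> \<le> C b / (1 - q b) * q b ^ n"
      using geometric_Cauchy[OF Cq(1-3)[OF b], of "\<lambda>n. fd (f n) x b"] Cq(4)[OF b x] by blast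
    moreover have "h b x = l" unfolding h_def using l(1) by (rule limI)
    ultimately show "(\<lambda>n. fd (f n) x b) \<longlonglongrightarrow> h b x" "\<bar>h b x - fd (f n) x b\<bar> \<le> C b / (1 - q b) * q b ^ n" by auto
  qed
  have hC: "Ck_holder_on m s V (h b)" if b: "b \<in> Basis" for b
  proof (rule Suc.IH[of "\<lambda>n x. fd (f n) x b"])
    show "Ck_on m V (\<lambda>x. fd (f n) x b)" for n using Suc.prems(1)[of n] by simp
    show "expdec V (\<lambda>n x. dirs vs (\<lambda>x. fd (f (Suc n)) x b) x - dirs vs (\<lambda>x. fd (f n) x b) x)"
      if "i \<le> m" "vs \<in> blists i" for i vs
      using Suc.prems(2)[OF _ cons[OF b that(2)]] that(1) by simp
    show "\<exists>C q. 0 \<le> C \<and> 0 < q \<and> q < 1 \<and> (\<forall>n. holder_bound V s (C * q ^ n)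
        (\<lambda>x. dirs vs (\<lambda>x. fd (f (Suc n)) x b) x - dirs vs (\<lambda>x. fd (f n) x b) x))" if "vs \<in> blists m" for vs
      using Suc.prems(3)[OF cons[OF b that]] by simp
    show "\<exists>C. holder_bound V s C (dirs vs (\<lambda>x. fd (f 0) x b))" if "vs \<in> blists m" for vs
      using Suc.prems(4)[OF cons[OF b that]] by simp
    show "(\<lambda>n. fd (f n) x b) \<longlonglongrightarrow> h b x" if "x \<in> V" for x using h(1)[OF b that] .
  qed
  define g' where "g' x v = (\<Sum>b\<in>Basis. (v \<bullet> b) * h b x)" for x v
  have lim0: "(\<lambda>n. \<Sum>b\<in>Basis. C b / (1 - q b) * q b ^ n) \<longlonglongrightarrow> (\<Sum>b\<in>(Basis::'a set). 0)"
  proof (intro tendsto_sum tendsto_mult_right_zero LIMSEQ_power_zero)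
    show "norm (q b) < 1" if "b \<in> Basis" for b using Cq(2,3)[OF that] by simp
  qed
  obtain x0 where x0: "x0 \<in> V" using V(3) by blast
  have "\<exists>G. \<forall>x\<in>V. (\<lambda>n. f n x) \<longlonglongrightarrow> G x \<and> (G has_derivative g' x) (at x within V)"
  proof (rule has_derivative_sequence[where f = f and f' = "\<lambda>n. fd (f n)", OF V(2) _ _ x0 Suc.prems(5)[OF x0]])
    show "(f n has_derivative fd (f n) x) (at x within V)" if "x \<in> V" for n x
      using fd_works[OF fd'[OF that]] has_derivative_at_withinI by blast
    fix e :: real assume "e > 0"
    then have "\<forall>\<^sub>F n in sequentially. (\<Sum>b\<in>(Basis::'a set). C b / (1 - q b) * q b ^ n) < e"
      using order_tendstoD(2)[OF lim0] by simp
    then show "\<forall>\<^sub>F n in sequentially. \<forall>x\<in>V. \<forall>v. norm (fd (f n) x v - g' x v) \<le> e * norm v"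
    proof eventually_elim
      case (elim n)
      show ?case
      proof (intro ballI allI)
        fix x v assume x: "x \<in> V"
        have "fd (f n) x v - g' x v = (\<Sum>b\<in>Basis. (v \<bullet> b) * (fd (f n) x b - h b x))"
          using fd_basis[OF fd'[OF x], of n v] by (simp add: g'_def sum_subtractf right_diff_distrib)
        then have "norm (fd (f n) x v - g' x v) \<le> (\<Sum>b\<in>Basis. \<bar>v \<bullet> b\<bar> * \<bar>fd (f n) x b - h b x\<bar>)"
          using sum_abs[of "\<lambda>b. (v \<bullet> b) * (fd (f n) x b - h b x)" Basis] by (simp add: abs_mult)
        also have "\<dots> \<le> (\<Sum>b\<in>Basis. norm v * (C b / (1 - q b) * q b ^ n))"
          using h(2)[OF _ x] by (intro sum_mono mult_mono Basis_le_norm) (auto simp: abs_minus_commute)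
        also have "\<dots> = norm v * (\<Sum>b\<in>(Basis::'a set). C b / (1 - q b) * q b ^ n)" by (simp add: sum_distrib_left)
        also have "\<dots> \<le> norm v * e" using elim by (intro mult_left_mono) auto
        finally show "norm (fd (f n) x v - g' x v) \<le> e * norm v" by (simp add: mult.commute)
      qed
    qed
  qed
  then obtain G where G: "\<And>x. x \<in> V \<Longrightarrow> (\<lambda>n. f n x) \<longlonglongrightarrow> G x"
    "\<And>x. x \<in> V \<Longrightarrow> (G has_derivative g' x) (at x within V)" by blast
  have Gg: "G x = g x" if "x \<in> V" for x using G(1)[OF that] Suc.prems(5)[OF that] LIMSEQ_unique by blast
  have der: "(g has_derivative g' x) (at x)" if x: "x \<in> V" for x
  proof -
    have "(G has_derivative g' x) (at x)" using G(2)[OF x] unfolding at_within_open[OF x V(1)] .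
    then show ?thesis by (rule has_derivative_transform_within_open[OF _ V(1) x]) (rule Gg)
  qed
  show ?case
  proof (rule Ck_holder_on_SucI_Basis[OF V(1)])
    show "g differentiable at x" if "x \<in> V" for x by (rule differentiableI[OF der[OF that]])
    show "Ck_holder_on m s V (\<lambda>x. fd g x b)" if b: "b \<in> Basis" for b
    proof (rule Ck_holder_on_cong[OF V(1) _ hC[OF b]])
      fix x assume "x \<in> V"
      have "(\<Sum>b'\<in>Basis. (b \<bullet> b') * h b' x) = h b x"
        using b by (subst sum.mono_neutral_cong_right[of Basis "{b}" _ "\<lambda>b'. h b' x"])
          (auto simp: inner_Basis)
      then show "h b x = fd g x b" using fd_eqI[OF der[OF \<open>x \<in> V\<close>]] by (simp add: g'_def)
    qed
  qed
qed

section \<open>The L2 form on the span of the translated metrics\<close>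

context maction
begin

text \<open>The field with coefficients \<open>d\<close> on the orbit of the base metric. The signs
  are arbitrary, so it need not be a metric.\<close>

definition fcomb :: "('g \<Rightarrow> real) \<Rightarrow> ('m, 'e) metric_field" where
  "fcomb d = (\<lambda>p v w. \<Sum>x\<in>{x. d x \<noteq> 0}. d x * u x p v w)"

lemma fcomb_superset:
  assumes "finite F" "{x. d x \<noteq> 0} \<subseteq> F" shows "fcomb d p v w = (\<Sum>x\<in>F. d x * u x p v w)"
  unfolding fcomb_def using assms by (intro sum.mono_neutral_left) auto

lemma fcomb_add:
  assumes "fsupp (carrier G) c" "fsupp (carrier G) e"
  shows "fcomb (c + e) p v w = fcomb c p v w + fcomb e p v w"
proof -
  let ?F = "{x. c x \<noteq> 0} \<union> {x. e x \<noteq> 0}"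
  have F: "finite ?F" using assms by (auto simp: fsupp_def)
  have s: "{x. (c + e) x \<noteq> 0} \<subseteq> ?F" by auto
  show ?thesis
    unfolding fcomb_superset[OF F s] fcomb_superset[OF F Un_upper1] fcomb_superset[OF F Un_upper2]
    by (simp add: sum.distrib distrib_right)
qed

lemma fcomb_scale:
  assumes "fsupp (carrier G) c" shows "fcomb (\<lambda>x. r * c x) p v w = r * fcomb c p v w"
proof -
  let ?F = "{x. c x \<noteq> 0}"
  have F: "finite ?F" using assms by (auto simp: fsupp_def)
  have s: "{x. r * c x \<noteq> 0} \<subseteq> ?F" by auto
  show ?thesis
    unfolding fcomb_superset[OF F s] fcomb_superset[OF F subset_refl]
    by (simp add: sum_distrib_left mult.assoc)
qed

lemma fcomb_diff:
  assumes c: "fsupp (carrier G) c" and e: "fsupp (carrier G) e"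
  shows "fcomb (c - e) p v w = fcomb c p v w - fcomb e p v w"
proof -
  have eq: "c - e = c + (\<lambda>x. (-1) * e x)" by (auto simp: fun_eq_iff)
  show ?thesis unfolding eq fcomb_add[OF c fsupp_mult[OF e]] fcomb_scale[OF e] by simp
qed

text \<open>Reindexing the sum by \<open>x \<otimes> y\<close> and using \<open>u_mult\<close>:
  \<open>fcomb\<close> intertwines translation of coefficients with pull-back of fields.\<close>

lemma fcomb_translate:
  assumes d: "fsupp (carrier G) d" and x: "x \<in> carrier G"
    and v: "v \<in> tangent_space A p" "w \<in> tangent_space A p"
  shows "fcomb (translate G x d) p v w = pull (\<alpha> (inv x)) (fcomb d) p v w"
proof -
  let ?D = "{y. d y \<noteq> 0}"
  have D: "finite ?D" "?D \<subseteq> carrier G" using d by (auto simp: fsupp_def)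
  have s: "{y. translate G x d y \<noteq> 0} \<subseteq> (\<lambda>y. x \<otimes> y) ` ?D"
  proof
    fix y assume "y \<in> {y. translate G x d y \<noteq> 0}"
    then have y: "y \<in> carrier G" "d (inv x \<otimes> y) \<noteq> 0" by (auto simp: translate_def split: if_splits)
    then have "y = x \<otimes> (inv x \<otimes> y)" using x by (simp add: m_assoc[symmetric])
    then show "y \<in> (\<lambda>y. x \<otimes> y) ` ?D" using y by blast
  qed
  have inj: "inj_on (\<lambda>y. x \<otimes> y) ?D" using inj_on_subset[OF inj_on_cmult[OF x] D(2)] .
  have "fcomb (translate G x d) p v w = (\<Sum>y\<in>(\<lambda>y. x \<otimes> y) ` ?D. translate G x d y * u y p v w)"
    by (rule fcomb_superset[OF finite_imageI[OF D(1)] s])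
  also have "\<dots> = (\<Sum>y\<in>?D. translate G x d (x \<otimes> y) * u (x \<otimes> y) p v w)"
    by (simp add: sum.reindex[OF inj])
  also have "\<dots> = (\<Sum>y\<in>?D. d y * pull (\<alpha> (inv x)) (u y) p v w)"
  proof (rule sum.cong)
    fix y assume "y \<in> ?D"
    then have y: "y \<in> carrier G" using D by blast
    have "translate G x d (x \<otimes> y) = d y" using x y by (simp add: translate_def m_assoc[symmetric])
    then show "translate G x d (x \<otimes> y) * u (x \<otimes> y) p v w = d y * pull (\<alpha> (inv x)) (u y) p v w"
      using u_mult[OF x y v] by simp
  qed simp
  finally show ?thesis by (simp add: pull_def fcomb_def)
qed

lemma cf_fcomb: "cf (fcomb d) c p a b = (\<Sum>x\<in>{x. d x \<noteq> 0}. d x * cf (u x) c p a b)"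
  by (simp add: cf_def fcomb_def)

text \<open>\<open>cf_expand\<close> speaks of inner products, whereas a signed combination may be
  indefinite; it is therefore applied to each \<open>u x\<close> separately.\<close>

lemma cf_fcomb_expand:
  assumes d: "fsupp (carrier G) d" and c: "c \<in> A" and p: "p \<in> snd c ` fst c"
  shows "cf (fcomb d) c p a b = (\<Sum>i\<in>Basis. \<Sum>j\<in>Basis. (a \<bullet> i) * (b \<bullet> j) * cf (fcomb d) c p i j)"
proof -
  let ?D = "{x. d x \<noteq> 0}"
  have "cf (fcomb d) c p a b = (\<Sum>x\<in>?D. d x * (\<Sum>i\<in>Basis. \<Sum>j\<in>Basis. (a \<bullet> i) * (b \<bullet> j) * cf (u x) c p i j))"
    unfolding cf_fcomb
  proof (rule sum.cong)
    fix x assume "x \<in> ?D"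
    then have "x \<in> carrier G" using d by (auto simp: fsupp_def)
    then show "d x * cf (u x) c p a b = d x * (\<Sum>i\<in>Basis. \<Sum>j\<in>Basis. (a \<bullet> i) * (b \<bullet> j) * cf (u x) c p i j)"
      using cf_expand[OF u_inner c p] by simp
  qed simp
  also have "\<dots> = (\<Sum>x\<in>?D. \<Sum>i\<in>Basis. \<Sum>j\<in>Basis. (a \<bullet> i) * (b \<bullet> j) * (d x * cf (u x) c p i j))"
    by (simp add: sum_distrib_left mult_ac)
  also have "\<dots> = (\<Sum>i\<in>Basis. \<Sum>x\<in>?D. \<Sum>j\<in>Basis. (a \<bullet> i) * (b \<bullet> j) * (d x * cf (u x) c p i j))"
    by (rule sum.swap)
  also have "\<dots> = (\<Sum>i\<in>Basis. \<Sum>j\<in>Basis. \<Sum>x\<in>?D. (a \<bullet> i) * (b \<bullet> j) * (d x * cf (u x) c p i j))"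
    by (intro sum.cong refl sum.swap)
  finally show ?thesis by (simp add: cf_fcomb sum_distrib_left)
qed

lemma fcomb_Ck:
  assumes d: "fsupp (carrier G) d" and c: "c \<in> A"
  shows "Ck_on (k - 1) (snd c ` fst c) (\<lambda>p. cf (fcomb d) c p a b)"
  unfolding cf_fcomb
proof (intro Ck_holder_on_sum Ck_on_mult Ck_holder_on_const chartD(2)[OF c] u_Ck c)
  show "x \<in> carrier G" if "x \<in> {x. d x \<noteq> 0}" for x using d that by (auto simp: fsupp_def)
qed

lemma dirs_fcomb:
  assumes d: "fsupp (carrier G) d" and c: "c \<in> A" and vs: "length vs \<le> k - 1" and p: "p \<in> snd c ` fst c"
  shows "dirs vs (\<lambda>p. cf (fcomb d) c p a b) p = (\<Sum>x\<in>{x. d x \<noteq> 0}. d x * dirs vs (\<lambda>p. cf (u x) c p a b) p)"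
proof -
  have x: "x \<in> carrier G" if "x \<in> {x. d x \<noteq> 0}" for x using d that by (auto simp: fsupp_def)
  have "dirs vs (\<lambda>p. cf (fcomb d) c p a b) p = (\<Sum>x\<in>{x. d x \<noteq> 0}. dirs vs (\<lambda>p. d x * cf (u x) c p a b) p)"
    unfolding cf_fcomb
    by (rule dirs_sum[OF chartD(2)[OF c] _ vs p])
      (intro Ck_on_mult Ck_holder_on_const chartD(2)[OF c] u_Ck c x)
  also have "\<dots> = (\<Sum>x\<in>{x. d x \<noteq> 0}. d x * dirs vs (\<lambda>p. cf (u x) c p a b) p)"
    by (intro sum.cong refl dirs_cmult[OF chartD(2)[OF c] u_Ck[OF x c] vs p])
  finally show ?thesis .
qed

lemma cf_fcomb_translate:
  assumes d: "fsupp (carrier G) d" and x: "x \<in> carrier G" and c: "c \<in> A" "c' \<in> A"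
    and p: "p \<in> lrdom (\<alpha> (inv x)) c c'"
  shows "cf (fcomb (translate G x d)) c p a b = (\<Sum>i\<in>Basis. \<Sum>j\<in>Basis.
     (fd (lr (\<alpha> (inv x)) c c') p a \<bullet> i) * (fd (lr (\<alpha> (inv x)) c c') p b \<bullet> j)
       * cf (fcomb d) c' (lr (\<alpha> (inv x)) c c' p) i j)"
proof -
  have p': "p \<in> snd c ` fst c" and q: "lr (\<alpha> (inv x)) c c' p \<in> snd c' ` fst c'"
    using p c(1) by (auto simp: lrdom_iff)
  have t: "cv c (chart_inv c p) a \<in> tangent_space A (chart_inv c p)" for a
    by (rule cv_tangent[OF c(1) chartD(5)[OF c(1) p']])
  have "cf (fcomb (translate G x d)) c p a b = cf (pull (\<alpha> (inv x)) (fcomb d)) c p a b"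
    unfolding cf_def by (rule fcomb_translate[OF d x t t])
  also have "\<dots> = cf (fcomb d) c' (lr (\<alpha> (inv x)) c c' p) (fd (lr (\<alpha> (inv x)) c c') p a) (fd (lr (\<alpha> (inv x)) c c') p b)"
    using \<alpha>_C1[OF inv_closed[OF x]] c p by (rule cf_pull)
  also have "\<dots> = (\<Sum>i\<in>Basis. \<Sum>j\<in>Basis.
     (fd (lr (\<alpha> (inv x)) c c') p a \<bullet> i) * (fd (lr (\<alpha> (inv x)) c c') p b \<bullet> j)
       * cf (fcomb d) c' (lr (\<alpha> (inv x)) c c' p) i j)"
    by (rule cf_fcomb_expand[OF d c(2) q])
  finally show ?thesis .
qed

end

section \<open>The quadratic form of a cover and its growth under translation\<close>

context pieces
begin

text \<open>Lebesgue measure in coordinates, with overlapping cubes counted repeatedly: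
  \<open>B\<close> is not invariant and depends on the cover, but translations change it only by
  subexponential factors.\<close>

definition B :: "('g \<Rightarrow> real) \<Rightarrow> ('g \<Rightarrow> real) \<Rightarrow> real" where
  "B d e = (\<Sum>(c, z, r)\<in>P. \<Sum>a\<in>Basis. \<Sum>b\<in>Basis.
     (LINT p|lborel. indicat_real (bx z r) p *\<^sub>R (cf (fcomb d) c p a b * cf (fcomb e) c p a b)))"

lemma fcomb_cont:
  assumes "(c, z, r) \<in> P" "fsupp (carrier G) d" shows "continuous_on (bx z r) (\<lambda>p. cf (fcomb d) c p a b)"
  by (rule continuous_on_subset[OF Ck_on_continuous[OF fcomb_Ck[OF assms(2) P_chart[OF assms(1)]]] P_sub[OF assms(1)]])

lemma B_integrable:
  assumes "(c, z, r) \<in> P" "fsupp (carrier G) d" "fsupp (carrier G) e"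
  shows "integrable lborel (\<lambda>p. indicat_real (bx z r) p *\<^sub>R (cf (fcomb d) c p a b * cf (fcomb e) c p a b))"
  using assms by (intro borel_integrable_compact compact_cbox continuous_on_mult fcomb_cont)

lemma cf_fcomb_linear:
  "fsupp (carrier G) c \<Longrightarrow> fsupp (carrier G) e \<Longrightarrow>
    cf (fcomb (c + e)) ch p a b = cf (fcomb c) ch p a b + cf (fcomb e) ch p a b"
  "fsupp (carrier G) c \<Longrightarrow> cf (fcomb (\<lambda>x. t * c x)) ch p a b = t * cf (fcomb c) ch p a b"
  by (simp_all add: cf_def fcomb_add fcomb_scale)

lemma B_eqI:
  assumes "\<And>c z r a b. (c, z, r) \<in> P \<Longrightarrow>
    (LINT p|lborel. indicat_real (bx z r) p *\<^sub>R (cf (fcomb d) c p a b * cf (fcomb e) c p a b)) = f c z r a b"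
  shows "B d e = (\<Sum>(c, z, r)\<in>P. \<Sum>a\<in>Basis. \<Sum>b\<in>Basis. f c z r a b)"
  unfolding B_def using assms by (intro sum.cong refl) (auto intro!: sum.cong)

lemma L2_form_add:
  assumes "fsupp (carrier G) d" "fsupp (carrier G) e" "fsupp (carrier G) f"
  shows "B (d + e) f = B d f + B e f"
proof -
  have "B (d + e) f = (\<Sum>(c, z, r)\<in>P. \<Sum>a\<in>Basis. \<Sum>b\<in>Basis.
     (LINT p|lborel. indicat_real (bx z r) p *\<^sub>R (cf (fcomb d) c p a b * cf (fcomb f) c p a b))
     + (LINT p|lborel. indicat_real (bx z r) p *\<^sub>R (cf (fcomb e) c p a b * cf (fcomb f) c p a b)))"
  proof (rule B_eqI)
    fix c z r a b assume i: "(c, z, r) \<in> P"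
    show "(LINT p|lborel. indicat_real (bx z r) p *\<^sub>R (cf (fcomb (d + e)) c p a b * cf (fcomb f) c p a b)) =
     (LINT p|lborel. indicat_real (bx z r) p *\<^sub>R (cf (fcomb d) c p a b * cf (fcomb f) c p a b))
     + (LINT p|lborel. indicat_real (bx z r) p *\<^sub>R (cf (fcomb e) c p a b * cf (fcomb f) c p a b))"
      unfolding cf_fcomb_linear(1)[OF assms(1,2)] distrib_right scaleR_add_right
      by (rule Bochner_Integration.integral_add[OF B_integrable[OF i assms(1,3)] B_integrable[OF i assms(2,3)]])
  qed
  then show ?thesis unfolding B_def by (simp add: sum.distrib case_prod_unfold)
qed

lemma L2_form_scale:
  assumes "fsupp (carrier G) d" "fsupp (carrier G) f"
  shows "B (\<lambda>x. t * d x) f = t * B d f"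
proof -
  have "B (\<lambda>x. t * d x) f = (\<Sum>(c, z, r)\<in>P. \<Sum>a\<in>Basis. \<Sum>b\<in>Basis.
     t * (LINT p|lborel. indicat_real (bx z r) p *\<^sub>R (cf (fcomb d) c p a b * cf (fcomb f) c p a b)))"
  proof (rule B_eqI)
    fix c z r a b assume i: "(c, z, r) \<in> P"
    show "(LINT p|lborel. indicat_real (bx z r) p *\<^sub>R (cf (fcomb (\<lambda>x. t * d x)) c p a b * cf (fcomb f) c p a b)) =
     t * (LINT p|lborel. indicat_real (bx z r) p *\<^sub>R (cf (fcomb d) c p a b * cf (fcomb f) c p a b))"
      unfolding cf_fcomb_linear(2)[OF assms(1)] integral_mult_right_zero[symmetric]
      by (simp add: mult_ac)
  qed
  then show ?thesis unfolding B_def by (simp add: sum_distrib_left case_prod_unfold)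
qed

text \<open>The quadratic form of \<open>B\<close> valued in \<open>ennreal\<close>, the setting of
  the change of variables estimate.\<close>

definition N :: "('g \<Rightarrow> real) \<Rightarrow> ennreal" where
  "N d = (\<Sum>(c, z, r)\<in>P. \<Sum>a\<in>Basis. \<Sum>b\<in>Basis.
     (\<integral>\<^sup>+p. indicator (bx z r) p * ennreal ((cf (fcomb d) c p a b)\<^sup>2) \<partial>lborel))"

lemma nn_integral_cf:
  assumes i: "(c, z, r) \<in> P" and d: "fsupp (carrier G) d"
  shows "(\<integral>\<^sup>+p. indicator (bx z r) p * ennreal ((cf (fcomb d) c p a b)\<^sup>2) \<partial>lborel)
    = ennreal (LINT p|lborel. indicat_real (bx z r) p *\<^sub>R (cf (fcomb d) c p a b * cf (fcomb d) c p a b))"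
proof -
  have "(\<integral>\<^sup>+p. indicator (bx z r) p * ennreal ((cf (fcomb d) c p a b)\<^sup>2) \<partial>lborel)
    = (\<integral>\<^sup>+p. ennreal (indicat_real (bx z r) p *\<^sub>R (cf (fcomb d) c p a b * cf (fcomb d) c p a b)) \<partial>lborel)"
    by (intro nn_integral_cong) (auto simp: indicator_def power2_eq_square)
  also have "\<dots> = ennreal (LINT p|lborel. indicat_real (bx z r) p *\<^sub>R (cf (fcomb d) c p a b * cf (fcomb d) c p a b))"
    by (rule nn_integral_eq_integral[OF B_integrable[OF i d d]]) (simp add: indicator_def)
  finally show ?thesis .
qed

lemma L2_integral_nonneg: "0 \<le> (LINT p|lborel. indicat_real (bx z r) p *\<^sub>R (cf (fcomb d) c p a b * cf (fcomb d) c p a b))"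
  by (intro Bochner_Integration.integral_nonneg) (simp add: indicator_def)

lemma L2_form_nonneg: "0 \<le> B d d"
  unfolding B_def case_prod_unfold by (intro sum_nonneg L2_integral_nonneg)

lemma N_eq:
  assumes d: "fsupp (carrier G) d" shows "N d = ennreal (B d d)"
proof -
  have "N d = (\<Sum>i\<in>P. \<Sum>a\<in>Basis. \<Sum>b\<in>Basis. ennreal (LINT p|lborel.
    indicat_real (bx (fst (snd i)) (snd (snd i))) p *\<^sub>R (cf (fcomb d) (fst i) p a b * cf (fcomb d) (fst i) p a b)))"
    unfolding N_def case_prod_unfold by (intro sum.cong refl nn_integral_cf[OF _ d]) simp
  then show ?thesis
    unfolding B_def case_prod_unfold by (simp add: sum_nonneg L2_integral_nonneg)
qed

lemma cf_le_N:
  assumes i: "(c, z, r) \<in> P" and "a \<in> Basis" "b \<in> Basis"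
  shows "(\<integral>\<^sup>+p. indicator (bx z r) p * ennreal ((cf (fcomb d) c p a b)\<^sup>2) \<partial>lborel) \<le> N d"
proof -
  let ?I = "\<lambda>c z r a b. (\<integral>\<^sup>+p. indicator (bx z r) p * ennreal ((cf (fcomb d) c p a b)\<^sup>2) \<partial>lborel)"
  have "?I c z r a b \<le> (\<Sum>b\<in>Basis. ?I c z r a b)" using assms by (intro member_le_sum) auto
  also have "\<dots> \<le> (\<Sum>a\<in>Basis. \<Sum>b\<in>Basis. ?I c z r a b)"
    using assms member_le_sum[of a Basis "\<lambda>a. \<Sum>b\<in>Basis. ?I c z r a b"] by auto
  also have "\<dots> \<le> N d"
    unfolding N_def using member_le_sum[OF i, of "\<lambda>(c, z, r). \<Sum>a\<in>Basis. \<Sum>b\<in>Basis. ?I c z r a b"] P_finite by auto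
  finally show ?thesis .
qed

lemma sum_sq_le:
  fixes f :: "'x \<Rightarrow> real"
  shows "(\<Sum>i\<in>I. f i)\<^sup>2 \<le> real (card I) * (\<Sum>i\<in>I. (f i)\<^sup>2)"
  using Cauchy_Schwarz_ineq_sum[of "\<lambda>_. 1" f I] by simp

lemma overlap_sub: "overlap f (c, z, r) (c', z', r') \<subseteq> bx z r"
  by (auto simp: overlap_def)

text \<open>In the constant, \<open>(real DIM('e))\<^sup>2\<close> comes from Cauchy-Schwarz over
  the pairs \<open>l\<close>, \<open>l'\<close>, \<open>\<beta> ^ 4\<close> from squaring two first
  derivatives of the map, and \<open>(10 * \<beta>) ^ DIM('e)\<close> from the distortion of volume,
  which is governed by the derivative of the inverse map. Hence the bounds in both
  directions.\<close>

lemma N_translate_overlap: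
  fixes \<beta> :: real
  assumes d: "fsupp (carrier G) d" and x: "x \<in> carrier G" and i: "(c, z, r) \<in> P" and j: "(c', z', r') \<in> P"
    and \<beta>: "\<beta> > 0"
    and b1: "\<And>p a. p \<in> overlap (\<alpha> (inv x)) (c, z, r) (c', z', r') \<Longrightarrow> norm (fd (lr (\<alpha> (inv x)) c c') p a) \<le> \<beta> * norm a"
    and b2: "\<And>p a. p \<in> overlap (\<alpha> x) (c', z', r') (c, z, r) \<Longrightarrow> norm (fd (lr (\<alpha> x) c' c) p a) \<le> \<beta> * norm a"
    and ab: "a \<in> Basis" "b \<in> Basis"
  shows "(\<integral>\<^sup>+p. indicator (overlap (\<alpha> (inv x)) (c, z, r) (c', z', r')) p * ennreal ((cf (fcomb (translate G x d)) c p a b)\<^sup>2) \<partial>lborel)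
    \<le> ennreal ((real DIM('e))\<^sup>2 * \<beta> ^ 4 * (10 * \<beta>) ^ DIM('e)) *
      (\<Sum>l\<in>Basis. \<Sum>l'\<in>Basis. (\<integral>\<^sup>+p. indicator (bx z' r') p * ennreal ((cf (fcomb d) c' p l l')\<^sup>2) \<partial>lborel))"
proof -
  let ?f = "\<alpha> (inv x)" and ?F = "lr (\<alpha> (inv x)) c c'" and ?H = "lr (\<alpha> x) c' c"
  let ?O = "overlap ?f (c, z, r) (c', z', r')"
  note ch = P_chart[OF i] P_chart[OF j]
  have ix: "inv x \<in> carrier G" using x by simp
  define h where "h y = (\<Sum>l\<in>Basis. \<Sum>l'\<in>Basis. (cf (fcomb d) c' y l l')\<^sup>2)" for y
  have h0: "h y \<ge> 0" for y unfolding h_def by (intro sum_nonneg) auto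
  let ?k = "real DIM('e)"
  have pt: "(cf (fcomb (translate G x d)) c p a b)\<^sup>2 \<le> ?k\<^sup>2 * \<beta> ^ 4 * h (?F p)" if p: "p \<in> ?O" for p
  proof -
    have pd: "p \<in> lrdom ?f c c'" using p by (auto simp: overlap_def)
    let ?t = "\<lambda>l l'. (fd ?F p a \<bullet> l) * (fd ?F p b \<bullet> l') * cf (fcomb d) c' (?F p) l l'"
    have le: "\<bar>fd ?F p a' \<bullet> l\<bar> \<le> \<beta>" if "a' \<in> Basis" "l \<in> Basis" for a' l
      using Basis_le_norm[OF that(2), of "fd ?F p a'"] b1[OF p, of a'] that(1) by simp
    have sq: "((fd ?F p a' \<bullet> l))\<^sup>2 \<le> \<beta>\<^sup>2" if "a' \<in> Basis" "l \<in> Basis" for a' l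
      using power_mono[OF le[OF that], of 2] by simp
    have tsq: "(?t l l')\<^sup>2 \<le> \<beta> ^ 4 * (cf (fcomb d) c' (?F p) l l')\<^sup>2" if l: "l \<in> Basis" "l' \<in> Basis" for l l'
    proof -
      have "(fd ?F p a \<bullet> l)\<^sup>2 * (fd ?F p b \<bullet> l')\<^sup>2 \<le> \<beta>\<^sup>2 * \<beta>\<^sup>2"
        using sq[OF ab(1) l(1)] sq[OF ab(2) l(2)] by (intro mult_mono) auto
      also have "\<dots> = \<beta> ^ 4" by (simp add: power2_eq_square power4_eq_xxxx)
      finally show ?thesis unfolding power_mult_distrib by (intro mult_right_mono) auto
    qed
    have "(cf (fcomb (translate G x d)) c p a b)\<^sup>2 = (\<Sum>l\<in>Basis. \<Sum>l'\<in>Basis. ?t l l')\<^sup>2"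
      by (simp only: cf_fcomb_translate[OF d x ch pd])
    also have "\<dots> \<le> ?k * (\<Sum>l\<in>Basis. (\<Sum>l'\<in>Basis. ?t l l')\<^sup>2)" by (rule sum_sq_le)
    also have "\<dots> \<le> ?k * (\<Sum>l\<in>(Basis::'e set). ?k * (\<Sum>l'\<in>Basis. (?t l l')\<^sup>2))"
      by (intro mult_left_mono sum_mono sum_sq_le) auto
    also have "\<dots> \<le> ?k * (\<Sum>l\<in>(Basis::'e set). ?k * (\<Sum>l'\<in>Basis. \<beta> ^ 4 * (cf (fcomb d) c' (?F p) l l')\<^sup>2))"
      by (intro mult_left_mono sum_mono tsq) auto
    also have "\<dots> = ?k\<^sup>2 * \<beta> ^ 4 * h (?F p)"
      unfolding h_def by (simp add: sum_distrib_left power2_eq_square mult_ac)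
    finally show ?thesis .
  qed
  have Oc: "compact ?O" by (rule overlap_compact[OF i j Ck_map_cont[OF \<alpha>_Ck[OF ix]]])
  define T where "T = ?F ` ?O"
  have Od: "?O \<subseteq> lrdom ?f c c'" by (auto simp: overlap_def)
  have Fc: "continuous_on ?O ?F"
    by (rule continuous_on_subset[OF Ck_on_continuous[OF Ck_map_lr[OF \<alpha>_Ck[OF ix] ch]] Od])
  have Tc: "compact T" unfolding T_def by (rule compact_continuous_image[OF Fc Oc])
  have Tsub: "T \<subseteq> bx z' r'" by (auto simp: T_def overlap_def)
  have inv: "\<alpha> x (?f q) = q" for q using \<alpha>_inv(2)[OF x] by (metis comp_apply id_apply)
  have HF: "?H (?F p) = p" "?F p \<in> overlap (\<alpha> x) (c', z', r') (c, z, r)" if p: "p \<in> ?O" for p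
  proof -
    have p': "p \<in> bx z r" "p \<in> lrdom ?f c c'" "?F p \<in> bx z' r'" using p by (auto simp: overlap_def)
    have q: "chart_inv c p \<in> fst c" "?f (chart_inv c p) \<in> fst c'" "p \<in> snd c ` fst c"
      using p'(2) chartD(5)[OF ch(1)] by (auto simp: lrdom_iff[OF ch(1)])
    have e: "chart_inv c' (?F p) = ?f (chart_inv c p)" using chartD(3)[OF ch(2) q(2)] by simp
    show H: "?H (?F p) = p" using chartD(4)[OF ch(1) q(3)] by (simp add: e[simplified] inv)
    have "?F p \<in> lrdom (\<alpha> x) c' c"
      unfolding lrdom_iff[OF ch(2)] e inv using q by auto
    then show "?F p \<in> overlap (\<alpha> x) (c', z', r') (c, z, r)"
      unfolding overlap_def prod.case mem_Collect_eq using p' H by metis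
  qed
  have der: "(?H has_derivative fd ?H y) (at y)" if "y \<in> T" for y
  proof -
    have "y \<in> lrdom (\<alpha> x) c' c" using that HF(2) by (auto simp: T_def overlap_def)
    then show ?thesis by (rule fd_works[OF lr_differentiable[OF \<alpha>_C1[OF x] ch(2,1)]])
  qed
  have bd: "norm (fd ?H y v) \<le> \<beta> * norm v" if "y \<in> T" for y v
    using that HF(2) b2 by (auto simp: T_def)
  have hcont: "continuous_on (bx z' r') h"
    unfolding h_def by (intro continuous_intros fcomb_cont[OF j d])
  have hm: "(\<lambda>y. indicator K y * ennreal (h y)) \<in> borel_measurable borel" if K: "compact K" "K \<subseteq> bx z' r'" for K
  proof -
    have "(\<lambda>y. indicat_real K y *\<^sub>R h y) \<in> borel_measurable lborel"
      using borel_integrable_compact[OF K(1) continuous_on_subset[OF hcont K(2)]] by blast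
    then have "(\<lambda>y. ennreal (indicat_real K y *\<^sub>R h y)) \<in> borel_measurable borel" by simp
    moreover have "(\<lambda>y. ennreal (indicat_real K y *\<^sub>R h y)) = (\<lambda>y. indicator K y * ennreal (h y))"
      by (auto simp: indicator_def)
    ultimately show ?thesis by simp
  qed
  have Ob: "?O \<in> sets borel" "T \<in> sets borel"
    using Oc Tc by (auto intro: borel_closed compact_imp_closed)
  have "(\<integral>\<^sup>+p. indicator ?O p * ennreal ((cf (fcomb (translate G x d)) c p a b)\<^sup>2) \<partial>lborel)
    \<le> (\<integral>\<^sup>+p. indicator ?O p * (ennreal (?k\<^sup>2 * \<beta> ^ 4) * ennreal (h (?F p))) \<partial>lborel)"
  proof (rule nn_integral_mono)
    fix p
    show "indicator ?O p * ennreal ((cf (fcomb (translate G x d)) c p a b)\<^sup>2)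
      \<le> indicator ?O p * (ennreal (?k\<^sup>2 * \<beta> ^ 4) * ennreal (h (?F p)))"
    proof (cases "p \<in> ?O")
      case True
      have "ennreal (?k\<^sup>2 * \<beta> ^ 4) * ennreal (h (?F p)) = ennreal (?k\<^sup>2 * \<beta> ^ 4 * h (?F p))"
        using h0 \<beta> by (simp add: ennreal_mult)
      then show ?thesis using ennreal_leI[OF pt[OF True]] True by simp
    qed simp
  qed
  also have "\<dots> \<le> ennreal ((10 * \<beta>) ^ DIM('e)) * (\<integral>\<^sup>+y. indicator T y * (ennreal (?k\<^sup>2 * \<beta> ^ 4) * ennreal (h y)) \<partial>lborel)"
  proof (rule nn_integral_change_le[where h = "\<lambda>y. ennreal (?k\<^sup>2 * \<beta> ^ 4) * ennreal (h y)", OF Ob Fc T_def[symmetric] HF(1) \<beta> der bd])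
    have "(\<lambda>y. ennreal (?k\<^sup>2 * \<beta> ^ 4) * (indicator T y * ennreal (h y))) \<in> borel_measurable borel"
      using hm[OF Tc Tsub] by simp
    then show "(\<lambda>y. indicator T y * (ennreal (?k\<^sup>2 * \<beta> ^ 4) * ennreal (h y))) \<in> borel_measurable borel"
      by (simp only: mult.left_commute)
  qed
  also have "(\<integral>\<^sup>+y. indicator T y * (ennreal (?k\<^sup>2 * \<beta> ^ 4) * ennreal (h y)) \<partial>lborel)
      = ennreal (?k\<^sup>2 * \<beta> ^ 4) * (\<integral>\<^sup>+y. indicator T y * ennreal (h y) \<partial>lborel)"
  proof -
    have "(\<integral>\<^sup>+y. indicator T y * (ennreal (?k\<^sup>2 * \<beta> ^ 4) * ennreal (h y)) \<partial>lborel)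
      = (\<integral>\<^sup>+y. ennreal (?k\<^sup>2 * \<beta> ^ 4) * (indicator T y * ennreal (h y)) \<partial>lborel)"
      by (rule nn_integral_cong) (rule mult.left_commute)
    also have "\<dots> = ennreal (?k\<^sup>2 * \<beta> ^ 4) * (\<integral>\<^sup>+y. indicator T y * ennreal (h y) \<partial>lborel)"
      by (rule nn_integral_cmult) (use hm[OF Tc Tsub] in simp)
    finally show ?thesis .
  qed
  also have "ennreal ((10 * \<beta>) ^ DIM('e)) * (ennreal (?k\<^sup>2 * \<beta> ^ 4) * (\<integral>\<^sup>+y. indicator T y * ennreal (h y) \<partial>lborel))
      = ennreal (?k\<^sup>2 * \<beta> ^ 4 * (10 * \<beta>) ^ DIM('e)) * (\<integral>\<^sup>+y. indicator T y * ennreal (h y) \<partial>lborel)"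
    using \<beta> by (simp add: ennreal_mult mult_ac)
  also have "\<dots> \<le> ennreal (?k\<^sup>2 * \<beta> ^ 4 * (10 * \<beta>) ^ DIM('e)) * (\<integral>\<^sup>+y. indicator (bx z' r') y * ennreal (h y) \<partial>lborel)"
    using Tsub by (intro mult_left_mono nn_integral_mono mult_right_mono) (auto simp: indicator_def)
  also have "(\<integral>\<^sup>+y. indicator (bx z' r') y * ennreal (h y) \<partial>lborel)
     = (\<Sum>l\<in>Basis. \<Sum>l'\<in>Basis. (\<integral>\<^sup>+p. indicator (bx z' r') p * ennreal ((cf (fcomb d) c' p l l')\<^sup>2) \<partial>lborel))"
  proof -
    have m: "(\<lambda>p. indicator (bx z' r') p * ennreal ((cf (fcomb d) c' p l l')\<^sup>2)) \<in> borel_measurable lborel" for l l'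
    proof -
      have "(\<lambda>p. indicat_real (bx z' r') p *\<^sub>R (cf (fcomb d) c' p l l' * cf (fcomb d) c' p l l')) \<in> borel_measurable lborel"
        using B_integrable[OF j d d] by blast
      then have "(\<lambda>p. ennreal (indicat_real (bx z' r') p *\<^sub>R (cf (fcomb d) c' p l l' * cf (fcomb d) c' p l l'))) \<in> borel_measurable lborel"
        by simp
      moreover have "(\<lambda>p. ennreal (indicat_real (bx z' r') p *\<^sub>R (cf (fcomb d) c' p l l' * cf (fcomb d) c' p l l')))
        = (\<lambda>p. indicator (bx z' r') p * ennreal ((cf (fcomb d) c' p l l')\<^sup>2))"
        by (auto simp: indicator_def power2_eq_square)
      ultimately show ?thesis by (simp only:)
    qed
    have "(\<integral>\<^sup>+y. indicator (bx z' r') y * ennreal (h y) \<partial>lborel)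
      = (\<integral>\<^sup>+y. (\<Sum>l\<in>Basis. \<Sum>l'\<in>Basis. indicator (bx z' r') y * ennreal ((cf (fcomb d) c' y l l')\<^sup>2)) \<partial>lborel)"
    proof (rule nn_integral_cong)
      fix y
      have "ennreal (h y) = (\<Sum>l\<in>Basis. \<Sum>l'\<in>Basis. ennreal ((cf (fcomb d) c' y l l')\<^sup>2))"
        unfolding h_def by (simp add: sum_nonneg)
      then show "indicator (bx z' r') y * ennreal (h y)
        = (\<Sum>l\<in>Basis. \<Sum>l'\<in>Basis. indicator (bx z' r') y * ennreal ((cf (fcomb d) c' y l l')\<^sup>2))"
        by (simp only: sum_distrib_left)
    qed
    also have "\<dots> = (\<Sum>l\<in>Basis. \<Sum>l'\<in>Basis. (\<integral>\<^sup>+p. indicator (bx z' r') p * ennreal ((cf (fcomb d) c' p l l')\<^sup>2) \<partial>lborel))"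
      by (rule trans[OF nn_integral_sum sum.cong[OF refl nn_integral_sum]])
        (intro borel_measurable_sum m, rule m)
    finally show ?thesis .
  qed
  finally show ?thesis .
qed

lemma nn_integral_bx_le_overlaps:
  assumes i: "(c, z, r) \<in> P" and f: "continuous_on UNIV f" and w: "\<And>p. w p \<ge> 0"
    and wc: "continuous_on (bx z r) w"
  shows "(\<integral>\<^sup>+p. indicator (bx z r) p * ennreal (w p) \<partial>lborel)
    \<le> (\<Sum>j\<in>P. \<integral>\<^sup>+p. indicator (overlap f (c, z, r) j) p * ennreal (w p) \<partial>lborel)"
proof -
  have m: "(\<lambda>p. indicator (overlap f (c, z, r) j) p * ennreal (w p)) \<in> borel_measurable lborel" if j: "j \<in> P" for j
  proof -
    obtain c' z' r' where j': "j = (c', z', r')" by (cases j)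
    have cp: "compact (overlap f (c, z, r) j)" unfolding j' using overlap_compact[OF i _ f] j j' by blast
    have sub: "overlap f (c, z, r) j \<subseteq> bx z r" unfolding j' by (rule overlap_sub)
    have "(\<lambda>p. indicat_real (overlap f (c, z, r) j) p *\<^sub>R w p) \<in> borel_measurable lborel"
      using borel_integrable_compact[OF cp continuous_on_subset[OF wc sub]] by blast
    then have "(\<lambda>p. ennreal (indicat_real (overlap f (c, z, r) j) p *\<^sub>R w p)) \<in> borel_measurable lborel" by simp
    moreover have "(\<lambda>p. ennreal (indicat_real (overlap f (c, z, r) j) p *\<^sub>R w p))
      = (\<lambda>p. indicator (overlap f (c, z, r) j) p * ennreal (w p))" by (auto simp: indicator_def)
    ultimately show ?thesis by (simp only:)
  qed
  have "(\<integral>\<^sup>+p. indicator (bx z r) p * ennreal (w p) \<partial>lborel)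
    \<le> (\<integral>\<^sup>+p. (\<Sum>j\<in>P. indicator (overlap f (c, z, r) j) p * ennreal (w p)) \<partial>lborel)"
  proof (rule nn_integral_mono)
    fix p
    show "indicator (bx z r) p * ennreal (w p) \<le> (\<Sum>j\<in>P. indicator (overlap f (c, z, r) j) p * ennreal (w p))"
    proof (cases "p \<in> bx z r")
      case True
      then obtain j where j: "j \<in> P" "p \<in> overlap f (c, z, r) j" using overlap_exists[OF i True] by blast
      have "indicator (bx z r) p * ennreal (w p) = indicator (overlap f (c, z, r) j) p * ennreal (w p)"
        using True j by simp
      also have "\<dots> \<le> (\<Sum>j\<in>P. indicator (overlap f (c, z, r) j) p * ennreal (w p))"
        using j P_finite by (intro member_le_sum) auto
      finally show ?thesis .
    qed simp
  qed
  also have "\<dots> = (\<Sum>j\<in>P. \<integral>\<^sup>+p. indicator (overlap f (c, z, r) j) p * ennreal (w p) \<partial>lborel)"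
    by (rule nn_integral_sum) (rule m)
  finally show ?thesis .
qed

lemma L2_form_growth:
  assumes t: "t > 0"
  shows "\<exists>L. \<forall>x\<in>carrier G. \<forall>d. fsupp (carrier G) d \<longrightarrow>
    B (translate G x d) (translate G x d) \<le> L * exp (t * real (len x)) * B d d"
proof -
  let ?n = "DIM('e)"
  \<comment> \<open>The constant of \<open>N_translate_overlap\<close> has degree
    \<open>?n + 4\<close> in the bound on first derivatives.\<close>
  define h where "h = t / real (?n + 4)"
  have h: "h > 0" using t by (simp add: h_def)
  from lr_growth[OF h] obtain C where C0: "C \<ge> 0"
    and C1: "\<forall>x\<in>carrier G. \<forall>c z r c' z' r' p a. (c, z, r) \<in> P \<longrightarrow> (c', z', r') \<in> P \<longrightarrow>
     p \<in> overlap (\<alpha> x) (c, z, r) (c', z', r') \<longrightarrow>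
     norm (fd (lr (\<alpha> x) c c') p a) \<le> C * exp (h * real (len x)) * norm a"
    by (elim exE conjE)
  note C = C1[rule_format]
  define L where "L = real (card P) * (real ?n)\<^sup>2 * ((real ?n)\<^sup>2 * 10 ^ ?n * (C + 1) ^ (?n + 4))"
  have "B (translate G x d) (translate G x d) \<le> L * exp (t * real (len x)) * B d d"
    if x: "x \<in> carrier G" and d: "fsupp (carrier G) d" for x d
  proof -
    let ?T = "translate G x d" and ?f = "\<alpha> (inv x)"
    have ix: "inv x \<in> carrier G" using x by simp
    have T: "fsupp (carrier G) ?T" by (rule fsupp_translate[OF d x])
    \<comment> \<open>\<open>C + 1\<close> instead of \<open>C\<close>, because the change of
      variables asks for a positive bound.\<close>
    define \<beta> where "\<beta> = (C + 1) * exp (h * real (len x))"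
    have \<beta>: "\<beta> > 0" using C0 by (simp add: \<beta>_def)
    have C\<beta>: "C * exp (h * real (len x)) * norm a \<le> \<beta> * norm a" for a :: 'e
      unfolding \<beta>_def by (intro mult_right_mono) auto
    define K where "K = (real ?n)\<^sup>2 * \<beta> ^ 4 * (10 * \<beta>) ^ ?n"
    have K0: "K \<ge> 0" using \<beta> by (simp add: K_def)
    let ?J = "\<lambda>(c', z', r'). \<Sum>l\<in>Basis. \<Sum>l'\<in>Basis. (\<integral>\<^sup>+p. indicator (bx z' r') p * ennreal ((cf (fcomb d) c' p l l')\<^sup>2) \<partial>lborel)"
    have one: "(\<integral>\<^sup>+p. indicator (bx z r) p * ennreal ((cf (fcomb ?T) c p a b)\<^sup>2) \<partial>lborel) \<le> ennreal K * N d"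
      if i: "(c, z, r) \<in> P" and ab: "a \<in> Basis" "b \<in> Basis" for c z r a b
    proof -
      have "(\<integral>\<^sup>+p. indicator (bx z r) p * ennreal ((cf (fcomb ?T) c p a b)\<^sup>2) \<partial>lborel)
        \<le> (\<Sum>j\<in>P. \<integral>\<^sup>+p. indicator (overlap ?f (c, z, r) j) p * ennreal ((cf (fcomb ?T) c p a b)\<^sup>2) \<partial>lborel)"
        by (rule nn_integral_bx_le_overlaps[OF i Ck_map_cont[OF \<alpha>_Ck[OF ix]]])
          (auto intro!: continuous_intros fcomb_cont[OF i T])
      also have "\<dots> \<le> (\<Sum>j\<in>P. ennreal K * ?J j)"
      proof (rule sum_mono)
        fix j assume j0: "j \<in> P"
        obtain c' z' r' where j': "j = (c', z', r')" by (cases j)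
        have j: "(c', z', r') \<in> P" using j0 j' by simp
        show "(\<integral>\<^sup>+p. indicator (overlap ?f (c, z, r) j) p * ennreal ((cf (fcomb ?T) c p a b)\<^sup>2) \<partial>lborel) \<le> ennreal K * ?J j"
          unfolding j' prod.case K_def
        proof (rule N_translate_overlap[OF d x i j \<beta> _ _ ab])
          show "norm (fd (lr ?f c c') p a) \<le> \<beta> * norm a" if "p \<in> overlap ?f (c, z, r) (c', z', r')" for p a
            using order_trans[OF C[OF ix i j that] C\<beta>[unfolded len_inv[OF x, symmetric]]]
            by (simp add: len_inv[OF x])
          show "norm (fd (lr (\<alpha> x) c' c) p a) \<le> \<beta> * norm a" if "p \<in> overlap (\<alpha> x) (c', z', r') (c, z, r)" for p a
            by (rule order_trans[OF C[OF x j i that] C\<beta>])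
        qed
      qed
      also have "\<dots> = ennreal K * N d" unfolding N_def by (rule sum_distrib_left[symmetric])
      finally show ?thesis .
    qed
    have "N ?T \<le> (\<Sum>i\<in>P. \<Sum>a\<in>(Basis::'e set). \<Sum>b\<in>(Basis::'e set). ennreal K * N d)"
      unfolding N_def[of ?T] case_prod_unfold by (intro sum_mono one) auto
    also have "\<dots> = ennreal (real (card P) * (real ?n)\<^sup>2 * K) * N d"
      using K0 by (simp add: power2_eq_square ennreal_mult mult_ac ennreal_of_nat_eq_real_of_nat)
    finally have "ennreal (B ?T ?T) \<le> ennreal (real (card P) * (real ?n)\<^sup>2 * K * B d d)"
      unfolding N_eq[OF T] N_eq[OF d] using K0 L2_form_nonneg[of d] by (simp add: ennreal_mult)
    then have "B ?T ?T \<le> real (card P) * (real ?n)\<^sup>2 * K * B d d"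
      using K0 L2_form_nonneg[of d] by (simp add: ennreal_le_iff)
    also have "K = (real ?n)\<^sup>2 * 10 ^ ?n * (C + 1) ^ (?n + 4) * exp (t * real (len x))"
    proof -
      have "exp (h * real (len x)) ^ (?n + 4) = exp (t * real (len x))"
        unfolding exp_of_nat_mult[symmetric] by (simp add: h_def)
      then have "\<beta> ^ (?n + 4) = (C + 1) ^ (?n + 4) * exp (t * real (len x))"
        by (simp only: \<beta>_def power_mult_distrib)
      moreover have "K = (real ?n)\<^sup>2 * 10 ^ ?n * \<beta> ^ (?n + 4)"
        by (simp add: K_def power_mult_distrib power_add mult_ac)
      ultimately show ?thesis by (simp only: mult.assoc)
    qed
    finally show ?thesis by (simp add: L_def mult_ac)
  qed
  then show ?thesis by blast
qed

sublocale form: group_form G S B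
proof
  fix c e f :: "'g \<Rightarrow> real" and r t :: real
  show "B (c + e) f = B c f + B e f" if "fsupp (carrier G) c" "fsupp (carrier G) e" "fsupp (carrier G) f"
    using that by (rule L2_form_add)
  show "B (\<lambda>x. r * c x) f = r * B c f" if "fsupp (carrier G) c" "fsupp (carrier G) f"
    using that by (rule L2_form_scale)
  show "B c f = B f c" unfolding B_def by (simp add: mult.commute)
  show "B c c \<ge> 0" by (rule L2_form_nonneg)
  show "\<exists>L. \<forall>a\<in>carrier G. \<forall>c. fsupp (carrier G) c \<longrightarrow>
      B (translate G a c) (translate G a c) \<le> L * exp (t * real (len a)) * B c c" if "t > 0"
    using that by (rule L2_form_growth)
qed

text \<open>Common features of the increments of the averages and of their defects of invariance:
  bounded total mass, and support in balls whose radius exceeds \<open>n\<close> by a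
  constant.\<close>

definition tame :: "(nat \<Rightarrow> 'g \<Rightarrow> real) \<Rightarrow> bool" where
  "tame d \<longleftrightarrow> (\<forall>n. fsupp (carrier G) (d n)) \<and> (\<exists>l0. \<forall>n x. d n x \<noteq> 0 \<longrightarrow> len x \<le> n + l0) \<and>
     (\<exists>M. \<forall>n. (\<Sum>x\<in>{x. d n x \<noteq> 0}. \<bar>d n x\<bar>) \<le> M)"

text \<open>The derivatives of each \<open>u x\<close> grow subexponentially in the length of
  \<open>x\<close>; here lengths are at most \<open>n + l0\<close> and the total mass is bounded by
  \<open>M\<close>.\<close>

lemma tame_subexp:
  assumes d: "tame d" and i: "(c, z, r) \<in> P" and ab: "a \<in> Basis" "b \<in> Basis"
    and vs: "vs \<in> blists j" "j \<le> k - 1"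
  shows "subexp (bx z r) (\<lambda>n. dirs vs (\<lambda>p. cf (fcomb (d n)) c p a b))"
  unfolding subexp_def
proof (intro allI impI)
  fix e :: real assume e: "e > 0"
  obtain l0 M where l0: "\<And>n x. d n x \<noteq> 0 \<Longrightarrow> len x \<le> n + l0"
    and M: "\<And>n. (\<Sum>x\<in>{x. d n x \<noteq> 0}. \<bar>d n x\<bar>) \<le> M" and fs: "\<And>n. fsupp (carrier G) (d n)"
    using d unfolding tame_def by blast
  obtain C where C: "\<And>x. x \<in> carrier G \<Longrightarrow> bnd j x (C * exp (e * real (len x)))"
    using bnd_growth[OF vs(2) e] by blast
  have "\<bar>dirs vs (\<lambda>p. cf (fcomb (d n)) c p a b) p\<bar> \<le> (\<bar>M\<bar> * \<bar>C\<bar> * exp (e * real l0)) * exp (e * real n)"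
    if p: "p \<in> bx z r" for n p
  proof -
    let ?K = "\<bar>C\<bar> * exp (e * real (n + l0))"
    have "\<bar>dirs vs (\<lambda>p. cf (u x) c p a b) p\<bar> \<le> ?K" if x: "d n x \<noteq> 0" for x
    proof -
      have xc: "x \<in> carrier G" using fs[of n] x by (auto simp: fsupp_def)
      have "\<bar>dirs vs (\<lambda>p. cf (u x) c p a b) p\<bar> \<le> C * exp (e * real (len x))"
        using C[OF xc] i p ab vs(1) unfolding bnd_def by blast
      also have "\<dots> \<le> ?K"
      proof (rule mult_mono)
        show "exp (e * real (len x)) \<le> exp (e * real (n + l0))" using l0[OF x] e by simp
      qed auto
      finally show ?thesis .
    qed
    then have "(\<Sum>x\<in>{x. d n x \<noteq> 0}. \<bar>d n x\<bar> * \<bar>dirs vs (\<lambda>p. cf (u x) c p a b) p\<bar>)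
        \<le> (\<Sum>x\<in>{x. d n x \<noteq> 0}. \<bar>d n x\<bar> * ?K)"
      by (intro sum_mono mult_left_mono) auto
    also have "\<dots> = (\<Sum>x\<in>{x. d n x \<noteq> 0}. \<bar>d n x\<bar>) * ?K" by (simp add: sum_distrib_right)
    also have "\<dots> \<le> \<bar>M\<bar> * ?K" using M[of n] by (intro mult_right_mono) auto
    also have "\<dots> = (\<bar>M\<bar> * \<bar>C\<bar> * exp (e * real l0)) * exp (e * real n)"
      by (simp add: exp_add distrib_left mult_ac)
    finally have s: "(\<Sum>x\<in>{x. d n x \<noteq> 0}. \<bar>d n x\<bar> * \<bar>dirs vs (\<lambda>p. cf (u x) c p a b) p\<bar>)
      \<le> (\<bar>M\<bar> * \<bar>C\<bar> * exp (e * real l0)) * exp (e * real n)" .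
    have lvs: "length vs \<le> k - 1" using vs by (simp add: blists_def)
    have "\<bar>dirs vs (\<lambda>p. cf (fcomb (d n)) c p a b) p\<bar> \<le> (\<Sum>x\<in>{x. d n x \<noteq> 0}. \<bar>d n x\<bar> * \<bar>dirs vs (\<lambda>p. cf (u x) c p a b) p\<bar>)"
      unfolding dirs_fcomb[OF fs P_chart[OF i] lvs P_subD[OF i p]] abs_mult[symmetric] by (rule sum_abs)
    then show ?thesis using s by linarith
  qed
  then show "\<exists>C\<ge>0. \<forall>n. \<forall>x\<in>bx z r. \<bar>dirs vs (\<lambda>p. cf (fcomb (d n)) c p a b) x\<bar> \<le> C * exp (e * real n)"
    by (intro exI[of _ "\<bar>M\<bar> * \<bar>C\<bar> * exp (e * real l0)"]) auto
qed

lemma fcomb_dirs_differentiable: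
  assumes d: "fsupp (carrier G) d" and i: "(c, z, r) \<in> P" and vs: "length vs < k - 1" and p: "p \<in> bx z r"
  shows "dirs vs (\<lambda>p. cf (fcomb d) c p a b) differentiable at p"
proof -
  have "Ck_on (Suc 0) (snd c ` fst c) (dirs vs (\<lambda>p. cf (fcomb d) c p a b))"
    by (rule Ck_on_dirs[OF fcomb_Ck[OF d P_chart[OF i]]]) (use vs in simp)
  then show ?thesis using P_subD[OF i p] unfolding Ck_holder_on.simps by blast
qed

text \<open>Induction on the order: order zero comes from the \<open>L2\<close> decay, and
  \<open>expdec_derivative\<close> gains one order by looking two beyond the one already treated.
  Growth is known up to order \<open>k - 1\<close>, so decay stops at order
  \<open>k - 2\<close>.\<close>

lemma tame_expdec:
  assumes d: "tame d" and q: "0 < q" "q < 1" and dec: "\<And>n. n \<ge> n0 \<Longrightarrow> sqrt (B (d n) (d n)) \<le> C * q ^ n"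
    and i: "(c, z, r) \<in> P" and ab: "a \<in> Basis" "b \<in> Basis"
    and vs: "vs \<in> blists j" "j \<le> k - 2"
  shows "expdec (bx z r) (\<lambda>n. dirs vs (\<lambda>p. cf (fcomb (d n)) c p a b))"
  using vs
proof (induction j arbitrary: vs)
  case 0
  then have vs: "vs = []" by (simp add: blists_def)
  have fs: "fsupp (carrier G) (d n)" for n using d by (simp add: tame_def)
  \<comment> \<open>The sum takes care of the finitely many \<open>n\<close> below
    \<open>n0\<close>, since \<open>expdec\<close> speaks of all \<open>n\<close>.\<close>
  define K where "K = (\<Sum>n<n0. B (d n) (d n) / (q\<^sup>2) ^ n) + C\<^sup>2"
  have K0: "K \<ge> 0" unfolding K_def using q L2_form_nonneg by (intro add_nonneg_nonneg sum_nonneg) auto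
  have BK: "B (d n) (d n) \<le> K * (q\<^sup>2) ^ n" for n
  proof (cases "n < n0")
    case True
    have "B (d n) (d n) / (q\<^sup>2) ^ n \<le> (\<Sum>n<n0. B (d n) (d n) / (q\<^sup>2) ^ n)"
      using True q L2_form_nonneg by (intro member_le_sum) auto
    also have "\<dots> \<le> K" by (simp add: K_def)
    finally show ?thesis using q by (simp add: field_simps)
  next
    case False
    have "B (d n) (d n) = (sqrt (B (d n) (d n)))\<^sup>2" using L2_form_nonneg by simp
    also have "\<dots> \<le> (C * q ^ n)\<^sup>2" using dec[of n] False L2_form_nonneg by (intro power_mono) auto
    also have "\<dots> = C\<^sup>2 * (q\<^sup>2) ^ n" by (simp add: power_mult_distrib power_mult[symmetric] mult.commute)
    also have "\<dots> \<le> K * (q\<^sup>2) ^ n"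
      using q L2_form_nonneg by (intro mult_right_mono) (auto simp: K_def intro!: sum_nonneg)
    finally show ?thesis .
  qed
  have "expdec (bx z r) (\<lambda>n p. cf (fcomb (d n)) c p a b)"
  proof (rule expdec_from_L2[OF _ P_pos[OF i] _ _ K0])
    show "(\<lambda>p. cf (fcomb (d n)) c p a b) differentiable at x" if "x \<in> bx z r" for n x
      using fcomb_dirs_differentiable[OF fs i _ that, of "[]"] k2 by simp
    show "subexp (bx z r) (\<lambda>n x. fd (\<lambda>p. cf (fcomb (d n)) c p a b) x l)" if "l \<in> Basis" for l
      using tame_subexp[OF d i ab, of "[l]" 1] that k2 by (simp add: blists_def)
    show "(\<integral>\<^sup>+y. indicator (bx z r) y * ennreal ((cf (fcomb (d n)) c y a b)\<^sup>2) \<partial>lborel) \<le> ennreal (K * (q\<^sup>2) ^ n)" for n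
      using cf_le_N[OF i ab, of "d n"] unfolding N_eq[OF fs]
      by (rule order_trans) (rule ennreal_leI[OF BK])
    show "0 < q\<^sup>2" "q\<^sup>2 < 1" using q by (auto simp: power_less_one_iff)
  qed
  then show ?case by (simp add: vs)
next
  case (Suc j)
  have fs: "fsupp (carrier G) (d n)" for n using d by (simp add: tame_def)
  obtain ws l where vs: "vs = ws @ [l]" using Suc.prems by (cases vs rule: rev_cases) (auto simp: blists_def)
  have l: "l \<in> Basis" "ws \<in> blists j" using Suc.prems vs by (auto simp: blists_def)
  have lw: "length ws = j" using l by (simp add: blists_def)
  have "expdec (bx z r) (\<lambda>n x. fd (dirs ws (\<lambda>p. cf (fcomb (d n)) c p a b)) x l)"
  proof (rule expdec_derivative[OF _ _ l(1) P_pos[OF i]])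
    show "dirs ws (\<lambda>p. cf (fcomb (d n)) c p a b) differentiable at x" if "x \<in> bx z r" for n x
      by (rule fcomb_dirs_differentiable[OF fs i _ that]) (use lw Suc.prems in simp)
    show "(\<lambda>y. fd (dirs ws (\<lambda>p. cf (fcomb (d n)) c p a b)) y l) differentiable at x" if "x \<in> bx z r" for n x
    proof -
      have "dirs (ws @ [l]) (\<lambda>p. cf (fcomb (d n)) c p a b) differentiable at x"
        by (rule fcomb_dirs_differentiable[OF fs i _ that]) (use lw Suc.prems in simp)
      then show ?thesis by (simp only: dirs_snoc[abs_def])
    qed
    show "expdec (bx z r) (\<lambda>n. dirs ws (\<lambda>p. cf (fcomb (d n)) c p a b))"
      using Suc.IH[OF l(2)] Suc.prems by simp
    \<comment> \<open>Landau's inequality asks only for the pure second derivative in the direction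
      \<open>l\<close>.\<close>
    have "subexp (bx z r) (\<lambda>n. dirs ((ws @ [l]) @ [l]) (\<lambda>p. cf (fcomb (d n)) c p a b))"
      by (rule tame_subexp[OF d i ab, of _ "Suc (Suc j)"]) (use l Suc.prems in \<open>auto simp: blists_def\<close>)
    then show "subexp (bx z r) (\<lambda>n x. fd (\<lambda>y. fd (dirs ws (\<lambda>p. cf (fcomb (d n)) c p a b)) y l) x l)"
      by (simp only: dirs_snoc[abs_def])
  qed
  then show ?case by (simp only: vs dirs_snoc[abs_def])
qed

text \<open>Up to order \<open>k - 2\<close> the functions decay while their first derivatives, of
  order at most \<open>k - 1\<close>, still grow subexponentially; this is the input of
  \<open>expdec_holder\<close>.\<close>

lemma tame_holder:
  assumes d: "tame d" and q: "0 < q" "q < 1" and dec: "\<And>n. n \<ge> n0 \<Longrightarrow> sqrt (B (d n) (d n)) \<le> C * q ^ n"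
    and i: "(c, z, r) \<in> P" and ab: "a \<in> Basis" "b \<in> Basis"
    and vs: "vs \<in> blists j" "j \<le> k - 2" and s: "0 \<le> s" "s < 1"
  shows "\<exists>C q. 0 \<le> C \<and> 0 < q \<and> q < 1 \<and>
     (\<forall>n. holder_bound (bx z r) s (C * q ^ n) (dirs vs (\<lambda>p. cf (fcomb (d n)) c p a b)))"
  unfolding holder_bound_def
proof (rule expdec_holder[OF _ tame_expdec[OF d q dec i ab vs] _ s])
  have lv: "length vs = j" using vs by (simp add: blists_def)
  have fs: "fsupp (carrier G) (d n)" for n using d by (simp add: tame_def)
  show "dirs vs (\<lambda>p. cf (fcomb (d n)) c p a b) differentiable at x" if "x \<in> bx z r" for n x
    by (rule fcomb_dirs_differentiable[OF fs i _ that]) (use lv vs k2 in simp)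
  show "subexp (bx z r) (\<lambda>n x. fd (dirs vs (\<lambda>p. cf (fcomb (d n)) c p a b)) x l)" if l: "l \<in> Basis" for l
  proof -
    have "subexp (bx z r) (\<lambda>n. dirs (vs @ [l]) (\<lambda>p. cf (fcomb (d n)) c p a b))"
      by (rule tame_subexp[OF d i ab, of _ "Suc j"]) (use l vs k2 in \<open>auto simp: blists_def\<close>)
    then show ?thesis by (simp only: dirs_snoc[abs_def])
  qed
qed

end

section \<open>The limit metric\<close>

lemma expdec_sum:
  assumes "finite I" "\<And>i. i \<in> I \<Longrightarrow> expdec X (f i)"
  shows "expdec X (\<lambda>n x. \<Sum>i\<in>I. c i * f i n x)"
  using assms
proof (induction I rule: finite_induct)
  case empty
  show ?case unfolding expdec_def by (rule exI[of _ 0], rule exI[of _ "1/2"]) simp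
next
  case (insert i I)
  obtain C q where C: "0 \<le> C" "0 < q" "q < 1" "\<And>n x. x \<in> X \<Longrightarrow> \<bar>f i n x\<bar> \<le> C * q ^ n"
    using insert.prems[of i] unfolding expdec_def by blast
  have "expdec X (\<lambda>n x. \<Sum>i\<in>I. c i * f i n x)" using insert by blast
  then obtain C' q' where C': "0 \<le> C'" "0 < q'" "q' < 1"
    "\<And>n x. x \<in> X \<Longrightarrow> \<bar>\<Sum>i\<in>I. c i * f i n x\<bar> \<le> C' * q' ^ n" unfolding expdec_def by blast
  define p where "p = max q q'"
  have "\<bar>\<Sum>i\<in>insert i I. c i * f i n x\<bar> \<le> (\<bar>c i\<bar> * C + C') * p ^ n" if x: "x \<in> X" for n x
  proof -
    have "\<bar>\<Sum>i\<in>insert i I. c i * f i n x\<bar> \<le> \<bar>c i\<bar> * \<bar>f i n x\<bar> + \<bar>\<Sum>i\<in>I. c i * f i n x\<bar>"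
      using insert.hyps abs_triangle_ineq[of "c i * f i n x" "\<Sum>i\<in>I. c i * f i n x"] by (simp add: abs_mult)
    also have "\<dots> \<le> \<bar>c i\<bar> * (C * q ^ n) + C' * q' ^ n"
      by (intro add_mono mult_left_mono C(4) C'(4) x) auto
    also have "\<dots> \<le> \<bar>c i\<bar> * (C * p ^ n) + C' * p ^ n"
      using C C' by (intro add_mono mult_left_mono power_mono) (auto simp: p_def)
    finally show ?thesis by (simp add: distrib_right mult.assoc)
  qed
  moreover have "0 < p" "p < 1" "0 \<le> \<bar>c i\<bar> * C + C'" using C C' by (auto simp: p_def less_max_iff_disj)
  ultimately show ?case unfolding expdec_def by blast
qed

lemma sum_pmf_le_1: "finite F \<Longrightarrow> (\<Sum>x\<in>F. pmf p x) \<le> 1"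
  by (metis measure_measure_pmf_finite measure_pmf.prob_le_1)

context wgroup
begin

lemma averaging_pmf:
  assumes "averaging_sequence G S \<E> \<mu>"
  shows "fsupp (carrier G) (pmf (\<mu> n))" "pmf (\<mu> n) x \<noteq> 0 \<Longrightarrow> x \<in> carrier G \<and> len x \<le> n"
proof -
  have sup: "set_pmf (\<mu> n) \<subseteq> {x \<in> carrier G. len x \<le> n}"
    using assms unfolding averaging_sequence_def by blast
  then have "finite (set_pmf (\<mu> n))" using finite_subset[OF sup ball_finite] by blast
  then show "fsupp (carrier G) (pmf (\<mu> n))" using sup by (auto simp: fsupp_def pmf_eq_0_set_pmf)
  show "pmf (\<mu> n) x \<noteq> 0 \<Longrightarrow> x \<in> carrier G \<and> len x \<le> n" using sup by (auto simp: pmf_eq_0_set_pmf)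
qed

end

context maction
begin

text \<open>For use near a given point: the regularity of the limit is read off a cube centred
  there, and that cube must belong to the cover.\<close>

lemma pieces_containing_exist:
  assumes i0: "c0 \<in> A" "r0 > 0" "bx z0 r0 \<subseteq> snd c0 ` fst c0"
  shows "\<exists>P. (c0, z0, r0) \<in> P \<and> pieces G S A g0 k \<alpha> P"
proof -
  have "\<exists>cr. fst cr \<in> A \<and> p \<in> fst (fst cr) \<and> snd cr > 0 \<and> bx (snd (fst cr) p) (snd cr) \<subseteq> snd (fst cr) ` fst (fst cr)" for p
  proof -
    obtain c where c: "c \<in> A" "p \<in> fst c" using chart_at[of p] by blast
    obtain r where "r > 0" "bx (snd c p) r \<subseteq> snd c ` fst c"
      using bx_exists[OF chartD(2)[OF c(1)], of "snd c p"] c(2) by blast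
    then show ?thesis using c by (intro exI[of _ "(c, r)"]) simp
  qed
  then obtain cr where cr: "\<And>p. fst (cr p) \<in> A" "\<And>p. p \<in> fst (fst (cr p))" "\<And>p. snd (cr p) > 0"
     "\<And>p. bx (snd (fst (cr p)) p) (snd (cr p)) \<subseteq> snd (fst (cr p)) ` fst (fst (cr p))" by metis
  define c r where "c p = fst (cr p)" and "r p = snd (cr p)" for p
  have cr: "c p \<in> A" "p \<in> fst (c p)" "r p > 0" "bx (snd (c p) p) (r p) \<subseteq> snd (c p) ` fst (c p)" for p
    using cr by (auto simp: c_def r_def)
  \<comment> \<open>Open cubes, so that compactness applies; the closed cubes of the cover contain
    them.\<close>
  define W where "W p = fst (c p) \<inter> snd (c p) -` box (snd (c p) p - r p *\<^sub>R One) (snd (c p) p + r p *\<^sub>R One)" for p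
  have W: "open (W p)" for p unfolding W_def by (rule open_chart_preimage[OF cr(1) open_box])
  have pW: "p \<in> W p" for p using cr(2,3)[of p] by (auto simp: W_def mem_box inner_diff_left inner_add_left)
  have cover: "UNIV \<subseteq> (\<Union>p\<in>UNIV. W p)" using pW by blast
  obtain F where F: "finite F" "UNIV \<subseteq> (\<Union>p\<in>F. W p)"
    by (rule compactE_image[OF cpt W cover])
  define P where "P = insert (c0, z0, r0) ((\<lambda>p. (c p, snd (c p) p, r p)) ` F)"
  have "pieces G S A g0 k \<alpha> P"
  proof
    show "finite P" using F by (simp add: P_def)
    fix c' z r' assume "(c', z, r') \<in> P"
    then consider "c' = c0" "z = z0" "r' = r0" | p where "c' = c p" "z = snd (c p) p" "r' = r p"
      unfolding P_def by auto
    then show "c' \<in> A" "r' > 0" "bx z r' \<subseteq> snd c' ` fst c'"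
      by (cases, use i0 cr in simp_all)+
  next
    fix q
    obtain p where p: "p \<in> F" "q \<in> W p" using F(2) by (meson UNIV_I UN_E subsetD)
    have "(c p, snd (c p) p, r p) \<in> P" using p(1) by (simp add: P_def)
    moreover have "q \<in> fst (c p)" "snd (c p) q \<in> bx (snd (c p) p) (r p)"
      using p(2) box_subset_cbox[of "snd (c p) p - r p *\<^sub>R One" "snd (c p) p + r p *\<^sub>R One"] by (auto simp: W_def)
    ultimately show "\<exists>c z r. (c, z, r) \<in> P \<and> q \<in> fst c \<and> snd c q \<in> bx z r" by blast
  qed
  then show ?thesis by (intro exI[of _ P]) (simp add: P_def)
qed

lemma pieces_exist: "\<exists>P. pieces G S A g0 k \<alpha> P"
proof -
  obtain c where c: "c \<in> A" "undefined \<in> fst c" using chart_at by blast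
  obtain r where "r > 0" "bx (snd c undefined) r \<subseteq> snd c ` fst c"
    using bx_exists[OF chartD(2)[OF c(1)], of "snd c undefined"] c(2) by blast
  then show ?thesis using pieces_containing_exist[OF c(1)] by blast
qed

end

locale averaged = maction G S A g0 k \<alpha>
  for G :: "('g, 'b) monoid_scheme" (structure) and S :: "'g set"
    and A :: "('m::t2_space, 'e::euclidean_space) chart set"
    and g0 :: "('m, 'e) metric_field" and k :: nat and \<alpha> :: "'g \<Rightarrow> 'm \<Rightarrow> 'm" +
  fixes \<E> :: "'i::infinite cspace set" and \<mu> :: "nat \<Rightarrow> 'g pmf"
  assumes E10: "E10_properties \<E>" and \<mu>: "averaging_sequence G S \<E> \<mu>"
begin

abbreviation m :: "nat \<Rightarrow> 'g \<Rightarrow> real" where "m n \<equiv> pmf (\<mu> n)"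

lemmas m_fsupp = averaging_pmf(1)[OF \<mu>]
lemmas m_supp = averaging_pmf(2)[OF \<mu>]

lemma diff_fsupp: "fsupp (carrier G) (c :: 'g \<Rightarrow> real) \<Longrightarrow> fsupp (carrier G) e \<Longrightarrow> fsupp (carrier G) (c - e)"
  using fsupp_add[of "carrier G" c "\<lambda>x. (-1) * e x"] fsupp_mult[of "carrier G" e "-1"]
  by (simp add: fun_diff_def plus_fun_def)

definition increment :: "nat \<Rightarrow> 'g \<Rightarrow> real" where "increment n = m n - m (Suc n)"
definition defect :: "'g \<Rightarrow> nat \<Rightarrow> 'g \<Rightarrow> real" where "defect x n = translate G x (m n) - m n"

lemma increment_fsupp: "fsupp (carrier G) (increment n)"
  unfolding increment_def by (intro diff_fsupp m_fsupp)

lemma defect_fsupp: "x \<in> carrier G \<Longrightarrow> fsupp (carrier G) (defect x n)"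
  unfolding defect_def by (intro diff_fsupp m_fsupp fsupp_translate)

text \<open>The cover is fixed only locally: \<open>m\<close>, \<open>increment\<close> and
  \<open>defect\<close> are defined without it, so estimates obtained from different covers, and
  thus from different Hilbert spaces, concern the same sequences.\<close>

context
  fixes P assumes P: "pieces G S A g0 k \<alpha> P"
begin

interpretation pieces G S A g0 k \<alpha> P by (rule P)

lemma increment_tame: "tame increment"
  unfolding tame_def
proof (intro conjI allI)
  show "fsupp (carrier G) (increment n)" for n by (rule increment_fsupp)
  have "len x \<le> n + 1" if "increment n x \<noteq> 0" for n x
  proof -
    have "m n x \<noteq> 0 \<or> m (Suc n) x \<noteq> 0" using that by (auto simp: increment_def)
    then show ?thesis using m_supp[of n x] m_supp[of "Suc n" x] by auto
  qed
  then show "\<exists>l0. \<forall>n x. increment n x \<noteq> 0 \<longrightarrow> len x \<le> n + l0" by blast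
  have "(\<Sum>x\<in>{x. increment n x \<noteq> 0}. \<bar>increment n x\<bar>) \<le> 2" for n
  proof -
    have F: "finite {x. increment n x \<noteq> 0}" using increment_fsupp[of n] by (simp add: fsupp_def)
    have "(\<Sum>x\<in>{x. increment n x \<noteq> 0}. \<bar>increment n x\<bar>) \<le> (\<Sum>x\<in>{x. increment n x \<noteq> 0}. m n x + m (Suc n) x)"
      by (intro sum_mono) (auto simp: increment_def abs_le_iff add_nonneg_nonneg)
    also have "\<dots> \<le> 1 + 1"
      unfolding sum.distrib using F by (intro add_mono sum_pmf_le_1)
    finally show ?thesis by simp
  qed
  then show "\<exists>M. \<forall>n. (\<Sum>x\<in>{x. increment n x \<noteq> 0}. \<bar>increment n x\<bar>) \<le> M" by blast
qed

lemma defect_tame: assumes x: "x \<in> carrier G" shows "tame (defect x)"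
  unfolding tame_def
proof (intro conjI allI)
  show "fsupp (carrier G) (defect x n)" for n by (rule defect_fsupp[OF x])
  have "len y \<le> n + len x" if "defect x n y \<noteq> 0" for n y
  proof -
    have "translate G x (m n) y \<noteq> 0 \<or> m n y \<noteq> 0" using that by (auto simp: defect_def)
    then show ?thesis
    proof
      assume "m n y \<noteq> 0"
      then show ?thesis using m_supp[of n y] by auto
    next
      assume "translate G x (m n) y \<noteq> 0"
      then have y: "y \<in> carrier G" "m n (inv x \<otimes> y) \<noteq> 0" by (auto simp: translate_def split: if_splits)
      then have "len (inv x \<otimes> y) \<le> n" using m_supp by blast
      moreover have "len (x \<otimes> (inv x \<otimes> y)) \<le> len x + len (inv x \<otimes> y)"
        using x y by (intro len_mult) auto
      moreover have "x \<otimes> (inv x \<otimes> y) = y" using x y by (simp add: m_assoc[symmetric])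
      ultimately show ?thesis by simp
    qed
  qed
  then show "\<exists>l0. \<forall>n y. defect x n y \<noteq> 0 \<longrightarrow> len y \<le> n + l0" by blast
  have "(\<Sum>y\<in>{y. defect x n y \<noteq> 0}. \<bar>defect x n y\<bar>) \<le> 2" for n
  proof -
    let ?F = "{y. defect x n y \<noteq> 0}"
    have F: "finite ?F" "?F \<subseteq> carrier G" using defect_fsupp[OF x, of n] by (auto simp: fsupp_def)
    have inj: "inj_on (\<lambda>y. inv x \<otimes> y) ?F"
      using inj_on_subset[OF inj_on_cmult F(2)] x by blast
    have "(\<Sum>y\<in>?F. \<bar>defect x n y\<bar>) \<le> (\<Sum>y\<in>?F. m n (inv x \<otimes> y) + m n y)"
      by (intro sum_mono) (auto simp: defect_def translate_def abs_le_iff add_nonneg_nonneg)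
    also have "\<dots> = (\<Sum>y\<in>(\<lambda>y. inv x \<otimes> y) ` ?F. m n y) + (\<Sum>y\<in>?F. m n y)"
      by (simp add: sum.distrib sum.reindex[OF inj])
    also have "\<dots> \<le> 1 + 1" using F(1) by (intro add_mono sum_pmf_le_1) auto
    finally show ?thesis by simp
  qed
  then show "\<exists>M. \<forall>n. (\<Sum>y\<in>{y. defect x n y \<noteq> 0}. \<bar>defect x n y\<bar>) \<le> M" by blast
qed

lemma L2_decay:
  "\<exists>q C n0. 0 < q \<and> q < 1 \<and> (\<forall>n\<ge>n0. sqrt (B (increment n) (increment n)) \<le> C * q ^ n) \<and>
     (\<forall>x\<in>carrier G. \<exists>C. \<forall>n\<ge>n0. sqrt (B (defect x n) (defect x n)) \<le> C * q ^ n)"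
  using form.averages_converge[OF E10 \<mu>] unfolding increment_def defect_def by simp

lemma increment_expdec:
  assumes "(c, z, r) \<in> P" "a \<in> Basis" "b \<in> Basis" "vs \<in> blists j" "j \<le> k - 2"
  shows "expdec (bx z r) (\<lambda>n. dirs vs (\<lambda>p. cf (fcomb (increment n)) c p a b))"
proof -
  obtain q C n0 where q: "0 < q" "q < 1" "\<And>n. n \<ge> n0 \<Longrightarrow> sqrt (B (increment n) (increment n)) \<le> C * q ^ n"
    using L2_decay by blast
  show ?thesis by (rule tame_expdec[OF increment_tame q assms])
qed

lemma increment_holder:
  assumes "(c, z, r) \<in> P" "a \<in> Basis" "b \<in> Basis" "vs \<in> blists j" "j \<le> k - 2" "0 \<le> s" "s < 1"
  shows "\<exists>C q. 0 \<le> C \<and> 0 < q \<and> q < 1 \<and>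
     (\<forall>n. holder_bound (bx z r) s (C * q ^ n) (dirs vs (\<lambda>p. cf (fcomb (increment n)) c p a b)))"
proof -
  obtain q C n0 where q: "0 < q" "q < 1" "\<And>n. n \<ge> n0 \<Longrightarrow> sqrt (B (increment n) (increment n)) \<le> C * q ^ n"
    using L2_decay by blast
  show ?thesis by (rule tame_holder[OF increment_tame q assms])
qed

lemma defect_expdec:
  assumes x: "x \<in> carrier G" and i: "(c, z, r) \<in> P" "a \<in> Basis" "b \<in> Basis"
  shows "expdec (bx z r) (\<lambda>n p. cf (fcomb (defect x n)) c p a b)"
proof -
  obtain q n0 where q: "0 < q" "q < 1" and "\<exists>C. \<forall>n\<ge>n0. sqrt (B (defect x n) (defect x n)) \<le> C * q ^ n"
    using L2_decay x by blast
  then obtain C where C: "\<And>n. n \<ge> n0 \<Longrightarrow> sqrt (B (defect x n) (defect x n)) \<le> C * q ^ n" by blast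
  have nil: "[] \<in> blists 0" by (simp add: blists_def)
  show ?thesis using tame_expdec[OF defect_tame[OF x] q C i nil] by simp
qed

text \<open>The coordinates of \<open>v\<close> and \<open>w\<close> in one chart reduce this to
  finitely many coefficients at one point. Constant and rate may depend on the point and the
  vectors, which is enough for pointwise limits.\<close>

lemma expdec_pointwise:
  assumes fs: "\<And>n. fsupp (carrier G) (d n)"
    and dec: "\<And>c z r a b. (c, z, r) \<in> P \<Longrightarrow> a \<in> Basis \<Longrightarrow> b \<in> Basis \<Longrightarrow>
      expdec (bx z r) (\<lambda>n p. cf (fcomb (d n)) c p a b)"
    and v: "v \<in> tangent_space A p" "w \<in> tangent_space A p"
  shows "\<exists>C q. 0 \<le> C \<and> 0 < q \<and> q < 1 \<and> (\<forall>n. \<bar>fcomb (d n) p v w\<bar> \<le> C * q ^ n)"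
proof -
  obtain c z r where i: "(c, z, r) \<in> P" "p \<in> fst c" "snd c p \<in> bx z r" using P_cover[of p] by blast
  note c = P_chart[OF i(1)]
  have eq: "fcomb (d n) p v w = (\<Sum>a\<in>Basis. (\<Sum>b\<in>Basis. (v c \<bullet> a) * (w c \<bullet> b) * cf (fcomb (d n)) c (snd c p) a b))" for n
  proof -
    have "fcomb (d n) p v w = cf (fcomb (d n)) c (snd c p) (v c) (w c)"
      using tangent_eq[OF v(1) c i(2)] tangent_eq[OF v(2) c i(2)] chartD(3)[OF c i(2)] by (simp add: cf_def)
    then show ?thesis using cf_fcomb_expand[OF fs c, of "snd c p" n "v c" "w c"] i(2) by simp
  qed
  have "expdec (bx z r) (\<lambda>n x. \<Sum>a\<in>Basis. 1 * (\<Sum>b\<in>Basis. ((v c \<bullet> a) * (w c \<bullet> b)) * cf (fcomb (d n)) c x a b))"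
    by (intro expdec_sum finite_Basis dec i(1))
  then obtain C q where C: "0 \<le> C" "0 < q" "q < 1" "\<forall>n. \<forall>x\<in>bx z r.
      \<bar>\<Sum>a\<in>Basis. 1 * (\<Sum>b\<in>Basis. ((v c \<bullet> a) * (w c \<bullet> b)) * cf (fcomb (d n)) c x a b)\<bar> \<le> C * q ^ n"
    unfolding expdec_def by (elim exE conjE)
  have "\<bar>fcomb (d n) p v w\<bar> \<le> C * q ^ n" for n
    using C(4)[THEN spec, THEN bspec, OF i(3), of n] unfolding eq mult_1 .
  then show ?thesis using C(1-3) by (intro exI conjI allI)
qed

end

section \<open>The limit: existence, invariance and positivity\<close>

definition limit_metric :: "('m, 'e) metric_field" where
  "limit_metric p v w = lim (\<lambda>n. fcomb (m n) p v w)"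

lemma limit_metric:
  assumes v: "v \<in> tangent_space A p" "w \<in> tangent_space A p"
  shows "(\<lambda>n. fcomb (m n) p v w) \<longlonglongrightarrow> limit_metric p v w"
    and "\<exists>C q. 0 \<le> C \<and> 0 < q \<and> q < 1 \<and> (\<forall>n. \<bar>limit_metric p v w - fcomb (m n) p v w\<bar> \<le> C * q ^ n)"
proof -
  obtain P where P: "pieces G S A g0 k \<alpha> P" using pieces_exist by blast
  have "expdec (bx z r) (\<lambda>n p. cf (fcomb (increment n)) c p a b)"
    if "(c, z, r) \<in> P" "a \<in> Basis" "b \<in> Basis" for c z r a b
    using increment_expdec[OF P that, of "[]" 0] by (simp add: blists_def)
  from expdec_pointwise[OF P increment_fsupp this v] obtain C q where
    C: "0 \<le> C" "0 < q" "q < 1" "\<And>n. \<bar>fcomb (increment n) p v w\<bar> \<le> C * q ^ n" by blast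
  have "\<bar>fcomb (m (Suc n)) p v w - fcomb (m n) p v w\<bar> \<le> C * q ^ n" for n
    using C(4)[of n] unfolding increment_def fcomb_diff[OF m_fsupp m_fsupp] by (simp add: abs_minus_commute)
  from geometric_Cauchy[OF C(1-3) this] obtain l where
    l: "(\<lambda>n. fcomb (m n) p v w) \<longlonglongrightarrow> l" "\<And>n. \<bar>l - fcomb (m n) p v w\<bar> \<le> C / (1 - q) * q ^ n" by blast
  have e: "limit_metric p v w = l" unfolding limit_metric_def using l(1) by (rule limI)
  show "(\<lambda>n. fcomb (m n) p v w) \<longlonglongrightarrow> limit_metric p v w" using l(1) e by simp
  show "\<exists>C q. 0 \<le> C \<and> 0 < q \<and> q < 1 \<and> (\<forall>n. \<bar>limit_metric p v w - fcomb (m n) p v w\<bar> \<le> C * q ^ n)"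
    using l(2) C e by (intro exI[of _ "C / (1 - q)"] exI[of _ q]) auto
qed

text \<open>Translation by \<open>inv x\<close> pulls back by \<open>\<alpha> x\<close>, so the
  defect of \<open>inv x\<close> is the difference between the transformed and the original average,
  and it tends to 0.\<close>

lemma limit_metric_invariant:
  assumes x: "x \<in> carrier G" and v: "v \<in> tangent_space A p" "w \<in> tangent_space A p"
  shows "limit_metric (\<alpha> x p) (differential A (\<alpha> x) p v) (differential A (\<alpha> x) p w) = limit_metric p v w"
proof -
  have ix: "inv x \<in> carrier G" using x by simp
  note t = differential_tangent[OF \<alpha>_C1[OF x]]
  obtain P where P: "pieces G S A g0 k \<alpha> P" using pieces_exist by blast
  from expdec_pointwise[OF P defect_fsupp[OF ix] defect_expdec[OF P ix] v] obtain C q where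
    C: "0 \<le> C" "0 < q" "q < 1" "\<And>n. \<bar>fcomb (defect (inv x) n) p v w\<bar> \<le> C * q ^ n" by blast
  have z: "(\<lambda>n. fcomb (defect (inv x) n) p v w) \<longlonglongrightarrow> 0"
  proof (rule Lim_null_comparison)
    show "\<forall>\<^sub>F n in sequentially. norm (fcomb (defect (inv x) n) p v w) \<le> C * q ^ n" using C by simp
    show "(\<lambda>n. C * q ^ n) \<longlonglongrightarrow> 0" using C by (intro tendsto_mult_right_zero LIMSEQ_power_zero) auto
  qed
  have "fcomb (defect (inv x) n) p v w
    = fcomb (m n) (\<alpha> x p) (differential A (\<alpha> x) p v) (differential A (\<alpha> x) p w) - fcomb (m n) p v w" for n
    unfolding defect_def fcomb_diff[OF fsupp_translate[OF m_fsupp ix] m_fsupp] fcomb_translate[OF m_fsupp ix v]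
    using x by (simp add: pull_def)
  then have "(\<lambda>n. fcomb (defect (inv x) n) p v w) \<longlonglongrightarrow>
     limit_metric (\<alpha> x p) (differential A (\<alpha> x) p v) (differential A (\<alpha> x) p w) - limit_metric p v w"
    using tendsto_diff[OF limit_metric(1)[OF t[OF v(1)] t[OF v(2)]] limit_metric(1)[OF v]] by simp
  from LIMSEQ_unique[OF this z] show ?thesis by simp
qed

text \<open>The growth bound for \<open>x\<close>, applied at the point
  \<open>\<alpha> (inv x) p\<close>, compares \<open>g0\<close> with \<open>u x\<close>; since the
  weights \<open>m n\<close> have sum 1 and live on lengths at most \<open>n\<close>, averaging
  keeps the inequality.\<close>

lemma fcomb_lower:
  assumes e: "e > 0"
  shows "\<exists>C>0. \<forall>n p. \<forall>v\<in>tangent_space A p. g0 p v v \<le> C * exp (e * real n) * fcomb (m n) p v v"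
proof -
  have e2: "e / 2 > 0" using e by simp
  from g0_growth[OF e2] obtain C where C0: "C \<ge> 0" and C1: "\<forall>x\<in>carrier G. \<forall>p. \<forall>v\<in>tangent_space A p.
    g0 (\<alpha> x p) (differential A (\<alpha> x) p v) (differential A (\<alpha> x) p v) \<le> (C * exp (e / 2 * real (len x)))\<^sup>2 * g0 p v v"
    by (elim exE conjE)
  have nonneg: "w p v v \<ge> 0" if "inner_product_field A w" "v \<in> tangent_space A p" for w p v
    using inner_fieldD(2)[OF that(1) that(2) that(2)] inner_field_0[OF that] by (cases "v = 0") auto
  have single: "g0 p v v \<le> (C\<^sup>2 + 1) * exp (e * real n) * u x p v v"
    if x: "x \<in> carrier G" "len x \<le> n" and v: "v \<in> tangent_space A p" for x n p v
  proof -
    have ix: "inv x \<in> carrier G" using x by simp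
    let ?q = "\<alpha> (inv x) p" and ?w = "differential A (\<alpha> (inv x)) p v"
    have w: "?w \<in> tangent_space A ?q" by (rule differential_tangent[OF \<alpha>_C1[OF ix] v])
    have "g0 p v v = g0 (\<alpha> x ?q) (differential A (\<alpha> x) ?q ?w) (differential A (\<alpha> x) ?q ?w)"
    proof -
      have "differential A (\<alpha> (x \<otimes> inv x)) p v = v" using x differential_id[OF v] by (simp add: \<alpha>_one)
      then have "differential A (\<alpha> x) ?q ?w = v" using differential_mult[OF x(1) ix v] by simp
      moreover have "\<alpha> x ?q = p" using \<alpha>_inv(2)[OF x(1)] by (metis comp_apply id_apply)
      ultimately show ?thesis by simp
    qed
    also have "\<dots> \<le> (C * exp (e / 2 * real (len x)))\<^sup>2 * g0 ?q ?w ?w" using C1 x(1) w by blast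
    also have "g0 ?q ?w ?w = u x p v v" by (simp add: u_def pull_def)
    also have "(C * exp (e / 2 * real (len x)))\<^sup>2 = C\<^sup>2 * exp (e * real (len x))"
      by (simp add: power_mult_distrib power2_eq_square exp_add[symmetric])
    also have "C\<^sup>2 * exp (e * real (len x)) * u x p v v \<le> (C\<^sup>2 + 1) * exp (e * real n) * u x p v v"
      using e x(2) nonneg[OF u_inner[OF x(1)] v] by (intro mult_right_mono mult_mono) auto
    finally show ?thesis .
  qed
  have "g0 p v v \<le> (C\<^sup>2 + 1) * exp (e * real n) * fcomb (m n) p v v" if v: "v \<in> tangent_space A p" for n p v
  proof -
    let ?D = "{x. m n x \<noteq> 0}"
    have D: "finite ?D" using m_fsupp[of n] by (simp add: fsupp_def)
    have "(\<Sum>x\<in>?D. m n x) = 1"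
      by (rule sum_pmf_eq_1[OF D]) (simp add: set_pmf_eq)
    then have "g0 p v v = (\<Sum>x\<in>?D. m n x * g0 p v v)" unfolding sum_distrib_right[symmetric] by simp
    also have "\<dots> \<le> (\<Sum>x\<in>?D. m n x * ((C\<^sup>2 + 1) * exp (e * real n) * u x p v v))"
      using m_supp by (intro sum_mono mult_left_mono single v) auto
    also have "\<dots> = (C\<^sup>2 + 1) * exp (e * real n) * fcomb (m n) p v v"
      by (simp add: fcomb_def sum_distrib_left mult_ac)
    finally show ?thesis .
  qed
  moreover have "C\<^sup>2 + 1 > 0" by (simp add: add_nonneg_pos)
  ultimately show ?thesis by blast
qed

lemma limit_metric_inner: "inner_product_field A limit_metric"
  unfolding inner_product_field_def
proof (intro allI ballI conjI impI)
  fix p v w assume v: "v \<in> tangent_space A p" and w: "w \<in> tangent_space A p"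
  have cls: "(\<lambda>c. r *\<^sub>R v c) \<in> tangent_space A p" "z \<in> tangent_space A p \<Longrightarrow> z + v \<in> tangent_space A p" for r z
  proof -
    obtain c where c: "c \<in> A" "p \<in> fst c" using chart_at by blast
    have v': "v = cv c p (v c)" by (rule tangent_eq[OF v c])
    show "(\<lambda>c. r *\<^sub>R v c) \<in> tangent_space A p"
      using cv_tangent[OF c, of "r *\<^sub>R v c"] unfolding cv_scale[OF c] v'[symmetric] .
    assume "z \<in> tangent_space A p"
    then have z': "z = cv c p (z c)" by (rule tangent_eq[OF _ c])
    show "z + v \<in> tangent_space A p"
      using cv_tangent[OF c, of "z c + v c"] unfolding cv_add[OF c] v'[symmetric] z'[symmetric] .
  qed
  have supp: "x \<in> carrier G" if "x \<in> {x. m n x \<noteq> 0}" for x n using m_supp that by blast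
  have "fcomb (m n) p v w = fcomb (m n) p w v" for n
    unfolding fcomb_def by (intro sum.cong refl) (use inner_fieldD(1)[OF u_inner[OF supp] v w] in simp)
  then show "limit_metric p v w = limit_metric p w v" unfolding limit_metric_def by simp
  show "limit_metric p (\<lambda>c. r *\<^sub>R v c) w = r * limit_metric p v w" for r
  proof -
    have "fcomb (m n) p (\<lambda>c. r *\<^sub>R v c) w = r * fcomb (m n) p v w" for n
      unfolding fcomb_def sum_distrib_left
      by (intro sum.cong refl) (use inner_fieldD(3)[OF u_inner[OF supp] v w] in simp)
    then have "(\<lambda>n. fcomb (m n) p (\<lambda>c. r *\<^sub>R v c) w) \<longlonglongrightarrow> r * limit_metric p v w"
      using tendsto_mult_left[OF limit_metric(1)[OF v w], of r] by simp
    then show ?thesis using limit_metric(1)[OF cls(1) w] LIMSEQ_unique by blast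
  qed
  show "limit_metric p (z + v) w = limit_metric p z w + limit_metric p v w" if z: "z \<in> tangent_space A p" for z
  proof -
    have "fcomb (m n) p (z + v) w = fcomb (m n) p z w + fcomb (m n) p v w" for n
      unfolding fcomb_def sum.distrib[symmetric]
      by (intro sum.cong refl)
        (use inner_fieldD(4)[OF u_inner[OF supp] v w z] in \<open>simp add: distrib_left del: plus_fun_apply\<close>)
    then have "(\<lambda>n. fcomb (m n) p (z + v) w) \<longlonglongrightarrow> limit_metric p z w + limit_metric p v w"
      using tendsto_add[OF limit_metric(1)[OF z w] limit_metric(1)[OF v w]] by simp
    then show ?thesis using limit_metric(1)[OF cls(2)[OF z] w] LIMSEQ_unique by blast
  qed
  assume v0: "v \<noteq> 0"
  show "0 < limit_metric p v v"
  proof (rule ccontr)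
    assume "\<not> 0 < limit_metric p v v"
    then have neg: "limit_metric p v v \<le> 0" by simp
    obtain C q where C: "0 \<le> C" "0 < q" "q < 1" "\<And>n. \<bar>limit_metric p v v - fcomb (m n) p v v\<bar> \<le> C * q ^ n"
      using limit_metric(2)[OF v v] by blast
    \<comment> \<open>Half of the rate at which the averages approach their limit: the lower bound
      loses \<open>exp (e * real n)\<close>, and a factor \<open>sqrt q ^ n\<close> still
      remains.\<close>
    define e where "e = - ln q / 2"
    have e: "e > 0" using C by (simp add: e_def divide_neg_pos)
    obtain C' where C': "C' > 0" "\<And>n. g0 p v v \<le> C' * exp (e * real n) * fcomb (m n) p v v"
      using fcomb_lower[OF e] v by blast
    have le: "g0 p v v \<le> C' * C * sqrt q ^ n" for n
    proof -
      have "fcomb (m n) p v v \<le> C * q ^ n" using C(4)[of n] neg by linarith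
      then have le: "C' * exp (e * real n) * fcomb (m n) p v v \<le> C' * exp (e * real n) * (C * q ^ n)"
        using C'(1) by (intro mult_left_mono) auto
      have "exp (e * real n) = (1 / sqrt q) ^ n"
      proof -
        have "exp e = 1 / sqrt q"
        proof -
          have "exp (ln q / 2) = sqrt q"
            using C by (intro real_sqrt_unique[symmetric]) (auto simp: power2_eq_square exp_add[symmetric])
          moreover have "exp e = 1 / exp (ln q / 2)" by (simp add: e_def exp_minus inverse_eq_divide)
          ultimately show ?thesis by simp
        qed
        then show ?thesis by (metis exp_of_nat2_mult)
      qed
      moreover have "(1 / sqrt q) ^ n * q ^ n = sqrt q ^ n"
        using C by (simp add: power_mult_distrib[symmetric] real_div_sqrt)
      ultimately have "C' * exp (e * real n) * (C * q ^ n) = C' * C * sqrt q ^ n" by (simp add: mult_ac)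
      then show ?thesis using C'(2)[of n] le by linarith
    qed
    have "(\<lambda>n. C' * C * sqrt q ^ n) \<longlonglongrightarrow> 0"
      using C by (intro tendsto_mult_right_zero LIMSEQ_power_zero) auto
    then have "g0 p v v \<le> 0" by (rule LIMSEQ_le_const) (use le in blast)
    then show False using inner_fieldD(2)[OF g0_inner v v v0] by simp
  qed
qed

section \<open>Regularity of the limit metric\<close>

lemma fcomb0_holder:
  assumes P: "pieces G S A g0 k \<alpha> P" and i: "(c, z, r) \<in> P" and d: "fsupp (carrier G) d"
    and ab: "a \<in> Basis" "b \<in> Basis" and vs: "vs \<in> blists j" "j \<le> k - 2" and s: "0 \<le> s" "s < 1"
  shows "\<exists>C. holder_bound (bx z r) s C (dirs vs (\<lambda>p. cf (fcomb d) c p a b))"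
proof -
  interpret pieces G S A g0 k \<alpha> P by (rule P)
  define w where "w = dirs vs (\<lambda>p. cf (fcomb d) c p a b)"
  have lv: "length vs = j" using vs by (simp add: blists_def)
  have Ck: "Ck_on (Suc 0) (snd c ` fst c) w"
    unfolding w_def by (rule Ck_on_dirs[OF fcomb_Ck[OF d P_chart[OF i]]]) (use lv vs k2 in simp)
  have bdd: "\<exists>M\<ge>0. \<forall>x\<in>bx z r. \<bar>h x\<bar> \<le> M" if "continuous_on (snd c ` fst c) h" for h :: "'e \<Rightarrow> real"
  proof -
    have "bounded (h ` bx z r)"
      by (intro compact_imp_bounded compact_continuous_image compact_cbox continuous_on_subset[OF that P_sub[OF i]])
    then obtain M where "M > 0" "\<forall>y\<in>h ` bx z r. norm y \<le> M" unfolding bounded_pos by blast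
    then show ?thesis by (intro exI[of _ M]) auto
  qed
  \<comment> \<open>The factor \<open>(1 / 2) ^ n\<close> turns the single function \<open>w\<close>
    into a decaying sequence, so that \<open>expdec_holder\<close> applies; its conclusion at
    \<open>n = 0\<close> is the Hoelder bound for \<open>w\<close>.\<close>
  define f where "f n x = (1 / 2) ^ n * w x" for n :: nat and x
  have wd: "w differentiable at x" if "x \<in> bx z r" for x
    using Ck P_subD[OF i that] unfolding Ck_holder_on.simps by blast
  have fdf: "fd (f n) x l = (1 / 2) ^ n * fd w x l" if "x \<in> bx z r" for n x l
    unfolding f_def using fd_eqI[OF has_derivative_mult_right[OF fd_works[OF wd[OF that]]]] by metis
  obtain M where M: "M \<ge> 0" "\<And>x. x \<in> bx z r \<Longrightarrow> \<bar>w x\<bar> \<le> M" using bdd[OF Ck_on_continuous[OF Ck]] by blast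
  have "\<exists>C q. 0 \<le> C \<and> 0 < q \<and> q < 1 \<and> (\<forall>n. \<forall>x\<in>bx z r. \<forall>y\<in>bx z r.
    \<bar>f n y - f n x\<bar> \<le> C * q ^ n * dist y x powr s)"
  proof (rule expdec_holder[OF _ _ _ s])
    show "f n differentiable at x" if "x \<in> bx z r" for n x
      unfolding f_def by (intro differentiable_mult differentiable_const wd that)
    show "expdec (bx z r) f"
      unfolding expdec_def
      by (rule exI[of _ M], rule exI[of _ "1/2"]) (use M in \<open>auto simp: f_def abs_mult mult.commute\<close>)
    show "subexp (bx z r) (\<lambda>n x. fd (f n) x l)" if l: "l \<in> Basis" for l
      unfolding subexp_def
    proof (intro allI impI)
      fix e :: real assume e: "e > 0"
      have "continuous_on (snd c ` fst c) (\<lambda>x. fd w x l)" using Ck by simp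
      from bdd[OF this] obtain K where K: "K \<ge> 0" "\<And>x. x \<in> bx z r \<Longrightarrow> \<bar>fd w x l\<bar> \<le> K" by blast
      have "\<bar>fd (f n) x l\<bar> \<le> K * exp (e * real n)" if x: "x \<in> bx z r" for n x
      proof -
        have "\<bar>fd (f n) x l\<bar> = (1 / 2) ^ n * \<bar>fd w x l\<bar>" unfolding fdf[OF x] by (simp add: abs_mult)
        also have "\<dots> \<le> 1 * K" using K x by (intro mult_mono power_le_one) auto
        also have "\<dots> \<le> K * exp (e * real n)" using K e by (simp add: mult_le_cancel_left1)
        finally show ?thesis .
      qed
      then show "\<exists>C\<ge>0. \<forall>n. \<forall>x\<in>bx z r. \<bar>fd (f n) x l\<bar> \<le> C * exp (e * real n)" using K(1) by blast
    qed
  qed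
  then obtain C q where "\<And>n x y. x \<in> bx z r \<Longrightarrow> y \<in> bx z r \<Longrightarrow> \<bar>f n y - f n x\<bar> \<le> C * q ^ n * dist y x powr s"
    by blast
  from this[of _ _ 0] have "holder_bound (bx z r) s C w" unfolding holder_bound_def f_def by simp
  then show ?thesis unfolding w_def by blast
qed

text \<open>The estimates come from a closed cube centred at \<open>x0\<close> that belongs to the
  cover; the limit theorem is applied on its interior, which is open and convex.\<close>

lemma limit_metric_Ck_basis:
  assumes c: "c \<in> A" and x0: "x0 \<in> snd c ` fst c" and ab: "a \<in> Basis" "b \<in> Basis"
    and n: "n \<le> k - 2" and s: "0 \<le> s" "s < 1"
  shows "\<exists>U. open U \<and> x0 \<in> U \<and> U \<subseteq> snd c ` fst c \<and> Ck_holder_on n s U (\<lambda>x. cf limit_metric c x a b)"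
proof -
  obtain r where r: "r > 0" "bx x0 r \<subseteq> snd c ` fst c" using bx_exists[OF chartD(2)[OF c] x0] by blast
  obtain P where i: "(c, x0, r) \<in> P" and P: "pieces G S A g0 k \<alpha> P" using pieces_containing_exist[OF c r] by blast
  let ?V = "box (x0 - r *\<^sub>R One) (x0 + r *\<^sub>R One)"
  have Vb: "?V \<subseteq> bx x0 r" by (rule box_subset_cbox)
  have xV: "x0 \<in> ?V" using r by (auto simp: mem_box inner_diff_left inner_add_left)
  have Vi: "?V \<subseteq> snd c ` fst c" using Vb r by blast
  define f where "f n = (\<lambda>p. cf (fcomb (m n)) c p a b)" for n
  have fC: "Ck_on (k - 1) (snd c ` fst c) (f j)" for j unfolding f_def by (rule fcomb_Ck[OF m_fsupp c])
  have deq: "dirs vs (\<lambda>p. cf (fcomb (increment j)) c p a b) x = dirs vs (f j) x - dirs vs (f (Suc j)) x"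
    if vs: "length vs \<le> k - 1" and x: "x \<in> snd c ` fst c" for vs j x
  proof -
    have e: "(\<lambda>p. cf (fcomb (increment j)) c p a b) = (\<lambda>p. f j p + (-1) * f (Suc j) p)"
      by (auto simp: f_def cf_def increment_def fcomb_diff[OF m_fsupp m_fsupp])
    have c1: "Ck_on (k - 1) (snd c ` fst c) (\<lambda>p. (-1) * f (Suc j) p)"
      by (intro Ck_on_mult chartD(2)[OF c] Ck_holder_on_const fC)
    show ?thesis
      unfolding e dirs_add[OF chartD(2)[OF c] fC c1 vs x] dirs_cmult[OF chartD(2)[OF c] fC vs x] by simp
  qed
  have "Ck_holder_on n s ?V (\<lambda>x. cf limit_metric c x a b)"
  proof (rule Ck_holder_on_limit[where f = f])
    show "open ?V" "convex ?V" by (auto simp: open_box convex_box)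
    show "?V \<noteq> {}" using xV by blast
    show "Ck_on n ?V (f j)" for j
      by (rule Ck_on_le[OF Ck_holder_on_subset[OF fC Vi]]) (use n in simp)
    show "expdec ?V (\<lambda>j x. dirs vs (f (Suc j)) x - dirs vs (f j) x)" if "l \<le> n" "vs \<in> blists l" for l vs
    proof -
      have lv: "length vs \<le> k - 1" using that n k2 by (simp add: blists_def)
      have "expdec (bx x0 r) (\<lambda>j. dirs vs (\<lambda>p. cf (fcomb (increment j)) c p a b))"
        by (rule increment_expdec[OF P i ab that(2)]) (use that n in simp)
      then obtain C q where C: "0 \<le> C" "0 < q" "q < 1"
        "\<And>j x. x \<in> bx x0 r \<Longrightarrow> \<bar>dirs vs (\<lambda>p. cf (fcomb (increment j)) c p a b) x\<bar> \<le> C * q ^ j"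
        unfolding expdec_def by blast
      have "\<bar>dirs vs (f (Suc j)) x - dirs vs (f j) x\<bar> \<le> C * q ^ j" if x: "x \<in> ?V" for j x
      proof -
        have "x \<in> bx x0 r" "x \<in> snd c ` fst c" using x Vb Vi by blast+
        then show ?thesis using C(4)[of x j] deq[OF lv, of x j] by (simp add: abs_minus_commute)
      qed
      then show ?thesis unfolding expdec_def using C(1-3) by blast
    qed
    show "\<exists>C q. 0 \<le> C \<and> 0 < q \<and> q < 1 \<and>
       (\<forall>j. holder_bound ?V s (C * q ^ j) (\<lambda>x. dirs vs (f (Suc j)) x - dirs vs (f j) x))" if vs: "vs \<in> blists n" for vs
    proof -
      have lv: "length vs \<le> k - 1" using vs n k2 by (simp add: blists_def)
      obtain C q where C: "0 \<le> C" "0 < q" "q < 1"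
        "\<And>j. holder_bound (bx x0 r) s (C * q ^ j) (dirs vs (\<lambda>p. cf (fcomb (increment j)) c p a b))"
        using increment_holder[OF P i ab vs n s] by blast
      have "holder_bound ?V s (C * q ^ j) (\<lambda>x. dirs vs (f (Suc j)) x - dirs vs (f j) x)" for j
        unfolding holder_bound_def
      proof (intro ballI)
        fix x y assume xy: "x \<in> ?V" "y \<in> ?V"
        have "\<bar>dirs vs (\<lambda>p. cf (fcomb (increment j)) c p a b) y - dirs vs (\<lambda>p. cf (fcomb (increment j)) c p a b) x\<bar>
          \<le> C * q ^ j * dist y x powr s"
          using C(4)[of j] xy Vb unfolding holder_bound_def by blast
        moreover have "x \<in> snd c ` fst c" "y \<in> snd c ` fst c" using xy Vi by blast+
        ultimately show "\<bar>dirs vs (f (Suc j)) y - dirs vs (f j) y - (dirs vs (f (Suc j)) x - dirs vs (f j) x)\<bar>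
          \<le> C * q ^ j * dist y x powr s"
          using deq[OF lv, of x j] deq[OF lv, of y j] by (simp add: abs_le_iff)
      qed
      then show ?thesis using C(1-3) by blast
    qed
    show "\<exists>C. holder_bound ?V s C (dirs vs (f 0))" if vs: "vs \<in> blists n" for vs
    proof -
      obtain C where "holder_bound (bx x0 r) s C (dirs vs (f 0))"
        unfolding f_def using fcomb0_holder[OF P i m_fsupp ab vs n s] by blast
      then show ?thesis using Vb unfolding holder_bound_def by blast
    qed
    show "(\<lambda>j. f j x) \<longlonglongrightarrow> cf limit_metric c x a b" if x: "x \<in> ?V" for x
      unfolding f_def cf_def
      by (intro limit_metric(1) cv_tangent[OF c] chartD(5)[OF c]) (use x Vi in blast)+
  qed
  then show ?thesis using xV Vi open_box by blast
qed

lemma limit_metric_Ck: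
  assumes c: "c \<in> A" and n: "n \<le> k - 2" and s: "0 \<le> s" "s < 1"
  shows "Ck_holder_on n s (snd c ` fst c) (\<lambda>x. cf limit_metric c x a b)"
proof (rule Ck_holder_on_cong[OF chartD(2)[OF c]])
  let ?S = "snd c ` fst c"
  show "(\<Sum>i\<in>Basis. \<Sum>j\<in>Basis. ((a \<bullet> i) * (b \<bullet> j)) *\<^sub>R cf limit_metric c x i j) = cf limit_metric c x a b" if "x \<in> ?S" for x
    using cf_expand[OF limit_metric_inner c that, of a b] by simp
  have "Ck_holder_on n s ?S (\<lambda>x. cf limit_metric c x i j)" if ij: "i \<in> Basis" "j \<in> Basis" for i j
  proof (rule Ck_holder_on_local)
    fix x assume "x \<in> ?S"
    from limit_metric_Ck_basis[OF c this ij n s] show "\<exists>U. open U \<and> x \<in> U \<and> Ck_holder_on n s U (\<lambda>x. cf limit_metric c x i j)" by blast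
  qed
  then show "Ck_holder_on n s ?S (\<lambda>x. \<Sum>i\<in>Basis. \<Sum>j\<in>Basis. ((a \<bullet> i) * (b \<bullet> j)) *\<^sub>R cf limit_metric c x i j)"
    by (intro Ck_holder_on_sum chartD(2)[OF c] Ck_holder_on_linear[OF bounded_linear_scaleR_right])
qed

theorem Cr_limit_metric:
  assumes \<delta>: "\<delta> > 0" "\<delta> \<le> real k - 1" shows "Cr_metric A (real k - 1 - \<delta>) limit_metric"
  unfolding Cr_metric_def Cr_on_def
proof (intro conjI ballI allI limit_metric_inner)
  fix c a b assume c: "c \<in> A"
  \<comment> \<open>As \<open>\<delta>\<close> is positive, the floor is at most
    \<open>k - 2\<close>; the fractional part, below 1, serves as Hoelder exponent.\<close>
  have "nat \<lfloor>real k - 1 - \<delta>\<rfloor> \<le> k - 2"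
  proof -
    have "\<lfloor>real k - 1 - \<delta>\<rfloor> < int k - 1" using \<delta> by (simp add: floor_less_iff)
    then show ?thesis using k2 by linarith
  qed
  from limit_metric_Ck[OF c this, of "frac (real k - 1 - \<delta>)" a b]
  show "Ck_holder_on (nat \<lfloor>real k - 1 - \<delta>\<rfloor>) (frac (real k - 1 - \<delta>)) (snd c ` fst c)
     (\<lambda>x. limit_metric (chart_inv c x) (cv c (chart_inv c x) a) (cv c (chart_inv c x) b))"
    by (simp add: cf_def frac_ge_0 frac_lt_1)
qed

end

theorem theorem2p4:
  fixes G :: "('g, 'b) monoid_scheme"
    and S :: "'g set"
    and A :: "('m::t2_space, 'e::euclidean_space) chart set"
    and g0 :: "('m, 'e) metric_field"
    and k :: nat
    and \<alpha> :: "'g \<Rightarrow> 'm \<Rightarrow> 'm"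
    and \<E> :: "'i::infinite cspace set"
  assumes "group G" and "symmetric_generating_set G S"
    and "compact (UNIV :: 'm set)" and "smooth_atlas A" and "smooth_metric A g0"
    and "k \<ge> 2" and "\<alpha> \<in> hom G (Diff A k)"
    and "E10_properties \<E>" and "strong_property_T G S \<E>"
    and "uniform_subexp_growth_of_derivatives G S A g0 \<alpha>"
  shows "\<exists>g. (\<forall>\<delta>>0. \<delta> \<le> real k - 1 \<longrightarrow> Cr_metric A (real k - 1 - \<delta>) g) \<and>
             (\<forall>\<gamma>\<in>carrier G. isometric_map A g (\<alpha> \<gamma>))"
proof -
  obtain \<mu> where \<mu>: "averaging_sequence G S \<E> \<mu>"
    using assms(9) unfolding strong_property_T_iff by blast
  interpret group G by fact
  interpret averaged G S A g0 k \<alpha> \<E> \<mu>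
    by unfold_locales (use assms \<mu> in auto)
  have "isometric_map A limit_metric (\<alpha> \<gamma>)" if "\<gamma> \<in> carrier G" for \<gamma>
    unfolding isometric_map_def using limit_metric_invariant[OF that] by blast
  then show ?thesis using Cr_limit_metric by blast
qed

end
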